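(* Let $\hat\Phi$ be the fan associated with a maximal cone of the secondary fan of $\mathbb{P}_{\hat\Sigma}$, let $\mathcal{C}_{\hat\Phi}=D_{\rm sg}(\mathrm{gr}\,\hat S)/D_{\rm sg}(\mathrm{tor}_{\hat\Phi}\hat S)$, and for a toric divisor class $D\in\mathrm{Pic}(\mathbb{P}_{\hat\Sigma})\cong\mathbb{Z}^k$ let $M^{D}_{\hat\Phi}$ be the automorphism of the K-theory (Grothendieck group) $K(\mathcal{C}_{\hat\Phi})$ induced by the autoequivalence $\mathcal{M}^D_{\hat\Phi}: A\mapsto A\otimes_{\hat S}\hat S(D)$ of $\mathcal{C}_{\hat\Phi}$. Then for each subset $\mathcal{I}\subset\{1,\dots,n+\ell\}$ such that the set $\{\hat v_i\}_{i\in\mathcal{I}}$ is not contained in the set of ray generators of any cone of $\hat\Phi$, $$\prod_{i\in\mathcal{I}}\bigl(M^{D_i}_{\hat\Phi}-\mathrm{id}\bigr)=0 .$$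
   Context: Toric data. $\Sigma$ is a fan in a lattice $N\cong\mathbb{Z}^{n-k}$ whose toric variety $\mathbb{P}_\Sigma$ over $\mathbb{C}$ is complete and smooth; $v_1,\dots,v_n$ are the primitive generators of its one-dimensional cones; $\mathrm{Pic}(\mathbb{P}_\Sigma)\cong\mathbb{Z}^k$. With $M=N^*$ there is the exact sequence $M\to\mathbb{Z}^n\to\mathrm{Pic}(\mathbb{P}_\Sigma)$, and $w_i\in\mathbb{Z}^k$ is the image of the $i$-th basis vector (the class of the toric divisor $D_i$). $R=\mathbb{C}[x_1,\dots,x_n]$ is $\mathbb{Z}^k$-graded with $\deg x_i=w_i$. $G_1,\dots,G_\ell\in R$ are homogeneous of degrees $d_1,\dots,d_\ell\in\mathbb{Z}^k$, form a regular sequence and are transversal (so $X=\{G_1=\dots=G_\ell=0\}\subset\mathbb{P}_\Sigma$ is smooth of codimension $\ell$), and satisfy the Calabi–Yau condition $\sum_{i=1}^n w_i=\sum_{a=1}^\ell d_a$. Enhanced data. Put $\hat N=N\oplus\mathbb{Z}^\ell$, $\hat v_i=(v_i,u_i^1,\dots,u_i^\ell)$ for $i\le n$ with integers $u_i^a$ satisfying $\sum_i w_iu_i^a=d_a$, and $\hat v_{n+a}=(0,e_a)$. $\hat\Sigma$ is the fan in $\hat N_{\mathbb{R}}$ with rays generated by $\hat v_1,\dots,\hat v_{n+\ell}$ and toric variety $\mathbb{P}_{\hat\Sigma}=\mathrm{Tot}(\bigoplus_a\mathcal{O}(-d_a)\to\mathbb{P}_\Sigma)$; $\mathrm{Pic}(\mathbb{P}_{\hat\Sigma})=\mathrm{Pic}(\mathbb{P}_\Sigma)\cong\mathbb{Z}^k$.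 Put $w_{n+a}=-d_a$, the class of the toric divisor $D_{n+a}$. $\hat R=\mathbb{C}[x_1,\dots,x_n,p_1,\dots,p_\ell]$, $x_{n+a}:=p_a$, is $\mathbb{Z}^k$-graded by $\deg x_i=w_i$ and has an additional $2\mathbb{Z}$-grading (R-grading) in which $x_i$ has R-degree $0$ for $i\le n$ and $p_a$ has R-degree $2$. $W=\sum_a p_aG_a$ (degree $0$, R-degree $2$), $\hat S=\hat R/(W)$. $\mathrm{gr}\,\hat S$ is the category of finitely generated $(\mathbb{Z}^k\times2\mathbb{Z})$-graded $\hat S$-modules with morphisms of bidegree $0$; $A(q)$ denotes the shift of $\mathbb{Z}^k$-degree by $q$. In particular $\hat S(D_i)=\hat S(w_i)$. Singularity categories. $D_{\rm sg}(\mathrm{gr}\,\hat S)=D^b(\mathrm{gr}\,\hat S)/\mathrm{Perf}(\mathrm{gr}\,\hat S)$, where $\mathrm{Perf}$ is the full triangulated subcategory of bounded complexes of free modules. Phases. The secondary fan of $\mathbb{P}_{\hat\Sigma}$ is the secondary (GKZ) fan in $\mathbb{R}^k=\mathrm{Pic}\otimes\mathbb{R}$ of the vectors $w_1,\dots,w_{n+\ell}$. Each maximal cone corresponds to a simplicial fan $\hat\Phi$ in $\hat N_{\mathbb{R}}$ whose rays are among those generated by $\hat v_1,\dots,\hat v_{n+\ell}$ (possibly not all of them), and is labelled by $\hat\Phi$. Put $J_{\hat\Phi}=\langle\prod_{i:\,\hat v_i\text{ not a ray generator of }\sigma}x_i\mid\sigma\in\hat\Phi\rangle$. A module is $J_{\hat\Phi}$-torsion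 if annihilated by a power of $J_{\hat\Phi}$. $D^b(\mathrm{tor}_{\hat\Phi}\hat S)\subset D^b(\mathrm{gr}\,\hat S)$ is the full triangulated subcategory of objects isomorphic to complexes of $J_{\hat\Phi}$-torsion modules, $D_{\rm sg}(\mathrm{tor}_{\hat\Phi}\hat S)$ is its image in $D_{\rm sg}(\mathrm{gr}\,\hat S)$, and $\mathcal{C}_{\hat\Phi}$ is the Verdier quotient (localization at morphisms whose cone lies in this subcategory). *)

theory Defs
  imports
    "HOL-Analysis.Analysis"
    "HOL-Algebra.Module"
    "HOL-Algebra.QuotRing"
    "HOL-Algebra.Ideal_Product"
    "HOL-Algebra.Free_Abelian_Groups"
    "HOL-Algebra.Algebraic_Closure_Type"
begin

no_notation var (\<open>X\<index>\<close>)

section \<open>Cones, fans and the secondary fan\<close>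

text \<open>The lattice \<open>\<int>\<^sup>r\<close> is regarded as the set of integral points of its real span.\<close>

definition lattice_points :: "'a::euclidean_space set" where
  "lattice_points = {x. \<forall>b\<in>Basis. x \<bullet> b \<in> \<int>}"

definition lattice_basis :: "'a::euclidean_space set \<Rightarrow> bool" where
  "lattice_basis B \<longleftrightarrow> finite B \<and> independent B \<and>
     lattice_points = {\<Sum>b\<in>B. c b *\<^sub>R b | c. \<forall>b\<in>B. c b \<in> \<int>}"

definition rational_polyhedral_cone :: "'a::euclidean_space set \<Rightarrow> bool" where
  "rational_polyhedral_cone \<sigma> \<longleftrightarrow>
     (\<exists>S. finite S \<and> S \<subseteq> lattice_points \<and> \<sigma> = convex_cone hull S)"

definition strongly_convex :: "'a::euclidean_space set \<Rightarrow> bool" where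
  "strongly_convex \<sigma> \<longleftrightarrow> (\<forall>x. x \<in> \<sigma> \<and> - x \<in> \<sigma> \<longrightarrow> x = 0)"

text \<open>The library's relation \<open>face_of\<close> also admits the empty face.\<close>

definition is_fan :: "'a::euclidean_space set set \<Rightarrow> bool" where
  "is_fan F \<longleftrightarrow> finite F \<and> F \<noteq> {} \<and>
     (\<forall>\<sigma>\<in>F. rational_polyhedral_cone \<sigma> \<and> strongly_convex \<sigma>) \<and>
     (\<forall>\<sigma>\<in>F. \<forall>\<tau>. \<tau> face_of \<sigma> \<and> \<tau> \<noteq> {} \<longrightarrow> \<tau> \<in> F) \<and>
     (\<forall>\<sigma>\<in>F. \<forall>\<tau>\<in>F. (\<sigma> \<inter> \<tau>) face_of \<sigma> \<and> (\<sigma> \<inter> \<tau>) face_of \<tau>)"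

text \<open>The toric variety of a fan is complete iff the cones cover the space, and smooth iff each
  cone is generated by a part of a lattice basis.\<close>

definition complete_fan :: "'a::euclidean_space set set \<Rightarrow> bool" where
  "complete_fan F \<longleftrightarrow> \<Union>F = UNIV"

definition smooth_fan :: "'a::euclidean_space set set \<Rightarrow> bool" where
  "smooth_fan F \<longleftrightarrow> (\<forall>\<sigma>\<in>F. \<exists>B C. lattice_basis B \<and> C \<subseteq> B \<and> \<sigma> = convex_cone hull C)"

definition primitive_vector :: "'a::euclidean_space \<Rightarrow> bool" where
  "primitive_vector x \<longleftrightarrow> x \<in> lattice_points \<and> x \<noteq> 0 \<and>
     (\<forall>t::real. 0 < t \<and> t < 1 \<longrightarrow> t *\<^sub>R x \<notin> lattice_points)"

definition primitive_ray_generators :: "'a::euclidean_space set set \<Rightarrow> ('i \<Rightarrow> 'a) \<Rightarrow> bool" where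
  "primitive_ray_generators F v \<longleftrightarrow> (\<forall>i. primitive_vector (v i)) \<and>
     bij_betw (\<lambda>i. convex_cone hull {v i}) UNIV {\<rho> \<in> F. aff_dim \<rho> = 1}"

text \<open>The indices of those vectors of the family \<open>v\<close> that generate a ray of \<open>\<sigma>\<close>.\<close>

definition ray_indices :: "('i \<Rightarrow> 'a::euclidean_space) \<Rightarrow> 'a set \<Rightarrow> 'i set" where
  "ray_indices v \<sigma> = {i. (convex_cone hull {v i}) face_of \<sigma>}"

text \<open>Exactness of \<open>M \<rightarrow> \<int>\<^sup>n \<rightarrow> \<int>\<^sup>k \<rightarrow> 0\<close>, where the first map is \<open>m \<mapsto> (\<langle>m, v i\<rangle>)\<^sub>i\<close> and the second
  one sends the \<open>i\<close>-th basis vector to \<open>w i\<close>; the lattice \<open>M\<close> dual to the integral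
  points is identified with these by means of the inner product.\<close>

definition divisor_classes :: "('n::finite \<Rightarrow> real^'r) \<Rightarrow> ('n \<Rightarrow> int^'k) \<Rightarrow> bool" where
  "divisor_classes v w \<longleftrightarrow>
     (\<forall>a :: 'n \<Rightarrow> int. (\<Sum>i\<in>UNIV. a i *s w i) = 0 \<longleftrightarrow>
        (\<exists>m \<in> lattice_points. \<forall>i. real_of_int (a i) = m \<bullet> v i)) \<and>
     (\<forall>q. \<exists>a :: 'n \<Rightarrow> int. (\<Sum>i\<in>UNIV. a i *s w i) = q)"

text \<open>The secondary fan of a vector configuration \<open>\<beta>\<close> is the coarsest common refinement of all
  cones spanned by subsets of \<open>\<beta>\<close>.\<close>

definition gkz_cone :: "('i \<Rightarrow> 'a::euclidean_space) \<Rightarrow> 'a \<Rightarrow> 'a set" where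
  "gkz_cone \<beta> x = \<Inter>{convex_cone hull (\<beta> ` I) | I. x \<in> convex_cone hull (\<beta> ` I)}"

definition secondary_fan :: "('i \<Rightarrow> 'a::euclidean_space) \<Rightarrow> 'a set set" where
  "secondary_fan \<beta> = gkz_cone \<beta> ` (convex_cone hull (range \<beta>))"

definition maximal_cone :: "'a set set \<Rightarrow> 'a set \<Rightarrow> bool" where
  "maximal_cone F \<Gamma> \<longleftrightarrow> \<Gamma> \<in> F \<and> (\<forall>\<Gamma>'\<in>F. \<Gamma> \<subseteq> \<Gamma>' \<longrightarrow> \<Gamma>' = \<Gamma>)"

text \<open>Gale duality: if \<open>\<beta>\<close> is the Gale dual of \<open>v\<close> and \<open>\<Gamma>\<close> is a maximal cone of the secondary fan,
  then the vectors \<open>v i\<close>, \<open>i \<in> I\<close>, span a cone of the associated simplicial fan iff \<open>\<Gamma>\<close> lies in the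
  cone spanned by the complementary vectors of \<open>\<beta>\<close>.\<close>

definition phase_fan ::
    "('i \<Rightarrow> 'b::euclidean_space) \<Rightarrow> ('i \<Rightarrow> 'a::euclidean_space) \<Rightarrow> 'a set \<Rightarrow> 'b set set" where
  "phase_fan v \<beta> \<Gamma> = {convex_cone hull (v ` I) | I. \<Gamma> \<subseteq> convex_cone hull (\<beta> ` (- I))}"

text \<open>The data of the total space of \<open>\<Oplus>\<^sub>a \<O>(- d a)\<close>. The index set is the disjoint sum of the set
  \<open>'n\<close> of homogeneous coordinates \<open>x\<close> and the set \<open>'l\<close> of fibre coordinates \<open>p\<close>.\<close>

definition enhanced_rays ::
    "('n \<Rightarrow> real^'r) \<Rightarrow> ('n \<Rightarrow> 'l::finite \<Rightarrow> int) \<Rightarrow> 'n + 'l \<Rightarrow> (real^'r) \<times> (real^'l)" where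
  "enhanced_rays v u = case_sum (\<lambda>i. (v i, \<chi> a. real_of_int (u i a))) (\<lambda>a. (0, axis a 1))"

definition enhanced_classes ::
    "('n \<Rightarrow> int^'k) \<Rightarrow> ('l \<Rightarrow> int^'k) \<Rightarrow> 'n + 'l \<Rightarrow> int^'k" where
  "enhanced_classes w d = case_sum w (\<lambda>a. - d a)"

definition real_vec :: "int^'k \<Rightarrow> real^'k" where
  "real_vec q = (\<chi> j. real_of_int (q $ j))"


section \<open>Polynomials\<close>

type_synonym 'v mpoly = "('v \<Rightarrow>\<^sub>0 nat) \<Rightarrow>\<^sub>0 complex"

definition mvar :: "'v \<Rightarrow> 'v mpoly" where
  "mvar i = Poly_Mapping.single (Poly_Mapping.single i 1) 1"

definition mpoly_subst ::
    "(complex \<Rightarrow> 'b) \<Rightarrow> ('v::finite \<Rightarrow> 'b) \<Rightarrow> 'v mpoly \<Rightarrow> 'b::comm_ring_1" where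
  "mpoly_subst \<phi> x p = (\<Sum>m\<in>Poly_Mapping.keys p.
     \<phi> (Poly_Mapping.lookup p m) * (\<Prod>i\<in>UNIV. x i ^ Poly_Mapping.lookup m i))"

definition mpoly_eval :: "('v::finite \<Rightarrow> complex) \<Rightarrow> 'v mpoly \<Rightarrow> complex" where
  "mpoly_eval z = mpoly_subst (\<lambda>c. c) z"

definition monomial_degree :: "('v \<Rightarrow> 'g) \<Rightarrow> ('v \<Rightarrow>\<^sub>0 nat) \<Rightarrow> 'g::comm_monoid_add" where
  "monomial_degree wt m =
     (\<Sum>i\<in>Poly_Mapping.keys m. \<Sum>_<Poly_Mapping.lookup m i. wt i)"

definition homogeneous :: "('v \<Rightarrow> 'g::comm_monoid_add) \<Rightarrow> 'g \<Rightarrow> 'v mpoly \<Rightarrow> bool" where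
  "homogeneous wt \<gamma> p \<longleftrightarrow> (\<forall>m\<in>Poly_Mapping.keys p. monomial_degree wt m = \<gamma>)"

definition regular_sequence :: "('l::{finite,linorder} \<Rightarrow> 'a::comm_ring_1) \<Rightarrow> bool" where
  "regular_sequence G \<longleftrightarrow>
     (\<forall>a f. f * G a \<in> genideal ring_of_type_algebra (G ` {..<a}) \<longrightarrow>
            f \<in> genideal ring_of_type_algebra (G ` {..<a})) \<and>
     genideal ring_of_type_algebra (range G) \<noteq> UNIV"

text \<open>At each common zero of the \<open>G a\<close> outside the exceptional set of the fan \<open>F\<close> (the zero set of the
  irrelevant ideal) the differentials of the \<open>G a\<close> are linearly independent.\<close>

definition transversal ::
    "(real^'r) set set \<Rightarrow> ('n::finite \<Rightarrow> real^'r) \<Rightarrow> ('l::finite \<Rightarrow> 'n mpoly) \<Rightarrow> bool" where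
  "transversal F v G \<longleftrightarrow>
     (\<forall>z. (\<exists>\<sigma>\<in>F. \<forall>i. i \<notin> ray_indices v \<sigma> \<longrightarrow> z i \<noteq> 0) \<and> (\<forall>a. mpoly_eval z (G a) = 0) \<longrightarrow>
        (\<forall>c. (\<forall>i. (\<Sum>a\<in>UNIV. c a * deriv (\<lambda>t. mpoly_eval (z(i := t)) (G a)) (z i)) = 0) \<longrightarrow>
             (\<forall>a. c a = 0)))"


section \<open>Graded rings and modules\<close>

record ('g, 'a) gring = "'a ring" +
  rcomp :: "'g \<Rightarrow> 'a set"

record ('g, 'a, 'b) gmod = "('a, 'b) module" +
  gcomp :: "'g \<Rightarrow> 'b set"

text \<open>The ring operations \<open>mult\<close> and \<open>one\<close> that modules inherit from \<^typ>\<open>'b ring\<close> carry no meaning.\<close>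

definition graded_module :: "('g::ab_group_add, 'a) gring \<Rightarrow> ('g, 'a, 'b) gmod \<Rightarrow> bool" where
  "graded_module S M \<longleftrightarrow> Module.module S M \<and>
     (\<forall>\<gamma>. subgroup (gcomp M \<gamma>) (add_monoid M)) \<and>
     (\<forall>\<gamma> \<delta>. \<forall>s\<in>rcomp S \<gamma>. \<forall>x\<in>gcomp M \<delta>. s \<odot>\<^bsub>M\<^esub> x \<in> gcomp M (\<gamma> + \<delta>)) \<and>
     (\<forall>x\<in>carrier M. \<exists>!c. (\<forall>\<gamma>. c \<gamma> \<in> gcomp M \<gamma>) \<and> finite {\<gamma>. c \<gamma> \<noteq> \<zero>\<^bsub>M\<^esub>} \<and>
        x = finsum M c {\<gamma>. c \<gamma> \<noteq> \<zero>\<^bsub>M\<^esub>})"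

definition fin_gen :: "('g, 'a) gring \<Rightarrow> ('g, 'a, 'b) gmod \<Rightarrow> bool" where
  "fin_gen S M \<longleftrightarrow> (\<exists>B. finite B \<and> B \<subseteq> carrier M \<and>
     (\<forall>x\<in>carrier M. \<exists>c \<in> B \<rightarrow> carrier S. x = finsum M (\<lambda>b. c b \<odot>\<^bsub>M\<^esub> b) B))"

text \<open>Free graded modules of finite rank: those with a finite basis of homogeneous elements.\<close>

definition graded_free :: "('g, 'a) gring \<Rightarrow> ('g, 'a, 'b) gmod \<Rightarrow> bool" where
  "graded_free S M \<longleftrightarrow> (\<exists>B. finite B \<and> B \<subseteq> (\<Union>\<gamma>. gcomp M \<gamma>) \<and>
     (\<forall>x\<in>carrier M. \<exists>!c. c \<in> B \<rightarrow>\<^sub>E carrier S \<and> x = finsum M (\<lambda>b. c b \<odot>\<^bsub>M\<^esub> b) B))"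

definition ideal_power :: "('g, 'a) gring \<Rightarrow> 'a set \<Rightarrow> nat \<Rightarrow> 'a set" where
  "ideal_power S J m = ((\<lambda>K. ideal_prod S K J) ^^ m) (carrier S)"

definition torsion :: "('g, 'a) gring \<Rightarrow> 'a set \<Rightarrow> ('g, 'a, 'b) gmod \<Rightarrow> bool" where
  "torsion S J M \<longleftrightarrow>
     (\<exists>m. \<forall>s\<in>ideal_power S J m. \<forall>x\<in>carrier M. s \<odot>\<^bsub>M\<^esub> x = \<zero>\<^bsub>M\<^esub>)"

text \<open>Homomorphisms of degree zero. Off the carrier they are \<open>undefined\<close>, so that equality of
  functions is equality of homomorphisms.\<close>

definition gmod_hom :: "('g, 'a) gring \<Rightarrow> ('g, 'a, 'b) gmod \<Rightarrow> ('g, 'a, 'c) gmod \<Rightarrow> ('b \<Rightarrow> 'c) set"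
  where
  "gmod_hom S M N = {f \<in> carrier M \<rightarrow>\<^sub>E carrier N.
     (\<forall>x\<in>carrier M. \<forall>y\<in>carrier M. f (x \<oplus>\<^bsub>M\<^esub> y) = f x \<oplus>\<^bsub>N\<^esub> f y) \<and>
     (\<forall>s\<in>carrier S. \<forall>x\<in>carrier M. f (s \<odot>\<^bsub>M\<^esub> x) = s \<odot>\<^bsub>N\<^esub> f x) \<and>
     (\<forall>\<gamma>. f ` gcomp M \<gamma> \<subseteq> gcomp N \<gamma>)}"

definition gmod_sum :: "('g, 'a, 'b) gmod \<Rightarrow> ('g, 'a, 'c) gmod \<Rightarrow> ('g, 'a, 'b \<times> 'c) gmod" where
  "gmod_sum M N = \<lparr>carrier = carrier M \<times> carrier N, monoid.mult = undefined, one = undefined,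
     ring.zero = (\<zero>\<^bsub>M\<^esub>, \<zero>\<^bsub>N\<^esub>),
     add = (\<lambda>p q. (fst p \<oplus>\<^bsub>M\<^esub> fst q, snd p \<oplus>\<^bsub>N\<^esub> snd q)),
     smult = (\<lambda>s p. (s \<odot>\<^bsub>M\<^esub> fst p, s \<odot>\<^bsub>N\<^esub> snd p)),
     gcomp = (\<lambda>\<gamma>. gcomp M \<gamma> \<times> gcomp N \<gamma>)\<rparr>"

text \<open>The module \<open>M(q)\<close> with \<open>M(q)\<^sub>\<gamma> = M\<^bsub>\<gamma> + q\<^esub>\<close>.\<close>

definition degree_shift :: "'g::ab_group_add \<Rightarrow> ('g, 'a, 'b) gmod \<Rightarrow> ('g, 'a, 'b) gmod" where
  "degree_shift q M = M\<lparr>gcomp := \<lambda>\<gamma>. gcomp M (\<gamma> + q)\<rparr>"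

text \<open>The shift \<open>M(q)\<close> is the graded tensor product of \<open>M\<close> with \<open>S(q)\<close>: it carries the universal
  bilinear map, which has degree zero, and its homogeneous components are the images of the
  products of homogeneous components.\<close>

definition regular_module :: "('g, 'a) gring \<Rightarrow> ('g, 'a, 'a) gmod" where
  "regular_module S = \<lparr>carrier = carrier S, monoid.mult = undefined, one = undefined,
     ring.zero = \<zero>\<^bsub>S\<^esub>, add = add S, smult = monoid.mult S, gcomp = rcomp S\<rparr>"

definition bilinear_map ::
    "('g, 'a) gring \<Rightarrow> ('g, 'a, 'b) gmod \<Rightarrow> ('g, 'a, 'c) gmod \<Rightarrow> ('g, 'a, 'd) gmod \<Rightarrow>
      ('b \<Rightarrow> 'c \<Rightarrow> 'd) \<Rightarrow> bool" where
  "bilinear_map S M N P \<beta> \<longleftrightarrow>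
     (\<forall>x\<in>carrier M. \<forall>y\<in>carrier N. \<beta> x y \<in> carrier P) \<and>
     (\<forall>x\<in>carrier M. \<forall>x'\<in>carrier M. \<forall>y\<in>carrier N. \<beta> (x \<oplus>\<^bsub>M\<^esub> x') y = \<beta> x y \<oplus>\<^bsub>P\<^esub> \<beta> x' y) \<and>
     (\<forall>x\<in>carrier M. \<forall>y\<in>carrier N. \<forall>y'\<in>carrier N. \<beta> x (y \<oplus>\<^bsub>N\<^esub> y') = \<beta> x y \<oplus>\<^bsub>P\<^esub> \<beta> x y') \<and>
     (\<forall>s\<in>carrier S. \<forall>x\<in>carrier M. \<forall>y\<in>carrier N.
        \<beta> (s \<odot>\<^bsub>M\<^esub> x) y = s \<odot>\<^bsub>P\<^esub> \<beta> x y \<and> \<beta> x (s \<odot>\<^bsub>N\<^esub> y) = s \<odot>\<^bsub>P\<^esub> \<beta> x y)"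

lemma degree_shift_is_tensor_product:
  fixes S :: "('g::ab_group_add, 'a) gring" and M :: "('g, 'a, 'b) gmod"
    and P :: "('g, 'a, 'c) gmod" and q :: 'g
  assumes M: "graded_module S M"
  defines "N \<equiv> degree_shift q (regular_module S)" and "T \<equiv> degree_shift q M"
  shows "bilinear_map S M N T (\<lambda>x s. s \<odot>\<^bsub>M\<^esub> x)"
    and "x \<in> gcomp M \<gamma> \<Longrightarrow> s \<in> gcomp N \<delta> \<Longrightarrow> s \<odot>\<^bsub>M\<^esub> x \<in> gcomp T (\<gamma> + \<delta>)"
    and "\<one>\<^bsub>S\<^esub> \<in> rcomp S 0 \<Longrightarrow> x \<in> gcomp T \<gamma> \<Longrightarrow>
      x \<in> gcomp M (\<gamma> + q) \<and> \<one>\<^bsub>S\<^esub> \<in> gcomp N (- q) \<and> x = \<one>\<^bsub>S\<^esub> \<odot>\<^bsub>M\<^esub> x"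
    and "Module.module S P \<Longrightarrow> bilinear_map S M N P \<beta> \<Longrightarrow>
      \<exists>!h. h \<in> carrier T \<rightarrow>\<^sub>E carrier P \<and>
        (\<forall>x\<in>carrier T. \<forall>y\<in>carrier T. h (x \<oplus>\<^bsub>T\<^esub> y) = h x \<oplus>\<^bsub>P\<^esub> h y) \<and>
        (\<forall>s\<in>carrier S. \<forall>x\<in>carrier T. h (s \<odot>\<^bsub>T\<^esub> x) = s \<odot>\<^bsub>P\<^esub> h x) \<and>
        (\<forall>x\<in>carrier M. \<forall>s\<in>carrier N. h (s \<odot>\<^bsub>M\<^esub> x) = \<beta> x s)"
proof -
  interpret Module.module S M using M by (simp add: graded_module_def)
  have sub: "gcomp M \<gamma> \<subseteq> carrier M" for \<gamma>
    using M subgroup.subset[of "gcomp M \<gamma>" "add_monoid M"] by (auto simp: graded_module_def)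
  have T: "carrier T = carrier M" "add T = add M" "smult T = smult M"
      "gcomp T \<gamma> = gcomp M (\<gamma> + q)" for \<gamma>
    by (auto simp: T_def degree_shift_def)
  have N: "carrier N = carrier S" "add N = add S" "smult N = monoid.mult S"
      "gcomp N \<gamma> = rcomp S (\<gamma> + q)" for \<gamma>
    by (auto simp: N_def degree_shift_def regular_module_def)
  show "bilinear_map S M N T (\<lambda>x s. s \<odot>\<^bsub>M\<^esub> x)"
    by (auto simp: bilinear_map_def T N smult_l_distr smult_r_distr smult_assoc1[symmetric] m_comm)
  show "s \<odot>\<^bsub>M\<^esub> x \<in> gcomp T (\<gamma> + \<delta>)" if "x \<in> gcomp M \<gamma>" "s \<in> gcomp N \<delta>"
  proof -
    have "s \<odot>\<^bsub>M\<^esub> x \<in> gcomp M ((\<delta> + q) + \<gamma>)"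
      using M that unfolding graded_module_def N by blast
    then show ?thesis by (simp add: T ac_simps)
  qed
  show "x \<in> gcomp M (\<gamma> + q) \<and> \<one>\<^bsub>S\<^esub> \<in> gcomp N (- q) \<and> x = \<one>\<^bsub>S\<^esub> \<odot>\<^bsub>M\<^esub> x"
    if "\<one>\<^bsub>S\<^esub> \<in> rcomp S 0" "x \<in> gcomp T \<gamma>"
    using that smult_one[of x] sub[of "\<gamma> + q"] by (auto simp: T N)
  show "\<exists>!h. h \<in> carrier T \<rightarrow>\<^sub>E carrier P \<and>
        (\<forall>x\<in>carrier T. \<forall>y\<in>carrier T. h (x \<oplus>\<^bsub>T\<^esub> y) = h x \<oplus>\<^bsub>P\<^esub> h y) \<and>
        (\<forall>s\<in>carrier S. \<forall>x\<in>carrier T. h (s \<odot>\<^bsub>T\<^esub> x) = s \<odot>\<^bsub>P\<^esub> h x) \<and>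
        (\<forall>x\<in>carrier M. \<forall>s\<in>carrier N. h (s \<odot>\<^bsub>M\<^esub> x) = \<beta> x s)"
    if P: "Module.module S P" and \<beta>: "bilinear_map S M N P \<beta>"
  proof (rule ex1I)
    let ?h = "\<lambda>x\<in>carrier M. \<beta> x \<one>\<^bsub>S\<^esub>"
    have \<beta>1: "s \<odot>\<^bsub>P\<^esub> \<beta> x \<one>\<^bsub>S\<^esub> = \<beta> x s" if "x \<in> carrier M" "s \<in> carrier S" for x s
    proof -
      have "\<forall>y\<in>carrier S. \<beta> x (s \<otimes>\<^bsub>S\<^esub> y) = s \<odot>\<^bsub>P\<^esub> \<beta> x y"
        using \<beta> that unfolding bilinear_map_def N by blast
      then have "\<beta> x (s \<otimes>\<^bsub>S\<^esub> \<one>\<^bsub>S\<^esub>) = s \<odot>\<^bsub>P\<^esub> \<beta> x \<one>\<^bsub>S\<^esub>" by simp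
      then show ?thesis using that by simp
    qed
    show "?h \<in> carrier T \<rightarrow>\<^sub>E carrier P \<and>
        (\<forall>x\<in>carrier T. \<forall>y\<in>carrier T. ?h (x \<oplus>\<^bsub>T\<^esub> y) = ?h x \<oplus>\<^bsub>P\<^esub> ?h y) \<and>
        (\<forall>s\<in>carrier S. \<forall>x\<in>carrier T. ?h (s \<odot>\<^bsub>T\<^esub> x) = s \<odot>\<^bsub>P\<^esub> ?h x) \<and>
        (\<forall>x\<in>carrier M. \<forall>s\<in>carrier N. ?h (s \<odot>\<^bsub>M\<^esub> x) = \<beta> x s)"
      using \<beta> by (auto simp: bilinear_map_def T N(1) \<beta>1)
    show "h = ?h" if h: "h \<in> carrier T \<rightarrow>\<^sub>E carrier P \<and>
        (\<forall>x\<in>carrier T. \<forall>y\<in>carrier T. h (x \<oplus>\<^bsub>T\<^esub> y) = h x \<oplus>\<^bsub>P\<^esub> h y) \<and>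
        (\<forall>s\<in>carrier S. \<forall>x\<in>carrier T. h (s \<odot>\<^bsub>T\<^esub> x) = s \<odot>\<^bsub>P\<^esub> h x) \<and>
        (\<forall>x\<in>carrier M. \<forall>s\<in>carrier N. h (s \<odot>\<^bsub>M\<^esub> x) = \<beta> x s)" for h
    proof (rule extensionalityI[of _ "carrier M"])
      show "h \<in> extensional (carrier M)" using h by (auto simp: T PiE_def)
      show "h x = ?h x" if "x \<in> carrier M" for x
      proof -
        have "h (\<one>\<^bsub>S\<^esub> \<odot>\<^bsub>M\<^esub> x) = \<beta> x \<one>\<^bsub>S\<^esub>"
          using h \<open>x \<in> carrier M\<close> unfolding N by blast
        moreover have "\<one>\<^bsub>S\<^esub> \<odot>\<^bsub>M\<^esub> x = x" using \<open>x \<in> carrier M\<close> by simp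
        ultimately show ?thesis using \<open>x \<in> carrier M\<close> by simp
      qed
    qed simp
  qed
qed


section \<open>Complexes\<close>

record ('g, 'a, 'b) cplx =
  cterm :: "int \<Rightarrow> ('g, 'a, 'b) gmod"
  cdiff :: "int \<Rightarrow> 'b \<Rightarrow> 'b"

definition is_complex :: "('g::ab_group_add, 'a) gring \<Rightarrow> ('g, 'a, 'b) cplx \<Rightarrow> bool" where
  "is_complex S A \<longleftrightarrow>
     (\<forall>i. graded_module S (cterm A i) \<and> cdiff A i \<in> gmod_hom S (cterm A i) (cterm A (i + 1))) \<and>
     (\<forall>i. \<forall>x\<in>carrier (cterm A i). cdiff A (i + 1) (cdiff A i x) = \<zero>\<^bsub>cterm A (i + 2)\<^esub>)"

definition bounded_fg_complexes ::
    "('g::ab_group_add, 'a) gring \<Rightarrow> ('g, 'a, 'b) cplx set" where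
  "bounded_fg_complexes S = {A. is_complex S A \<and> (\<forall>i. fin_gen S (cterm A i)) \<and>
     (\<exists>N. \<forall>i. \<bar>i\<bar> > N \<longrightarrow> carrier (cterm A i) = {\<zero>\<^bsub>cterm A i\<^esub>})}"

definition chain_map ::
    "('g, 'a) gring \<Rightarrow> ('g, 'a, 'b) cplx \<Rightarrow> ('g, 'a, 'c) cplx \<Rightarrow> (int \<Rightarrow> 'b \<Rightarrow> 'c) \<Rightarrow> bool" where
  "chain_map S A B f \<longleftrightarrow> (\<forall>i. f i \<in> gmod_hom S (cterm A i) (cterm B i)) \<and>
     (\<forall>i. \<forall>x\<in>carrier (cterm A i). f (i + 1) (cdiff A i x) = cdiff B i (f i x))"

definition chain_iso ::
    "('g, 'a) gring \<Rightarrow> ('g, 'a, 'b) cplx \<Rightarrow> ('g, 'a, 'c) cplx \<Rightarrow> (int \<Rightarrow> 'b \<Rightarrow> 'c) \<Rightarrow> bool" where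
  "chain_iso S A B f \<longleftrightarrow> chain_map S A B f \<and>
     (\<forall>i. bij_betw (f i) (carrier (cterm A i)) (carrier (cterm B i)) \<and>
          (\<forall>\<gamma>. f i ` gcomp (cterm A i) \<gamma> = gcomp (cterm B i) \<gamma>))"

definition cocycles :: "('g, 'a, 'b) cplx \<Rightarrow> int \<Rightarrow> 'b set" where
  "cocycles A i = {x \<in> carrier (cterm A i). cdiff A i x = \<zero>\<^bsub>cterm A (i + 1)\<^esub>}"

definition coboundaries :: "('g, 'a, 'b) cplx \<Rightarrow> int \<Rightarrow> 'b set" where
  "coboundaries A i = cdiff A (i - 1) ` carrier (cterm A (i - 1))"

text \<open>The two conditions say that the maps induced on cohomology are injective and surjective.\<close>

definition quasi_iso ::
    "('g, 'a) gring \<Rightarrow> ('g, 'a, 'b) cplx \<Rightarrow> ('g, 'a, 'c) cplx \<Rightarrow> (int \<Rightarrow> 'b \<Rightarrow> 'c) \<Rightarrow> bool" where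
  "quasi_iso S A B f \<longleftrightarrow> chain_map S A B f \<and>
     (\<forall>i. (\<forall>x\<in>cocycles A i. f i x \<in> coboundaries B i \<longrightarrow> x \<in> coboundaries A i) \<and>
          (\<forall>y\<in>cocycles B i. \<exists>x\<in>cocycles A i. \<exists>b\<in>coboundaries B i. y = f i x \<oplus>\<^bsub>cterm B i\<^esub> b))"

definition cplx_shift :: "('g, 'a, 'b) cplx \<Rightarrow> ('g, 'a, 'b) cplx" where
  "cplx_shift A = \<lparr>cterm = \<lambda>i. cterm A (i + 1),
     cdiff = \<lambda>i. \<lambda>x\<in>carrier (cterm A (i + 1)). \<ominus>\<^bsub>cterm A (i + 2)\<^esub> (cdiff A (i + 1) x)\<rparr>"

definition mapping_cone ::
    "('g, 'a, 'b) cplx \<Rightarrow> ('g, 'a, 'c) cplx \<Rightarrow> (int \<Rightarrow> 'b \<Rightarrow> 'c) \<Rightarrow> ('g, 'a, 'b \<times> 'c) cplx" where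
  "mapping_cone A B f = \<lparr>cterm = \<lambda>i. gmod_sum (cterm A (i + 1)) (cterm B i),
     cdiff = \<lambda>i. \<lambda>p\<in>carrier (cterm A (i + 1)) \<times> carrier (cterm B i).
       (\<ominus>\<^bsub>cterm A (i + 2)\<^esub> (cdiff A (i + 1) (fst p)),
        f (i + 1) (fst p) \<oplus>\<^bsub>cterm B (i + 1)\<^esub> cdiff B i (snd p))\<rparr>"

definition cplx_twist :: "'g::ab_group_add \<Rightarrow> ('g, 'a, 'b) cplx \<Rightarrow> ('g, 'a, 'b) cplx" where
  "cplx_twist q A = A\<lparr>cterm := \<lambda>i. degree_shift q (cterm A i)\<rparr>"


section \<open>Localization of categories with triangles\<close>

text \<open>A category with a shift functor and a class of triangles
  \<open>X \<rightarrow>\<^bsup>f\<^esup> Y \<rightarrow>\<^bsup>g\<^esup> Z \<rightarrow>\<^bsup>h\<^esup> X[1]\<close>, given as triples \<open>(f, g, h)\<close> of arrows.\<close>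

record ('o, 'm) tcat =
  Ob :: "'o set"
  Ar :: "'m set"
  Dom :: "'m \<Rightarrow> 'o"
  Cod :: "'m \<Rightarrow> 'o"
  Idt :: "'o \<Rightarrow> 'm"
  Cmp :: "'m \<Rightarrow> 'm \<Rightarrow> 'm"
  ShO :: "'o \<Rightarrow> 'o"
  ShA :: "'m \<Rightarrow> 'm"
  Tri :: "('m \<times> 'm \<times> 'm) set"

text \<open>\<open>Cmp C g f\<close> is \<open>g \<circ> f\<close>.\<close>

definition iso_arrow :: "('o, 'm) tcat \<Rightarrow> 'm \<Rightarrow> bool" where
  "iso_arrow C f \<longleftrightarrow> f \<in> Ar C \<and> (\<exists>g\<in>Ar C. Dom C g = Cod C f \<and> Cod C g = Dom C f \<and>
     Cmp C g f = Idt C (Dom C f) \<and> Cmp C f g = Idt C (Cod C f))"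

definition isomorphic :: "('o, 'm) tcat \<Rightarrow> 'o \<Rightarrow> 'o \<Rightarrow> bool" where
  "isomorphic C X Y \<longleftrightarrow> (\<exists>f. iso_arrow C f \<and> Dom C f = X \<and> Cod C f = Y)"

definition is_triangle :: "('o, 'm) tcat \<Rightarrow> 'm \<times> 'm \<times> 'm \<Rightarrow> bool" where
  "is_triangle C t \<longleftrightarrow> (case t of (f, g, h) \<Rightarrow> f \<in> Ar C \<and> g \<in> Ar C \<and> h \<in> Ar C \<and>
     Cod C f = Dom C g \<and> Cod C g = Dom C h \<and> Cod C h = ShO C (Dom C f))"

definition triangle_iso :: "('o, 'm) tcat \<Rightarrow> 'm \<times> 'm \<times> 'm \<Rightarrow> 'm \<times> 'm \<times> 'm \<Rightarrow> bool" where
  "triangle_iso C t t' \<longleftrightarrow> is_triangle C t \<and> is_triangle C t' \<and>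
     (case t of (f, g, h) \<Rightarrow> case t' of (f', g', h') \<Rightarrow>
       \<exists>a b c. iso_arrow C a \<and> iso_arrow C b \<and> iso_arrow C c \<and>
         Dom C a = Dom C f \<and> Cod C a = Dom C f' \<and>
         Dom C b = Dom C g \<and> Cod C b = Dom C g' \<and>
         Dom C c = Dom C h \<and> Cod C c = Dom C h' \<and>
         Cmp C b f = Cmp C f' a \<and> Cmp C c g = Cmp C g' b \<and> Cmp C (ShA C a) h = Cmp C h' c)"

text \<open>Arrows of the localization are zigzags of arrows modulo the evident relations; a zigzag is
  read in the order in which its steps are followed, and \<open>Bw s\<close> is the formal inverse of \<open>s\<close>.\<close>

datatype 'm zstep = Fw 'm | Bw 'm

fun zigzag :: "('o, 'm) tcat \<Rightarrow> 'm set \<Rightarrow> 'o \<Rightarrow> 'm zstep list \<Rightarrow> 'o \<Rightarrow> bool" where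
  "zigzag C W X [] Y \<longleftrightarrow> X \<in> Ob C \<and> X = Y"
| "zigzag C W X (Fw f # p) Y \<longleftrightarrow> f \<in> Ar C \<and> Dom C f = X \<and> zigzag C W (Cod C f) p Y"
| "zigzag C W X (Bw s # p) Y \<longleftrightarrow> s \<in> Ar C \<inter> W \<and> Cod C s = X \<and> zigzag C W (Dom C s) p Y"

inductive zigzag_eq ::
    "('o, 'm) tcat \<Rightarrow> 'm set \<Rightarrow> 'o \<Rightarrow> 'o \<Rightarrow> 'm zstep list \<Rightarrow> 'm zstep list \<Rightarrow> bool"
  for C W where
  refl: "zigzag C W X p Y \<Longrightarrow> zigzag_eq C W X Y p p"
| sym: "zigzag_eq C W X Y p q \<Longrightarrow> zigzag_eq C W X Y q p"
| trans: "zigzag_eq C W X Y p q \<Longrightarrow> zigzag_eq C W X Y q r \<Longrightarrow> zigzag_eq C W X Y p r"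
| append: "zigzag_eq C W X Y p q \<Longrightarrow> zigzag_eq C W Y Z r s \<Longrightarrow> zigzag_eq C W X Z (p @ r) (q @ s)"
| idt: "X \<in> Ob C \<Longrightarrow> zigzag_eq C W X X [Fw (Idt C X)] []"
| cmp: "f \<in> Ar C \<Longrightarrow> g \<in> Ar C \<Longrightarrow> Cod C f = Dom C g \<Longrightarrow>
    zigzag_eq C W (Dom C f) (Cod C g) [Fw f, Fw g] [Fw (Cmp C g f)]"
| inv1: "s \<in> Ar C \<inter> W \<Longrightarrow> zigzag_eq C W (Dom C s) (Dom C s) [Fw s, Bw s] []"
| inv2: "s \<in> Ar C \<inter> W \<Longrightarrow> zigzag_eq C W (Cod C s) (Cod C s) [Bw s, Fw s] []"

type_synonym ('o, 'm) larrow = "'o \<times> 'o \<times> 'm zstep list set"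

definition zclass ::
    "('o, 'm) tcat \<Rightarrow> 'm set \<Rightarrow> 'o \<Rightarrow> 'o \<Rightarrow> 'm zstep list \<Rightarrow> ('o, 'm) larrow" where
  "zclass C W X Y p = (X, Y, {q. zigzag_eq C W X Y p q})"

definition loc_arrow :: "('o, 'm) tcat \<Rightarrow> 'm set \<Rightarrow> 'm \<Rightarrow> ('o, 'm) larrow" where
  "loc_arrow C W f = zclass C W (Dom C f) (Cod C f) [Fw f]"

text \<open>The localization of \<open>C\<close> at \<open>W\<close> as a bare category with shift. The shift is well defined
  on arrows as soon as \<open>W\<close> is closed under it.\<close>

definition loc_cat :: "('o, 'm) tcat \<Rightarrow> 'm set \<Rightarrow> ('o, ('o, 'm) larrow) tcat" where
  "loc_cat C W = \<lparr>Ob = Ob C,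
     Ar = {zclass C W X Y p | X Y p. zigzag C W X p Y},
     Dom = fst, Cod = fst \<circ> snd,
     Idt = (\<lambda>X. zclass C W X X []),
     Cmp = (\<lambda>(Y', Z, Q) (X, Y, P). (X, Z, {r. \<exists>p\<in>P. \<exists>q\<in>Q. zigzag_eq C W X Z (p @ q) r})),
     ShO = ShO C,
     ShA = (\<lambda>(X, Y, P). (ShO C X, ShO C Y,
       {r. \<exists>p\<in>P. zigzag_eq C W (ShO C X) (ShO C Y) (map (map_zstep (ShA C)) p) r})),
     Tri = {}\<rparr>"

text \<open>Its distinguished triangles are those isomorphic to images of triangles of \<open>C\<close>.\<close>

definition localization :: "('o, 'm) tcat \<Rightarrow> 'm set \<Rightarrow> ('o, ('o, 'm) larrow) tcat" where
  "localization C W = (loc_cat C W)\<lparr>Tri := {t. \<exists>(f, g, h)\<in>Tri C.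
     triangle_iso (loc_cat C W) (loc_arrow C W f, loc_arrow C W g, loc_arrow C W h) t}\<rparr>"

text \<open>The full subcategory of the objects isomorphic to an object of \<open>N\<close>, given by its objects.\<close>

definition essential_closure :: "('o, 'm) tcat \<Rightarrow> 'o set \<Rightarrow> 'o set" where
  "essential_closure C N = {X \<in> Ob C. \<exists>Y\<in>N. isomorphic C X Y}"

definition arrows_with_cone_in :: "('o, 'm) tcat \<Rightarrow> 'o set \<Rightarrow> 'm set" where
  "arrows_with_cone_in C N = {s \<in> Ar C. \<exists>g h. (s, g, h) \<in> Tri C \<and> Cod C g \<in> N}"

definition verdier_quotient :: "('o, 'm) tcat \<Rightarrow> 'o set \<Rightarrow> ('o, ('o, 'm) larrow) tcat" where
  "verdier_quotient C N = localization C (arrows_with_cone_in C N)"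


section \<open>Derived and singularity categories\<close>

text \<open>The category of bounded complexes of finitely generated graded \<open>S\<close>-modules with carriers in the
  type \<open>'b\<close>. Its triangles are the mapping cone triangles; as the cone itself has carriers in
  \<^typ>\<open>'b \<times> 'b\<close>, it is transported along an isomorphism of complexes \<open>\<phi>\<close>.\<close>

type_synonym ('g, 'a, 'b) cplx_arrow =
  "('g, 'a, 'b) cplx \<times> ('g, 'a, 'b) cplx \<times> (int \<Rightarrow> 'b \<Rightarrow> 'b)"

definition complexes_cat ::
    "('g::ab_group_add, 'a) gring \<Rightarrow> (('g, 'a, 'b) cplx, ('g, 'a, 'b) cplx_arrow) tcat" where
  "complexes_cat S = \<lparr>Ob = bounded_fg_complexes S,
     Ar = {(A, B, f). A \<in> bounded_fg_complexes S \<and> B \<in> bounded_fg_complexes S \<and> chain_map S A B f},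
     Dom = fst, Cod = fst \<circ> snd,
     Idt = (\<lambda>A. (A, A, \<lambda>i. \<lambda>x\<in>carrier (cterm A i). x)),
     Cmp = (\<lambda>(B', C, g) (A, B, f). (A, C, \<lambda>i. compose (carrier (cterm A i)) (g i) (f i))),
     ShO = cplx_shift,
     ShA = (\<lambda>(A, B, f). (cplx_shift A, cplx_shift B, \<lambda>i. f (i + 1))),
     Tri = {((A, B, f), (B, C, g), (C, cplx_shift A, h)) | A B C f g h.
       A \<in> bounded_fg_complexes S \<and> B \<in> bounded_fg_complexes S \<and> C \<in> bounded_fg_complexes S \<and>
       chain_map S A B f \<and> chain_map S B C g \<and> chain_map S C (cplx_shift A) h \<and>
       (\<exists>\<phi>. chain_iso S (mapping_cone A B f) C \<phi> \<and>
         (\<forall>i. \<forall>b\<in>carrier (cterm B i). g i b = \<phi> i (\<zero>\<^bsub>cterm A (i + 1)\<^esub>, b)) \<and>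
         (\<forall>i. \<forall>a\<in>carrier (cterm A (i + 1)). \<forall>b\<in>carrier (cterm B i). h i (\<phi> i (a, b)) = a))}\<rparr>"

definition derived_cat where
  "derived_cat S =
     localization (complexes_cat S) {(A, B, f) \<in> Ar (complexes_cat S). quasi_iso S A B f}"

definition perf where
  "perf S = essential_closure (derived_cat S)
     {A \<in> bounded_fg_complexes S. \<forall>i. graded_free S (cterm A i)}"

definition derived_tor where
  "derived_tor S J = essential_closure (derived_cat S)
     {A \<in> bounded_fg_complexes S. \<forall>i. torsion S J (cterm A i)}"

definition sing_cat where
  "sing_cat S = verdier_quotient (derived_cat S) (perf S)"

definition sing_tor where
  "sing_tor S J = essential_closure (sing_cat S) (derived_tor S J)"

definition phase_cat where
  "phase_cat S J = verdier_quotient (sing_cat S) (sing_tor S J)"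


section \<open>Grothendieck groups\<close>

text \<open>The free abelian group on the objects modulo \<open>[Y] = [X] + [Z]\<close> for each distinguished triangle
  \<open>X \<rightarrow> Y \<rightarrow> Z \<rightarrow> X[1]\<close>. The library writes the group multiplicatively.\<close>

definition K_relations :: "('o, 'm) tcat \<Rightarrow> ('o \<Rightarrow>\<^sub>0 int) set" where
  "K_relations C = generate (free_Abelian_group (Ob C))
     {frag_of (Dom C g) - frag_of (Dom C f) - frag_of (Dom C h) | f g h. (f, g, h) \<in> Tri C}"

definition K_group :: "('o, 'm) tcat \<Rightarrow> ('o \<Rightarrow>\<^sub>0 int) set monoid" where
  "K_group C = free_Abelian_group (Ob C) Mod K_relations C"

text \<open>The endomorphism \<open>[A] \<mapsto> [F A]\<close> induced by a triangulated endofunctor with object map \<open>F\<close>: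
  the image of a coset is the (only) coset that contains the images of its elements.\<close>

definition K_map :: "('o, 'm) tcat \<Rightarrow> ('o \<Rightarrow> 'o) \<Rightarrow> ('o \<Rightarrow>\<^sub>0 int) set \<Rightarrow> ('o \<Rightarrow>\<^sub>0 int) set" where
  "K_map C F X = (\<Union>c\<in>X. K_relations C #>\<^bsub>free_Abelian_group (Ob C)\<^esub> frag_extend (\<lambda>A. frag_of (F A)) c)"

definition minus_id :: "('a, 'c) monoid_scheme \<Rightarrow> ('a \<Rightarrow> 'a) \<Rightarrow> 'a \<Rightarrow> 'a" where
  "minus_id K M x = M x \<otimes>\<^bsub>K\<^esub> inv\<^bsub>K\<^esub> x"


section \<open>The hypersurface ring of the superpotential\<close>

text \<open>A bidegree in \<open>\<int>\<^sup>k \<times> 2\<int>\<close> is represented by the first component together with half of the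
  second one.\<close>

type_synonym 'k bidegree = "(int^'k) \<times> int"

definition var_bidegree ::
    "('n \<Rightarrow> int^'k) \<Rightarrow> ('l \<Rightarrow> int^'k) \<Rightarrow> 'n + 'l \<Rightarrow> 'k bidegree" where
  "var_bidegree w d = case_sum (\<lambda>i. (w i, 0)) (\<lambda>a. (- d a, 1))"

definition superpotential :: "('l::finite \<Rightarrow> 'n::finite mpoly) \<Rightarrow> ('n + 'l) mpoly" where
  "superpotential G =
     (\<Sum>a\<in>UNIV. mvar (Inr a) * mpoly_subst (Poly_Mapping.single 0) (\<lambda>i. mvar (Inl i)) (G a))"

definition residue_class ::
    "('l::finite \<Rightarrow> 'n::finite mpoly) \<Rightarrow> ('n + 'l) mpoly \<Rightarrow> ('n + 'l) mpoly set" where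
  "residue_class G p = (PIdl\<^bsub>ring_of_type_algebra\<^esub> (superpotential G)) +>\<^bsub>ring_of_type_algebra\<^esub> p"

definition hypersurface_ring ::
    "('n::finite \<Rightarrow> int^'k) \<Rightarrow> ('l::finite \<Rightarrow> int^'k) \<Rightarrow> ('l \<Rightarrow> 'n mpoly) \<Rightarrow>
      ('k bidegree, ('n + 'l) mpoly set) gring" where
  "hypersurface_ring w d G =
     ring.extend (ring_of_type_algebra Quot (PIdl\<^bsub>ring_of_type_algebra\<^esub> (superpotential G)))
       \<lparr>rcomp = \<lambda>\<gamma>. residue_class G ` {p. homogeneous (var_bidegree w d) \<gamma> p}\<rparr>"

text \<open>The image in the hypersurface ring of the irrelevant ideal of the fan \<open>\<Phi>\<close>.\<close>

definition irrelevant_ideal ::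
    "('n::finite \<Rightarrow> int^'k) \<Rightarrow> ('l::finite \<Rightarrow> int^'k) \<Rightarrow> ('l \<Rightarrow> 'n mpoly) \<Rightarrow>
      ('n + 'l \<Rightarrow> 'a::euclidean_space) \<Rightarrow> 'a set set \<Rightarrow> ('n + 'l) mpoly set set" where
  "irrelevant_ideal w d G v \<Phi> = genideal (hypersurface_ring w d G)
     {residue_class G (\<Prod>i\<in>- ray_indices v \<sigma>. mvar i) | \<sigma>. \<sigma> \<in> \<Phi>}"

text \<open>Each finitely generated module over the hypersurface ring is a quotient of a free module of
  finite rank, whose elements are represented by sequences of polynomials; hence its elements
  can be encoded as sets of such sequences, and the following type of carriers yields
  a small model of the category of all finitely generated graded modules.\<close>

type_synonym ('n, 'l) mod_elem = "(nat \<Rightarrow> ('n + 'l) mpoly) set"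

definition phase_category ::
    "('n::finite \<Rightarrow> int^'k) \<Rightarrow> ('l::finite \<Rightarrow> int^'k) \<Rightarrow> ('l \<Rightarrow> 'n mpoly) \<Rightarrow>
      ('n + 'l \<Rightarrow> 'a::euclidean_space) \<Rightarrow> 'a set set \<Rightarrow>
      (('k bidegree, ('n + 'l) mpoly set, ('n, 'l) mod_elem) cplx, _) tcat" where
  "phase_category w d G v \<Phi> = phase_cat (hypersurface_ring w d G) (irrelevant_ideal w d G v \<Phi>)"

text \<open>\<open>A \<otimes> S(q)\<close> is taken termwise and identified with \<open>A(q)\<close>; see \<open>degree_shift_is_tensor_product\<close>.\<close>

definition monodromy where
  "monodromy w d G v \<Phi> q = K_map (phase_category w d G v \<Phi>) (cplx_twist (q, 0))"

end

theory Submission imports Defs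
begin

text \<open>All relations are verified in the free abelian group on the bounded complexes, modulo the
  distinguished triangles. Multiplication by a homogeneous element \<open>s\<close> of degree \<open>\<gamma>\<close> gives
  \<open>[A(\<gamma>)] - [A] = [C] - [K]\<close> with cokernel and kernel complexes annihilated by \<open>s\<close> and by everything that
  annihilates \<open>A\<close>. Iterating over the variables in \<open>I\<close>, every class is carried to classes of complexes
  annihilated by all \<open>x\<^sub>i\<close>, \<open>i \<in> I\<close>, and these are torsion, since each generator of the irrelevant
  ideal is divisible by some \<open>x\<^sub>i\<close>, \<open>i \<in> I\<close>.

  The variables \<open>p\<^sub>a\<close> have degree \<open>(- d\<^sub>a, 1)\<close> instead of \<open>(- d\<^sub>a, 0)\<close>, so one also needs the periodicity
  \<open>[A(0, 1)] = [A]\<close>. Let \<open>P\<close> be the polynomial ring and \<open>W\<close> the superpotential, of degree \<open>\<delta> = (0, 1)\<close>.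
  By a filtration one may take \<open>A = P/I\<close> with \<open>W \<in> I\<close>, where the exact sequence
  \<open>0 \<rightarrow> (P/I)(- \<delta>) \<rightarrow> I/WI \<rightarrow> P/WP \<rightarrow> P/I \<rightarrow> 0\<close> reduces the claim to \<open>[I/WI] = 0\<close>. Since \<open>P\<close> need
  not be positively graded, graded syzygies do not obviously terminate; instead the variables acting on
  \<open>I\<close> are separated from those occurring in it, which turns \<open>I\<close> into a free module, and are identified
  again one at a time by means of Grothendieck's exact sequence
  \<open>0 \<rightarrow> T\<^sub>m[x](- deg x) \<rightarrow> T\<^sub>k[x] \<rightarrow> T \<rightarrow> 0\<close> with \<open>k = m + 1\<close>, whose first map is multiplication by \<open>x - y\<close>,
  for a filtration \<open>T\<^sub>0 \<subseteq> T\<^sub>1 \<subseteq> \<dots>\<close> of \<open>T\<close> by degree in \<open>y\<close> and \<open>m\<close> sufficiently large.\<close>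

section \<open>Functors on localizations and transport of triangles\<close>

section \<open>Categories with triangles and their localizations\<close>

text \<open>Every relation is found in the bottom category, that of complexes, where the cone of the
  injection in a short exact sequence is quasi-isomorphic to the quotient. Each of the three
  localizations keeps the objects and retains the relations, so no morphism of a localized category
  has to be analysed; the two Verdier quotients contribute that free and torsion complexes have
  class zero.

  The delicate point is [I/WI] = 0. Let V be the set of ring variables that act through the copy in
  which I is written. For V empty the module is a tensor product, over the constants, of P with a
  finite-dimensional space, and is free; for V full it is I. Adding one variable v to V expresses
  the new module by two modules for the old V, but with other generators (multiplied by powers of y)
  and another degree shift. Hence the vanishing is claimed for all finite homogeneous generating
  sets and all shifts at once, and the bound m comes from the Noetherian property.

  Two properties of W enter: it is nonzero, so multiplication by it is injective on polynomials; its
  degree is nonzero, so 1 is not a multiple of it.\<close>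

definition endofunctor :: "('o, 'm) tcat \<Rightarrow> ('o \<Rightarrow> 'o) \<Rightarrow> ('m \<Rightarrow> 'm) \<Rightarrow> bool" where
  "endofunctor C Fo Fm \<longleftrightarrow> (\<forall>X\<in>Ob C. Fo X \<in> Ob C \<and> Fm (Idt C X) = Idt C (Fo X)) \<and>
     (\<forall>f\<in>Ar C. Fm f \<in> Ar C \<and> Dom C (Fm f) = Fo (Dom C f) \<and> Cod C (Fm f) = Fo (Cod C f)) \<and>
     (\<forall>f\<in>Ar C. \<forall>g\<in>Ar C. Cod C f = Dom C g \<longrightarrow> Fm (Cmp C g f) = Cmp C (Fm g) (Fm f))"

text \<open>Only the first arrow of a triangle and its cone are required to be respected: the shift
  functor itself changes the sign of the last arrow of a triangle.\<close>

definition cone_preserving :: "('o, 'm) tcat \<Rightarrow> ('o \<Rightarrow> 'o) \<Rightarrow> ('m \<Rightarrow> 'm) \<Rightarrow> bool" where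
  "cone_preserving C Fo Fm \<longleftrightarrow> endofunctor C Fo Fm \<and>
     (\<forall>f g h. (f, g, h) \<in> Tri C \<longrightarrow> (\<exists>g' h'. (Fm f, g', h') \<in> Tri C \<and> Cod C g' = Fo (Cod C g)))"

locale cat =
  fixes C :: "('o, 'm) tcat"
  assumes Dom_Ob [simp]: "f \<in> Ar C ==> Dom C f \<in> Ob C"
    and Cod_Ob [simp]: "f \<in> Ar C ==> Cod C f \<in> Ob C"
    and Idt [simp]: "X \<in> Ob C ==> Idt C X \<in> Ar C" "X \<in> Ob C ==> Dom C (Idt C X) = X"
      "X \<in> Ob C ==> Cod C (Idt C X) = X"
    and Cmp [simp]: "\<lbrakk>f \<in> Ar C; g \<in> Ar C; Cod C f = Dom C g\<rbrakk> \<Longrightarrow> Cmp C g f \<in> Ar C"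
      "\<lbrakk>f \<in> Ar C; g \<in> Ar C; Cod C f = Dom C g\<rbrakk> \<Longrightarrow> Dom C (Cmp C g f) = Dom C f"
      "\<lbrakk>f \<in> Ar C; g \<in> Ar C; Cod C f = Dom C g\<rbrakk> \<Longrightarrow> Cod C (Cmp C g f) = Cod C g"
    and Cmp_Idt [simp]: "f \<in> Ar C ==> Cmp C (Idt C (Cod C f)) f = f"
      "f \<in> Ar C ==> Cmp C f (Idt C (Dom C f)) = f"
    and Cmp_assoc: "\<lbrakk>f \<in> Ar C; g \<in> Ar C; h \<in> Ar C; Cod C f = Dom C g; Cod C g = Dom C h\<rbrakk> \<Longrightarrow>
      Cmp C h (Cmp C g f) = Cmp C (Cmp C h g) f"

text \<open>The properties of a triangulated category from which relations between classes are
  drawn. \<open>idt_tri\<close> supplies a triangle on an identity, used to show that isomorphic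
  objects have equal classes; \<open>zero_tri\<close> asks for a single object Z with a triangle Z
  -> X -> X on every X, so that there is always an arrow with cone X.\<close>

locale tri_cat = cat C for C :: "('o, 'm) tcat" +
  assumes shift: "cone_preserving C (ShO C) (ShA C)"
    and tri: "t \<in> Tri C ==> is_triangle C t"
    and idt_tri: "X \<in> Ob C ==> \<exists>g h. (Idt C X, g, h) \<in> Tri C"
    and zero_tri: "\<exists>Z\<in>Ob C. \<forall>X\<in>Ob C. \<exists>f h. (f, Idt C X, h) \<in> Tri C \<and> Dom C f = Z"

lemma zigzag_append: "zigzag C W X p Y ==> zigzag C W Y q Z ==> zigzag C W X (p @ q) Z"
  by (induction C W X p Y rule: zigzag.induct) auto

context cat
begin

lemma zigzag_Ob: "zigzag C W X p Y ==> X \<in> Ob C \<and> Y \<in> Ob C"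
proof (induction p arbitrary: X)
  case (Cons a p)
  then show ?case by (cases a) auto
qed auto

lemma zclass_eqI: "zigzag_eq C W X Y p q ==> zclass C W X Y p = zclass C W X Y q"
  unfolding zclass_def by (auto intro: zigzag_eq.trans zigzag_eq.sym)

lemma zclass_Cmp:
  assumes "zigzag C W X p Y" "zigzag C W Y q Z"
  shows "Cmp (loc_cat C W) (zclass C W Y Z q) (zclass C W X Y p) = zclass C W X Z (p @ q)"
  using assms
  by (auto simp: loc_cat_def zclass_def intro: zigzag_eq.refl zigzag_eq.trans zigzag_eq.append)

text \<open>The functor induced on the localization, acting stepwise on zigzags. For the shift
  functor it is literally \<open>ShA\<close> of \<open>loc_cat\<close>, so the same lemmas cover the
  shift and the twists.\<close>

definition loc_map :: "'m set \<Rightarrow> ('o \<Rightarrow> 'o) \<Rightarrow> ('m \<Rightarrow> 'm) \<Rightarrow> ('o, 'm) larrow \<Rightarrow> ('o, 'm) larrow" where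
  "loc_map W Fo Fm = (\<lambda>(X, Y, P). (Fo X, Fo Y,
     {r. \<exists>p\<in>P. zigzag_eq C W (Fo X) (Fo Y) (map (map_zstep Fm) p) r}))"

lemma zigzag_map:
  assumes F: "endofunctor C Fo Fm" and W: "Fm ` (Ar C \<inter> W) \<subseteq> W"
  shows "zigzag C W X p Y ==> zigzag C W (Fo X) (map (map_zstep Fm) p) (Fo Y)"
proof (induction p arbitrary: X)
  case (Cons a p)
  then show ?case using F W unfolding endofunctor_def by (cases a) auto
qed (use F in \<open>auto simp: endofunctor_def\<close>)

text \<open>The generating relations survive because a functor preserves identities and composites
  and \<open>W\<close> is mapped into itself; the latter also makes the image of a backward step
  legitimate.\<close>

lemma zigzag_eq_map:
  assumes F: "endofunctor C Fo Fm" and W: "Fm ` (Ar C \<inter> W) \<subseteq> W"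
  shows "zigzag_eq C W X Y p q ==>
    zigzag_eq C W (Fo X) (Fo Y) (map (map_zstep Fm) p) (map (map_zstep Fm) q)"
proof (induction rule: zigzag_eq.induct)
  case (refl X p Y)
  show ?case by (rule zigzag_eq.refl) (rule zigzag_map[OF F W refl])
next
  case (idt X)
  then show ?case using F zigzag_eq.idt[of "Fo X" C W] by (auto simp: endofunctor_def)
next
  case (cmp f g)
  then show ?case using F zigzag_eq.cmp[of "Fm f" C "Fm g" W] by (auto simp: endofunctor_def)
next
  case (inv1 s)
  then show ?case using F W zigzag_eq.inv1[of "Fm s" C W] by (auto simp: endofunctor_def)
next
  case (inv2 s)
  then show ?case using F W zigzag_eq.inv2[of "Fm s" C W] by (auto simp: endofunctor_def)
qed (auto intro: zigzag_eq.sym zigzag_eq.trans zigzag_eq.append)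

lemma loc_map_zclass:
  assumes F: "endofunctor C Fo Fm" and W: "Fm ` (Ar C \<inter> W) \<subseteq> W"
    and p: "zigzag C W X p Y"
  shows "loc_map W Fo Fm (zclass C W X Y p) =
    zclass C W (Fo X) (Fo Y) (map (map_zstep Fm) p)"
  unfolding loc_map_def zclass_def
  using zigzag_eq_map[OF F W, where X = X and Y = Y and p = p] zigzag_eq.refl[OF p]
  by (auto intro: zigzag_eq.trans)

lemma loc_simps [simp]:
  "Ob (localization C W) = Ob C" "Ar (localization C W) = Ar (loc_cat C W)"
  "Dom (localization C W) = Dom (loc_cat C W)" "Cod (localization C W) = Cod (loc_cat C W)"
  "Idt (localization C W) = Idt (loc_cat C W)" "Cmp (localization C W) = Cmp (loc_cat C W)"
  "ShO (localization C W) = ShO C" "ShA (localization C W) = ShA (loc_cat C W)"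
  "Ob (loc_cat C W) = Ob C" "ShO (loc_cat C W) = ShO C"
  "Dom (loc_cat C W) (zclass C W X Y p) = X" "Cod (loc_cat C W) (zclass C W X Y p) = Y"
  by (auto simp: localization_def loc_cat_def zclass_def)

lemma ShA_loc: "ShA (loc_cat C W) = loc_map W (ShO C) (ShA C)"
  by (simp add: loc_cat_def loc_map_def)

lemma Idt_loc: "Idt (loc_cat C W) X = zclass C W X X []"
  by (simp add: loc_cat_def)

lemma Ar_locE:
  assumes "f \<in> Ar (loc_cat C W)"
  obtains X Y p where "f = zclass C W X Y p" "zigzag C W X p Y" "X \<in> Ob C" "Y \<in> Ob C"
  using assms zigzag_Ob by (fastforce simp: loc_cat_def)

lemma Ar_locI: "zigzag C W X p Y ==> zclass C W X Y p \<in> Ar (loc_cat C W)"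
  by (auto simp: loc_cat_def)

lemma cat_loc: "cat (loc_cat C W)"
proof
  fix f g h assume f: "f \<in> Ar (loc_cat C W)"
  then obtain X Y p where p: "f = zclass C W X Y p" "zigzag C W X p Y" "X \<in> Ob C" "Y \<in> Ob C"
    by (rule Ar_locE)
  show "Dom (loc_cat C W) f \<in> Ob (loc_cat C W)" "Cod (loc_cat C W) f \<in> Ob (loc_cat C W)"
    using p by auto
  show "Cmp (loc_cat C W) (Idt (loc_cat C W) (Cod (loc_cat C W) f)) f = f"
    "Cmp (loc_cat C W) f (Idt (loc_cat C W) (Dom (loc_cat C W) f)) = f"
    using zclass_Cmp[OF p(2), where q = "[]" and Z = Y]
      zclass_Cmp[where X = X and p = "[]" and Y = X and q = p and Z = Y and W = W] p by (auto simp: Idt_loc)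
  assume g: "g \<in> Ar (loc_cat C W)" and fg: "Cod (loc_cat C W) f = Dom (loc_cat C W) g"
  then obtain Z q where q: "g = zclass C W Y Z q" "zigzag C W Y q Z"
    using p by (auto elim!: Ar_locE)
  show "Cmp (loc_cat C W) g f \<in> Ar (loc_cat C W)"
    "Dom (loc_cat C W) (Cmp (loc_cat C W) g f) = Dom (loc_cat C W) f"
    "Cod (loc_cat C W) (Cmp (loc_cat C W) g f) = Cod (loc_cat C W) g"
    using zclass_Cmp[OF p(2) q(2)] zigzag_append[OF p(2) q(2)] by (auto simp: p q intro: Ar_locI)
  assume h: "h \<in> Ar (loc_cat C W)" and gh: "Cod (loc_cat C W) g = Dom (loc_cat C W) h"
  then obtain U r where r: "h = zclass C W Z U r" "zigzag C W Z r U"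
    using q by (auto elim!: Ar_locE)
  show "Cmp (loc_cat C W) h (Cmp (loc_cat C W) g f) = Cmp (loc_cat C W) (Cmp (loc_cat C W) h g) f"
    using p q r by (simp add: zclass_Cmp zigzag_append)
next
  fix X assume "X \<in> Ob (loc_cat C W)"
  then show "Idt (loc_cat C W) X \<in> Ar (loc_cat C W)"
    "Dom (loc_cat C W) (Idt (loc_cat C W) X) = X" "Cod (loc_cat C W) (Idt (loc_cat C W) X) = X"
    by (auto simp: Idt_loc intro!: Ar_locI)
qed

lemma endofunctor_loc:
  assumes F: "endofunctor C Fo Fm" and W: "Fm ` (Ar C \<inter> W) \<subseteq> W"
  shows "endofunctor (loc_cat C W) Fo (loc_map W Fo Fm)"
  unfolding endofunctor_def
proof (intro conjI ballI impI)
  note m = loc_map_zclass[OF F W] zigzag_map[OF F W]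
  fix X assume X: "X \<in> Ob (loc_cat C W)"
  then show "Fo X \<in> Ob (loc_cat C W)" using F by (auto simp: endofunctor_def)
  show "loc_map W Fo Fm (Idt (loc_cat C W) X) = Idt (loc_cat C W) (Fo X)"
    using X m(1)[of X "[]" X] by (simp add: Idt_loc)
next
  note m = loc_map_zclass[OF F W] zigzag_map[OF F W]
  fix f assume "f \<in> Ar (loc_cat C W)"
  then obtain X Y p where p: "f = zclass C W X Y p" "zigzag C W X p Y" "X \<in> Ob C" "Y \<in> Ob C"
    by (rule Ar_locE)
  then show "loc_map W Fo Fm f \<in> Ar (loc_cat C W)"
    "Dom (loc_cat C W) (loc_map W Fo Fm f) = Fo (Dom (loc_cat C W) f)"
    "Cod (loc_cat C W) (loc_map W Fo Fm f) = Fo (Cod (loc_cat C W) f)"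
    by (auto simp: m intro!: Ar_locI)
  fix g assume g: "g \<in> Ar (loc_cat C W)" and fg: "Cod (loc_cat C W) f = Dom (loc_cat C W) g"
  then obtain Z q where q: "g = zclass C W Y Z q" "zigzag C W Y q Z"
    using p by (auto elim!: Ar_locE)
  show "loc_map W Fo Fm (Cmp (loc_cat C W) g f) =
    Cmp (loc_cat C W) (loc_map W Fo Fm g) (loc_map W Fo Fm f)"
    using p q by (simp add: m zclass_Cmp zigzag_append)
qed

lemma zigzag_Fw: "f \<in> Ar C ==> zigzag C W (Dom C f) [Fw f] (Cod C f)"
  by auto

lemma loc_arrow:
  assumes "f \<in> Ar C"
  shows "loc_arrow C W f \<in> Ar (loc_cat C W)" "Dom (loc_cat C W) (loc_arrow C W f) = Dom C f"
    "Cod (loc_cat C W) (loc_arrow C W f) = Cod C f"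
  using Ar_locI[OF zigzag_Fw[OF assms]] by (auto simp: loc_arrow_def)

lemma loc_arrow_Idt: "X \<in> Ob C ==> loc_arrow C W (Idt C X) = Idt (loc_cat C W) X"
  using zclass_eqI[OF zigzag_eq.idt[of X C W]] by (simp add: loc_arrow_def Idt_loc)

lemma loc_map_loc_arrow:
  assumes F: "endofunctor C Fo Fm" and W: "Fm ` (Ar C \<inter> W) \<subseteq> W" and f: "f \<in> Ar C"
  shows "loc_map W Fo Fm (loc_arrow C W f) = loc_arrow C W (Fm f)"
  using loc_map_zclass[OF F W zigzag_Fw[OF f]] F f
  by (auto simp: loc_arrow_def endofunctor_def)

lemma iso_loc_arrow:
  assumes "s \<in> Ar C \<inter> W"
  shows "iso_arrow (loc_cat C W) (loc_arrow C W s)"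
proof -
  let ?g = "zclass C W (Cod C s) (Dom C s) [Bw s]"
  have z: "zigzag C W (Cod C s) [Bw s] (Dom C s)" "zigzag C W (Dom C s) [Fw s] (Cod C s)"
    using assms by auto
  have "Cmp (loc_cat C W) ?g (loc_arrow C W s) = Idt (loc_cat C W) (Dom C s)"
    "Cmp (loc_cat C W) (loc_arrow C W s) ?g = Idt (loc_cat C W) (Cod C s)"
    using zclass_Cmp[OF z(2,1)] zclass_Cmp[OF z] zclass_eqI[OF zigzag_eq.inv1[OF assms]]
      zclass_eqI[OF zigzag_eq.inv2[OF assms]]
    by (auto simp: loc_arrow_def Idt_loc)
  then show ?thesis
    using Ar_locI[OF z(1)] assms loc_arrow[of s W] unfolding iso_arrow_def
    by (auto intro!: bexI[of _ ?g])
qed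

lemma iso_Idt: "X \<in> Ob C ==> iso_arrow C (Idt C X)"
  unfolding iso_arrow_def using Cmp_Idt[of "Idt C X"] by (auto intro!: bexI[of _ "Idt C X"])

lemma isomorphic_refl: "X \<in> Ob C ==> isomorphic C X X"
  unfolding isomorphic_def by (auto intro!: exI[of _ "Idt C X"] iso_Idt)

lemma endofunctor_iso:
  assumes F: "endofunctor C Fo Fm" and "iso_arrow C f"
  shows "iso_arrow C (Fm f)"
proof -
  obtain g where g: "f \<in> Ar C" "g \<in> Ar C" "Dom C g = Cod C f" "Cod C g = Dom C f"
     "Cmp C g f = Idt C (Dom C f)" "Cmp C f g = Idt C (Cod C f)"
    using assms by (auto simp: iso_arrow_def)
  have "Cmp C (Fm g) (Fm f) = Idt C (Fo (Dom C f))" "Cmp C (Fm f) (Fm g) = Idt C (Fo (Cod C f))"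
    using F g Dom_Ob[OF g(1)] Cod_Ob[OF g(1)] unfolding endofunctor_def by metis+
  then show ?thesis using F g unfolding iso_arrow_def endofunctor_def
    by (auto intro!: bexI[of _ "Fm g"])
qed

lemma isomorphic_endofunctor:
  assumes F: "endofunctor C Fo Fm" and "isomorphic C X Y"
  shows "isomorphic C (Fo X) (Fo Y)"
proof -
  obtain f where f: "iso_arrow C f" "Dom C f = X" "Cod C f = Y"
    using assms by (auto simp: isomorphic_def)
  have "f \<in> Ar C" using f by (auto simp: iso_arrow_def)
  then show ?thesis using f endofunctor_iso[OF F f(1)] F
    by (auto simp: isomorphic_def endofunctor_def intro!: exI[of _ "Fm f"])
qed

lemma essential_closure_endofunctor:
  assumes F: "endofunctor C Fo Fm" and N: "\<And>X. X \<in> N ==> Fo X \<in> N"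
    and X: "X \<in> essential_closure C N"
  shows "Fo X \<in> essential_closure C N"
  using X N isomorphic_endofunctor[OF F] F
  by (auto simp: essential_closure_def endofunctor_def)

lemma essential_closureI: "X \<in> N ==> X \<in> Ob C ==> X \<in> essential_closure C N"
  by (auto simp: essential_closure_def intro: isomorphic_refl)

end

text \<open>This is what the clause on cones in \<open>cone_preserving\<close> is for: the image of
  an arrow has to sit in a triangle whose cone is the image of the old cone.\<close>

lemma arrows_with_cone_in_endofunctor:
  assumes F: "cone_preserving C Fo Fm" and N: "\<And>X. X \<in> N ==> Fo X \<in> N"
  shows "Fm ` (Ar C \<inter> arrows_with_cone_in C N) \<subseteq> arrows_with_cone_in C N"
proof (rule image_subsetI)
  fix s assume s: "s \<in> Ar C \<inter> arrows_with_cone_in C N"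
  obtain g h where "(s, g, h) \<in> Tri C" "Cod C g \<in> N" "s \<in> Ar C"
    using s by (auto simp: arrows_with_cone_in_def)
  then obtain g' h' where "(Fm s, g', h') \<in> Tri C" "Cod C g' = Fo (Cod C g)" "Fm s \<in> Ar C"
    using F unfolding cone_preserving_def endofunctor_def by blast
  then show "Fm s \<in> arrows_with_cone_in C N" using N \<open>Cod C g \<in> N\<close> by (auto simp: arrows_with_cone_in_def)
qed

context tri_cat
begin

lemma tri_ends:
  assumes "(f, g, h) \<in> Tri C"
  shows "f \<in> Ar C" "g \<in> Ar C" "h \<in> Ar C" "Cod C f = Dom C g" "Cod C g = Dom C h"
    "Cod C h = ShO C (Dom C f)"
  using tri[OF assms] by (auto simp: is_triangle_def)

lemma endofunctor_shift: "endofunctor C (ShO C) (ShA C)"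
  using shift by (simp add: cone_preserving_def)

text \<open>The triangles of the localization are closed under isomorphism, and the remaining two arrows
  can be transported along any isomorphisms of the objects.\<close>

lemma tri_transport:
  fixes W
  defines "L \<equiv> loc_cat C W"
  assumes W: "ShA C ` (Ar C \<inter> W) \<subseteq> W"
    and t: "(f, g, h) \<in> Tri C"
    and iso: "iso_arrow L a" "iso_arrow L b" "iso_arrow L c"
    and dom: "Dom L a = Dom C f" "Dom L b = Cod C f" "Dom L c = Cod C g"
    and f': "f' \<in> Ar L" "Dom L f' = Cod L a" "Cod L f' = Cod L b"
      "Cmp L b (loc_arrow C W f) = Cmp L f' a"
  shows "\<exists>g' h'. (f', g', h') \<in> Tri (localization C W) \<and> Cod L g' = Cod L c"
proof -
  interpret L: cat L unfolding L_def by (rule cat_loc)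
  note t' = tri_ends[OF t]
  have lf: "loc_arrow C W f \<in> Ar L" "Dom L (loc_arrow C W f) = Dom C f"
      "Cod L (loc_arrow C W f) = Cod C f"
    and lg: "loc_arrow C W g \<in> Ar L" "Dom L (loc_arrow C W g) = Dom C g"
      "Cod L (loc_arrow C W g) = Cod C g"
    and lh: "loc_arrow C W h \<in> Ar L" "Dom L (loc_arrow C W h) = Dom C h"
      "Cod L (loc_arrow C W h) = Cod C h"
    unfolding L_def using t' loc_arrow by auto
  have Fs: "endofunctor L (ShO L) (ShA L)"
    using endofunctor_loc[OF endofunctor_shift W] unfolding L_def ShA_loc by simp
  have ar: "a \<in> Ar L" "b \<in> Ar L" "c \<in> Ar L" using iso by (auto simp: iso_arrow_def)
  have sa: "ShA L a \<in> Ar L" "Dom L (ShA L a) = ShO C (Dom L a)" "Cod L (ShA L a) = ShO C (Cod L a)"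
    using Fs ar unfolding endofunctor_def by (auto simp: L_def)
  obtain bi where bi: "bi \<in> Ar L" "Dom L bi = Cod L b" "Cod L bi = Dom L b"
      "Cmp L bi b = Idt L (Dom L b)" using iso by (auto simp: iso_arrow_def)
  obtain ci where ci: "ci \<in> Ar L" "Dom L ci = Cod L c" "Cod L ci = Dom L c"
      "Cmp L ci c = Idt L (Dom L c)" using iso by (auto simp: iso_arrow_def)
  \<comment> \<open>Commutativity of the two remaining squares forces both choices: the old arrows,
    conjugated by the given isomorphisms.\<close>
  define g' where "g' = Cmp L (Cmp L c (loc_arrow C W g)) bi"
  define h' where "h' = Cmp L (Cmp L (ShA L a) (loc_arrow C W h)) ci"
  have cg: "Cmp L c (loc_arrow C W g) \<in> Ar L" "Dom L (Cmp L c (loc_arrow C W g)) = Dom C g"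
    "Cod L (Cmp L c (loc_arrow C W g)) = Cod L c" using ar lg dom by auto
  have ah: "Cmp L (ShA L a) (loc_arrow C W h) \<in> Ar L"
    "Dom L (Cmp L (ShA L a) (loc_arrow C W h)) = Dom C h"
    "Cod L (Cmp L (ShA L a) (loc_arrow C W h)) = ShO C (Cod L a)" using ar lh dom sa t' by auto
  have g': "g' \<in> Ar L" "Dom L g' = Cod L b" "Cod L g' = Cod L c"
    unfolding g'_def using cg bi dom t' by auto
  have h': "h' \<in> Ar L" "Dom L h' = Cod L c" "Cod L h' = ShO C (Cod L a)"
    unfolding h'_def using ah ci dom t' by auto
  have "Cmp L g' b = Cmp L (Cmp L c (loc_arrow C W g)) (Cmp L bi b)"
    unfolding g'_def using L.Cmp_assoc[of b bi "Cmp L c (loc_arrow C W g)"] cg bi dom t' ar by simp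
  also have "\<dots> = Cmp L c (loc_arrow C W g)"
    using cg bi dom t' L.Cmp_Idt(2)[OF cg(1)] by simp
  finally have e1: "Cmp L c (loc_arrow C W g) = Cmp L g' b" by simp
  have "Cmp L h' c = Cmp L (Cmp L (ShA L a) (loc_arrow C W h)) (Cmp L ci c)"
    unfolding h'_def using L.Cmp_assoc[of c ci "Cmp L (ShA L a) (loc_arrow C W h)"] ah ci dom t' ar by simp
  also have "\<dots> = Cmp L (ShA L a) (loc_arrow C W h)"
    using ah ci dom t' L.Cmp_Idt(2)[OF ah(1)] by simp
  finally have e2: "Cmp L (ShA L a) (loc_arrow C W h) = Cmp L h' c" by simp
  have s: "ShO L = ShO C" by (simp add: L_def)
  have "triangle_iso L (loc_arrow C W f, loc_arrow C W g, loc_arrow C W h) (f', g', h')"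
    unfolding triangle_iso_def is_triangle_def
    apply (simp add: lf lg lh t' f' g' h' s del: split_paired_Ex)
    apply (rule exI[of _ a], simp add: iso dom del: split_paired_Ex, rule exI[of _ b], simp add: iso dom t' f' del: split_paired_Ex,
        rule exI[of _ c], simp add: iso dom t' f' h' e1 e2 g')
    done
  then have "(f', g', h') \<in> Tri (localization C W)"
    using t unfolding localization_def L_def by auto
  then show ?thesis using g'(3) by blast
qed

text \<open>The distinguished triangles are those isomorphic to an image, so identities have to be
  exhibited as an isomorphism of triangles. The third square contains the shift of an identity,
  which is an identity because \<open>W\<close> is stable under the shift.\<close>

lemma loc_tri:
  assumes W: "ShA C ` (Ar C \<inter> W) \<subseteq> W" and t: "(f, g, h) \<in> Tri C"
  shows "(loc_arrow C W f, loc_arrow C W g, loc_arrow C W h) \<in> Tri (localization C W)"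
proof -
  let ?L = "loc_cat C W"
  interpret L: cat ?L by (rule cat_loc)
  note t' = tri_ends[OF t]
  have lf: "loc_arrow C W f \<in> Ar ?L" "Dom ?L (loc_arrow C W f) = Dom C f"
      "Cod ?L (loc_arrow C W f) = Cod C f"
    and lg: "loc_arrow C W g \<in> Ar ?L" "Dom ?L (loc_arrow C W g) = Dom C g"
      "Cod ?L (loc_arrow C W g) = Cod C g"
    and lh: "loc_arrow C W h \<in> Ar ?L" "Dom ?L (loc_arrow C W h) = Dom C h"
      "Cod ?L (loc_arrow C W h) = Cod C h"
    using t' loc_arrow by auto
  have Fs: "endofunctor ?L (ShO ?L) (ShA ?L)"
    using endofunctor_loc[OF endofunctor_shift W] unfolding ShA_loc by simp
  have ob: "Dom C f \<in> Ob ?L" "Dom C g \<in> Ob ?L" "Dom C h \<in> Ob ?L"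
    using t' Dom_Ob by auto
  have sI: "ShA ?L (Idt ?L (Dom C f)) = Idt ?L (ShO C (Dom C f))"
    using Fs ob unfolding endofunctor_def by simp
  have "triangle_iso ?L (loc_arrow C W f, loc_arrow C W g, loc_arrow C W h)
     (loc_arrow C W f, loc_arrow C W g, loc_arrow C W h)"
    unfolding triangle_iso_def is_triangle_def
    using L.Cmp_Idt[OF lf(1)] L.Cmp_Idt[OF lg(1)] L.Cmp_Idt[OF lh(1)]
    apply (simp add: lf lg lh t' del: split_paired_Ex)
    apply (rule exI[of _ "Idt ?L (Dom C f)"], simp add: ob L.iso_Idt del: loc_simps split_paired_Ex)
    apply (rule exI[of _ "Idt ?L (Dom C g)"], simp add: ob L.iso_Idt t' del: loc_simps split_paired_Ex)
    apply (rule exI[of _ "Idt ?L (Dom C h)"], simp add: ob L.iso_Idt t' sI del: loc_simps split_paired_Ex)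
    done
  then show ?thesis using t unfolding localization_def by auto
qed

lemma cat_localization: "cat (localization C W)"
  using cat_loc[of W] unfolding cat_def by simp

text \<open>A triangle of the localization comes with an isomorphism (a, b, c) from the image of
  some triangle on f. The functor carries f to the base of a triangle whose cone is
  \<open>Fo\<close> of the old one, and the images of a, b, c transport that triangle to the image
  of the given arrow.\<close>

lemma cone_preserving_loc:
  assumes W: "ShA C ` (Ar C \<inter> W) \<subseteq> W"
    and F: "cone_preserving C Fo Fm" and FW: "Fm ` (Ar C \<inter> W) \<subseteq> W"
  shows "cone_preserving (localization C W) Fo (loc_map W Fo Fm)"
proof -
  let ?L = "loc_cat C W" and ?F = "loc_map W Fo Fm"
  interpret L: cat ?L by (rule cat_loc)
  have e: "endofunctor C Fo Fm" using F by (simp add: cone_preserving_def)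
  note eL = endofunctor_loc[OF e FW]
  have "\<exists>g2 h2. (?F f', g2, h2) \<in> Tri (localization C W) \<and> Cod ?L g2 = Fo (Cod ?L g')"
    if t': "(f', g', h') \<in> Tri (localization C W)" for f' g' h'
  proof -
    obtain f g h a b c where t: "(f, g, h) \<in> Tri C"
      and i: "is_triangle ?L (f', g', h')"
      "iso_arrow ?L a" "iso_arrow ?L b" "iso_arrow ?L c"
      "Dom ?L a = Dom ?L (loc_arrow C W f)" "Cod ?L a = Dom ?L f'"
      "Dom ?L b = Dom ?L (loc_arrow C W g)" "Cod ?L b = Dom ?L g'"
      "Dom ?L c = Dom ?L (loc_arrow C W h)" "Cod ?L c = Dom ?L h'"
      "Cmp ?L b (loc_arrow C W f) = Cmp ?L f' a"
      using t' by (auto simp: localization_def triangle_iso_def)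
    note te = tri_ends[OF t]
    obtain g1 h1 where t1: "(Fm f, g1, h1) \<in> Tri C" "Cod C g1 = Fo (Cod C g)"
      using F t unfolding cone_preserving_def by blast
    have fe: "f' \<in> Ar ?L" "Cod ?L f' = Dom ?L g'" "Cod ?L g' = Dom ?L h'"
      using i by (auto simp: is_triangle_def)
    have ar: "a \<in> Ar ?L" "b \<in> Ar ?L" "c \<in> Ar ?L" using i by (auto simp: iso_arrow_def)
    have la: "loc_arrow C W f \<in> Ar ?L" "Dom ?L (loc_arrow C W f) = Dom C f"
      "Cod ?L (loc_arrow C W f) = Cod C f" "Dom ?L (loc_arrow C W g) = Dom C g"
      "Dom ?L (loc_arrow C W h) = Dom C h"
      using te loc_arrow by auto
    have eC: "Dom C (Fm f) = Fo (Dom C f)" "Cod C (Fm f) = Fo (Cod C f)"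
      using e te unfolding endofunctor_def by auto
    have eA: "?F x \<in> Ar ?L" "Dom ?L (?F x) = Fo (Dom ?L x)" "Cod ?L (?F x) = Fo (Cod ?L x)"
      if "x \<in> Ar ?L" for x
      using eL that unfolding endofunctor_def by auto
    have eCmp: "?F (Cmp ?L y x) = Cmp ?L (?F y) (?F x)"
      if "x \<in> Ar ?L" "y \<in> Ar ?L" "Cod ?L x = Dom ?L y" for x y
      using eL that unfolding endofunctor_def by blast
    have "Cmp ?L (?F b) (loc_arrow C W (Fm f)) = Cmp ?L (?F b) (?F (loc_arrow C W f))"
      using loc_map_loc_arrow[OF e FW] te by simp
    also have "\<dots> = ?F (Cmp ?L b (loc_arrow C W f))"
      using eCmp[of "loc_arrow C W f" b] ar la i te by simp
    also have "\<dots> = Cmp ?L (?F f') (?F a)"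
      using eCmp[of a f'] ar i fe by simp
    finally have sq: "Cmp ?L (?F b) (loc_arrow C W (Fm f)) = Cmp ?L (?F f') (?F a)" .
    have "\<exists>g2 h2. (?F f', g2, h2) \<in> Tri (localization C W) \<and> Cod ?L g2 = Cod ?L (?F c)"
      by (rule tri_transport[OF W t1(1), of "?F a" "?F b" "?F c"])
        (use i ar fe la te eC eA t1 sq L.endofunctor_iso[OF eL] in auto)
    then show ?thesis using eA ar fe i by auto
  qed
  then show ?thesis using eL unfolding cone_preserving_def endofunctor_def by auto
qed

text \<open>Makes localization iterable: three passes lead from complexes to the derived, the
  singularity and the phase category.\<close>

lemma tri_cat_localization:
  assumes W: "ShA C ` (Ar C \<inter> W) \<subseteq> W"
  shows "tri_cat (localization C W)"
proof (rule tri_cat.intro[OF cat_localization], unfold_locales)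
  show "cone_preserving (localization C W) (ShO (localization C W)) (ShA (localization C W))"
    using cone_preserving_loc[OF W shift W] by (simp add: ShA_loc)
  show "is_triangle (localization C W) t" if "t \<in> Tri (localization C W)" for t
    using that by (auto simp: localization_def triangle_iso_def is_triangle_def)
  show "\<exists>g h. (Idt (localization C W) X, g, h) \<in> Tri (localization C W)"
    if "X \<in> Ob (localization C W)" for X
    using idt_tri[of X] loc_tri[OF W] that loc_arrow_Idt[of X W] by fastforce
  obtain Z where Z: "Z \<in> Ob C" "\<And>X. X \<in> Ob C ==> \<exists>f h. (f, Idt C X, h) \<in> Tri C \<and> Dom C f = Z"
    using zero_tri by blast
  show "\<exists>Z\<in>Ob (localization C W). \<forall>X\<in>Ob (localization C W).
     \<exists>f h. (f, Idt (localization C W) X, h) \<in> Tri (localization C W) \<and> Dom (localization C W) f = Z"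
  proof (rule bexI[of _ Z], rule ballI)
    fix X assume X: "X \<in> Ob (localization C W)"
    then have "X \<in> Ob C" by simp
    from Z(2)[OF this] obtain f h where f: "(f, Idt C X, h) \<in> Tri C" "Dom C f = Z" by blast
    show "\<exists>f h. (f, Idt (localization C W) X, h) \<in> Tri (localization C W) \<and>
        Dom (localization C W) f = Z"
      using loc_tri[OF W f(1)] f(2) loc_arrow_Idt[of X W] X loc_arrow(2)[of f W] tri_ends[OF f(1)]
      by (intro exI[of _ "loc_arrow C W f"] exI[of _ "loc_arrow C W h"]) auto
  qed (use Z in simp)
qed

end

section \<open>Grothendieck groups of localizations\<close>

context tri_cat
begin

lemma K_generators:
  assumes "(f, g, h) \<in> Tri C"
  shows "frag_of (Dom C g) - frag_of (Dom C f) - frag_of (Dom C h) \<in> K_relations C"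
  unfolding K_relations_def by (rule generate.incl) (use assms in blast)

lemma K_generators_carrier:
  "{frag_of (Dom C g) - frag_of (Dom C f) - frag_of (Dom C h) | f g h. (f, g, h) \<in> Tri C}
     \<subseteq> carrier (free_Abelian_group (Ob C))"
proof clarify
  fix f g h assume t: "(f, g, h) \<in> Tri C"
  have "Dom C f \<in> Ob C" "Dom C g \<in> Ob C" "Dom C h \<in> Ob C" using tri_ends[OF t] by auto
  then show "frag_of (Dom C g) - frag_of (Dom C f) - frag_of (Dom C h)
      \<in> carrier (free_Abelian_group (Ob C))"
    using keys_diff[of "frag_of (Dom C g) - frag_of (Dom C f)" "frag_of (Dom C h)"]
      keys_diff[of "frag_of (Dom C g)" "frag_of (Dom C f)"]
    by (auto simp: keys_frag_of)
qed

lemma K_subgroup: "subgroup (K_relations C) (free_Abelian_group (Ob C))"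
  unfolding K_relations_def
  by (rule group.generate_is_subgroup[OF _ K_generators_carrier]) simp

lemma K_keys: "c \<in> K_relations C ==> Poly_Mapping.keys c \<subseteq> Ob C"
  using subsetD[OF subgroup.subset[OF K_subgroup], of c] by simp

lemma K_zero [simp]: "0 \<in> K_relations C"
  using subgroup.one_closed[OF K_subgroup] by simp

lemma K_add: "x \<in> K_relations C ==> y \<in> K_relations C ==> x + y \<in> K_relations C"
  using subgroup.m_closed[OF K_subgroup] by simp

lemma K_uminus: "x \<in> K_relations C ==> - x \<in> K_relations C"
  using subgroup.m_inv_closed[OF K_subgroup, of x] K_keys[of x] by simp

lemma K_diff: "x \<in> K_relations C ==> y \<in> K_relations C ==> x - y \<in> K_relations C"
  using K_add[of x "- y"] K_uminus by simp

lemma K_relations_induct [consumes 1, case_names zero tri add minus]: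
  assumes "c \<in> K_relations C" and "P 0"
    and "\<And>f g h. (f, g, h) \<in> Tri C ==> P (frag_of (Dom C g) - frag_of (Dom C f) - frag_of (Dom C h))"
    and "\<And>x y. P x ==> P y ==> P (x + y)" and "\<And>x. P x ==> P (- x)"
  shows "P c"
  using assms(1) unfolding K_relations_def
proof (induction rule: generate.induct)
  case (inv h)
  then have "Poly_Mapping.keys h \<subseteq> Ob C"
    using subsetD[OF K_generators_carrier, of h] by simp
  then have "inv\<^bsub>free_Abelian_group (Ob C)\<^esub> h = - h" by simp
  moreover have "P h" using inv assms(3) by blast
  ultimately show ?case using assms(5) by simp
qed (use assms in auto)

text \<open>Localizing keeps the objects and adds triangles, so relations only accumulate.\<close>

lemma K_relations_loc:
  assumes W: "ShA C ` (Ar C \<inter> W) \<subseteq> W"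
  shows "K_relations C \<subseteq> K_relations (localization C W)"
proof
  interpret L: tri_cat "localization C W" by (rule tri_cat_localization[OF W])
  show "c \<in> K_relations (localization C W)" if "c \<in> K_relations C" for c
    using that
  proof (induction rule: K_relations_induct)
    case (tri f g h)
    show ?case using L.K_generators[OF loc_tri[OF W tri]] loc_arrow(2) tri_ends[OF tri]
      by auto
  qed (auto intro: L.K_add L.K_uminus)
qed

text \<open>Transport a triangle X -> X -> c along the identity of X, the isomorphism and the
  identity of c; the result is X -> Y -> c. The two relations differ by [Y] - [X].\<close>

lemma K_iso:
  assumes W: "ShA C ` (Ar C \<inter> W) \<subseteq> W" and "isomorphic (localization C W) X Y"
  shows "frag_of Y - frag_of X \<in> K_relations (localization C W)"
proof -
  let ?L = "loc_cat C W"
  interpret L: tri_cat "localization C W" by (rule tri_cat_localization[OF W])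
  interpret L0: cat ?L by (rule cat_loc)
  obtain b where b: "iso_arrow ?L b" "Dom ?L b = X" "Cod ?L b = Y" "b \<in> Ar ?L"
    using assms(2) by (auto simp: isomorphic_def iso_arrow_def)
  have X: "X \<in> Ob C" "Y \<in> Ob C" using L0.Dom_Ob[OF b(4)] L0.Cod_Ob[OF b(4)] b by auto
  obtain g h where t: "(Idt C X, g, h) \<in> Tri C" using idt_tri X by blast
  note te = tri_ends[OF t]
  have c: "Cod C g \<in> Ob C" using te by simp
  obtain g' h' where t': "(b, g', h') \<in> Tri (localization C W)"
    "Cod ?L g' = Cod ?L (Idt ?L (Cod C g))"
    using tri_transport[OF W t, of "Idt ?L X" b "Idt ?L (Cod C g)" b] b X c L0.iso_Idt
      L0.Idt loc_arrow_Idt[of X W] L0.Cmp_Idt(2)[OF b(4)] by auto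
  have "Dom ?L g' = Y" "Dom ?L h' = Cod C g"
    using L.tri_ends[OF t'(1)] t'(2) b L0.Idt c by auto
  then have 1: "frag_of Y - frag_of X - frag_of (Cod C g) \<in> K_relations (localization C W)"
    using L.K_generators[OF t'(1)] b by simp
  have "frag_of X - frag_of X - frag_of (Cod C g) \<in> K_relations (localization C W)"
    using K_generators[OF t] te X K_relations_loc[OF W] by auto
  from L.K_diff[OF 1 this] show ?thesis by simp
qed

lemma K_inverted:
  assumes W: "ShA C ` (Ar C \<inter> W) \<subseteq> W" and s: "s \<in> Ar C \<inter> W"
  shows "frag_of (Cod C s) - frag_of (Dom C s) \<in> K_relations (localization C W)"
proof (rule K_iso[OF W])
  show "isomorphic (localization C W) (Dom C s) (Cod C s)"
    using iso_loc_arrow[OF s] loc_arrow[of s W] s unfolding isomorphic_def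
    by (intro exI[of _ "loc_arrow C W s"]) (simp add: iso_arrow_def)
qed

text \<open>The arrow Z -> X from \<open>zero_tri\<close> has cone X in \<open>N\<close>, so it is
  inverted and [X] = [Z]; its triangle itself says [Z] = 0.\<close>

lemma K_verdier_null:
  fixes N
  defines "W \<equiv> arrows_with_cone_in C N"
  assumes W: "ShA C ` (Ar C \<inter> W) \<subseteq> W" and X: "X \<in> N" "X \<in> Ob C"
  shows "frag_of X \<in> K_relations (verdier_quotient C N)"
proof -
  interpret L: tri_cat "localization C W" by (rule tri_cat_localization[OF W])
  obtain f h where t: "(f, Idt C X, h) \<in> Tri C" using zero_tri X by blast
  note te = tri_ends[OF t]
  have f: "f \<in> Ar C \<inter> W" using t X te by (auto simp: W_def arrows_with_cone_in_def)
  have "frag_of X - frag_of (Dom C f) - frag_of X \<in> K_relations (localization C W)"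
    using K_generators[OF t] te X K_relations_loc[OF W] by auto
  moreover have "frag_of X - frag_of (Dom C f) \<in> K_relations (localization C W)"
    using K_inverted[OF W f] te X by simp
  ultimately have "frag_of X - frag_of (Dom C f) - (frag_of X - frag_of (Dom C f) - frag_of X)
      \<in> K_relations (localization C W)"
    using L.K_diff by blast
  then show ?thesis by (simp add: verdier_quotient_def W_def)
qed

text \<open>A relation involves the ends of the first arrow and the cone, and these are exactly what
  \<open>cone_preserving\<close> controls.\<close>

lemma K_relations_functor:
  assumes F: "cone_preserving C Fo Fm" and c: "c \<in> K_relations C"
  shows "frag_extend (\<lambda>A. frag_of (Fo A)) c \<in> K_relations C"
  using c
proof (induction rule: K_relations_induct)
  case (tri f g h)
  note te = tri_ends[OF tri]
  obtain g' h' where t': "(Fm f, g', h') \<in> Tri C" "Cod C g' = Fo (Cod C g)"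
    using F tri unfolding cone_preserving_def by blast
  note te' = tri_ends[OF t'(1)]
  have "Dom C (Fm f) = Fo (Dom C f)" "Cod C (Fm f) = Fo (Cod C f)"
    using F te unfolding cone_preserving_def endofunctor_def by auto
  then show ?case using K_generators[OF t'(1)] te te' t'(2) by (simp add: frag_extend_diff)
qed (auto simp: frag_extend_add frag_extend_minus intro: K_add K_uminus)

lemma keys_functor:
  assumes F: "cone_preserving C Fo Fm" and c: "Poly_Mapping.keys c \<subseteq> Ob C"
  shows "Poly_Mapping.keys (frag_extend (\<lambda>A. frag_of (Fo A)) c) \<subseteq> Ob C"
  using keys_frag_extend[of "\<lambda>A. frag_of (Fo A)" c] F c
  by (force simp: keys_frag_of cone_preserving_def endofunctor_def)

abbreviation K_class where "K_class c \<equiv> K_relations C #>\<^bsub>free_Abelian_group (Ob C)\<^esub> c"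

lemma K_class_def': "K_class c = {r + c | r. r \<in> K_relations C}"
  by (auto simp: r_coset_def)

lemma K_class_eq: "K_class c = K_class c' \<longleftrightarrow> c - c' \<in> K_relations C"
proof
  assume "K_class c = K_class c'"
  moreover have "c \<in> K_class c" unfolding K_class_def' using K_zero by force
  ultimately show "c - c' \<in> K_relations C" unfolding K_class_def' by auto
next
  assume d: "c - c' \<in> K_relations C"
  have "r + c = (r + (c - c')) + c'" "r + c' = (r - (c - c')) + c" for r by auto
  then show "K_class c = K_class c'" unfolding K_class_def'
    using K_add[OF _ d] K_diff[OF _ d] by blast
qed

lemma K_normal: "K_relations C \<lhd> free_Abelian_group (Ob C)"
proof -
  interpret comm_group "free_Abelian_group (Ob C)" by (rule abelian_free_Abelian_group)
  show ?thesis using subgroup_imp_normal[OF K_subgroup] .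
qed

text \<open>\<open>K_map\<close> is a union over all representatives; since relations go to
  relations, each of them contributes the same coset.\<close>

lemma K_map_class:
  assumes F: "cone_preserving C Fo Fm" and c: "Poly_Mapping.keys c \<subseteq> Ob C"
  shows "K_map C Fo (K_class c) = K_class (frag_extend (\<lambda>A. frag_of (Fo A)) c)"
proof -
  let ?e = "frag_extend (\<lambda>A. frag_of (Fo A))"
  have "K_class (?e x) = K_class (?e c)" if x: "x \<in> K_class c" for x
  proof -
    obtain r where r: "r \<in> K_relations C" "x = r + c" using x unfolding K_class_def' by blast
    show ?thesis unfolding K_class_eq
      using K_relations_functor[OF F r(1)] unfolding r frag_extend_add by simp
  qed
  moreover have "c \<in> K_class c" unfolding K_class_def' using K_zero by force
  ultimately show ?thesis unfolding K_map_def by blast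
qed

lemma minus_id_class:
  assumes F: "cone_preserving C Fo Fm" and c: "Poly_Mapping.keys c \<subseteq> Ob C"
  shows "minus_id (K_group C) (K_map C Fo) (K_class c) =
    K_class (frag_extend (\<lambda>A. frag_of (Fo A)) c - c)"
proof -
  interpret normal "K_relations C" "free_Abelian_group (Ob C)" by (rule K_normal)
  have "inv\<^bsub>K_group C\<^esub> (K_class c) = K_class (- c)"
  proof -
    have c': "c \<in> carrier (free_Abelian_group (Ob C))" using c by simp
    then have "K_class c \<in> carrier (K_group C)"
      unfolding K_group_def FactGroup_def RCOSETS_def
      by (auto simp del: carrier_free_Abelian_group_iff)
    then have "inv\<^bsub>K_group C\<^esub> (K_class c) = set_inv\<^bsub>free_Abelian_group (Ob C)\<^esub> (K_class c)"
      unfolding K_group_def by (rule inv_FactGroup)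
    also have "\<dots> = K_class (- c)" using rcos_inv[OF c'] c by simp
    finally show ?thesis .
  qed
  then show ?thesis unfolding minus_id_def K_map_class[OF F c]
    using rcos_sum[of "frag_extend (\<lambda>A. frag_of (Fo A)) c" "- c"] c keys_functor[OF F c]
    by (simp add: K_group_def FactGroup_def)
qed

text \<open>Moves the computation to the free abelian group. The operators are additive there, so it
  is enough to test single objects.\<close>

lemma foldr_minus_id_eq_one:
  assumes F: "\<And>j. \<exists>Fm. cone_preserving C (F j) Fm"
    and null: "\<And>X. X \<in> Ob C ==>
      foldr (\<lambda>j c. frag_extend (\<lambda>A. frag_of (F j A)) c - c) js (frag_of X) \<in> K_relations C"
    and x: "x \<in> carrier (K_group C)"
  shows "foldr (\<lambda>j. minus_id (K_group C) (K_map C (F j))) js x = \<one>\<^bsub>K_group C\<^esub>"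
proof -
  let ?D = "\<lambda>j c. frag_extend (\<lambda>A. frag_of (F j A)) c - c"
  have keys: "Poly_Mapping.keys (?D j c) \<subseteq> Ob C" if "Poly_Mapping.keys c \<subseteq> Ob C" for j c
    using F[of j] keys_functor[of "F j" _ c] that keys_diff[of "frag_extend (\<lambda>A. frag_of (F j A)) c" c]
    by blast
  have *: "foldr (\<lambda>j. minus_id (K_group C) (K_map C (F j))) js (K_class c) = K_class (foldr ?D js c) \<and>
      Poly_Mapping.keys (foldr ?D js c) \<subseteq> Ob C"
    if "Poly_Mapping.keys c \<subseteq> Ob C" for c
  proof (induction js)
    case (Cons j js)
    obtain Fm where "cone_preserving C (F j) Fm" using F by blast
    note m = minus_id_class[OF this conjunct2[OF Cons.IH]]
    show ?case using conjunct1[OF Cons.IH] keys[OF conjunct2[OF Cons.IH], of j] m by simp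
  qed (use that in auto)
  obtain c where c: "Poly_Mapping.keys c \<subseteq> Ob C" "x = K_class c"
    using x unfolding K_group_def FactGroup_def RCOSETS_def by fastforce
  have diff: "foldr ?D js (a - b) = foldr ?D js a - foldr ?D js b" for a b
    by (induction js) (auto simp: frag_extend_diff)
  have zero: "foldr ?D js 0 = 0" by (induction js) auto
  have "foldr ?D js c \<in> K_relations C"
    using c(1)
  proof (induction c rule: frag_induction)
    case zero
    then show ?case using \<open>foldr ?D js 0 = 0\<close> by simp
  next
    case (diff a b)
    then show ?case using \<open>\<And>a b. foldr ?D js (a - b) = foldr ?D js a - foldr ?D js b\<close>
      by (simp add: K_diff)
  qed (use null in auto)
  then have "K_class (foldr ?D js c) = K_class 0" unfolding K_class_eq by simp
  also have "K_class 0 = \<one>\<^bsub>K_group C\<^esub>"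
    by (auto simp: K_group_def FactGroup_def K_class_def')
  finally show ?thesis using * c by simp
qed

end

section \<open>Graded modules\<close>

definition additive_map :: "('b, 'x) ring_scheme \<Rightarrow> ('c, 'y) ring_scheme \<Rightarrow> ('b \<Rightarrow> 'c) \<Rightarrow> bool" where
  "additive_map M N h \<longleftrightarrow> h \<in> carrier M \<rightarrow> carrier N \<and>
     (\<forall>x\<in>carrier M. \<forall>y\<in>carrier M. h (x \<oplus>\<^bsub>M\<^esub> y) = h x \<oplus>\<^bsub>N\<^esub> h y)"

lemma additive_map_props:
  assumes "abelian_group M" "abelian_group N" "additive_map M N h"
  shows additive_map_closed: "x \<in> carrier M ==> h x \<in> carrier N"
    and additive_map_add: "x \<in> carrier M ==> y \<in> carrier M ==> h (x \<oplus>\<^bsub>M\<^esub> y) = h x \<oplus>\<^bsub>N\<^esub> h y"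
    and additive_map_zero: "h \<zero>\<^bsub>M\<^esub> = \<zero>\<^bsub>N\<^esub>"
    and additive_map_neg: "x \<in> carrier M ==> h (\<ominus>\<^bsub>M\<^esub> x) = \<ominus>\<^bsub>N\<^esub> h x"
    and additive_map_minus: "x \<in> carrier M ==> y \<in> carrier M ==> h (x \<ominus>\<^bsub>M\<^esub> y) = h x \<ominus>\<^bsub>N\<^esub> h y"
proof -
  interpret M: abelian_group M by fact
  interpret N: abelian_group N by fact
  show c: "h x \<in> carrier N" if "x \<in> carrier M" for x
    using assms(3) that by (auto simp: additive_map_def)
  show a: "h (x \<oplus>\<^bsub>M\<^esub> y) = h x \<oplus>\<^bsub>N\<^esub> h y" if "x \<in> carrier M" "y \<in> carrier M" for x y
    using assms(3) that by (auto simp: additive_map_def)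
  show z: "h \<zero>\<^bsub>M\<^esub> = \<zero>\<^bsub>N\<^esub>"
    using a[of "\<zero>\<^bsub>M\<^esub>" "\<zero>\<^bsub>M\<^esub>"] c[of "\<zero>\<^bsub>M\<^esub>"] by (metis M.l_zero M.zero_closed N.add.r_cancel_one')
  show n: "h (\<ominus>\<^bsub>M\<^esub> x) = \<ominus>\<^bsub>N\<^esub> h x" if "x \<in> carrier M" for x
    using a[of "\<ominus>\<^bsub>M\<^esub> x" x] that c z by (metis M.a_inv_closed M.l_neg N.minus_equality)
  show "h (x \<ominus>\<^bsub>M\<^esub> y) = h x \<ominus>\<^bsub>N\<^esub> h y" if "x \<in> carrier M" "y \<in> carrier M" for x y
    using a[of x "\<ominus>\<^bsub>M\<^esub> y"] n that by (simp add: a_minus_def)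
qed

lemma additive_map_finsum:
  assumes "abelian_group M" "abelian_group N" "additive_map M N h" and "finite F" "c \<in> F \<rightarrow> carrier M"
  shows "h (finsum M c F) = finsum N (\<lambda>i. h (c i)) F"
proof -
  interpret M: abelian_group M by fact
  interpret N: abelian_group N by fact
  note h = additive_map_props[OF assms(1-3)]
  show ?thesis using assms(4,5)
  proof (induction F)
    case (insert i F)
    then have "c \<in> F \<rightarrow> carrier M" "c i \<in> carrier M" by auto
    moreover have "(\<lambda>i. h (c i)) \<in> F \<rightarrow> carrier N" "h (c i) \<in> carrier N"
      using insert.prems h(1) by auto
    ultimately show ?case
      using insert.hyps insert.IH M.finsum_insert[of F i c] N.finsum_insert[of F i "\<lambda>i. h (c i)"]
        h(2)[of "c i" "finsum M c F"] M.finsum_closed[of c F] by simp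
  qed (use h in simp)
qed

lemma (in abelian_group) finsum_extend:
  assumes "finite F" "A \<subseteq> F" "c \<in> F \<rightarrow> carrier G" "\<And>i. i \<in> F - A ==> c i = \<zero>"
  shows "finsum G c A = finsum G c F"
  using add.finprod_mono_neutral_cong_left[OF assms(1,2), of c c] assms(3,4) by auto

lemma (in abelian_group) finsum_neg:
  assumes "finite F" "c \<in> F \<rightarrow> carrier G"
  shows "finsum G (\<lambda>i. \<ominus> c i) F = \<ominus> finsum G c F"
  using assms
proof (induction F)
  case (insert i F)
  then have "c \<in> F \<rightarrow> carrier G" "c i \<in> carrier G" by auto
  then show ?case using insert finsum_insert[of F i c] finsum_insert[of F i "\<lambda>i. \<ominus> c i"]
      finsum_closed[of c F] by (auto simp: minus_add Pi_def)
qed (simp, metis r_neg l_zero zero_closed a_inv_closed)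

lemma (in abelian_group) finsum_minus:
  assumes "finite F" "c \<in> F \<rightarrow> carrier G" "d \<in> F \<rightarrow> carrier G"
  shows "finsum G (\<lambda>i. c i \<ominus> d i) F = finsum G c F \<ominus> finsum G d F"
proof -
  have "finsum G (\<lambda>i. c i \<oplus> \<ominus> d i) F = finsum G c F \<oplus> finsum G (\<lambda>i. \<ominus> d i) F"
    by (rule finsum_addf) (use assms in auto)
  then show ?thesis using finsum_neg[OF assms(1,3)] by (simp add: a_minus_def)
qed

lemma (in abelian_group) minus_eq_zero_iff:
  "x \<in> carrier G ==> y \<in> carrier G ==> x \<ominus> y = \<zero> \<longleftrightarrow> x = y"
  by (metis a_minus_def add.inv_closed local.minus_minus minus_equality r_neg)

lemma graded_moduleD:
  assumes "graded_module S M"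
  shows "Module.module S M" "subgroup (gcomp M \<gamma>) (add_monoid M)"
    "gcomp M \<gamma> \<subseteq> carrier M" "abelian_group M" "cring S"
    "s \<in> rcomp S \<gamma> ==> x \<in> gcomp M \<delta> ==> s \<odot>\<^bsub>M\<^esub> x \<in> gcomp M (\<gamma> + \<delta>)"
  using assms subgroup.subset[of "gcomp M \<gamma>" "add_monoid M"]
  by (auto simp: graded_module_def Module.module_def)

lemma gcomp_closed:
  assumes "graded_module S M"
  shows "\<zero>\<^bsub>M\<^esub> \<in> gcomp M \<gamma>"
    "x \<in> gcomp M \<gamma> ==> y \<in> gcomp M \<gamma> ==> x \<oplus>\<^bsub>M\<^esub> y \<in> gcomp M \<gamma>"
    "x \<in> gcomp M \<gamma> ==> y \<in> gcomp M \<gamma> ==> x \<ominus>\<^bsub>M\<^esub> y \<in> gcomp M \<gamma>"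
    "x \<in> gcomp M \<gamma> ==> \<ominus>\<^bsub>M\<^esub> x \<in> gcomp M \<gamma>"
  using subgroup.one_closed[OF graded_moduleD(2)[OF assms], of \<gamma>]
    subgroup.m_closed[OF graded_moduleD(2)[OF assms], of _ \<gamma>]
    subgroup.m_inv_closed[OF graded_moduleD(2)[OF assms], of _ \<gamma>]
  by (auto simp: a_minus_def a_inv_def)

lemma ex1_unique: "\<exists>!x. P x ==> P a ==> P b ==> a = b"
  by blast

lemma add_subgroupI:
  assumes "H \<subseteq> carrier M" "\<zero>\<^bsub>M\<^esub> \<in> H"
    "\<And>x y. x \<in> H ==> y \<in> H ==> x \<oplus>\<^bsub>M\<^esub> y \<in> H" "\<And>x. x \<in> H ==> \<ominus>\<^bsub>M\<^esub> x \<in> H"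
  shows "subgroup H (add_monoid M)"
  using assms by (intro subgroup.intro) (auto simp: a_inv_def)

lemma graded_module_decomp:
  assumes "graded_module S M" "x \<in> carrier M"
  shows "\<exists>F c. finite F \<and> (\<forall>\<gamma>. c \<gamma> \<in> gcomp M \<gamma>) \<and> x = finsum M c F"
  using assms unfolding graded_module_def by blast

text \<open>Compare with the trivial decomposition of zero. The family \<open>c\<close> is
  homogeneous on \<open>F\<close> only, hence it is cut off outside \<open>F\<close> before
  uniqueness applies.\<close>

lemma graded_module_indep:
  assumes M: "graded_module S M" and F: "finite F" "\<And>\<gamma>. \<gamma> \<in> F ==> c \<gamma> \<in> gcomp M \<gamma>"
    and sum: "finsum M c F = \<zero>\<^bsub>M\<^esub>" and \<gamma>: "\<gamma> \<in> F"
  shows "c \<gamma> = \<zero>\<^bsub>M\<^esub>"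
proof -
  interpret M: Module.module S M using graded_moduleD(1)[OF M] .
  let ?P = "\<lambda>c. (\<forall>\<gamma>. c \<gamma> \<in> gcomp M \<gamma>) \<and> finite {\<gamma>. c \<gamma> \<noteq> \<zero>\<^bsub>M\<^esub>} \<and>
      \<zero>\<^bsub>M\<^esub> = finsum M c {\<gamma>. c \<gamma> \<noteq> \<zero>\<^bsub>M\<^esub>}"
  have "\<forall>x\<in>carrier M. \<exists>!c. (\<forall>\<gamma>. c \<gamma> \<in> gcomp M \<gamma>) \<and> finite {\<gamma>. c \<gamma> \<noteq> \<zero>\<^bsub>M\<^esub>} \<and>
        x = finsum M c {\<gamma>. c \<gamma> \<noteq> \<zero>\<^bsub>M\<^esub>}"
    using M unfolding graded_module_def by (elim conjE)
  from bspec[OF this M.zero_closed] have ex: "\<exists>!c. ?P c" .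
  define c' where "c' = (\<lambda>\<gamma>. if \<gamma> \<in> F then c \<gamma> else \<zero>\<^bsub>M\<^esub>)"
  have cl: "c' \<delta> \<in> gcomp M \<delta>" for \<delta> using F gcomp_closed(1)[OF M] by (auto simp: c'_def)
  have cc: "c' \<in> F \<rightarrow> carrier M" using cl graded_moduleD(3)[OF M] by blast
  have sup: "{\<gamma>. c' \<gamma> \<noteq> \<zero>\<^bsub>M\<^esub>} \<subseteq> F" by (auto simp: c'_def)
  have "finsum M c' {\<gamma>. c' \<gamma> \<noteq> \<zero>\<^bsub>M\<^esub>} = finsum M c' F"
    by (rule M.finsum_extend[OF F(1) sup cc]) auto
  also have "\<dots> = finsum M c F" by (rule M.finsum_cong') (use cc in \<open>auto simp: c'_def Pi_def\<close>)
  finally have "?P c'" using sum cl finite_subset[OF sup F(1)] by simp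
  moreover have "?P (\<lambda>_. \<zero>\<^bsub>M\<^esub>)" using gcomp_closed(1)[OF M] by simp
  ultimately have "c' = (\<lambda>_. \<zero>\<^bsub>M\<^esub>)" by (rule ex1_unique[OF ex])
  then show ?thesis using \<gamma> by (metis c'_def)
qed

text \<open>Existence on some finite index set and independence are what constructions deliver;
  unique decomposition follows by subtracting two families on the union of their supports.\<close>

lemma graded_moduleI:
  assumes M: "Module.module S M" and sub: "\<And>\<gamma>. subgroup (gcomp M \<gamma>) (add_monoid M)"
    and sm: "\<And>\<gamma> \<delta> s x. s \<in> rcomp S \<gamma> ==> x \<in> gcomp M \<delta> ==> s \<odot>\<^bsub>M\<^esub> x \<in> gcomp M (\<gamma> + \<delta>)"
    and ex: "\<And>x. x \<in> carrier M ==>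
      \<exists>F c. finite F \<and> (\<forall>\<gamma>\<in>F. c \<gamma> \<in> gcomp M \<gamma>) \<and> x = finsum M c F"
    and indep: "\<And>F c \<gamma>. finite F ==> (\<And>\<gamma>. \<gamma> \<in> F ==> c \<gamma> \<in> gcomp M \<gamma>) ==>
      finsum M c F = \<zero>\<^bsub>M\<^esub> ==> \<gamma> \<in> F ==> c \<gamma> = \<zero>\<^bsub>M\<^esub>"
  shows "graded_module S M"
proof -
  interpret M: Module.module S M by fact
  have gc: "gcomp M \<gamma> \<subseteq> carrier M" for \<gamma> using subgroup.subset[OF sub] by auto
  have z: "\<zero>\<^bsub>M\<^esub> \<in> gcomp M \<gamma>" for \<gamma> using subgroup.one_closed[OF sub] by auto
  have mi: "x \<ominus>\<^bsub>M\<^esub> y \<in> gcomp M \<gamma>" if "x \<in> gcomp M \<gamma>" "y \<in> gcomp M \<gamma>" for x y \<gamma>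
    using subgroup.m_closed[OF sub that(1) subgroup.m_inv_closed[OF sub that(2)]]
    by (simp add: a_minus_def a_inv_def)
  have "\<exists>!c. (\<forall>\<gamma>. c \<gamma> \<in> gcomp M \<gamma>) \<and> finite {\<gamma>. c \<gamma> \<noteq> \<zero>\<^bsub>M\<^esub>} \<and>
        x = finsum M c {\<gamma>. c \<gamma> \<noteq> \<zero>\<^bsub>M\<^esub>}" if x: "x \<in> carrier M" for x
  proof -
    obtain F c where F: "finite F" "\<forall>\<gamma>\<in>F. c \<gamma> \<in> gcomp M \<gamma>" "x = finsum M c F"
      using ex[OF x] by blast
    define c' where "c' = (\<lambda>\<gamma>. if \<gamma> \<in> F then c \<gamma> else \<zero>\<^bsub>M\<^esub>)"
    have cl: "c' \<delta> \<in> gcomp M \<delta>" for \<delta> using F z by (auto simp: c'_def)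
    have cc: "c' \<in> F \<rightarrow> carrier M" using cl gc by blast
    have sup: "{\<gamma>. c' \<gamma> \<noteq> \<zero>\<^bsub>M\<^esub>} \<subseteq> F" by (auto simp: c'_def)
    have "finsum M c' {\<gamma>. c' \<gamma> \<noteq> \<zero>\<^bsub>M\<^esub>} = finsum M c' F"
      by (rule M.finsum_extend[OF F(1) sup cc]) auto
    also have "\<dots> = finsum M c F" by (rule M.finsum_cong') (use cc in \<open>auto simp: c'_def Pi_def\<close>)
    finally have e: "x = finsum M c' {\<gamma>. c' \<gamma> \<noteq> \<zero>\<^bsub>M\<^esub>}" using F by simp
    show ?thesis
    proof (rule ex1I[of _ c'])
      show "(\<forall>\<gamma>. c' \<gamma> \<in> gcomp M \<gamma>) \<and> finite {\<gamma>. c' \<gamma> \<noteq> \<zero>\<^bsub>M\<^esub>} \<and>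
        x = finsum M c' {\<gamma>. c' \<gamma> \<noteq> \<zero>\<^bsub>M\<^esub>}"
        by (intro conjI allI cl finite_subset[OF sup F(1)] e)
      fix d assume d: "(\<forall>\<gamma>. d \<gamma> \<in> gcomp M \<gamma>) \<and> finite {\<gamma>. d \<gamma> \<noteq> \<zero>\<^bsub>M\<^esub>} \<and>
        x = finsum M d {\<gamma>. d \<gamma> \<noteq> \<zero>\<^bsub>M\<^esub>}"
      have d1: "d \<gamma> \<in> gcomp M \<gamma>" for \<gamma> using d by (elim conjE) (erule spec)
      have d2: "finite {\<gamma>. d \<gamma> \<noteq> \<zero>\<^bsub>M\<^esub>}" using d by (elim conjE)
      have d3: "x = finsum M d {\<gamma>. d \<gamma> \<noteq> \<zero>\<^bsub>M\<^esub>}" using d by (elim conjE)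
      let ?H = "{\<gamma>. c' \<gamma> \<noteq> \<zero>\<^bsub>M\<^esub>} \<union> {\<gamma>. d \<gamma> \<noteq> \<zero>\<^bsub>M\<^esub>}"
      have H: "finite ?H" using d2 finite_subset[OF sup F(1)] by (rule_tac finite_UnI)
      have dH: "d \<in> ?H \<rightarrow> carrier M" "c' \<in> ?H \<rightarrow> carrier M"
        using subsetD[OF gc d1] subsetD[OF gc cl] by (auto intro!: Pi_I)
      have "finsum M d {\<gamma>. d \<gamma> \<noteq> \<zero>\<^bsub>M\<^esub>} = finsum M d ?H"
        by (rule M.finsum_extend[OF H _ dH(1)]) auto
      moreover have "finsum M c' {\<gamma>. c' \<gamma> \<noteq> \<zero>\<^bsub>M\<^esub>} = finsum M c' ?H"
        by (rule M.finsum_extend[OF H _ dH(2)]) auto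
      moreover note M.finsum_closed[OF dH(1)]
      ultimately have "finsum M d ?H \<ominus>\<^bsub>M\<^esub> finsum M c' ?H = \<zero>\<^bsub>M\<^esub>"
        using d3 e M.minus_eq_zero_iff[of "finsum M d ?H" "finsum M c' ?H"] by simp
      then have 0: "finsum M (\<lambda>i. d i \<ominus>\<^bsub>M\<^esub> c' i) ?H = \<zero>\<^bsub>M\<^esub>"
        using M.finsum_minus[OF H dH] by simp
      show "d = c'"
      proof
        fix \<gamma>
        show "d \<gamma> = c' \<gamma>"
        proof (cases "\<gamma> \<in> ?H")
          case True
          have "d \<gamma> \<ominus>\<^bsub>M\<^esub> c' \<gamma> = \<zero>\<^bsub>M\<^esub>"
            by (rule indep[OF H _ 0 True]) (rule mi[OF d1 cl])
          then show ?thesis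
            using M.minus_eq_zero_iff[OF subsetD[OF gc d1] subsetD[OF gc cl]] by simp
        qed auto
      qed
    qed
  qed
  note uniq = this
  have "\<forall>\<gamma> \<delta>. \<forall>s\<in>rcomp S \<gamma>. \<forall>x\<in>gcomp M \<delta>. s \<odot>\<^bsub>M\<^esub> x \<in> gcomp M (\<gamma> + \<delta>)"
    using sm by blast
  moreover have "\<forall>\<gamma>. subgroup (gcomp M \<gamma>) (add_monoid M)" using sub by blast
  ultimately show ?thesis unfolding graded_module_def
    by (rule_tac conjI[OF M]) (rule conjI, assumption, rule conjI, assumption, rule ballI, rule uniq)
qed

section \<open>Homomorphisms, spans and finite generation\<close>

lemma gmod_homD:
  assumes "h \<in> gmod_hom S M N"
  shows "additive_map M N h" "x \<in> carrier M ==> h x \<in> carrier N"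
    "h \<in> extensional (carrier M)"
    "s \<in> carrier S ==> x \<in> carrier M ==> h (s \<odot>\<^bsub>M\<^esub> x) = s \<odot>\<^bsub>N\<^esub> h x"
    "x \<in> gcomp M \<gamma> ==> h x \<in> gcomp N \<gamma>"
  using assms unfolding gmod_hom_def additive_map_def PiE_def by blast+

lemma gmod_homI:
  assumes "h \<in> extensional (carrier M)" "\<And>x. x \<in> carrier M ==> h x \<in> carrier N"
    "\<And>x y. x \<in> carrier M ==> y \<in> carrier M ==> h (x \<oplus>\<^bsub>M\<^esub> y) = h x \<oplus>\<^bsub>N\<^esub> h y"
    "\<And>s x. s \<in> carrier S ==> x \<in> carrier M ==> h (s \<odot>\<^bsub>M\<^esub> x) = s \<odot>\<^bsub>N\<^esub> h x"
    "\<And>\<gamma> x. x \<in> gcomp M \<gamma> ==> h x \<in> gcomp N \<gamma>"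
  shows "h \<in> gmod_hom S M N"
  using assms by (auto simp: gmod_hom_def PiE_def)

lemma gmod_hom_compose:
  assumes "f \<in> gmod_hom S M N" "g \<in> gmod_hom S N P" and M: "graded_module S M"
  shows "compose (carrier M) g f \<in> gmod_hom S M P"
proof -
  interpret M: Module.module S M using graded_moduleD(1)[OF M] .
  note f = assms(1)[unfolded gmod_hom_def] and g = assms(2)[unfolded gmod_hom_def]
  have c: "f x \<in> carrier N" if "x \<in> carrier M" for x using f that by auto
  show ?thesis
  proof (rule gmod_homI)
    show "compose (carrier M) g f x \<in> gcomp P \<gamma>" if "x \<in> gcomp M \<gamma>" for \<gamma> x
    proof -
      have "x \<in> carrier M" using that graded_moduleD(3)[OF M] by blast
      moreover have "f x \<in> gcomp N \<gamma>" using f that by blast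
      then have "g (f x) \<in> gcomp P \<gamma>" using g by blast
      ultimately show ?thesis by (simp add: compose_def)
    qed
  qed (use f g c in \<open>auto simp: compose_def\<close>)
qed

text \<open>Iterated multiplication by elements of \<open>Z\<close> is allowed, so this is the span
  over all scalars generated by \<open>Z\<close>. The set \<open>Z\<close> itself need not be closed
  under the ring operations: later it consists of variables and constants.\<close>

inductive_set scalar_span :: "'a set \<Rightarrow> ('a, 'b, 'x) module_scheme \<Rightarrow> 'b set \<Rightarrow> 'b set"
  for Z M B where
  span_zero: "\<zero>\<^bsub>M\<^esub> \<in> scalar_span Z M B"
| span_base: "b \<in> B ==> b \<in> scalar_span Z M B"
| span_add: "x \<in> scalar_span Z M B ==> y \<in> scalar_span Z M B ==> x \<oplus>\<^bsub>M\<^esub> y \<in> scalar_span Z M B"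
| span_smult: "z \<in> Z ==> x \<in> scalar_span Z M B ==> z \<odot>\<^bsub>M\<^esub> x \<in> scalar_span Z M B"

lemma (in Module.module) span_closed:
  "Z \<subseteq> carrier R ==> B \<subseteq> carrier M ==> scalar_span Z M B \<subseteq> carrier M"
proof
  fix x assume "Z \<subseteq> carrier R" "B \<subseteq> carrier M" "x \<in> scalar_span Z M B"
  from this(3,1,2) show "x \<in> carrier M" by (induction rule: scalar_span.induct) auto
qed

lemma span_subset: "B \<subseteq> scalar_span Z M B' ==> scalar_span Z M B \<subseteq> scalar_span Z M B'"
proof
  fix x assume "B \<subseteq> scalar_span Z M B'" "x \<in> scalar_span Z M B"
  from this(2,1) show "x \<in> scalar_span Z M B'"
    by (induction rule: scalar_span.induct) (auto intro: scalar_span.intros)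
qed

lemma span_mono: "B \<subseteq> B' ==> scalar_span Z M B \<subseteq> scalar_span Z M B'"
  by (rule span_subset) (auto intro: span_base)

lemma (in Module.module) combinations_eq_span:
  assumes B: "finite B" "B \<subseteq> carrier M"
  shows "x \<in> scalar_span (carrier R) M B \<longleftrightarrow>
    (\<exists>c \<in> B \<rightarrow> carrier R. x = finsum M (\<lambda>b. c b \<odot>\<^bsub>M\<^esub> b) B)"
proof
  assume "x \<in> scalar_span (carrier R) M B"
  then show "\<exists>c \<in> B \<rightarrow> carrier R. x = finsum M (\<lambda>b. c b \<odot>\<^bsub>M\<^esub> b) B"
  proof (induction rule: scalar_span.induct)
    case span_zero
    have "finsum M (\<lambda>b. \<zero> \<odot>\<^bsub>M\<^esub> b) B = finsum M (\<lambda>b. \<zero>\<^bsub>M\<^esub>) B"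
      by (rule M.finsum_cong') (use B in auto)
    then show ?case by (intro bexI[of _ "\<lambda>_. \<zero>"]) auto
  next
    case (span_base b)
    let ?c = "\<lambda>a. if a = b then \<one> else \<zero>"
    have "finsum M (\<lambda>a. ?c a \<odot>\<^bsub>M\<^esub> a) B = finsum M (\<lambda>a. if b = a then a else \<zero>\<^bsub>M\<^esub>) B"
      by (rule M.finsum_cong') (use B in auto)
    also have "\<dots> = b" using M.finsum_singleton[OF span_base B(1), of "\<lambda>x. x"] B by auto
    finally show ?case by (intro bexI[of _ ?c]) auto
  next
    case (span_add x y)
    then obtain c d where c: "c \<in> B \<rightarrow> carrier R" "x = finsum M (\<lambda>b. c b \<odot>\<^bsub>M\<^esub> b) B"
       and d: "d \<in> B \<rightarrow> carrier R" "y = finsum M (\<lambda>b. d b \<odot>\<^bsub>M\<^esub> b) B" by blast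
    have "finsum M (\<lambda>b. (c b \<oplus> d b) \<odot>\<^bsub>M\<^esub> b) B = finsum M (\<lambda>b. c b \<odot>\<^bsub>M\<^esub> b \<oplus>\<^bsub>M\<^esub> d b \<odot>\<^bsub>M\<^esub> b) B"
      by (rule M.finsum_cong') (use B c d in \<open>auto simp: smult_l_distr Pi_def subset_iff\<close>)
    also have "\<dots> = x \<oplus>\<^bsub>M\<^esub> y" unfolding c d
      by (rule M.finsum_addf) (use B c d in \<open>auto simp: Pi_def subset_iff\<close>)
    finally show ?case using c d by (intro bexI[of _ "\<lambda>b. c b \<oplus> d b"]) (auto simp: Pi_def)
  next
    case (span_smult z x)
    then obtain c where c: "c \<in> B \<rightarrow> carrier R" "x = finsum M (\<lambda>b. c b \<odot>\<^bsub>M\<^esub> b) B" by blast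
    have "z \<odot>\<^bsub>M\<^esub> x = finsum M (\<lambda>b. z \<odot>\<^bsub>M\<^esub> (c b \<odot>\<^bsub>M\<^esub> b)) B" unfolding c
      by (rule finsum_smult_ldistr) (use span_smult B c in \<open>auto simp: Pi_def subset_iff\<close>)
    also have "\<dots> = finsum M (\<lambda>b. (z \<otimes> c b) \<odot>\<^bsub>M\<^esub> b) B"
      by (rule M.finsum_cong')
        (use span_smult B c in \<open>auto simp: Pi_def subset_iff smult_assoc1\<close>)
    finally show ?case using c span_smult by (intro bexI[of _ "\<lambda>b. z \<otimes> c b"]) (auto simp: Pi_def)
  qed
next
  assume "\<exists>c \<in> B \<rightarrow> carrier R. x = finsum M (\<lambda>b. c b \<odot>\<^bsub>M\<^esub> b) B"
  then obtain c where c: "c \<in> B \<rightarrow> carrier R" "x = finsum M (\<lambda>b. c b \<odot>\<^bsub>M\<^esub> b) B" by blast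
  have "finsum M (\<lambda>b. c b \<odot>\<^bsub>M\<^esub> b) A \<in> scalar_span (carrier R) M B" if "A \<subseteq> B" for A
    using finite_subset[OF that B(1)] that
  proof (induction A)
    case (insert a A)
    have "finsum M (\<lambda>b. c b \<odot>\<^bsub>M\<^esub> b) (insert a A) = c a \<odot>\<^bsub>M\<^esub> a \<oplus>\<^bsub>M\<^esub> finsum M (\<lambda>b. c b \<odot>\<^bsub>M\<^esub> b) A"
      by (rule M.finsum_insert) (use insert B c in \<open>auto simp: Pi_def subset_iff\<close>)
    then show ?case using insert c by (auto intro: scalar_span.intros)
  qed (auto intro: scalar_span.intros)
  then show "x \<in> scalar_span (carrier R) M B" using c by simp
qed

lemma fin_gen_iff:
  assumes "Module.module S M"
  shows "fin_gen S M \<longleftrightarrow> (\<exists>B. finite B \<and> B \<subseteq> carrier M \<and> carrier M \<subseteq> scalar_span (carrier S) M B)"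
proof -
  interpret Module.module S M by fact
  have eq: "(\<forall>x\<in>carrier M. \<exists>c\<in>B \<rightarrow> carrier S. x = finsum M (\<lambda>b. c b \<odot>\<^bsub>M\<^esub> b) B) \<longleftrightarrow>
      carrier M \<subseteq> scalar_span (carrier S) M B" if "finite B" "B \<subseteq> carrier M" for B
    unfolding subset_iff combinations_eq_span[OF that] Ball_def ..
  show ?thesis unfolding fin_gen_def by (intro ex_cong1 conj_cong HOL.refl eq)
qed

lemma span_image:
  assumes N: "abelian_group N" and M: "Module.module S M" and h: "additive_map M N h"
    "\<And>s x. s \<in> carrier S ==> x \<in> carrier M ==> h (s \<odot>\<^bsub>M\<^esub> x) = s \<odot>\<^bsub>N\<^esub> h x"
    and B: "B \<subseteq> carrier M" and x: "x \<in> scalar_span (carrier S) M B"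
  shows "h x \<in> scalar_span (carrier S) N (h ` B)"
proof -
  interpret M: Module.module S M by fact
  note hp = additive_map_props[OF M.abelian_group_axioms N h(1)]
  have "x \<in> carrier M \<and> h x \<in> scalar_span (carrier S) N (h ` B)"
    using x
  proof (induction rule: scalar_span.induct)
    case (span_add x y)
    then show ?case using hp(2)[of x y] by (auto intro: scalar_span.intros)
  next
    case (span_smult z x)
    then show ?case using h(2)[of z x] by (auto intro: scalar_span.intros)
  qed (use hp(3) B in \<open>auto intro: scalar_span.intros\<close>)
  then show ?thesis ..
qed

lemma fin_gen_image:
  assumes M: "graded_module S M" and N: "graded_module S N" and h: "h \<in> gmod_hom S M N"
    and surj: "h ` carrier M = carrier N" and fg: "fin_gen S M"
  shows "fin_gen S N"
proof -
  obtain B where B: "finite B" "B \<subseteq> carrier M" "carrier M \<subseteq> scalar_span (carrier S) M B"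
    using fg fin_gen_iff[OF graded_moduleD(1)[OF M]] by blast
  have "h x \<in> scalar_span (carrier S) N (h ` B)" if "x \<in> carrier M" for x
  proof (rule span_image[OF graded_moduleD(4)[OF N] graded_moduleD(1)[OF M] gmod_homD(1)[OF h] _ B(2)])
    show "x \<in> scalar_span (carrier S) M B" by (rule subsetD[OF B(3) that])
  qed (rule gmod_homD(4)[OF h])
  then have "carrier N \<subseteq> scalar_span (carrier S) N (h ` B)"
    unfolding surj[symmetric] by (rule image_subsetI)
  moreover have "h ` B \<subseteq> carrier N" using image_mono[OF B(2), of h] surj by simp
  ultimately show ?thesis unfolding fin_gen_iff[OF graded_moduleD(1)[OF N]]
    by (intro exI[of _ "h ` B"] conjI finite_imageI B(1))
qed

subsection \<open>Submodules and quotients\<close>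

text \<open>The last clause is homogeneity, in a form that applies to any finite family of
  homogeneous elements and not just to a chosen decomposition.\<close>

definition graded_sub :: "('g::ab_group_add, 'a) gring \<Rightarrow> ('g, 'a, 'b) gmod \<Rightarrow> 'b set \<Rightarrow> bool" where
  "graded_sub S M N \<longleftrightarrow> subgroup N (add_monoid M) \<and>
     (\<forall>s\<in>carrier S. \<forall>x\<in>N. s \<odot>\<^bsub>M\<^esub> x \<in> N) \<and>
     (\<forall>F c. finite F \<longrightarrow> (\<forall>\<gamma>\<in>F. c \<gamma> \<in> gcomp M \<gamma>) \<longrightarrow> finsum M c F \<in> N \<longrightarrow> (\<forall>\<gamma>\<in>F. c \<gamma> \<in> N))"

definition sub_gmod :: "'b set \<Rightarrow> ('g, 'a, 'b) gmod \<Rightarrow> ('g, 'a, 'b) gmod" where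
  "sub_gmod N M = M\<lparr>carrier := N, gcomp := \<lambda>\<gamma>. N \<inter> gcomp M \<gamma>\<rparr>"

text \<open>The module structure on the image of \<open>\<theta>\<close>, when \<open>\<theta>\<close> identifies exactly the elements that
  are congruent modulo a graded submodule. It serves both for quotients and for transporting
  modules to another carrier type.\<close>

definition image_gmod :: "('b \<Rightarrow> 'c) \<Rightarrow> ('g, 'a, 'b) gmod \<Rightarrow> ('g, 'a, 'c) gmod" where
  "image_gmod \<theta> M = \<lparr>carrier = \<theta> ` carrier M, monoid.mult = undefined, one = undefined,
     ring.zero = \<theta> \<zero>\<^bsub>M\<^esub>,
     add = (\<lambda>a b. \<theta> (inv_into (carrier M) \<theta> a \<oplus>\<^bsub>M\<^esub> inv_into (carrier M) \<theta> b)),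
     smult = (\<lambda>s a. \<theta> (s \<odot>\<^bsub>M\<^esub> inv_into (carrier M) \<theta> a)),
     gcomp = (\<lambda>\<gamma>. \<theta> ` gcomp M \<gamma>)\<rparr>"

lemma graded_subD:
  assumes "graded_sub S M N"
  shows "N \<subseteq> carrier M" "\<zero>\<^bsub>M\<^esub> \<in> N" "x \<in> N ==> y \<in> N ==> x \<oplus>\<^bsub>M\<^esub> y \<in> N"
    "x \<in> N ==> \<ominus>\<^bsub>M\<^esub> x \<in> N" "s \<in> carrier S ==> x \<in> N ==> s \<odot>\<^bsub>M\<^esub> x \<in> N"
    "finite F ==> (\<And>\<gamma>. \<gamma> \<in> F ==> c \<gamma> \<in> gcomp M \<gamma>) ==> finsum M c F \<in> N ==> \<gamma> \<in> F ==> c \<gamma> \<in> N"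
    "x \<in> N ==> y \<in> N ==> x \<ominus>\<^bsub>M\<^esub> y \<in> N"
proof -
  have s: "subgroup N (add_monoid M)" using assms by (simp add: graded_sub_def)
  show "N \<subseteq> carrier M" "\<zero>\<^bsub>M\<^esub> \<in> N"
    using subgroup.subset[OF s] subgroup.one_closed[OF s] by simp_all
  show "x \<in> N ==> y \<in> N ==> x \<oplus>\<^bsub>M\<^esub> y \<in> N"
    using subgroup.m_closed[OF s] by simp
  show "x \<in> N ==> \<ominus>\<^bsub>M\<^esub> x \<in> N"
    unfolding a_inv_def by (rule subgroup.m_inv_closed[OF s])
  show "x \<in> N ==> y \<in> N ==> x \<ominus>\<^bsub>M\<^esub> y \<in> N"
    using subgroup.m_closed[OF s _ subgroup.m_inv_closed[OF s]] by (simp add: a_minus_def a_inv_def)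
  have g: "\<forall>s\<in>carrier S. \<forall>x\<in>N. s \<odot>\<^bsub>M\<^esub> x \<in> N"
    and h: "\<forall>F c. finite F \<longrightarrow> (\<forall>\<gamma>\<in>F. c \<gamma> \<in> gcomp M \<gamma>) \<longrightarrow> finsum M c F \<in> N \<longrightarrow> (\<forall>\<gamma>\<in>F. c \<gamma> \<in> N)"
    using assms[unfolded graded_sub_def, THEN conjunct2, THEN conjunct1]
      assms[unfolded graded_sub_def, THEN conjunct2, THEN conjunct2] by this
  show "s \<in> carrier S ==> x \<in> N ==> s \<odot>\<^bsub>M\<^esub> x \<in> N"
    by (rule g[rule_format])
  show "finite F ==> (\<And>\<gamma>. \<gamma> \<in> F ==> c \<gamma> \<in> gcomp M \<gamma>) ==> finsum M c F \<in> N ==> \<gamma> \<in> F ==> c \<gamma> \<in> N"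
    by (rule h[rule_format])
qed

lemma graded_subI:
  assumes M: "graded_module S M"
    and "N \<subseteq> carrier M" "\<zero>\<^bsub>M\<^esub> \<in> N" "\<And>x y. x \<in> N ==> y \<in> N ==> x \<oplus>\<^bsub>M\<^esub> y \<in> N"
    and sm: "\<And>s x. s \<in> carrier S ==> x \<in> N ==> s \<odot>\<^bsub>M\<^esub> x \<in> N"
    and "\<And>F c \<gamma>. finite F ==> (\<And>\<gamma>. \<gamma> \<in> F ==> c \<gamma> \<in> gcomp M \<gamma>) ==> finsum M c F \<in> N ==>
       \<gamma> \<in> F ==> c \<gamma> \<in> N"
  shows "graded_sub S M N"
proof -
  interpret M: Module.module S M using graded_moduleD(1)[OF M] .
  have "\<ominus>\<^bsub>M\<^esub> x \<in> N" if x: "x \<in> N" for x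
  proof -
    have "x \<in> carrier M" using x assms(2) by blast
    then show ?thesis
      using sm[of "\<ominus>\<^bsub>S\<^esub> \<one>\<^bsub>S\<^esub>" x] x M.smult_l_minus[of "\<one>\<^bsub>S\<^esub>" x] by simp
  qed
  then have "subgroup N (add_monoid M)" using assms(2-4) by (intro add_subgroupI)
  moreover have "\<forall>s\<in>carrier S. \<forall>x\<in>N. s \<odot>\<^bsub>M\<^esub> x \<in> N" using sm by blast
  moreover have "\<forall>F c. finite F \<longrightarrow> (\<forall>\<gamma>\<in>F. c \<gamma> \<in> gcomp M \<gamma>) \<longrightarrow> finsum M c F \<in> N \<longrightarrow> (\<forall>\<gamma>\<in>F. c \<gamma> \<in> N)"
    by (intro allI impI ballI) (rule assms(6), assumption, erule bspec)
  ultimately show ?thesis unfolding graded_sub_def by (intro conjI)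
qed

lemma finsum_subcarrier:
  assumes "abelian_group M" "subgroup N (add_monoid M)" and F: "finite F" "c \<in> F \<rightarrow> N"
    and M': "carrier M' = N" "add M' = add M" "\<zero>\<^bsub>M'\<^esub> = \<zero>\<^bsub>M\<^esub>" and "abelian_group M'"
  shows "finsum M' c F = finsum M c F"
proof -
  interpret M: abelian_group M by fact
  interpret M': abelian_group M' by fact
  have "additive_map M' M (\<lambda>x. x)"
    using subgroup.subset[OF assms(2)] M' by (auto simp: additive_map_def)
  from additive_map_finsum[OF assms(8,1) this F(1)] show ?thesis using F(2) M' by simp
qed


locale graded_base = cring S for S :: "('g::ab_group_add, 'a) gring" +
  assumes rcomp_closed: "rcomp S \<gamma> \<subseteq> carrier S"
begin

lemma graded_module_sub:
  assumes M: "graded_module S M" and N: "graded_sub S M N"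
  shows "graded_module S (sub_gmod N M)"
proof -
  interpret M: Module.module S M using graded_moduleD(1)[OF M] .
  note n = graded_subD[OF N]
  have sub: "subgroup N (add_monoid M)" using N by (simp add: graded_sub_def)
  let ?N = "sub_gmod N M"
  have f: "carrier ?N = N" "add ?N = add M" "\<zero>\<^bsub>?N\<^esub> = \<zero>\<^bsub>M\<^esub>" "smult ?N = smult M"
      "gcomp ?N \<gamma> = N \<inter> gcomp M \<gamma>" for \<gamma>
    by (auto simp: sub_gmod_def)
  have mod: "Module.module S ?N"
  proof (rule Module.moduleI)
    show "abelian_group ?N"
    proof (rule abelian_groupI)
      fix x assume x: "x \<in> carrier ?N"
      then show "\<exists>y\<in>carrier ?N. y \<oplus>\<^bsub>?N\<^esub> x = \<zero>\<^bsub>?N\<^esub>"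
        unfolding f using n(1) n(4)[of x] M.l_neg[of x] by blast
    qed (use n(1-3) in \<open>auto simp: f subset_iff M.a_ac\<close>)
  qed (use n(1,5) is_cring in \<open>auto simp: f subset_iff M.smult_l_distr M.smult_r_distr M.smult_assoc1\<close>)
  interpret N: Module.module S ?N by (rule mod)
  have fs: "finsum ?N c F = finsum M c F" if "finite F" "c \<in> F \<rightarrow> N" for c and F :: "'g set"
    by (rule finsum_subcarrier[OF M.abelian_group_axioms sub that f(1-3) N.abelian_group_axioms])
  have ainv: "\<ominus>\<^bsub>?N\<^esub> x = \<ominus>\<^bsub>M\<^esub> x" if "x \<in> N" for x
    using that n(1,4) by (intro N.minus_equality) (auto simp: f subset_iff M.l_neg)
  show ?thesis
  proof (rule graded_moduleI[OF mod])
    show "subgroup (gcomp ?N \<gamma>) (add_monoid ?N)" for \<gamma>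
      by (rule add_subgroupI) (use n(1-4) gcomp_closed[OF M] ainv in \<open>auto simp: f\<close>)
    show "s \<odot>\<^bsub>?N\<^esub> x \<in> gcomp ?N (\<gamma> + \<delta>)" if "s \<in> rcomp S \<gamma>" "x \<in> gcomp ?N \<delta>" for \<gamma> \<delta> s x
      using that n(5) rcomp_closed graded_moduleD(6)[OF M] by (auto simp: f subset_iff)
    show "\<exists>F c. finite F \<and> (\<forall>\<gamma>\<in>F. c \<gamma> \<in> gcomp ?N \<gamma>) \<and> x = finsum ?N c F"
      if x: "x \<in> carrier ?N" for x
    proof -
      have "x \<in> carrier M" using x n(1) by (auto simp: f)
      then obtain F c where F: "finite F" "\<And>\<gamma>. c \<gamma> \<in> gcomp M \<gamma>" "x = finsum M c F"
        using graded_module_decomp[OF M] by blast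
      have c: "c \<gamma> \<in> N" if "\<gamma> \<in> F" for \<gamma>
        by (rule n(6)[OF F(1)]) (use F x that in \<open>auto simp: f\<close>)
      show ?thesis
        by (rule exI[of _ F], rule exI[of _ c]) (use F c fs[of F c] in \<open>auto simp: f\<close>)
    qed
    show "c \<gamma> = \<zero>\<^bsub>?N\<^esub>" if "finite F" "\<And>\<gamma>. \<gamma> \<in> F ==> c \<gamma> \<in> gcomp ?N \<gamma>"
      "finsum ?N c F = \<zero>\<^bsub>?N\<^esub>" "\<gamma> \<in> F" for F c \<gamma>
      unfolding f by (rule graded_module_indep[OF M that(1)]) (use that fs[of F c] in \<open>auto simp: f\<close>)
  qed
qed

text \<open>The operations of \<open>image_gmod\<close> use preimages picked by
  \<open>inv_into\<close>. A picked preimage differs from any other by an element of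
  \<open>N\<close>, which the submodule property makes harmless.\<close>

lemma image_gmod_ops:
  assumes M: "graded_module S M" and N: "graded_sub S M N"
    and \<theta>: "\<And>x y. x \<in> carrier M ==> y \<in> carrier M ==> \<theta> x = \<theta> y \<longleftrightarrow> x \<ominus>\<^bsub>M\<^esub> y \<in> N"
  shows "x \<in> carrier M ==> y \<in> carrier M ==> \<theta> x \<oplus>\<^bsub>image_gmod \<theta> M\<^esub> \<theta> y = \<theta> (x \<oplus>\<^bsub>M\<^esub> y)"
    and "s \<in> carrier S ==> x \<in> carrier M ==> s \<odot>\<^bsub>image_gmod \<theta> M\<^esub> \<theta> x = \<theta> (s \<odot>\<^bsub>M\<^esub> x)"
    and "\<zero>\<^bsub>image_gmod \<theta> M\<^esub> = \<theta> \<zero>\<^bsub>M\<^esub>" "carrier (image_gmod \<theta> M) = \<theta> ` carrier M"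
      "gcomp (image_gmod \<theta> M) \<gamma> = \<theta> ` gcomp M \<gamma>"
    and "x \<in> carrier M ==> \<theta> x = \<zero>\<^bsub>image_gmod \<theta> M\<^esub> \<longleftrightarrow> x \<in> N"
proof -
  interpret M: Module.module S M using graded_moduleD(1)[OF M] .
  note n = graded_subD[OF N]
  let ?r = "\<lambda>x. inv_into (carrier M) \<theta> (\<theta> x)"
  have r: "?r x \<in> carrier M" "?r x \<ominus>\<^bsub>M\<^esub> x \<in> N" if "x \<in> carrier M" for x
    using that inv_into_into[of "\<theta> x" \<theta> "carrier M"] f_inv_into_f[of "\<theta> x" \<theta> "carrier M"]
      \<theta>[of "?r x" x] by auto
  show "\<theta> x \<oplus>\<^bsub>image_gmod \<theta> M\<^esub> \<theta> y = \<theta> (x \<oplus>\<^bsub>M\<^esub> y)" if "x \<in> carrier M" "y \<in> carrier M"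
  proof -
    have "(?r x \<oplus>\<^bsub>M\<^esub> ?r y) \<ominus>\<^bsub>M\<^esub> (x \<oplus>\<^bsub>M\<^esub> y) = (?r x \<ominus>\<^bsub>M\<^esub> x) \<oplus>\<^bsub>M\<^esub> (?r y \<ominus>\<^bsub>M\<^esub> y)"
      using r that by (simp add: a_minus_def M.minus_add M.a_ac)
    then show ?thesis using \<theta>[of "?r x \<oplus>\<^bsub>M\<^esub> ?r y" "x \<oplus>\<^bsub>M\<^esub> y"] r that n(3)
      by (simp add: image_gmod_def)
  qed
  show "s \<odot>\<^bsub>image_gmod \<theta> M\<^esub> \<theta> x = \<theta> (s \<odot>\<^bsub>M\<^esub> x)" if "s \<in> carrier S" "x \<in> carrier M"
  proof -
    have "s \<odot>\<^bsub>M\<^esub> ?r x \<ominus>\<^bsub>M\<^esub> s \<odot>\<^bsub>M\<^esub> x = s \<odot>\<^bsub>M\<^esub> (?r x \<ominus>\<^bsub>M\<^esub> x)"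
      using r that by (simp add: a_minus_def M.smult_r_distr M.smult_r_minus)
    then show ?thesis using \<theta>[of "s \<odot>\<^bsub>M\<^esub> ?r x" "s \<odot>\<^bsub>M\<^esub> x"] r that n(5)
      by (simp add: image_gmod_def)
  qed
  show "\<zero>\<^bsub>image_gmod \<theta> M\<^esub> = \<theta> \<zero>\<^bsub>M\<^esub>" "carrier (image_gmod \<theta> M) = \<theta> ` carrier M"
      "gcomp (image_gmod \<theta> M) \<gamma> = \<theta> ` gcomp M \<gamma>" by (auto simp: image_gmod_def)
  show "\<theta> x = \<zero>\<^bsub>image_gmod \<theta> M\<^esub> \<longleftrightarrow> x \<in> N" if "x \<in> carrier M"
    using \<theta>[of x "\<zero>\<^bsub>M\<^esub>"] that M.minus_equality[of "\<zero>\<^bsub>M\<^esub>" "\<zero>\<^bsub>M\<^esub>"]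
    by (simp add: image_gmod_def a_minus_def)
qed

lemma graded_module_image:
  assumes M: "graded_module S M" and N: "graded_sub S M N"
    and \<theta>: "\<And>x y. x \<in> carrier M ==> y \<in> carrier M ==> \<theta> x = \<theta> y \<longleftrightarrow> x \<ominus>\<^bsub>M\<^esub> y \<in> N"
  shows "graded_module S (image_gmod \<theta> M)" and "restrict \<theta> (carrier M) \<in> gmod_hom S M (image_gmod \<theta> M)"
    and "fin_gen S M ==> fin_gen S (image_gmod \<theta> M)"
proof -
  interpret M: Module.module S M using graded_moduleD(1)[OF M] .
  note n = graded_subD[OF N]
  note ops = image_gmod_ops[OF M N \<theta>]
  let ?Q = "image_gmod \<theta> M"
  have ops1: "\<theta> x \<oplus>\<^bsub>?Q\<^esub> \<theta> y = \<theta> (x \<oplus>\<^bsub>M\<^esub> y)" if "x \<in> carrier M" "y \<in> carrier M" for x y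
    using ops(1)[OF _ _ that] by simp
  have ops2: "s \<odot>\<^bsub>?Q\<^esub> \<theta> x = \<theta> (s \<odot>\<^bsub>M\<^esub> x)" if "s \<in> carrier S" "x \<in> carrier M" for s x
    using ops(2)[OF _ _ that] by simp
  have ops3: "\<zero>\<^bsub>?Q\<^esub> = \<theta> \<zero>\<^bsub>M\<^esub>" "carrier ?Q = \<theta> ` carrier M" "gcomp ?Q \<gamma> = \<theta> ` gcomp M \<gamma>" for \<gamma>
    by (auto simp: image_gmod_def)
  have ops4: "\<theta> x = \<zero>\<^bsub>?Q\<^esub> \<longleftrightarrow> x \<in> N" if "x \<in> carrier M" for x
    using ops(6)[OF _ _ that] by simp
  have mod: "Module.module S ?Q"
  proof (rule Module.moduleI)
    show "abelian_group ?Q"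
    proof (rule abelian_groupI)
      fix x assume "x \<in> carrier ?Q"
      then obtain y where y: "x = \<theta> y" "y \<in> carrier M" by (auto simp: ops3)
      show "\<exists>y\<in>carrier ?Q. y \<oplus>\<^bsub>?Q\<^esub> x = \<zero>\<^bsub>?Q\<^esub>"
        by (rule bexI[of _ "\<theta> (\<ominus>\<^bsub>M\<^esub> y)"]) (use y in \<open>auto simp: ops1 ops3 M.l_neg\<close>)
    qed (auto simp: ops1 ops3 M.a_ac)
  qed (use is_cring in \<open>auto simp: ops1 ops2 ops3 M.smult_l_distr M.smult_r_distr M.smult_assoc1\<close>)
  interpret Q: Module.module S ?Q by (rule mod)
  have gM: "gcomp M \<gamma> \<subseteq> carrier M" for \<gamma> using graded_moduleD(3)[OF M] .
  have add: "additive_map M ?Q \<theta>" by (auto simp: additive_map_def ops1 ops3)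
  note fs = additive_map_finsum[OF M.abelian_group_axioms Q.abelian_group_axioms add]
  note neg = additive_map_neg[OF M.abelian_group_axioms Q.abelian_group_axioms add]
  show gm: "graded_module S ?Q"
  proof (rule graded_moduleI[OF mod])
    show "subgroup (gcomp ?Q \<gamma>) (add_monoid ?Q)" for \<gamma>
    proof (rule add_subgroupI)
      show "\<ominus>\<^bsub>?Q\<^esub> x \<in> gcomp ?Q \<gamma>" if x: "x \<in> gcomp ?Q \<gamma>" for x
      proof -
        obtain y where y: "y \<in> gcomp M \<gamma>" "x = \<theta> y" using x by (auto simp: ops3)
        then show ?thesis using neg[OF subsetD[OF gM y(1)], symmetric] gcomp_closed(4)[OF M y(1)]
          by (simp add: ops3)
      qed
      show "x \<oplus>\<^bsub>?Q\<^esub> y \<in> gcomp ?Q \<gamma>" if xy: "x \<in> gcomp ?Q \<gamma>" "y \<in> gcomp ?Q \<gamma>" for x y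
      proof -
        obtain a b where a: "a \<in> gcomp M \<gamma>" "x = \<theta> a" "b \<in> gcomp M \<gamma>" "y = \<theta> b"
          using xy by (auto simp: ops3)
        moreover have "a \<in> carrier M" "b \<in> carrier M" using a gM by blast+
        ultimately show ?thesis using gcomp_closed(2)[OF M a(1,3)] by (simp add: ops1 ops3)
      qed
    qed (use gM[of \<gamma>] gcomp_closed(1)[OF M] in \<open>auto simp: ops3\<close>)
    show "s \<odot>\<^bsub>?Q\<^esub> x \<in> gcomp ?Q (\<gamma> + \<delta>)" if s: "s \<in> rcomp S \<gamma>" "x \<in> gcomp ?Q \<delta>" for \<gamma> \<delta> s x
    proof -
      obtain y where y: "y \<in> gcomp M \<delta>" "x = \<theta> y" using s by (auto simp: ops3)
      then have "y \<in> carrier M" "s \<in> carrier S" using s gM rcomp_closed by blast+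
      then show ?thesis using y s graded_moduleD(6)[OF M s(1) y(1)] by (simp add: ops2 ops3)
    qed
    show "\<exists>F c. finite F \<and> (\<forall>\<gamma>\<in>F. c \<gamma> \<in> gcomp ?Q \<gamma>) \<and> x = finsum ?Q c F"
      if x: "x \<in> carrier ?Q" for x
    proof -
      obtain y where y: "y \<in> carrier M" "x = \<theta> y" using x by (auto simp: ops3)
      obtain F c where F: "finite F" "\<And>\<gamma>. c \<gamma> \<in> gcomp M \<gamma>" "y = finsum M c F"
        using graded_module_decomp[OF M y(1)] by blast
      have "c \<in> F \<rightarrow> carrier M" using F gM by blast
      from fs[OF F(1) this] show ?thesis
        by (intro exI[of _ F] exI[of _ "\<lambda>i. \<theta> (c i)"]) (use F y in \<open>auto simp: ops3\<close>)
    qed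
    show "c \<gamma> = \<zero>\<^bsub>?Q\<^esub>" if F: "finite F" "\<And>\<gamma>. \<gamma> \<in> F ==> c \<gamma> \<in> gcomp ?Q \<gamma>"
      "finsum ?Q c F = \<zero>\<^bsub>?Q\<^esub>" "\<gamma> \<in> F" for F c \<gamma>
    proof -
      \<comment> \<open>Lift the family to homogeneous elements of \<open>M\<close>; their sum lies
        in \<open>N\<close>, and homogeneity of \<open>N\<close> puts each of them there.\<close>
      have "\<forall>\<gamma>\<in>F. \<exists>b. b \<in> gcomp M \<gamma> \<and> c \<gamma> = \<theta> b" using F(2) by (auto simp: ops3)
      then obtain b where b: "\<And>\<gamma>. \<gamma> \<in> F ==> b \<gamma> \<in> gcomp M \<gamma> \<and> c \<gamma> = \<theta> (b \<gamma>)" by metis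
      have bc: "b \<in> F \<rightarrow> carrier M" using b gM by blast
      have "finsum ?Q c F = finsum ?Q (\<lambda>i. \<theta> (b i)) F"
        by (rule Q.finsum_cong') (use b bc in \<open>auto simp: ops3\<close>)
      then have "\<theta> (finsum M b F) = \<zero>\<^bsub>?Q\<^esub>" using fs[OF F(1) bc] F by simp
      then have "finsum M b F \<in> N" using ops4 M.finsum_closed[OF bc] by simp
      then have "b \<gamma> \<in> N" using n(6)[OF F(1) _ _ F(4), of b] b by blast
      then show ?thesis using ops4[of "b \<gamma>"] b F bc by auto
    qed
  qed
  show h: "restrict \<theta> (carrier M) \<in> gmod_hom S M ?Q"
    using gM by (intro gmod_homI) (auto simp: ops1 ops2 ops3 subset_iff)
  show "fin_gen S ?Q" if "fin_gen S M"
    by (rule fin_gen_image[OF M gm h _ that]) (auto simp: ops3)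
qed

definition zero_gmod :: "'b \<Rightarrow> ('g, 'a, 'b) gmod" where
  "zero_gmod z = \<lparr>carrier = {z}, monoid.mult = undefined, one = undefined,
     ring.zero = z, add = (\<lambda>_ _. z), smult = (\<lambda>_ _. z), gcomp = (\<lambda>_. {z})\<rparr>"

lemma graded_module_zero: "graded_module S (zero_gmod z)" "fin_gen S (zero_gmod z)"
proof -
  let ?Z = "zero_gmod z"
  have mod: "Module.module S ?Z"
  proof (rule Module.moduleI)
    show "abelian_group ?Z" by (rule abelian_groupI) (auto simp: zero_gmod_def)
  qed (use is_cring in \<open>auto simp: zero_gmod_def\<close>)
  interpret Z: Module.module S ?Z by (rule mod)
  have cZ: "x \<in> carrier ?Z \<longleftrightarrow> x = z" "\<zero>\<^bsub>?Z\<^esub> = z" "gcomp ?Z \<gamma> = {z}" for x \<gamma>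
    by (auto simp: zero_gmod_def)
  show "graded_module S ?Z"
  proof (rule graded_moduleI[OF mod])
    show "subgroup (gcomp ?Z \<gamma>) (add_monoid ?Z)" for \<gamma>
      by (rule add_subgroupI) (use Z.a_inv_closed[of z] cZ in \<open>auto simp: zero_gmod_def\<close>)
    show "\<exists>F c. finite F \<and> (\<forall>\<gamma>\<in>F. c \<gamma> \<in> gcomp ?Z \<gamma>) \<and> x = finsum ?Z c F"
      if "x \<in> carrier ?Z" for x
      by (intro exI[of _ "{}"]) (use that cZ in auto)
  qed (auto simp: zero_gmod_def)
  show "fin_gen S ?Z" unfolding fin_gen_iff[OF mod]
    by (rule exI[of _ "{}"]) (use cZ in \<open>auto intro: scalar_span.span_zero[of ?Z, unfolded cZ]\<close>)
qed

lemma sum_ops: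
  "carrier (gmod_sum M N) = carrier M \<times> carrier N" "\<zero>\<^bsub>gmod_sum M N\<^esub> = (\<zero>\<^bsub>M\<^esub>, \<zero>\<^bsub>N\<^esub>)"
  "p \<oplus>\<^bsub>gmod_sum M N\<^esub> q = (fst p \<oplus>\<^bsub>M\<^esub> fst q, snd p \<oplus>\<^bsub>N\<^esub> snd q)"
  "s \<odot>\<^bsub>gmod_sum M N\<^esub> p = (s \<odot>\<^bsub>M\<^esub> fst p, s \<odot>\<^bsub>N\<^esub> snd p)"
  "gcomp (gmod_sum M N) \<gamma> = gcomp M \<gamma> \<times> gcomp N \<gamma>"
  by (auto simp: gmod_sum_def)

lemma graded_module_sum:
  assumes M: "graded_module S M" and N: "graded_module S N"
  shows "graded_module S (gmod_sum M N)"
    "fin_gen S M ==> fin_gen S N ==> fin_gen S (gmod_sum M N)"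
proof -
  interpret M: Module.module S M using graded_moduleD(1)[OF M] .
  interpret N: Module.module S N using graded_moduleD(1)[OF N] .
  let ?P = "gmod_sum M N"
  have mod: "Module.module S ?P"
  proof (rule Module.moduleI)
    show "abelian_group ?P"
    proof (rule abelian_groupI)
      fix x assume "x \<in> carrier ?P"
      then show "\<exists>y\<in>carrier ?P. y \<oplus>\<^bsub>?P\<^esub> x = \<zero>\<^bsub>?P\<^esub>"
        by (intro bexI[of _ "(\<ominus>\<^bsub>M\<^esub> fst x, \<ominus>\<^bsub>N\<^esub> snd x)"]) (auto simp: sum_ops M.l_neg N.l_neg)
    qed (auto simp: sum_ops M.a_ac N.a_ac)
  qed (use is_cring in \<open>auto simp: sum_ops M.smult_l_distr M.smult_r_distr M.smult_assoc1
      N.smult_l_distr N.smult_r_distr N.smult_assoc1\<close>)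
  interpret P: Module.module S ?P by (rule mod)
  have a: "additive_map ?P M fst" "additive_map ?P N snd"
    by (auto simp: additive_map_def sum_ops)
  have fst: "fst (finsum ?P c F) = finsum M (\<lambda>i. fst (c i)) F"
    and snd: "snd (finsum ?P c F) = finsum N (\<lambda>i. snd (c i)) F"
    if "finite F" "c \<in> F \<rightarrow> carrier ?P" for c and F :: "'g set"
    using additive_map_finsum[OF P.abelian_group_axioms M.abelian_group_axioms a(1) that]
      additive_map_finsum[OF P.abelian_group_axioms N.abelian_group_axioms a(2) that] by auto
  have gM: "gcomp M \<gamma> \<subseteq> carrier M" "gcomp N \<gamma> \<subseteq> carrier N" for \<gamma>
    using graded_moduleD(3)[OF M] graded_moduleD(3)[OF N] by auto
  have neg: "\<ominus>\<^bsub>?P\<^esub> p = (\<ominus>\<^bsub>M\<^esub> fst p, \<ominus>\<^bsub>N\<^esub> snd p)" if "p \<in> carrier ?P" for p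
    by (rule P.minus_equality) (use that in \<open>auto simp: sum_ops M.l_neg N.l_neg\<close>)
  show "graded_module S ?P"
  proof (rule graded_moduleI[OF mod])
    show "subgroup (gcomp ?P \<gamma>) (add_monoid ?P)" for \<gamma>
    proof (rule add_subgroupI)
      show s: "gcomp ?P \<gamma> \<subseteq> carrier ?P" using gM by (force simp: sum_ops)
      show "\<ominus>\<^bsub>?P\<^esub> x \<in> gcomp ?P \<gamma>" if "x \<in> gcomp ?P \<gamma>" for x
        using that subsetD[OF s that] neg[of x] gcomp_closed(4)[OF M] gcomp_closed(4)[OF N]
        by (auto simp: sum_ops)
    qed (use gcomp_closed[OF M] gcomp_closed[OF N] in \<open>auto simp: sum_ops\<close>)
    show "s \<odot>\<^bsub>?P\<^esub> x \<in> gcomp ?P (\<gamma> + \<delta>)" if s: "s \<in> rcomp S \<gamma>" "x \<in> gcomp ?P \<delta>" for \<gamma> \<delta> s x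
      using s graded_moduleD(6)[OF M s(1)] graded_moduleD(6)[OF N s(1)] by (auto simp: sum_ops)
    show "\<exists>F c. finite F \<and> (\<forall>\<gamma>\<in>F. c \<gamma> \<in> gcomp ?P \<gamma>) \<and> x = finsum ?P c F"
      if x: "x \<in> carrier ?P" for x
    proof -
      obtain F c where F: "finite F" "\<And>\<gamma>. c \<gamma> \<in> gcomp M \<gamma>" "fst x = finsum M c F"
        using graded_module_decomp[OF M, of "fst x"] x unfolding sum_ops mem_Times_iff by blast
      obtain F' d where F': "finite F'" "\<And>\<gamma>. d \<gamma> \<in> gcomp N \<gamma>" "snd x = finsum N d F'"
        using graded_module_decomp[OF N, of "snd x"] x unfolding sum_ops mem_Times_iff by blast
      let ?b = "\<lambda>\<gamma>. (if \<gamma> \<in> F then c \<gamma> else \<zero>\<^bsub>M\<^esub>, if \<gamma> \<in> F' then d \<gamma> else \<zero>\<^bsub>N\<^esub>)"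
      have fin: "finite (F \<union> F')" using F F' by blast
      have b: "\<And>\<gamma>. ?b \<gamma> \<in> gcomp ?P \<gamma>"
        using F F' gcomp_closed(1)[OF M] gcomp_closed(1)[OF N] by (auto simp: sum_ops)
      have bc: "?b \<in> (F \<union> F') \<rightarrow> carrier ?P" using b gM by (force simp: sum_ops)
      have bc': "(\<lambda>i. fst (?b i)) \<in> F \<union> F' \<rightarrow> carrier M" "(\<lambda>i. snd (?b i)) \<in> F \<union> F' \<rightarrow> carrier N"
        using subsetD[OF gM(1) F(2)] subsetD[OF gM(2) F'(2)] by auto
      have "finsum M c F = finsum M (\<lambda>i. fst (?b i)) F"
        by (rule M.finsum_cong') (use subsetD[OF gM(1) F(2)] in auto)
      also have "\<dots> = finsum M (\<lambda>i. fst (?b i)) (F \<union> F')"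
        by (rule M.finsum_extend[OF fin _ bc'(1)]) auto
      finally have 1: "fst x = fst (finsum ?P ?b (F \<union> F'))" using fst[OF fin bc] F by simp
      have "finsum N d F' = finsum N (\<lambda>i. snd (?b i)) F'"
        by (rule N.finsum_cong') (use subsetD[OF gM(2) F'(2)] in auto)
      also have "\<dots> = finsum N (\<lambda>i. snd (?b i)) (F \<union> F')"
        by (rule N.finsum_extend[OF fin _ bc'(2)]) auto
      finally have 2: "snd x = snd (finsum ?P ?b (F \<union> F'))" using snd[OF fin bc] F' by simp
      show ?thesis
        by (rule exI[of _ "F \<union> F'"], rule exI[of _ ?b]) (use fin b 1 2 in \<open>auto simp: prod_eq_iff\<close>)
    qed
    show "c \<gamma> = \<zero>\<^bsub>?P\<^esub>" if F: "finite F" "\<And>\<gamma>. \<gamma> \<in> F ==> c \<gamma> \<in> gcomp ?P \<gamma>"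
      "finsum ?P c F = \<zero>\<^bsub>?P\<^esub>" "\<gamma> \<in> F" for F c \<gamma>
    proof -
      have cc: "c \<in> F \<rightarrow> carrier ?P" using F(2) gM by (force simp: sum_ops)
      have "fst (c \<gamma>) = \<zero>\<^bsub>M\<^esub>"
        by (rule graded_module_indep[OF M F(1) _ _ F(4)])
          (use F(2) fst[OF F(1) cc] F(3) in \<open>auto simp: sum_ops mem_Times_iff\<close>)
      moreover have "snd (c \<gamma>) = \<zero>\<^bsub>N\<^esub>"
        by (rule graded_module_indep[OF N F(1) _ _ F(4)])
          (use F(2) snd[OF F(1) cc] F(3) in \<open>auto simp: sum_ops mem_Times_iff\<close>)
      ultimately show ?thesis by (auto simp: sum_ops prod_eq_iff)
    qed
  qed
  show "fin_gen S ?P" if fg: "fin_gen S M" "fin_gen S N"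
  proof -
    obtain B where B: "finite B" "B \<subseteq> carrier M" "carrier M \<subseteq> scalar_span (carrier S) M B"
      using fg fin_gen_iff[OF graded_moduleD(1)[OF M]] by blast
    obtain B' where B': "finite B'" "B' \<subseteq> carrier N" "carrier N \<subseteq> scalar_span (carrier S) N B'"
      using fg fin_gen_iff[OF graded_moduleD(1)[OF N]] by blast
    let ?B = "(\<lambda>b. (b, \<zero>\<^bsub>N\<^esub>)) ` B \<union> (\<lambda>b. (\<zero>\<^bsub>M\<^esub>, b)) ` B'"
    have "additive_map M ?P (\<lambda>b. (b, \<zero>\<^bsub>N\<^esub>))"
      by (auto simp: additive_map_def sum_ops)
    then have "(x, \<zero>\<^bsub>N\<^esub>) \<in> scalar_span (carrier S) ?P ((\<lambda>b. (b, \<zero>\<^bsub>N\<^esub>)) ` B)" if "x \<in> carrier M" for x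
      by (rule span_image[OF P.abelian_group_axioms M.module_axioms]) (use B that in \<open>auto simp: sum_ops\<close>)
    then have 1: "(x, \<zero>\<^bsub>N\<^esub>) \<in> scalar_span (carrier S) ?P ?B" if "x \<in> carrier M" for x
      using that span_mono[of "(\<lambda>b. (b, \<zero>\<^bsub>N\<^esub>)) ` B" ?B] by blast
    have "additive_map N ?P (\<lambda>b. (\<zero>\<^bsub>M\<^esub>, b))" by (auto simp: additive_map_def sum_ops)
    then have "(\<zero>\<^bsub>M\<^esub>, x) \<in> scalar_span (carrier S) ?P ((\<lambda>b. (\<zero>\<^bsub>M\<^esub>, b)) ` B')" if "x \<in> carrier N" for x
      by (rule span_image[OF P.abelian_group_axioms N.module_axioms]) (use B' that in \<open>auto simp: sum_ops\<close>)
    then have 2: "(\<zero>\<^bsub>M\<^esub>, x) \<in> scalar_span (carrier S) ?P ?B" if "x \<in> carrier N" for x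
      using that span_mono[of "(\<lambda>b. (\<zero>\<^bsub>M\<^esub>, b)) ` B'" ?B] by blast
    have "(x, y) \<in> scalar_span (carrier S) ?P ?B" if "x \<in> carrier M" "y \<in> carrier N" for x y
      using scalar_span.span_add[OF 1[OF that(1)] 2[OF that(2)]] that by (simp add: sum_ops)
    then have "carrier ?P \<subseteq> scalar_span (carrier S) ?P ?B" by (auto simp: sum_ops)
    moreover have "finite ?B" "?B \<subseteq> carrier ?P" using B B' by (auto simp: sum_ops)
    ultimately show ?thesis unfolding fin_gen_iff[OF mod] by (intro exI[of _ ?B] conjI)
  qed
qed

lemma shift_ops [simp]:
  "carrier (degree_shift q M) = carrier M" "add (degree_shift q M) = add M"
  "\<zero>\<^bsub>degree_shift q M\<^esub> = \<zero>\<^bsub>M\<^esub>" "smult (degree_shift q M) = smult M"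
  "gcomp (degree_shift q M) \<gamma> = gcomp M (\<gamma> + q)"
  by (auto simp: degree_shift_def)

end

section \<open>Complexes of graded modules\<close>

lemma gmod_hom_props:
  assumes M: "graded_module S M" and N: "graded_module S N" and h: "h \<in> gmod_hom S M N"
  shows "x \<in> carrier M ==> h x \<in> carrier N"
    "x \<in> carrier M ==> y \<in> carrier M ==> h (x \<oplus>\<^bsub>M\<^esub> y) = h x \<oplus>\<^bsub>N\<^esub> h y"
    "h \<zero>\<^bsub>M\<^esub> = \<zero>\<^bsub>N\<^esub>" "x \<in> carrier M ==> h (\<ominus>\<^bsub>M\<^esub> x) = \<ominus>\<^bsub>N\<^esub> h x"
    "x \<in> carrier M ==> y \<in> carrier M ==> h (x \<ominus>\<^bsub>M\<^esub> y) = h x \<ominus>\<^bsub>N\<^esub> h y"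
    "s \<in> carrier S ==> x \<in> carrier M ==> h (s \<odot>\<^bsub>M\<^esub> x) = s \<odot>\<^bsub>N\<^esub> h x"
    "x \<in> gcomp M \<gamma> ==> h x \<in> gcomp N \<gamma>" "h \<in> extensional (carrier M)"
  using additive_map_props[OF graded_moduleD(4)[OF M] graded_moduleD(4)[OF N] gmod_homD(1)[OF h]]
    gmod_homD[OF h] by simp_all

lemma finsum_same_ops:
  fixes M N :: "('g, 'a, 'b) gmod"
  assumes "carrier M = carrier N" "add M = add N" "\<zero>\<^bsub>M\<^esub> = \<zero>\<^bsub>N\<^esub>"
  shows "finsum M c F = finsum N c F"
  using assms by (simp add: finsum_def)

lemma a_inv_same_ops:
  fixes M N :: "('g, 'a, 'b) gmod"
  assumes "carrier M = carrier N" "add M = add N" "\<zero>\<^bsub>M\<^esub> = \<zero>\<^bsub>N\<^esub>"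
  shows "\<ominus>\<^bsub>M\<^esub> x = \<ominus>\<^bsub>N\<^esub> x"
  using assms by (simp add: a_inv_def)

context graded_base
begin

lemma shift_neg [simp]: "\<ominus>\<^bsub>degree_shift q M\<^esub> x = \<ominus>\<^bsub>M\<^esub> x"
  by (rule a_inv_same_ops) auto

lemma shift_finsum [simp]: "finsum (degree_shift q M) c F = finsum M c F"
  by (rule finsum_same_ops) auto

lemma graded_module_shift:
  assumes M: "graded_module S M"
  shows "graded_module S (degree_shift q M)"
proof -
  interpret M: Module.module S M using graded_moduleD(1)[OF M] .
  let ?T = "degree_shift q M"
  have mod: "Module.module S ?T"
  proof (rule Module.moduleI)
    show "abelian_group ?T"
    proof (rule abelian_groupI)
      show "\<exists>y\<in>carrier ?T. y \<oplus>\<^bsub>?T\<^esub> x = \<zero>\<^bsub>?T\<^esub>" if "x \<in> carrier ?T" for x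
        by (rule bexI[of _ "\<ominus>\<^bsub>M\<^esub> x"]) (use that in \<open>auto simp: M.l_neg\<close>)
    qed (auto simp: M.a_ac)
  qed (use is_cring in \<open>auto simp: M.smult_l_distr M.smult_r_distr M.smult_assoc1\<close>)
  have gM: "gcomp M \<gamma> \<subseteq> carrier M" for \<gamma> using graded_moduleD(3)[OF M] .
  show ?thesis
  proof (rule graded_moduleI[OF mod])
    show "subgroup (gcomp ?T \<gamma>) (add_monoid ?T)" for \<gamma>
      by (rule add_subgroupI) (use gM gcomp_closed[OF M] in auto)
    show "s \<odot>\<^bsub>?T\<^esub> x \<in> gcomp ?T (\<gamma> + \<delta>)" if "s \<in> rcomp S \<gamma>" "x \<in> gcomp ?T \<delta>" for \<gamma> \<delta> s x
      using graded_moduleD(6)[OF M that(1), of x "\<delta> + q"] that by (simp add: add.assoc)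
    show "\<exists>F c. finite F \<and> (\<forall>\<gamma>\<in>F. c \<gamma> \<in> gcomp ?T \<gamma>) \<and> x = finsum ?T c F"
      if x: "x \<in> carrier ?T" for x
    proof -
      obtain F c where F: "finite F" "\<And>\<gamma>. c \<gamma> \<in> gcomp M \<gamma>" "x = finsum M c F"
        using graded_module_decomp[OF M, of x] x by auto
      let ?F = "(\<lambda>\<gamma>. \<gamma> - q) ` F"
      have "finsum M (\<lambda>\<gamma>. c (\<gamma> + q)) ?F = finsum M (\<lambda>\<gamma>. c (\<gamma> - q + q)) F"
        by (rule M.finsum_reindex) (use subsetD[OF gM F(2)] in \<open>auto simp: inj_on_def\<close>)
      then show ?thesis using F by (intro exI[of _ ?F] exI[of _ "\<lambda>\<gamma>. c (\<gamma> + q)"]) auto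
    qed
    show "c \<gamma> = \<zero>\<^bsub>?T\<^esub>" if F: "finite F" "\<And>\<gamma>. \<gamma> \<in> F ==> c \<gamma> \<in> gcomp ?T \<gamma>"
      "finsum ?T c F = \<zero>\<^bsub>?T\<^esub>" "\<gamma> \<in> F" for F c \<gamma>
    proof -
      let ?F = "(\<lambda>\<gamma>. \<gamma> + q) ` F"
      have cF: "c \<gamma> \<in> carrier M" if "\<gamma> \<in> F" for \<gamma> using subsetD[OF gM, of "c \<gamma>"] F(2)[OF that] by simp
      have "finsum M (\<lambda>\<gamma>. c (\<gamma> - q)) ?F = finsum M (\<lambda>\<gamma>. c (\<gamma> + q - q)) F"
        by (rule M.finsum_reindex) (use cF in \<open>auto simp: inj_on_def\<close>)
      then have 0: "finsum M (\<lambda>\<gamma>. c (\<gamma> - q)) ?F = \<zero>\<^bsub>M\<^esub>" using F(3) by simp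
      have "c (\<gamma> + q - q) = \<zero>\<^bsub>M\<^esub>"
        by (rule graded_module_indep[OF M _ _ 0]) (use F in auto)
      then show ?thesis by simp
    qed
  qed
qed

lemma fin_gen_shift: "fin_gen S M ==> fin_gen S (degree_shift q M)"
  unfolding fin_gen_def shift_ops shift_finsum .

lemma gmod_hom_shift: "h \<in> gmod_hom S M N ==> h \<in> gmod_hom S (degree_shift q M) (degree_shift q N)"
  unfolding gmod_hom_def shift_ops by auto

lemma neg_hom:
  assumes M: "graded_module S M" and N: "graded_module S N" and h: "h \<in> gmod_hom S M N"
  shows "(\<lambda>x\<in>carrier M. \<ominus>\<^bsub>N\<^esub> h x) \<in> gmod_hom S M N"
proof -
  interpret M: Module.module S M using graded_moduleD(1)[OF M] .
  interpret N: Module.module S N using graded_moduleD(1)[OF N] .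
  note p = gmod_hom_props[OF M N h]
  show ?thesis
    by (rule gmod_homI) (use p graded_moduleD(3)[OF M] gcomp_closed(4)[OF N] in
      \<open>auto simp: N.minus_add N.smult_r_minus subset_iff\<close>)
qed

lemma id_hom: "graded_module S M ==> (\<lambda>x\<in>carrier M. x) \<in> gmod_hom S M M"
proof -
  assume M: "graded_module S M"
  interpret M: Module.module S M using graded_moduleD(1)[OF M] .
  show ?thesis by (rule gmod_homI) (use graded_moduleD(3)[OF M] in \<open>auto simp: subset_iff\<close>)
qed

lemma zero_hom:
  assumes M: "graded_module S M" and N: "graded_module S N"
  shows "(\<lambda>x\<in>carrier M. \<zero>\<^bsub>N\<^esub>) \<in> gmod_hom S M N"
proof -
  interpret M: Module.module S M using graded_moduleD(1)[OF M] .
  interpret N: Module.module S N using graded_moduleD(1)[OF N] .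
  show ?thesis
    by (rule gmod_homI) (use graded_moduleD(3)[OF M] gcomp_closed(1)[OF N] in \<open>auto simp: subset_iff\<close>)
qed

lemma int_add_1_1: "(i::int) + 1 + 1 = i + 2"
  by simp

lemma complexD:
  assumes "A \<in> bounded_fg_complexes S"
  shows "graded_module S (cterm A i)" "cdiff A i \<in> gmod_hom S (cterm A i) (cterm A (i + 1))"
    "x \<in> carrier (cterm A i) ==> cdiff A (i + 1) (cdiff A i x) = \<zero>\<^bsub>cterm A (i + 2)\<^esub>"
    "fin_gen S (cterm A i)" "\<exists>N. \<forall>i. \<bar>i\<bar> > N \<longrightarrow> carrier (cterm A i) = {\<zero>\<^bsub>cterm A i\<^esub>}"
    "abelian_group (cterm A i)"
  using assms graded_moduleD(4)[of S "cterm A i"] by (auto simp: bounded_fg_complexes_def is_complex_def)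

lemma complexI:
  assumes "\<And>i. graded_module S (cterm A i)" "\<And>i. cdiff A i \<in> gmod_hom S (cterm A i) (cterm A (i + 1))"
    "\<And>i x. x \<in> carrier (cterm A i) ==> cdiff A (i + 1) (cdiff A i x) = \<zero>\<^bsub>cterm A (i + 2)\<^esub>"
    "\<And>i. fin_gen S (cterm A i)" "\<exists>N. \<forall>i. \<bar>i\<bar> > N \<longrightarrow> carrier (cterm A i) = {\<zero>\<^bsub>cterm A i\<^esub>}"
  shows "A \<in> bounded_fg_complexes S"
  using assms by (auto simp: bounded_fg_complexes_def is_complex_def)

lemma diff_props:
  assumes A: "A \<in> bounded_fg_complexes S"
  shows "x \<in> carrier (cterm A i) ==> cdiff A i x \<in> carrier (cterm A (i + 1))"
    "x \<in> carrier (cterm A i) ==> y \<in> carrier (cterm A i) ==>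
       cdiff A i (x \<oplus>\<^bsub>cterm A i\<^esub> y) = cdiff A i x \<oplus>\<^bsub>cterm A (i + 1)\<^esub> cdiff A i y"
    "cdiff A i \<zero>\<^bsub>cterm A i\<^esub> = \<zero>\<^bsub>cterm A (i + 1)\<^esub>"
    "x \<in> carrier (cterm A i) ==> cdiff A i (\<ominus>\<^bsub>cterm A i\<^esub> x) = \<ominus>\<^bsub>cterm A (i + 1)\<^esub> cdiff A i x"
    "x \<in> carrier (cterm A i) ==> y \<in> carrier (cterm A i) ==>
       cdiff A i (x \<ominus>\<^bsub>cterm A i\<^esub> y) = cdiff A i x \<ominus>\<^bsub>cterm A (i + 1)\<^esub> cdiff A i y"
    "s \<in> carrier S ==> x \<in> carrier (cterm A i) ==>
       cdiff A i (s \<odot>\<^bsub>cterm A i\<^esub> x) = s \<odot>\<^bsub>cterm A (i + 1)\<^esub> cdiff A i x"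
    "x \<in> gcomp (cterm A i) \<gamma> ==> cdiff A i x \<in> gcomp (cterm A (i + 1)) \<gamma>"
  by (fact gmod_hom_props[OF complexD(1)[OF A] complexD(1)[OF A] complexD(2)[OF A]])+

lemma chain_mapD:
  assumes "chain_map S A B f"
  shows "f i \<in> gmod_hom S (cterm A i) (cterm B i)"
    "x \<in> carrier (cterm A i) ==> f (i + 1) (cdiff A i x) = cdiff B i (f i x)"
  using assms by (auto simp: chain_map_def)

lemma chain_map_props:
  assumes A: "A \<in> bounded_fg_complexes S" and B: "B \<in> bounded_fg_complexes S" and f: "chain_map S A B f"
  shows "x \<in> carrier (cterm A i) ==> f i x \<in> carrier (cterm B i)"
    "x \<in> carrier (cterm A i) ==> y \<in> carrier (cterm A i) ==>
       f i (x \<oplus>\<^bsub>cterm A i\<^esub> y) = f i x \<oplus>\<^bsub>cterm B i\<^esub> f i y"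
    "f i \<zero>\<^bsub>cterm A i\<^esub> = \<zero>\<^bsub>cterm B i\<^esub>"
    "x \<in> carrier (cterm A i) ==> f i (\<ominus>\<^bsub>cterm A i\<^esub> x) = \<ominus>\<^bsub>cterm B i\<^esub> f i x"
    "x \<in> carrier (cterm A i) ==> y \<in> carrier (cterm A i) ==>
       f i (x \<ominus>\<^bsub>cterm A i\<^esub> y) = f i x \<ominus>\<^bsub>cterm B i\<^esub> f i y"
    "s \<in> carrier S ==> x \<in> carrier (cterm A i) ==>
       f i (s \<odot>\<^bsub>cterm A i\<^esub> x) = s \<odot>\<^bsub>cterm B i\<^esub> f i x"
    "x \<in> gcomp (cterm A i) \<gamma> ==> f i x \<in> gcomp (cterm B i) \<gamma>"
    "f i \<in> extensional (carrier (cterm A i))"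
  by (fact gmod_hom_props[OF complexD(1)[OF A] complexD(1)[OF B] chain_mapD(1)[OF f]])+

lemma cplx_shift_ops:
  "cterm (cplx_shift A) i = cterm A (i + 1)"
  "x \<in> carrier (cterm A (i + 1)) ==> cdiff (cplx_shift A) i x = \<ominus>\<^bsub>cterm A (i + 2)\<^esub> (cdiff A (i + 1) x)"
  by (auto simp: cplx_shift_def)

lemma cplx_shift_complex:
  assumes A: "A \<in> bounded_fg_complexes S"
  shows "cplx_shift A \<in> bounded_fg_complexes S"
proof (rule complexI)
  note c = complexD[OF A] and d = diff_props[OF A]
  fix i
  show "graded_module S (cterm (cplx_shift A) i)" "fin_gen S (cterm (cplx_shift A) i)"
    using c by (auto simp: cplx_shift_ops)
  show "cdiff (cplx_shift A) i \<in> gmod_hom S (cterm (cplx_shift A) i) (cterm (cplx_shift A) (i + 1))"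
    using neg_hom[OF c(1) c(1) c(2)[of "i + 1"]] by (simp add: cplx_shift_def int_add_1_1)
  show "cdiff (cplx_shift A) (i + 1) (cdiff (cplx_shift A) i x) = \<zero>\<^bsub>cterm (cplx_shift A) (i + 2)\<^esub>"
    if x: "x \<in> carrier (cterm (cplx_shift A) i)" for x
  proof -
    interpret A2: abelian_group "cterm A (i + 2)" by (rule c(6))
    interpret A3: abelian_group "cterm A (i + 3)" by (rule c(6))
    have x': "x \<in> carrier (cterm A (i + 1))" using x by (simp add: cplx_shift_ops)
    have e: "i + 1 + 1 = i + 2" "i + 1 + 2 = i + 3" "i + 2 + 1 = i + 3" by auto
    have d1: "cdiff A (i + 1) x \<in> carrier (cterm A (i + 2))" using d(1)[OF x'] by (simp add: e)
    have "cdiff (cplx_shift A) (i + 1) (cdiff (cplx_shift A) i x) =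
        \<ominus>\<^bsub>cterm A (i + 3)\<^esub> cdiff A (i + 2) (\<ominus>\<^bsub>cterm A (i + 2)\<^esub> (cdiff A (i + 1) x))"
      using cplx_shift_ops(2)[of "\<ominus>\<^bsub>cterm A (i + 2)\<^esub> (cdiff A (i + 1) x)" A "i + 1"] d1
      by (simp add: cplx_shift_ops(2)[OF x'] e)
    also have "\<dots> = cdiff A (i + 2) (cdiff A (i + 1) x)"
      using d(4)[OF d1] d(1)[OF d1] by (simp add: e)
    also have "\<dots> = \<zero>\<^bsub>cterm A (i + 3)\<^esub>" using c(3)[OF x'] by (simp add: e)
    finally show ?thesis by (simp add: cplx_shift_ops e)
  qed
next
  obtain N where N: "\<forall>i. \<bar>i\<bar> > N \<longrightarrow> carrier (cterm A i) = {\<zero>\<^bsub>cterm A i\<^esub>}"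
    using complexD(5)[OF A] by blast
  show "\<exists>N. \<forall>i. \<bar>i\<bar> > N \<longrightarrow> carrier (cterm (cplx_shift A) i) = {\<zero>\<^bsub>cterm (cplx_shift A) i\<^esub>}"
    by (rule exI[of _ "N + 1"]) (use N in \<open>auto simp: cplx_shift_ops\<close>)
qed

lemma cplx_shift_map:
  assumes A: "A \<in> bounded_fg_complexes S" and B: "B \<in> bounded_fg_complexes S" and f: "chain_map S A B f"
  shows "chain_map S (cplx_shift A) (cplx_shift B) (\<lambda>i. f (i + 1))"
  unfolding chain_map_def
proof (intro conjI allI ballI)
  fix i show "f (i + 1) \<in> gmod_hom S (cterm (cplx_shift A) i) (cterm (cplx_shift B) i)"
    using chain_mapD(1)[OF f] by (simp add: cplx_shift_ops)
  fix x assume "x \<in> carrier (cterm (cplx_shift A) i)"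
  then have x: "x \<in> carrier (cterm A (i + 1))" by (simp add: cplx_shift_ops)
  show "f (i + 1 + 1) (cdiff (cplx_shift A) i x) = cdiff (cplx_shift B) i (f (i + 1) x)"
    using chain_map_props(4)[OF A B f diff_props(1)[OF A x]] chain_mapD(2)[OF f x]
      chain_map_props(1)[OF A B f x]
    by (simp add: cplx_shift_ops(2)[OF x] cplx_shift_ops(2) int_add_1_1)
qed

lemma twist_ops [simp]: "cterm (cplx_twist q A) i = degree_shift q (cterm A i)" "cdiff (cplx_twist q A) = cdiff A"
  by (auto simp: cplx_twist_def)

lemma cplx_twist_complex:
  assumes A: "A \<in> bounded_fg_complexes S"
  shows "cplx_twist q A \<in> bounded_fg_complexes S"
  by (rule complexI) (use complexD[OF A] in \<open>auto intro: graded_module_shift gmod_hom_shift fin_gen_shift\<close>)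

lemma cplx_twist_map: "chain_map S A B f ==> chain_map S (cplx_twist q A) (cplx_twist q B) f"
  by (auto simp: chain_map_def intro: gmod_hom_shift)

lemma id_chain_map:
  assumes A: "A \<in> bounded_fg_complexes S"
  shows "chain_map S A A (\<lambda>i. \<lambda>x\<in>carrier (cterm A i). x)"
  using id_hom[OF complexD(1)[OF A]] diff_props(1)[OF A] by (auto simp: chain_map_def)

lemma compose_chain_map:
  assumes A: "A \<in> bounded_fg_complexes S" and B: "B \<in> bounded_fg_complexes S"
    and f: "chain_map S A B f" and g: "chain_map S B C g"
  shows "chain_map S A C (\<lambda>i. compose (carrier (cterm A i)) (g i) (f i))"
  unfolding chain_map_def
proof (intro conjI allI ballI)
  fix i show "compose (carrier (cterm A i)) (g i) (f i) \<in> gmod_hom S (cterm A i) (cterm C i)"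
    by (rule gmod_hom_compose[OF chain_mapD(1)[OF f] chain_mapD(1)[OF g] complexD(1)[OF A]])
  fix x assume x: "x \<in> carrier (cterm A i)"
  show "compose (carrier (cterm A (i + 1))) (g (i + 1)) (f (i + 1)) (cdiff A i x) =
      cdiff C i (compose (carrier (cterm A i)) (g i) (f i) x)"
    using chain_mapD(2)[OF f x] chain_mapD(2)[OF g chain_map_props(1)[OF A B f x]]
      diff_props(1)[OF A x] x by (simp add: compose_def)
qed

subsection \<open>Mapping cones\<close>

lemma cone_ops:
  "cterm (mapping_cone A B f) i = gmod_sum (cterm A (i + 1)) (cterm B i)"
  "a \<in> carrier (cterm A (i + 1)) ==> b \<in> carrier (cterm B i) ==> cdiff (mapping_cone A B f) i (a, b) =
     (\<ominus>\<^bsub>cterm A (i + 2)\<^esub> (cdiff A (i + 1) a), f (i + 1) a \<oplus>\<^bsub>cterm B (i + 1)\<^esub> cdiff B i b)"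
  by (auto simp: mapping_cone_def)

lemma cone_complex:
  assumes A: "A \<in> bounded_fg_complexes S" and B: "B \<in> bounded_fg_complexes S" and f: "chain_map S A B f"
  shows "mapping_cone A B f \<in> bounded_fg_complexes S"
proof (rule complexI)
  let ?C = "mapping_cone A B f"
  note cA = complexD[OF A] and cB = complexD[OF B] and dA = diff_props[OF A] and dB = diff_props[OF B]
    and fp = chain_map_props[OF A B f]
  fix i
  show "graded_module S (cterm ?C i)" "fin_gen S (cterm ?C i)"
    unfolding cone_ops(1) using graded_module_sum[OF cA(1) cB(1)] cA(4) cB(4) by auto
  have e: "i + 1 + 1 = i + 2" "i + 1 + 2 = i + 3" "i + 2 + 1 = i + 3" by auto
  interpret A1: Module.module S "cterm A (i + 1)" by (rule graded_moduleD(1)[OF cA(1)])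
  interpret A2: Module.module S "cterm A (i + 2)" by (rule graded_moduleD(1)[OF cA(1)])
  interpret A3: Module.module S "cterm A (i + 3)" by (rule graded_moduleD(1)[OF cA(1)])
  interpret B0: Module.module S "cterm B i" by (rule graded_moduleD(1)[OF cB(1)])
  interpret B1: Module.module S "cterm B (i + 1)" by (rule graded_moduleD(1)[OF cB(1)])
  interpret B2: Module.module S "cterm B (i + 2)" by (rule graded_moduleD(1)[OF cB(1)])
  note dA1 = dA[where i = "i + 1", unfolded e] and dA2 = dA[where i = "i + 2", unfolded e]
    and f1 = fp[where i = "i + 1"] and f2 = fp[where i = "i + 2"] and dB0 = dB[where i = i]
    and dB1 = dB[where i = "i + 1", unfolded e]
  show "cdiff ?C i \<in> gmod_hom S (cterm ?C i) (cterm ?C (i + 1))"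
  proof (rule gmod_homI)
    show "cdiff ?C i \<in> extensional (carrier (cterm ?C i))"
      by (auto simp: mapping_cone_def sum_ops)
    fix x assume x: "x \<in> carrier (cterm ?C i)"
    then obtain a b where ab: "x = (a, b)" "a \<in> carrier (cterm A (i + 1))" "b \<in> carrier (cterm B i)"
      by (auto simp: cone_ops(1) sum_ops)
    show "cdiff ?C i x \<in> carrier (cterm ?C (i + 1))"
      using ab dA1(1) f1(1) dB0(1) by (simp add: cone_ops sum_ops e)
    show "cdiff ?C i (s \<odot>\<^bsub>cterm ?C i\<^esub> x) = s \<odot>\<^bsub>cterm ?C (i + 1)\<^esub> cdiff ?C i x"
      if "s \<in> carrier S" for s
      using ab dA1(1,6) f1(1,6) dB0(1,6) that
      by (simp add: cone_ops sum_ops e A2.smult_r_minus B1.smult_r_distr)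
    fix y assume y: "y \<in> carrier (cterm ?C i)"
    then obtain a' b' where ab': "y = (a', b')" "a' \<in> carrier (cterm A (i + 1))" "b' \<in> carrier (cterm B i)"
      by (auto simp: cone_ops(1) sum_ops)
    show "cdiff ?C i (x \<oplus>\<^bsub>cterm ?C i\<^esub> y) = cdiff ?C i x \<oplus>\<^bsub>cterm ?C (i + 1)\<^esub> cdiff ?C i y"
      using ab ab' dA1(1,2) f1(1,2) dB0(1,2)
      by (simp add: cone_ops sum_ops e A2.minus_add B1.a_ac)
  next
    fix \<gamma> x assume "x \<in> gcomp (cterm ?C i) \<gamma>"
    then obtain a b where ab: "x = (a, b)" "a \<in> gcomp (cterm A (i + 1)) \<gamma>" "b \<in> gcomp (cterm B i) \<gamma>"
      by (auto simp: cone_ops(1) sum_ops)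
    moreover have "a \<in> carrier (cterm A (i + 1))" "b \<in> carrier (cterm B i)"
      using ab graded_moduleD(3)[OF cA(1)] graded_moduleD(3)[OF cB(1)] by blast+
    ultimately show "cdiff ?C i x \<in> gcomp (cterm ?C (i + 1)) \<gamma>"
      using dA1(7) f1(7) dB0(7) gcomp_closed(4)[OF cA(1)] gcomp_closed(2)[OF cB(1)]
      by (simp add: cone_ops sum_ops e)
  qed
  show "cdiff ?C (i + 1) (cdiff ?C i x) = \<zero>\<^bsub>cterm ?C (i + 2)\<^esub>" if x: "x \<in> carrier (cterm ?C i)" for x
  proof -
    obtain a b where ab: "x = (a, b)" "a \<in> carrier (cterm A (i + 1))" "b \<in> carrier (cterm B i)"
      using x by (auto simp: cone_ops(1) sum_ops)
    have da: "cdiff A (i + 1) a \<in> carrier (cterm A (i + 2))" using dA1(1) ab by simp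
    have fa: "f (i + 1) a \<in> carrier (cterm B (i + 1))" using f1(1) ab by simp
    have db: "cdiff B i b \<in> carrier (cterm B (i + 1))" using dB0(1) ab by simp
    have dda: "cdiff A (i + 2) (cdiff A (i + 1) a) = \<zero>\<^bsub>cterm A (i + 3)\<^esub>"
      using cA(3)[OF ab(2)] by (simp add: e)
    have ddb: "cdiff B (i + 1) (cdiff B i b) = \<zero>\<^bsub>cterm B (i + 2)\<^esub>" using cB(3)[OF ab(3)] .
    \<comment> \<open>This term enters the second coordinate twice, negated through the first
      coordinate and unchanged through \<open>cdiff B\<close>; the two cancel.\<close>
    have fd: "f (i + 2) (cdiff A (i + 1) a) = cdiff B (i + 1) (f (i + 1) a)"
      using chain_mapD(2)[OF f ab(2)] by (simp add: e)
    have dfa: "cdiff B (i + 1) (f (i + 1) a) \<in> carrier (cterm B (i + 2))" using dB1(1) fa by simp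
    have "cdiff ?C i x = (\<ominus>\<^bsub>cterm A (i + 2)\<^esub> (cdiff A (i + 1) a), f (i + 1) a \<oplus>\<^bsub>cterm B (i + 1)\<^esub> cdiff B i b)"
      unfolding ab(1) by (rule cone_ops(2)[OF ab(2,3)])
    also have "cdiff ?C (i + 1) \<dots> = (\<ominus>\<^bsub>cterm A (i + 3)\<^esub> (cdiff A (i + 2) (\<ominus>\<^bsub>cterm A (i + 2)\<^esub> (cdiff A (i + 1) a))),
        f (i + 2) (\<ominus>\<^bsub>cterm A (i + 2)\<^esub> (cdiff A (i + 1) a)) \<oplus>\<^bsub>cterm B (i + 2)\<^esub>
        cdiff B (i + 1) (f (i + 1) a \<oplus>\<^bsub>cterm B (i + 1)\<^esub> cdiff B i b))"
      using cone_ops(2)[of "\<ominus>\<^bsub>cterm A (i + 2)\<^esub> (cdiff A (i + 1) a)" A "i + 1"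
          "f (i + 1) a \<oplus>\<^bsub>cterm B (i + 1)\<^esub> cdiff B i b" B f] da fa db by (simp add: e)
    also have "\<dots> = (\<zero>\<^bsub>cterm A (i + 3)\<^esub>, \<zero>\<^bsub>cterm B (i + 2)\<^esub>)"
      using dA2(4)[OF da] f2(4)[OF da] dB1(2)[OF fa db] dfa
      by (simp add: dda ddb fd B2.l_neg)
    finally show ?thesis by (simp add: cone_ops(1) sum_ops e)
  qed
next
  obtain N where N: "\<And>i. \<bar>i\<bar> > N ==> carrier (cterm A i) = {\<zero>\<^bsub>cterm A i\<^esub>}"
    using complexD(5)[OF A] by blast
  obtain N' where N': "\<And>i. \<bar>i\<bar> > N' ==> carrier (cterm B i) = {\<zero>\<^bsub>cterm B i\<^esub>}"
    using complexD(5)[OF B] by blast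
  have "carrier (cterm (mapping_cone A B f) i) = {\<zero>\<^bsub>cterm (mapping_cone A B f) i\<^esub>}"
    if "\<bar>i\<bar> > \<bar>N\<bar> + \<bar>N'\<bar> + 1" for i
  proof -
    have "\<bar>i + 1\<bar> > N" "\<bar>i\<bar> > N'" using that by auto
    then show ?thesis using N N' by (simp add: cone_ops sum_ops)
  qed
  then show "\<exists>N. \<forall>i. \<bar>i\<bar> > N \<longrightarrow> carrier (cterm (mapping_cone A B f) i) = {\<zero>\<^bsub>cterm (mapping_cone A B f) i\<^esub>}"
    by blast
qed

subsection \<open>Subcomplexes and quotient complexes\<close>

text \<open>Two uses: for an injective map it is a copy of the complex on another carrier type, for
  the quotient map by a subcomplex it is the quotient complex.\<close>

definition image_cplx :: "(int \<Rightarrow> 'b \<Rightarrow> 'c) \<Rightarrow> ('g, 'a, 'b) cplx \<Rightarrow> ('g, 'a, 'c) cplx" where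
  "image_cplx \<theta> A = \<lparr>cterm = \<lambda>i. image_gmod (\<theta> i) (cterm A i),
     cdiff = \<lambda>i. \<lambda>y\<in>\<theta> i ` carrier (cterm A i).
       \<theta> (i + 1) (cdiff A i (inv_into (carrier (cterm A i)) (\<theta> i) y))\<rparr>"

definition sub_cplx :: "(int \<Rightarrow> 'b set) \<Rightarrow> ('g, 'a, 'b) cplx \<Rightarrow> ('g, 'a, 'b) cplx" where
  "sub_cplx N A = \<lparr>cterm = \<lambda>i. sub_gmod (N i) (cterm A i), cdiff = \<lambda>i. \<lambda>x\<in>N i. cdiff A i x\<rparr>"

definition graded_subcplx :: "('g, 'a, 'b) cplx \<Rightarrow> (int \<Rightarrow> 'b set) \<Rightarrow> bool" where
  "graded_subcplx A N \<longleftrightarrow> (\<forall>i. graded_sub S (cterm A i) (N i)) \<and> (\<forall>i. \<forall>x\<in>N i. cdiff A i x \<in> N (i + 1))"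

lemma image_cplx:
  assumes A: "A \<in> bounded_fg_complexes S" and N: "graded_subcplx A N"
    and \<theta>: "\<And>i x y. x \<in> carrier (cterm A i) ==> y \<in> carrier (cterm A i) ==>
      \<theta> i x = \<theta> i y \<longleftrightarrow> x \<ominus>\<^bsub>cterm A i\<^esub> y \<in> N i"
  defines "t \<equiv> \<lambda>i. restrict (\<theta> i) (carrier (cterm A i))"
  shows "image_cplx \<theta> A \<in> bounded_fg_complexes S" and "chain_map S A (image_cplx \<theta> A) t"
    and "t i ` carrier (cterm A i) = carrier (cterm (image_cplx \<theta> A) i)"
    and "t i ` gcomp (cterm A i) \<gamma> = gcomp (cterm (image_cplx \<theta> A) i) \<gamma>"
    and "x \<in> carrier (cterm A i) ==> t i x = \<zero>\<^bsub>cterm (image_cplx \<theta> A) i\<^esub> \<longleftrightarrow> x \<in> N i"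
proof -
  let ?Q = "image_cplx \<theta> A"
  note c = complexD[OF A] and d = diff_props[OF A]
  have gs: "graded_sub S (cterm A i) (N i)" for i using N by (simp add: graded_subcplx_def)
  have dN: "cdiff A i x \<in> N (i + 1)" if "x \<in> N i" for i x using N that by (simp add: graded_subcplx_def)
  note gi = graded_module_image[OF c(1) gs \<theta>] and ops = image_gmod_ops[OF c(1) gs \<theta>]
  have Qt: "cterm ?Q i = image_gmod (\<theta> i) (cterm A i)" for i by (simp add: image_cplx_def)
  have gQ: "graded_module S (cterm ?Q i)" for i unfolding Qt by (rule gi(1))
  have th: "t i \<in> gmod_hom S (cterm A i) (cterm ?Q i)" for i unfolding Qt t_def by (rule gi(2))
  have tx: "t i x = \<theta> i x" if "x \<in> carrier (cterm A i)" for i x using that by (simp add: t_def)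
  have Qc: "carrier (cterm ?Q i) = \<theta> i ` carrier (cterm A i)" for i unfolding Qt by (simp add: image_gmod_def)
  have Qg: "gcomp (cterm ?Q i) \<gamma> = \<theta> i ` gcomp (cterm A i) \<gamma>" for i \<gamma>
    unfolding Qt by (simp add: image_gmod_def)
  \<comment> \<open>Independent of the picked preimage: two preimages differ by an element of
    \<open>N i\<close>, which the differential sends into \<open>N (i + 1)\<close>.\<close>
  have dQ: "cdiff ?Q i (\<theta> i x) = \<theta> (i + 1) (cdiff A i x)" if x: "x \<in> carrier (cterm A i)" for i x
  proof -
    let ?r = "inv_into (carrier (cterm A i)) (\<theta> i) (\<theta> i x)"
    have r: "?r \<in> carrier (cterm A i)" "\<theta> i ?r = \<theta> i x"
      using x by (auto intro: inv_into_into f_inv_into_f)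
    then have "cdiff A i ?r \<ominus>\<^bsub>cterm A (i + 1)\<^esub> cdiff A i x \<in> N (i + 1)"
      using \<theta>[OF r(1) x] dN d(5)[OF r(1) x] by metis
    then show ?thesis using \<theta>[OF d(1)[OF r(1)] d(1)[OF x]] x by (simp add: image_cplx_def)
  qed
  note tp = gmod_hom_props[OF c(1) gQ th]
  show "?Q \<in> bounded_fg_complexes S"
  proof (rule complexI)
    fix i
    show "graded_module S (cterm ?Q i)" by (rule gQ)
    show "fin_gen S (cterm ?Q i)" unfolding Qt by (rule gi(3)[OF _ _ c(4)])
    have tD: "t (i + 1) (cdiff A i x) = cdiff ?Q i (t i x)" if "x \<in> carrier (cterm A i)" for x
      using that dQ d(1) by (simp add: tx)
    interpret Q1: Module.module S "cterm ?Q (i + 1)" by (rule graded_moduleD(1)[OF gQ])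
    show "cdiff ?Q i \<in> gmod_hom S (cterm ?Q i) (cterm ?Q (i + 1))"
    proof (rule gmod_homI)
      show "cdiff ?Q i \<in> extensional (carrier (cterm ?Q i))"
        unfolding Qc by (simp add: image_cplx_def)
      fix x assume "x \<in> carrier (cterm ?Q i)"
      then obtain a where a: "a \<in> carrier (cterm A i)" "x = t i a" unfolding Qc by (auto simp: tx)
      show "cdiff ?Q i x \<in> carrier (cterm ?Q (i + 1))"
        using tD[OF a(1)] tp(1)[OF d(1)[OF a(1)]] a by simp
      show "cdiff ?Q i (s \<odot>\<^bsub>cterm ?Q i\<^esub> x) = s \<odot>\<^bsub>cterm ?Q (i + 1)\<^esub> cdiff ?Q i x" if s: "s \<in> carrier S" for s
        using tD[OF a(1)] tD[of "s \<odot>\<^bsub>cterm A i\<^esub> a"] tp(6)[OF s a(1)] tp(6)[OF s d(1)[OF a(1)]]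
          d(6)[OF s a(1)] a module.smult_closed[OF graded_moduleD(1)[OF c(1)] s a(1)] by simp
      fix y assume "y \<in> carrier (cterm ?Q i)"
      then obtain b where b: "b \<in> carrier (cterm A i)" "y = t i b" unfolding Qc by (auto simp: tx)
      show "cdiff ?Q i (x \<oplus>\<^bsub>cterm ?Q i\<^esub> y) = cdiff ?Q i x \<oplus>\<^bsub>cterm ?Q (i + 1)\<^esub> cdiff ?Q i y"
        using tD[OF a(1)] tD[OF b(1)] tD[of "a \<oplus>\<^bsub>cterm A i\<^esub> b"] tp(2)[OF a(1) b(1)]
          tp(2)[OF d(1)[OF a(1)] d(1)[OF b(1)]] d(2)[OF a(1) b(1)] a b
          abelian_monoid.a_closed[OF abelian_group.axioms(1)[OF c(6)] a(1) b(1)] by simp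
    next
      fix \<gamma> x assume "x \<in> gcomp (cterm ?Q i) \<gamma>"
      then obtain a where a: "a \<in> gcomp (cterm A i) \<gamma>" "x = \<theta> i a" unfolding Qg by auto
      then have "a \<in> carrier (cterm A i)" using graded_moduleD(3)[OF c(1)] by blast
      then show "cdiff ?Q i x \<in> gcomp (cterm ?Q (i + 1)) \<gamma>"
        using dQ d(7)[OF a(1)] a by (simp add: Qg)
    qed
    show "cdiff ?Q (i + 1) (cdiff ?Q i x) = \<zero>\<^bsub>cterm ?Q (i + 2)\<^esub>" if x: "x \<in> carrier (cterm ?Q i)" for x
    proof -
      obtain a where a: "a \<in> carrier (cterm A i)" "x = \<theta> i a" using x unfolding Qc by auto
      then have "cdiff ?Q (i + 1) (cdiff ?Q i x) = \<theta> (i + 1 + 1) (cdiff A (i + 1) (cdiff A i a))"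
        using dQ d(1) by simp
      then show ?thesis using c(3)[OF a(1)] by (simp add: int_add_1_1 Qt image_gmod_def)
    qed
  next
    obtain n where n: "\<And>i. \<bar>i\<bar> > n ==> carrier (cterm A i) = {\<zero>\<^bsub>cterm A i\<^esub>}"
      using c(5) by blast
    show "\<exists>N. \<forall>i. \<bar>i\<bar> > N \<longrightarrow> carrier (cterm ?Q i) = {\<zero>\<^bsub>cterm ?Q i\<^esub>}"
      by (rule exI[of _ n]) (use n in \<open>auto simp: Qt image_gmod_def\<close>)
  qed
  show "chain_map S A ?Q t" unfolding chain_map_def using th dQ d(1) by (auto simp: tx)
  show "t i ` carrier (cterm A i) = carrier (cterm ?Q i)" unfolding Qc by (simp add: tx)
  show "t i ` gcomp (cterm A i) \<gamma> = gcomp (cterm ?Q i) \<gamma>"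
    unfolding Qg using subsetD[OF graded_moduleD(3)[OF c(1)]] by (auto simp: tx intro!: image_eqI)
  show "x \<in> carrier (cterm A i) ==> t i x = \<zero>\<^bsub>cterm ?Q i\<^esub> \<longleftrightarrow> x \<in> N i"
    unfolding Qt using ops(6) by (simp add: tx)
qed

lemma sub_ops:
  "carrier (sub_gmod N M) = N" "add (sub_gmod N M) = add M" "\<zero>\<^bsub>sub_gmod N M\<^esub> = \<zero>\<^bsub>M\<^esub>"
  "smult (sub_gmod N M) = smult M" "gcomp (sub_gmod N M) \<gamma> = N \<inter> gcomp M \<gamma>"
  by (auto simp: sub_gmod_def)

lemma sub_cplx:
  assumes A: "A \<in> bounded_fg_complexes S" and N: "graded_subcplx A N"
    and fg: "\<And>i. fin_gen S (sub_gmod (N i) (cterm A i))"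
  shows "sub_cplx N A \<in> bounded_fg_complexes S" and "chain_map S (sub_cplx N A) A (\<lambda>i. \<lambda>x\<in>N i. x)"
proof -
  let ?B = "sub_cplx N A"
  note c = complexD[OF A] and d = diff_props[OF A]
  have gs: "graded_sub S (cterm A i) (N i)" for i using N by (simp add: graded_subcplx_def)
  have dN: "cdiff A i x \<in> N (i + 1)" if "x \<in> N i" for i x using N that by (simp add: graded_subcplx_def)
  note n = graded_subD[OF gs]
  have Nc: "x \<in> carrier (cterm A i)" if "x \<in> N i" for i x using n(1) that by blast
  have Bt: "cterm ?B i = sub_gmod (N i) (cterm A i)" for i by (simp add: sub_cplx_def)
  have dB: "cdiff ?B i x = cdiff A i x" if "x \<in> N i" for i x using that by (simp add: sub_cplx_def)
  show "?B \<in> bounded_fg_complexes S"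
  proof (rule complexI)
    fix i
    show "graded_module S (cterm ?B i)" "fin_gen S (cterm ?B i)"
      unfolding Bt by (rule graded_module_sub[OF c(1) gs], rule fg)
    show "cdiff ?B i \<in> gmod_hom S (cterm ?B i) (cterm ?B (i + 1))"
    proof (rule gmod_homI)
      show "cdiff ?B i \<in> extensional (carrier (cterm ?B i))"
        by (simp add: Bt sub_ops) (simp add: sub_cplx_def)
      fix \<gamma> x assume "x \<in> gcomp (cterm ?B i) \<gamma>"
      then show "cdiff ?B i x \<in> gcomp (cterm ?B (i + 1)) \<gamma>"
        using d(7) dN by (auto simp: Bt sub_ops dB)
    qed (use dN d Nc n(3,5) in \<open>auto simp: Bt sub_ops dB\<close>)
    show "cdiff ?B (i + 1) (cdiff ?B i x) = \<zero>\<^bsub>cterm ?B (i + 2)\<^esub>" if "x \<in> carrier (cterm ?B i)" for x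
      using that dN c(3)[OF Nc] by (simp add: Bt sub_ops dB)
  next
    obtain m where m: "\<And>i. \<bar>i\<bar> > m ==> carrier (cterm A i) = {\<zero>\<^bsub>cterm A i\<^esub>}"
      using c(5) by blast
    show "\<exists>N. \<forall>i. \<bar>i\<bar> > N \<longrightarrow> carrier (cterm ?B i) = {\<zero>\<^bsub>cterm ?B i\<^esub>}"
      by (rule exI[of _ m]) (use m n(1,2) in \<open>fastforce simp: Bt sub_ops\<close>)
  qed
  show "chain_map S ?B A (\<lambda>i. \<lambda>x\<in>N i. x)"
    unfolding chain_map_def
  proof (intro conjI allI ballI)
    fix i show "(\<lambda>x\<in>N i. x) \<in> gmod_hom S (cterm ?B i) (cterm A i)"
      by (rule gmod_homI) (use Nc n(3,5) in \<open>auto simp: Bt sub_ops\<close>)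
    show "(\<lambda>x\<in>N (i + 1). x) (cdiff ?B i x) = cdiff A i ((\<lambda>x\<in>N i. x) x)"
      if "x \<in> carrier (cterm ?B i)" for x
      using that dN by (simp add: Bt sub_ops dB)
  qed
qed

end

context graded_base
begin

subsection \<open>Isomorphisms and quasi-isomorphisms of complexes\<close>

lemma chain_isoD:
  assumes "chain_iso S X Y \<phi>"
  shows "chain_map S X Y \<phi>" "bij_betw (\<phi> i) (carrier (cterm X i)) (carrier (cterm Y i))"
    "\<phi> i ` gcomp (cterm X i) \<gamma> = gcomp (cterm Y i) \<gamma>" "inj_on (\<phi> i) (carrier (cterm X i))"
    "\<phi> i ` carrier (cterm X i) = carrier (cterm Y i)"
  using assms by (auto simp: chain_iso_def bij_betw_def)

lemma chain_iso_inv: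
  assumes X: "X \<in> bounded_fg_complexes S" and Y: "Y \<in> bounded_fg_complexes S" and \<phi>: "chain_iso S X Y \<phi>"
  defines "\<psi> \<equiv> \<lambda>i. \<lambda>y\<in>carrier (cterm Y i). inv_into (carrier (cterm X i)) (\<phi> i) y"
  shows "chain_map S Y X \<psi>" "x \<in> carrier (cterm X i) ==> \<psi> i (\<phi> i x) = x"
proof -
  note i = chain_isoD[OF \<phi>] and p = chain_map_props[OF X Y chain_isoD(1)[OF \<phi>]]
  have inv: "\<psi> j (\<phi> j x) = x" if "x \<in> carrier (cterm X j)" for j x
    using inv_into_f_f[OF i(4) that] p(1)[OF that] by (simp add: \<psi>_def)
  then show "x \<in> carrier (cterm X i) ==> \<psi> i (\<phi> i x) = x" .
  have ex: "\<exists>x\<in>carrier (cterm X j). y = \<phi> j x" if "y \<in> carrier (cterm Y j)" for j y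
    using that i(5)[of j] by blast
  show "chain_map S Y X \<psi>" unfolding chain_map_def
  proof (intro conjI allI ballI)
    fix j
    interpret Xj: Module.module S "cterm X j" by (rule graded_moduleD(1)[OF complexD(1)[OF X]])
    show "\<psi> j \<in> gmod_hom S (cterm Y j) (cterm X j)"
    proof (rule gmod_homI)
      show "\<psi> j \<in> extensional (carrier (cterm Y j))" by (simp add: \<psi>_def)
      fix y assume "y \<in> carrier (cterm Y j)"
      then obtain x where x: "x \<in> carrier (cterm X j)" "y = \<phi> j x" using ex by blast
      show "\<psi> j y \<in> carrier (cterm X j)" using x inv by simp
      show "\<psi> j (s \<odot>\<^bsub>cterm Y j\<^esub> y) = s \<odot>\<^bsub>cterm X j\<^esub> \<psi> j y" if s: "s \<in> carrier S" for s
        using p(6)[OF s x(1), symmetric] inv[OF x(1)] inv[OF Xj.smult_closed[OF s x(1)]] x(2) by simp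
      fix y' assume "y' \<in> carrier (cterm Y j)"
      then obtain x' where x': "x' \<in> carrier (cterm X j)" "y' = \<phi> j x'" using ex by blast
      show "\<psi> j (y \<oplus>\<^bsub>cterm Y j\<^esub> y') = \<psi> j y \<oplus>\<^bsub>cterm X j\<^esub> \<psi> j y'"
        using p(2)[OF x(1) x'(1), symmetric] inv[OF x(1)] inv[OF x'(1)]
          inv[OF Xj.M.a_closed[OF x(1) x'(1)]] x(2) x'(2) by simp
    next
      fix \<gamma> y assume "y \<in> gcomp (cterm Y j) \<gamma>"
      then obtain x where x: "x \<in> gcomp (cterm X j) \<gamma>" "y = \<phi> j x" using i(3)[of j \<gamma>] by blast
      have "x \<in> carrier (cterm X j)" using x(1) graded_moduleD(3)[OF complexD(1)[OF X]] by blast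
      then show "\<psi> j y \<in> gcomp (cterm X j) \<gamma>" using x inv by simp
    qed
    fix y assume "y \<in> carrier (cterm Y j)"
    then obtain x where x: "x \<in> carrier (cterm X j)" "y = \<phi> j x" using ex by blast
    show "\<psi> (j + 1) (cdiff Y j y) = cdiff X j (\<psi> j y)"
      using chain_mapD(2)[OF i(1) x(1), symmetric] inv[OF x(1)] inv[OF diff_props(1)[OF X x(1)]] x(2) by simp
  qed
qed

lemma chain_iso_compose:
  assumes X: "X \<in> bounded_fg_complexes S" and Y: "Y \<in> bounded_fg_complexes S"
    and f: "chain_iso S X Y f" and g: "chain_iso S Y Z g"
  shows "chain_iso S X Z (\<lambda>i. compose (carrier (cterm X i)) (g i) (f i))"
  unfolding chain_iso_def
proof (intro conjI allI)
  show "chain_map S X Z (\<lambda>i. compose (carrier (cterm X i)) (g i) (f i))"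
    by (rule compose_chain_map[OF X Y chain_isoD(1)[OF f] chain_isoD(1)[OF g]])
  fix i
  show "bij_betw (compose (carrier (cterm X i)) (g i) (f i)) (carrier (cterm X i)) (carrier (cterm Z i))"
    by (rule bij_betw_compose[OF chain_isoD(2)[OF f] chain_isoD(2)[OF g]])
  fix \<gamma>
  have "compose (carrier (cterm X i)) (g i) (f i) ` gcomp (cterm X i) \<gamma> = g i ` (f i ` gcomp (cterm X i) \<gamma>)"
    using subsetD[OF graded_moduleD(3)[OF complexD(1)[OF X]]] by (force simp: compose_def image_image)
  then show "compose (carrier (cterm X i)) (g i) (f i) ` gcomp (cterm X i) \<gamma> = gcomp (cterm Z i) \<gamma>"
    using chain_isoD(3)[OF f] chain_isoD(3)[OF g] by simp
qed

lemma chain_iso_shift: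
  assumes "X \<in> bounded_fg_complexes S" "Y \<in> bounded_fg_complexes S" "chain_iso S X Y f"
  shows "chain_iso S (cplx_shift X) (cplx_shift Y) (\<lambda>i. f (i + 1))"
  using cplx_shift_map[OF assms(1,2) chain_isoD(1)[OF assms(3)]] assms(3)
  unfolding chain_iso_def cplx_shift_ops(1) by blast

lemma chain_iso_twist: "chain_iso S X Y f ==> chain_iso S (cplx_twist q X) (cplx_twist q Y) f"
  using cplx_twist_map unfolding chain_iso_def by auto

lemma neg_chain_map:
  assumes X: "X \<in> bounded_fg_complexes S" and Y: "Y \<in> bounded_fg_complexes S" and f: "chain_map S X Y f"
  shows "chain_map S X Y (\<lambda>i. \<lambda>x\<in>carrier (cterm X i). \<ominus>\<^bsub>cterm Y i\<^esub> f i x)"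
  unfolding chain_map_def
proof (intro conjI allI ballI)
  fix i show "(\<lambda>x\<in>carrier (cterm X i). \<ominus>\<^bsub>cterm Y i\<^esub> f i x) \<in> gmod_hom S (cterm X i) (cterm Y i)"
    by (rule neg_hom[OF complexD(1)[OF X] complexD(1)[OF Y] chain_mapD(1)[OF f]])
  fix x assume x: "x \<in> carrier (cterm X i)"
  show "(\<lambda>x\<in>carrier (cterm X (i + 1)). \<ominus>\<^bsub>cterm Y (i + 1)\<^esub> f (i + 1) x) (cdiff X i x) =
      cdiff Y i ((\<lambda>x\<in>carrier (cterm X i). \<ominus>\<^bsub>cterm Y i\<^esub> f i x) x)"
    using x diff_props(1)[OF X x] chain_mapD(2)[OF f x] diff_props(4)[OF Y chain_map_props(1)[OF X Y f x]]
    by simp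
qed

text \<open>The third object of a triangle is only a copy of the mapping cone, so a
  quasi-isomorphism out of the cone has to be composed with the inverse of the copying map.\<close>

lemma quasi_iso_compose_inv:
  assumes X: "X \<in> bounded_fg_complexes S" and Y: "Y \<in> bounded_fg_complexes S" and \<phi>: "chain_iso S X Y \<phi>"
    and q: "quasi_iso S X Z \<psi>"
  shows "quasi_iso S Y Z (\<lambda>i. compose (carrier (cterm Y i)) (\<psi> i)
    (\<lambda>y\<in>carrier (cterm Y i). inv_into (carrier (cterm X i)) (\<phi> i) y))"
proof -
  let ?i = "\<lambda>i. \<lambda>y\<in>carrier (cterm Y i). inv_into (carrier (cterm X i)) (\<phi> i) y"
  note iv = chain_iso_inv[OF X Y \<phi>] and p = chain_map_props[OF X Y chain_isoD(1)[OF \<phi>]]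
  note ip = chain_map_props[OF Y X iv(1)]
  have \<phi>i: "\<phi> i (?i i y) = y" if "y \<in> carrier (cterm Y i)" for i y
    using that chain_isoD(5)[OF \<phi>, of i] by (simp add: f_inv_into_f)
  have co: "?i i y \<in> cocycles X i" if "y \<in> cocycles Y i" for i y
  proof -
    have y: "y \<in> carrier (cterm Y i)" "cdiff Y i y = \<zero>\<^bsub>cterm Y (i + 1)\<^esub>"
      using that by (auto simp: cocycles_def)
    have "cdiff X i (?i i y) = ?i (i + 1) (cdiff Y i y)" using chain_mapD(2)[OF iv(1) y(1)] by simp
    also have "\<dots> = \<zero>\<^bsub>cterm X (i + 1)\<^esub>" unfolding y(2) by (rule ip(3))
    finally show ?thesis using ip(1)[OF y(1)] by (simp add: cocycles_def)
  qed
  have cb: "\<phi> i x \<in> coboundaries Y i" if cb: "x \<in> coboundaries X i" for i x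
  proof -
    obtain z where z: "z \<in> carrier (cterm X (i - 1))" "x = cdiff X (i - 1) z"
      using cb by (auto simp: coboundaries_def)
    then show ?thesis using chain_mapD(2)[OF chain_isoD(1)[OF \<phi>] z(1)] p(1)[OF z(1)]
      by (auto simp: coboundaries_def)
  qed
  have q1: "\<And>i x. x \<in> cocycles X i ==> \<psi> i x \<in> coboundaries Z i ==> x \<in> coboundaries X i"
    and q2: "\<And>i y. y \<in> cocycles Z i ==> \<exists>x\<in>cocycles X i. \<exists>b\<in>coboundaries Z i. y = \<psi> i x \<oplus>\<^bsub>cterm Z i\<^esub> b"
    and q0: "chain_map S X Z \<psi>"
    using q unfolding quasi_iso_def by blast+
  show ?thesis unfolding quasi_iso_def
  proof (intro conjI allI ballI impI)
    show "chain_map S Y Z (\<lambda>i. compose (carrier (cterm Y i)) (\<psi> i) (?i i))"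
      by (rule compose_chain_map[OF Y X iv(1) q0])
    fix i
    { fix y assume y: "y \<in> cocycles Y i" "compose (carrier (cterm Y i)) (\<psi> i) (?i i) y \<in> coboundaries Z i"
      then have yc: "y \<in> carrier (cterm Y i)" by (simp add: cocycles_def)
      then have "\<psi> i (?i i y) \<in> coboundaries Z i" using y(2) by (simp add: compose_def)
      from cb[OF q1[OF co[OF y(1)] this]] show "y \<in> coboundaries Y i" using \<phi>i[OF yc] by simp }
    fix z assume "z \<in> cocycles Z i"
    then obtain x b where x: "x \<in> cocycles X i" "b \<in> coboundaries Z i" "z = \<psi> i x \<oplus>\<^bsub>cterm Z i\<^esub> b"
      using q2 by blast
    then have xc: "x \<in> carrier (cterm X i)" "cdiff X i x = \<zero>\<^bsub>cterm X (i + 1)\<^esub>" by (auto simp: cocycles_def)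
    have "\<phi> i x \<in> cocycles Y i" using p(1)[OF xc(1)] p(3) chain_mapD(2)[OF chain_isoD(1)[OF \<phi>] xc(1)] xc(2)
      by (simp add: cocycles_def)
    moreover have "compose (carrier (cterm Y i)) (\<psi> i) (?i i) (\<phi> i x) = \<psi> i x"
      using iv(2)[OF xc(1)] p(1)[OF xc(1)] by (simp add: compose_def)
    ultimately show "\<exists>x\<in>cocycles Y i. \<exists>b\<in>coboundaries Z i.
        z = compose (carrier (cterm Y i)) (\<psi> i) (?i i) x \<oplus>\<^bsub>cterm Z i\<^esub> b"
      using x by (intro bexI[of _ "\<phi> i x"] bexI[of _ b]) simp_all
  qed
qed

text \<open>The bridge from exact sequences to triangles. Both conditions on cohomology are diagram
  chases that lift along p and correct the lift by an element from A'.\<close>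

lemma cone_quasi_iso:
  assumes A': "A' \<in> bounded_fg_complexes S" and A: "A \<in> bounded_fg_complexes S"
    and A'': "A'' \<in> bounded_fg_complexes S"
    and \<iota>: "chain_map S A' A \<iota>" and p: "chain_map S A A'' p"
    and inj: "\<And>i. inj_on (\<iota> i) (carrier (cterm A' i))"
    and surj: "\<And>i. p i ` carrier (cterm A i) = carrier (cterm A'' i)"
    and ex: "\<And>i x. x \<in> carrier (cterm A i) ==> p i x = \<zero>\<^bsub>cterm A'' i\<^esub> \<longleftrightarrow> x \<in> \<iota> i ` carrier (cterm A' i)"
  shows "quasi_iso S (mapping_cone A' A \<iota>) A'' (\<lambda>i. \<lambda>q\<in>carrier (cterm (mapping_cone A' A \<iota>) i). p i (snd q))"
    (is "quasi_iso S ?C A'' ?\<psi>")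
proof -
  note C = cone_complex[OF A' A \<iota>]
  note dA' = diff_props[OF A'] and dA = diff_props[OF A] and dA'' = diff_props[OF A'']
    and \<iota>p = chain_map_props[OF A' A \<iota>] and pp = chain_map_props[OF A A'' p]
    and \<iota>d = chain_mapD(2)[OF \<iota>] and pd = chain_mapD(2)[OF p]
  have cC: "carrier (cterm ?C i) = carrier (cterm A' (i + 1)) \<times> carrier (cterm A i)" for i
    by (simp add: cone_ops sum_ops)
  have gA: "abelian_group (cterm A i)" "abelian_group (cterm A' i)" "abelian_group (cterm A'' i)" for i
    using complexD(6)[OF A] complexD(6)[OF A'] complexD(6)[OF A''] by auto
  have p\<iota>: "p i (\<iota> i x) = \<zero>\<^bsub>cterm A'' i\<^esub>" if "x \<in> carrier (cterm A' i)" for i x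
    using ex[OF \<iota>p(1)[OF that]] that by blast
  have dC: "cdiff ?C i (a, b) = (\<ominus>\<^bsub>cterm A' (i + 2)\<^esub> (cdiff A' (i + 1) a), \<iota> (i + 1) a \<oplus>\<^bsub>cterm A (i + 1)\<^esub> cdiff A i b)"
    if "a \<in> carrier (cterm A' (i + 1))" "b \<in> carrier (cterm A i)" for i a b
    by (rule cone_ops(2)[OF that])
  have \<psi>: "chain_map S ?C A'' ?\<psi>"
    unfolding chain_map_def
  proof (intro conjI allI ballI)
    fix i
    show "?\<psi> i \<in> gmod_hom S (cterm ?C i) (cterm A'' i)"
    proof (rule gmod_homI)
      show "?\<psi> i x \<in> gcomp (cterm A'' i) \<gamma>" if "x \<in> gcomp (cterm ?C i) \<gamma>" for x \<gamma>
        using that subsetD[OF graded_moduleD(3)[OF complexD(1)[OF C]] that] pp(7)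
        by (auto simp: cone_ops sum_ops)
      show "?\<psi> i (s \<odot>\<^bsub>cterm ?C i\<^esub> x) = s \<odot>\<^bsub>cterm A'' i\<^esub> ?\<psi> i x"
        if s: "s \<in> carrier S" "x \<in> carrier (cterm ?C i)" for s x
        using that pp(6)[OF s(1), of "snd x" i] module.smult_closed[OF graded_moduleD(1)[OF complexD(1)[OF C]] s]
        by (auto simp: cone_ops sum_ops)
      show "?\<psi> i (x \<oplus>\<^bsub>cterm ?C i\<^esub> y) = ?\<psi> i x \<oplus>\<^bsub>cterm A'' i\<^esub> ?\<psi> i y"
        if xy: "x \<in> carrier (cterm ?C i)" "y \<in> carrier (cterm ?C i)" for x y
        using xy pp(2)[of "snd x" i "snd y"]
          abelian_monoid.a_closed[OF abelian_group.axioms(1)[OF complexD(6)[OF C]] xy]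
        by (auto simp: cone_ops sum_ops)
    qed (use pp(1) cC in auto)
    fix x assume "x \<in> carrier (cterm ?C i)"
    then obtain a b where ab: "x = (a, b)" "a \<in> carrier (cterm A' (i + 1))" "b \<in> carrier (cterm A i)"
      unfolding cC by auto
    interpret A''1: abelian_group "cterm A'' (i + 1)" by (rule gA)
    have "?\<psi> (i + 1) (cdiff ?C i x) = p (i + 1) (\<iota> (i + 1) a \<oplus>\<^bsub>cterm A (i + 1)\<^esub> cdiff A i b)"
      using diff_props(1)[OF C, of x i] dC[OF ab(2,3)] ab by (simp add: cC)
    also have "\<dots> = cdiff A'' i (p i b)"
      using pp(2)[OF \<iota>p(1)[OF ab(2)] dA(1)[OF ab(3)]] p\<iota>[OF ab(2)] pd[OF ab(3)] dA''(1)[OF pp(1)[OF ab(3)]]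
      by simp
    finally show "?\<psi> (i + 1) (cdiff ?C i x) = cdiff A'' i (?\<psi> i x)" using ab cC by simp
  qed
  show ?thesis unfolding quasi_iso_def
  proof (intro conjI allI ballI impI \<psi>)
    fix i
    interpret A'1: abelian_group "cterm A' (i + 1)" by (rule gA)
    interpret A'2: abelian_group "cterm A' (i + 2)" by (rule gA)
    interpret A'0: abelian_group "cterm A' i" by (rule gA)
    interpret A0: abelian_group "cterm A i" by (rule gA)
    interpret A1: abelian_group "cterm A (i + 1)" by (rule gA)
    interpret A''0: abelian_group "cterm A'' i" by (rule gA)
    { fix x assume x: "x \<in> cocycles ?C i" "?\<psi> i x \<in> coboundaries A'' i"
      obtain a b where ab: "x = (a, b)" "a \<in> carrier (cterm A' (i + 1))" "b \<in> carrier (cterm A i)"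
        using x(1) unfolding cocycles_def cC by auto
      have z: "\<iota> (i + 1) a \<oplus>\<^bsub>cterm A (i + 1)\<^esub> cdiff A i b = \<zero>\<^bsub>cterm A (i + 1)\<^esub>"
        using x(1) dC[OF ab(2,3)] unfolding cocycles_def ab(1) by (simp add: cone_ops sum_ops)
      obtain c where c: "c \<in> carrier (cterm A'' (i - 1))" "p i b = cdiff A'' (i - 1) c"
        using x ab cC by (auto simp: coboundaries_def cocycles_def)
      \<comment> \<open>Lift the element c, whose differential is p b. Then b - d b' lies in the
        kernel of p and comes from some a'; the pair (a', b') will have the differential x.\<close>
      obtain b' where b': "b' \<in> carrier (cterm A (i - 1))" "c = p (i - 1) b'"
        using c(1) surj[of "i - 1"] by blast
      have db': "cdiff A (i - 1) b' \<in> carrier (cterm A i)" using dA(1)[OF b'(1)] by simp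
      have pb': "p i (cdiff A (i - 1) b') = p i b" using pd[OF b'(1)] c b' by simp
      have m: "b \<ominus>\<^bsub>cterm A i\<^esub> cdiff A (i - 1) b' \<in> carrier (cterm A i)" using db' ab(3) by simp
      have "p i (b \<ominus>\<^bsub>cterm A i\<^esub> cdiff A (i - 1) b') = \<zero>\<^bsub>cterm A'' i\<^esub>"
        using pp(5)[OF ab(3) db'] pb' pp(1)[OF ab(3)] A''0.minus_eq_zero_iff by simp
      then obtain a' where a': "a' \<in> carrier (cterm A' i)" "b \<ominus>\<^bsub>cterm A i\<^esub> cdiff A (i - 1) b' = \<iota> i a'"
        using ex[OF m] by blast
      have b: "b = \<iota> i a' \<oplus>\<^bsub>cterm A i\<^esub> cdiff A (i - 1) b'"
        unfolding a'(2)[symmetric] using db' ab(3) by (simp add: a_minus_def A0.a_assoc A0.l_neg)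
      have ddb': "cdiff A i (cdiff A (i - 1) b') = \<zero>\<^bsub>cterm A (i + 1)\<^esub>"
        using complexD(3)[OF A b'(1)] by (simp add: add.commute)
      have "cdiff A i b = \<iota> (i + 1) (cdiff A' i a')"
        unfolding b using dA(2)[OF \<iota>p(1)[OF a'(1)] db'] ddb' \<iota>d[OF a'(1)] dA(1)[OF \<iota>p(1)[OF a'(1)]] by simp
      then have "\<iota> (i + 1) a = \<ominus>\<^bsub>cterm A (i + 1)\<^esub> \<iota> (i + 1) (cdiff A' i a')"
        using z A1.minus_equality[OF z] \<iota>p(1)[OF ab(2)] dA(1)[OF ab(3)] by simp
      also have "\<dots> = \<iota> (i + 1) (\<ominus>\<^bsub>cterm A' (i + 1)\<^esub> cdiff A' i a')"
        using \<iota>p(4)[OF dA'(1)[OF a'(1)]] by simp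
      finally have a: "a = \<ominus>\<^bsub>cterm A' (i + 1)\<^esub> cdiff A' i a'"
        using inj_onD[OF inj _ ab(2)] A'1.a_inv_closed[OF dA'(1)[OF a'(1)]] by blast
      have "cdiff ?C (i - 1) (a', b') = x"
        using dC[of a' "i - 1" b'] a'(1) b'(1) unfolding ab(1) a by (simp add: b[symmetric] add.commute)
      moreover have "(a', b') \<in> carrier (cterm ?C (i - 1))" using a'(1) b'(1) by (simp add: cC)
      ultimately show "x \<in> coboundaries ?C i" unfolding coboundaries_def by blast }
    fix y assume y: "y \<in> cocycles A'' i"
    then obtain b where b: "b \<in> carrier (cterm A i)" "y = p i b"
      using surj[of i] by (auto simp: cocycles_def)
    have "p (i + 1) (cdiff A i b) = \<zero>\<^bsub>cterm A'' (i + 1)\<^esub>"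
      using pd[OF b(1)] y b by (simp add: cocycles_def)
    then obtain e where e: "e \<in> carrier (cterm A' (i + 1))" "cdiff A i b = \<iota> (i + 1) e"
      using ex[OF dA(1)[OF b(1)]] by blast
    have "\<iota> (i + 2) (cdiff A' (i + 1) e) = cdiff A (i + 1) (cdiff A i b)"
      using \<iota>d[OF e(1)] e(2) by (simp add: int_add_1_1)
    also have "\<dots> = \<iota> (i + 2) \<zero>\<^bsub>cterm A' (i + 2)\<^esub>" using complexD(3)[OF A b(1)] \<iota>p(3) by simp
    finally have de: "cdiff A' (i + 1) e = \<zero>\<^bsub>cterm A' (i + 2)\<^esub>"
      using inj_onD[OF inj] dA'(1)[OF e(1)] by (simp add: int_add_1_1)
    \<comment> \<open>The sign makes the second coordinate of the differential, \<iota>(- e) + d b,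
      vanish.\<close>
    let ?x = "(\<ominus>\<^bsub>cterm A' (i + 1)\<^esub> e, b)"
    have xc: "?x \<in> carrier (cterm ?C i)" using e b by (simp add: cC)
    have "cdiff ?C i ?x = \<zero>\<^bsub>cterm ?C (i + 1)\<^esub>"
      using dC[of "\<ominus>\<^bsub>cterm A' (i + 1)\<^esub> e" i b] e b dA'(4)[OF e(1)] de \<iota>p(4)[OF e(1)] \<iota>p(1)[OF e(1)]
        A'2.a_inv_closed[OF A'2.zero_closed] A'2.minus_equality[of "\<zero>\<^bsub>cterm A' (i + 2)\<^esub>" "\<zero>\<^bsub>cterm A' (i + 2)\<^esub>"]
      by (simp add: cone_ops sum_ops int_add_1_1 A1.l_neg)
    then have 1: "?x \<in> cocycles ?C i" using xc by (simp add: cocycles_def)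
    have "cdiff A'' (i - 1) \<zero>\<^bsub>cterm A'' (i - 1)\<^esub> = \<zero>\<^bsub>cterm A'' i\<^esub>"
      using dA''(3)[of "i - 1"] by simp
    then have 2: "\<zero>\<^bsub>cterm A'' i\<^esub> \<in> coboundaries A'' i"
      unfolding coboundaries_def
      using abelian_monoid.zero_closed[OF abelian_group.axioms(1)[OF gA(3)], of "i - 1"] by force
    show "\<exists>x\<in>cocycles ?C i. \<exists>b\<in>coboundaries A'' i. y = ?\<psi> i x \<oplus>\<^bsub>cterm A'' i\<^esub> b"
      using 1 2 xc b pp(1)[OF b(1)] by (intro bexI[OF _ 1] bexI[OF _ 2]) simp
  qed
qed

lemma cocycles_twist: "cocycles (cplx_twist q A) i = cocycles A i" "coboundaries (cplx_twist q A) i = coboundaries A i"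
  by (auto simp: cocycles_def coboundaries_def)

lemma quasi_iso_twist: "quasi_iso S A B f ==> quasi_iso S (cplx_twist q A) (cplx_twist q B) f"
  using cplx_twist_map unfolding quasi_iso_def cocycles_twist twist_ops shift_ops by blast

text \<open>The sign of the shifted differential affects neither its kernel nor its image.\<close>

lemma cocycles_shift:
  assumes A: "A \<in> bounded_fg_complexes S"
  shows "cocycles (cplx_shift A) i = cocycles A (i + 1)" "coboundaries (cplx_shift A) i = coboundaries A (i + 1)"
proof -
  interpret A2: abelian_group "cterm A (i + 2)" by (rule complexD(6)[OF A])
  interpret A1: abelian_group "cterm A (i + 1)" by (rule complexD(6)[OF A])
  interpret A0: abelian_group "cterm A i" by (rule complexD(6)[OF A])
  have z: "\<ominus>\<^bsub>cterm A (i + 2)\<^esub> x = \<zero>\<^bsub>cterm A (i + 2)\<^esub> \<longleftrightarrow> x = \<zero>\<^bsub>cterm A (i + 2)\<^esub>"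
    if "x \<in> carrier (cterm A (i + 2))" for x
    using that by (metis A2.l_neg A2.r_zero A2.a_inv_closed A2.minus_minus)
  have "cdiff A (i + 1) x \<in> carrier (cterm A (i + 2))" if "x \<in> carrier (cterm A (i + 1))" for x
    using diff_props(1)[OF A that] by (simp add: int_add_1_1)
  then show "cocycles (cplx_shift A) i = cocycles A (i + 1)"
    using z by (auto simp: cocycles_def cplx_shift_ops int_add_1_1)
  have 1: "cdiff (cplx_shift A) (i - 1) x = cdiff A i (\<ominus>\<^bsub>cterm A i\<^esub> x)" if "x \<in> carrier (cterm A i)" for x
  proof -
    have "i - 1 + 1 = i" "i - 1 + 2 = i + 1" by auto
    then show ?thesis using cplx_shift_ops(2)[of x A "i - 1"] that diff_props(4)[OF A that] by (simp add: add.commute)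
  qed
  have 2: "cdiff A i x = cdiff (cplx_shift A) (i - 1) (\<ominus>\<^bsub>cterm A i\<^esub> x)" if "x \<in> carrier (cterm A i)" for x
    using 1[of "\<ominus>\<^bsub>cterm A i\<^esub> x"] that by simp
  have "cdiff (cplx_shift A) (i - 1) ` carrier (cterm A i) = cdiff A i ` carrier (cterm A i)"
  proof (intro equalityI image_subsetI)
    fix x assume x: "x \<in> carrier (cterm A i)"
    show "cdiff (cplx_shift A) (i - 1) x \<in> cdiff A i ` carrier (cterm A i)"
      unfolding 1[OF x] using x by simp
    show "cdiff A i x \<in> cdiff (cplx_shift A) (i - 1) ` carrier (cterm A i)"
      unfolding 2[OF x] using x by simp
  qed
  then show "coboundaries (cplx_shift A) i = coboundaries A (i + 1)"
    by (simp add: coboundaries_def cplx_shift_ops)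
qed

lemma quasi_iso_shift:
  assumes A: "A \<in> bounded_fg_complexes S" and B: "B \<in> bounded_fg_complexes S" and q: "quasi_iso S A B f"
  shows "quasi_iso S (cplx_shift A) (cplx_shift B) (\<lambda>i. f (i + 1))"
proof -
  have "chain_map S A B f" using q by (simp add: quasi_iso_def)
  from cplx_shift_map[OF A B this] show ?thesis
    using q unfolding quasi_iso_def cocycles_shift[OF A] cocycles_shift[OF B] cplx_shift_ops(1) by blast
qed

end

lemma (in abelian_group) minus_zero_eq [simp]: "\<ominus> \<zero> = \<zero>"
  by (rule minus_equality[OF l_zero[OF zero_closed] zero_closed zero_closed])

section \<open>The derived category and its Grothendieck group\<close>

text \<open>The cone of a map has carriers in pairs; an injection of pairs into the type itself lets
  cones be copied back into the same category.\<close>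

locale cplx_setting = graded_base S for S :: "('g::ab_group_add, 'a) gring" +
  fixes \<pi> :: "'b \<times> 'b \<Rightarrow> 'b"
  assumes inj_\<pi>: "inj \<pi>"
begin

abbreviation BF :: "('g, 'a, 'b) cplx set" where "BF \<equiv> bounded_fg_complexes S"
abbreviation CC :: "(('g, 'a, 'b) cplx, ('g, 'a, 'b) cplx_arrow) tcat" where "CC \<equiv> complexes_cat S"

lemma CC_simps [simp]:
  "Ob CC = BF" "Dom CC (A, B, f) = A" "Cod CC (A, B, f) = B"
  "(A, B, f) \<in> Ar CC \<longleftrightarrow> A \<in> BF \<and> B \<in> BF \<and> chain_map S A B f"
  "Idt CC A = (A, A, \<lambda>i. \<lambda>x\<in>carrier (cterm A i). x)"
  "Cmp CC (B', C, g) (A, B, f) = (A, C, \<lambda>i. compose (carrier (cterm A i)) (g i) (f i))"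
  "ShO CC A = cplx_shift A" "ShA CC (A, B, f) = (cplx_shift A, cplx_shift B, \<lambda>i. f (i + 1))"
  by (auto simp: complexes_cat_def)

lemma triI:
  assumes "A \<in> BF" "B \<in> BF" "C \<in> BF" "chain_map S A B f" "chain_map S B C g" "chain_map S C (cplx_shift A) h"
    and "chain_iso S (mapping_cone A B f) C \<phi>"
    and "\<And>i b. b \<in> carrier (cterm B i) ==> g i b = \<phi> i (\<zero>\<^bsub>cterm A (i + 1)\<^esub>, b)"
    and "\<And>i a b. a \<in> carrier (cterm A (i + 1)) ==> b \<in> carrier (cterm B i) ==> h i (\<phi> i (a, b)) = a"
  shows "((A, B, f), (B, C, g), (C, cplx_shift A, h)) \<in> Tri CC"
  using assms unfolding complexes_cat_def by auto

lemma triE: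
  assumes "(f', g', h') \<in> Tri CC"
  obtains A B C f g h \<phi> where "f' = (A, B, f)" "g' = (B, C, g)" "h' = (C, cplx_shift A, h)"
    "A \<in> BF" "B \<in> BF" "C \<in> BF" "chain_map S A B f" "chain_map S B C g" "chain_map S C (cplx_shift A) h"
    "chain_iso S (mapping_cone A B f) C \<phi>"
    "\<And>i b. b \<in> carrier (cterm B i) ==> g i b = \<phi> i (\<zero>\<^bsub>cterm A (i + 1)\<^esub>, b)"
    "\<And>i a b. a \<in> carrier (cterm A (i + 1)) ==> b \<in> carrier (cterm B i) ==> h i (\<phi> i (a, b)) = a"
  using assms unfolding complexes_cat_def by auto

lemma cat_CC: "cat CC"
proof
  fix f g h assume f: "f \<in> Ar CC"
  obtain A B f0 where f0: "f = (A, B, f0)" by (cases f)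
  have A: "A \<in> BF" "B \<in> BF" "chain_map S A B f0" using f f0 by auto
  show "Dom CC f \<in> Ob CC" "Cod CC f \<in> Ob CC" using A f0 by auto
  have fi: "f0 i \<in> carrier (cterm A i) \<rightarrow> carrier (cterm B i)" "f0 i \<in> extensional (carrier (cterm A i))" for i
    using chain_map_props(1,8)[OF A] by auto
  show "Cmp CC (Idt CC (Cod CC f)) f = f" "Cmp CC f (Idt CC (Dom CC f)) = f"
    using Id_compose[OF fi] compose_Id[OF fi] by (auto simp: f0)
  assume g: "g \<in> Ar CC" and fg: "Cod CC f = Dom CC g"
  then obtain C g0 where g0: "g = (B, C, g0)" by (cases g) (auto simp: f0)
  have C: "C \<in> BF" "chain_map S B C g0" using g g0 by auto
  show "Cmp CC g f \<in> Ar CC" "Dom CC (Cmp CC g f) = Dom CC f" "Cod CC (Cmp CC g f) = Cod CC g"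
    using compose_chain_map[OF A C(2)] A C by (auto simp: f0 g0)
  assume h: "h \<in> Ar CC" and gh: "Cod CC g = Dom CC h"
  then obtain D h0 where h0: "h = (C, D, h0)" by (cases h) (auto simp: g0)
  show "Cmp CC h (Cmp CC g f) = Cmp CC (Cmp CC h g) f"
    by (simp add: f0 g0 h0, rule ext, rule compose_assoc[OF fi(1)])
next
  fix X assume "X \<in> Ob CC"
  then show "Idt CC X \<in> Ar CC" "Dom CC (Idt CC X) = X" "Cod CC (Idt CC X) = X"
    using id_chain_map by auto
qed

text \<open>Copy the cone along \<open>\<pi>\<close>, which is \<open>image_cplx\<close> for the
  zero subcomplex, and compose the inclusion and the projection of the cone with the copying map and
  its inverse.\<close>

lemma cone_triangle:
  assumes A: "A \<in> BF" and B: "B \<in> BF" and f: "chain_map S A B f"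
  shows "\<exists>C g h \<phi>. C \<in> BF \<and> ((A, B, f), (B, C, g), (C, cplx_shift A, h)) \<in> Tri CC \<and>
    chain_iso S (mapping_cone A B f) C \<phi>"
proof -
  let ?X = "mapping_cone A B f"
  note X = cone_complex[OF A B f]
  let ?N = "\<lambda>i. {\<zero>\<^bsub>cterm ?X i\<^esub>}"
  have ab: "abelian_group (cterm ?X i)" for i by (rule complexD(6)[OF X])
  have cX: "carrier (cterm ?X i) = carrier (cterm A (i + 1)) \<times> carrier (cterm B i)"
    "\<zero>\<^bsub>cterm ?X i\<^esub> = (\<zero>\<^bsub>cterm A (i + 1)\<^esub>, \<zero>\<^bsub>cterm B i\<^esub>)" for i
    by (simp_all add: cone_ops sum_ops)
  have zX: "\<zero>\<^bsub>cterm ?X i\<^esub> \<in> carrier (cterm ?X i)" for i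
    using abelian_monoid.zero_closed[OF abelian_group.axioms(1)[OF ab]] .
  have N: "graded_subcplx ?X ?N"
    unfolding graded_subcplx_def
  proof (intro conjI allI ballI)
    fix i
    interpret Xi: Module.module S "cterm ?X i" by (rule graded_moduleD(1)[OF complexD(1)[OF X]])
    show "graded_sub S (cterm ?X i) (?N i)"
    proof (rule graded_subI[OF complexD(1)[OF X]])
      show "c \<gamma> \<in> ?N i" if "finite F" "\<And>\<gamma>. \<gamma> \<in> F ==> c \<gamma> \<in> gcomp (cterm ?X i) \<gamma>"
        "finsum (cterm ?X i) c F \<in> ?N i" "\<gamma> \<in> F" for F c \<gamma>
        using graded_module_indep[OF complexD(1)[OF X] that(1,2) _ that(4)] that(3) by simp
    qed auto
    show "cdiff ?X i x \<in> ?N (i + 1)" if "x \<in> ?N i" for x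
      using that diff_props(3)[OF X] by simp
  qed
  have \<theta>: "\<pi> x = \<pi> y \<longleftrightarrow> x \<ominus>\<^bsub>cterm ?X i\<^esub> y \<in> ?N i"
    if "x \<in> carrier (cterm ?X i)" "y \<in> carrier (cterm ?X i)" for i x y
    using abelian_group.minus_eq_zero_iff[OF ab that] inj_eq[OF inj_\<pi>] by simp
  define C where "C = image_cplx (\<lambda>_. \<pi>) ?X"
  define t where "t = (\<lambda>i::int. restrict \<pi> (carrier (cterm ?X i)))"
  have C: "C \<in> BF" unfolding C_def by (rule image_cplx(1)[OF X N \<theta>])
  have t1: "chain_map S ?X C t" unfolding C_def t_def by (rule image_cplx(2)[OF X N \<theta>])
  have t2: "t i ` carrier (cterm ?X i) = carrier (cterm C i)" for i
    unfolding C_def t_def by (rule image_cplx(3)[OF X N \<theta>])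
  have t3: "t i ` gcomp (cterm ?X i) \<gamma> = gcomp (cterm C i) \<gamma>" for i \<gamma>
    unfolding C_def t_def by (rule image_cplx(4)[OF X N \<theta>])
  have t4: "inj_on (t i) (carrier (cterm ?X i))" for i
    unfolding t_def by (rule inj_onI) (simp add: inj_eq[OF inj_\<pi>])
  have it: "chain_iso S ?X C t"
    unfolding chain_iso_def bij_betw_def by (intro conjI allI t1 t2 t3 t4)
  have incl: "chain_map S B ?X (\<lambda>i. \<lambda>b\<in>carrier (cterm B i). (\<zero>\<^bsub>cterm A (i + 1)\<^esub>, b))"
    unfolding chain_map_def
  proof (intro conjI allI ballI)
    fix i
    interpret A1: Module.module S "cterm A (i + 1)" by (rule graded_moduleD(1)[OF complexD(1)[OF A]])
    interpret A2: Module.module S "cterm A (i + 2)" by (rule graded_moduleD(1)[OF complexD(1)[OF A]])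
    interpret Bi: Module.module S "cterm B i" by (rule graded_moduleD(1)[OF complexD(1)[OF B]])
    interpret B1: Module.module S "cterm B (i + 1)" by (rule graded_moduleD(1)[OF complexD(1)[OF B]])
    show "(\<lambda>b\<in>carrier (cterm B i). (\<zero>\<^bsub>cterm A (i + 1)\<^esub>, b)) \<in> gmod_hom S (cterm B i) (cterm ?X i)"
      by (rule gmod_homI) (use gcomp_closed(1)[OF complexD(1)[OF A]]
          subsetD[OF graded_moduleD(3)[OF complexD(1)[OF B]]] in \<open>auto simp: cone_ops sum_ops\<close>)
    fix b assume b: "b \<in> carrier (cterm B i)"
    show "(\<lambda>b\<in>carrier (cterm B (i + 1)). (\<zero>\<^bsub>cterm A (i + 1 + 1)\<^esub>, b)) (cdiff B i b) =
        cdiff ?X i ((\<lambda>b\<in>carrier (cterm B i). (\<zero>\<^bsub>cterm A (i + 1)\<^esub>, b)) b)"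
      using b diff_props(1)[OF B b] diff_props(3)[OF A, of "i + 1"] chain_map_props(3)[OF A B f]
        A2.minus_equality[of "\<zero>\<^bsub>cterm A (i + 2)\<^esub>" "\<zero>\<^bsub>cterm A (i + 2)\<^esub>"]
      by (simp add: cone_ops int_add_1_1)
  qed
  have proj: "chain_map S ?X (cplx_shift A) (\<lambda>i. \<lambda>p\<in>carrier (cterm ?X i). fst p)"
    unfolding chain_map_def
  proof (intro conjI allI ballI)
    fix i
    interpret Xi: Module.module S "cterm ?X i" by (rule graded_moduleD(1)[OF complexD(1)[OF X]])
    show "(\<lambda>p\<in>carrier (cterm ?X i). fst p) \<in> gmod_hom S (cterm ?X i) (cterm (cplx_shift A) i)"
    proof (rule gmod_homI)
      show "(\<lambda>p\<in>carrier (cterm ?X i). fst p) x \<in> gcomp (cterm (cplx_shift A) i) \<gamma>"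
        if "x \<in> gcomp (cterm ?X i) \<gamma>" for x \<gamma>
        using that subsetD[OF graded_moduleD(3)[OF complexD(1)[OF X]] that]
        by (auto simp: cone_ops sum_ops cplx_shift_ops)
      show "(\<lambda>p\<in>carrier (cterm ?X i). fst p) (x \<oplus>\<^bsub>cterm ?X i\<^esub> y) =
          (\<lambda>p\<in>carrier (cterm ?X i). fst p) x \<oplus>\<^bsub>cterm (cplx_shift A) i\<^esub> (\<lambda>p\<in>carrier (cterm ?X i). fst p) y"
        if "x \<in> carrier (cterm ?X i)" "y \<in> carrier (cterm ?X i)" for x y
        using that Xi.M.a_closed[OF that] by (simp add: cone_ops(1) cplx_shift_ops(1) sum_ops(3))
      show "(\<lambda>p\<in>carrier (cterm ?X i). fst p) (s \<odot>\<^bsub>cterm ?X i\<^esub> x) =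
          s \<odot>\<^bsub>cterm (cplx_shift A) i\<^esub> (\<lambda>p\<in>carrier (cterm ?X i). fst p) x"
        if "s \<in> carrier S" "x \<in> carrier (cterm ?X i)" for s x
        using that Xi.smult_closed[OF that] by (simp add: cone_ops(1) cplx_shift_ops(1) sum_ops(4))
    qed (auto simp: cone_ops sum_ops cplx_shift_ops)
    fix x assume x: "x \<in> carrier (cterm ?X i)"
    then obtain a b where ab: "x = (a, b)" "a \<in> carrier (cterm A (i + 1))" "b \<in> carrier (cterm B i)"
      unfolding cX by auto
    show "(\<lambda>p\<in>carrier (cterm ?X (i + 1)). fst p) (cdiff ?X i x) =
        cdiff (cplx_shift A) i ((\<lambda>p\<in>carrier (cterm ?X i). fst p) x)"
      using diff_props(1)[OF X x] x cone_ops(2)[OF ab(2,3)] ab by (simp add: cplx_shift_ops(2))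
  qed
  note iv = chain_iso_inv[OF X C it]
  define g where "g = (\<lambda>i. compose (carrier (cterm B i)) (t i) (\<lambda>b\<in>carrier (cterm B i). (\<zero>\<^bsub>cterm A (i + 1)\<^esub>, b)))"
  define h where "h = (\<lambda>i. compose (carrier (cterm C i)) (\<lambda>p\<in>carrier (cterm ?X i). fst p)
    (\<lambda>y\<in>carrier (cterm C i). inv_into (carrier (cterm ?X i)) (t i) y))"
  have "((A, B, f), (B, C, g), (C, cplx_shift A, h)) \<in> Tri CC"
  proof (rule triI[OF A B C f _ _ it])
    show "chain_map S B C g" unfolding g_def by (rule compose_chain_map[OF B X incl chain_isoD(1)[OF it]])
    show "chain_map S C (cplx_shift A) h" unfolding h_def by (rule compose_chain_map[OF C X iv(1) proj])
    fix i a b assume b: "b \<in> carrier (cterm B i)"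
    show "g i b = t i (\<zero>\<^bsub>cterm A (i + 1)\<^esub>, b)" using b by (simp add: g_def compose_def)
    assume a: "a \<in> carrier (cterm A (i + 1))"
    have ab: "(a, b) \<in> carrier (cterm ?X i)" using a b by (simp add: cX)
    show "h i (t i (a, b)) = a"
      using iv(2)[OF ab] chain_map_props(1)[OF X C chain_isoD(1)[OF it] ab] ab
      by (simp add: h_def compose_def)
  qed
  then show ?thesis using C it by blast
qed

text \<open>Shifting negates differentials, so the cone of f[1] and the shift of the cone of f
  differ by signs; negating the \<open>A\<close>-coordinate reconciles them.\<close>

lemma cone_shift:
  assumes A: "A \<in> BF" and B: "B \<in> BF" and f: "chain_map S A B f"
  shows "chain_iso S (mapping_cone (cplx_shift A) (cplx_shift B) (\<lambda>i. f (i + 1))) (cplx_shift (mapping_cone A B f))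
    (\<lambda>i. \<lambda>p\<in>carrier (cterm A (i + 1 + 1)) \<times> carrier (cterm B (i + 1)). (\<ominus>\<^bsub>cterm A (i + 1 + 1)\<^esub> fst p, snd p))"
  (is "chain_iso S ?X ?Y ?s")
proof -
  note sA = cplx_shift_complex[OF A] and sB = cplx_shift_complex[OF B] and sf = cplx_shift_map[OF A B f]
  note X = cone_complex[OF sA sB sf] and C = cone_complex[OF A B f]
  note Y = cplx_shift_complex[OF C]
  have t: "cterm ?X i = gmod_sum (cterm A (i + 1 + 1)) (cterm B (i + 1))" "cterm ?Y i = cterm ?X i" for i
    by (simp_all add: cone_ops(1) cplx_shift_ops(1))
  show ?thesis unfolding chain_iso_def chain_map_def
  proof (intro conjI allI ballI)
    fix i
    interpret A2: Module.module S "cterm A (i + 1 + 1)" by (rule graded_moduleD(1)[OF complexD(1)[OF A]])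
    interpret A2': Module.module S "cterm A (2 + i)" by (rule graded_moduleD(1)[OF complexD(1)[OF A]])
    interpret B1: Module.module S "cterm B (i + 1)" by (rule graded_moduleD(1)[OF complexD(1)[OF B]])
    interpret A3: Module.module S "cterm A (i + 3)" by (rule graded_moduleD(1)[OF complexD(1)[OF A]])
    interpret B2: Module.module S "cterm B (i + 2)" by (rule graded_moduleD(1)[OF complexD(1)[OF B]])
    have gA: "gcomp (cterm A (i + 1 + 1)) \<gamma> \<subseteq> carrier (cterm A (i + 1 + 1))"
      "gcomp (cterm B (i + 1)) \<gamma> \<subseteq> carrier (cterm B (i + 1))" for \<gamma>
      using graded_moduleD(3)[OF complexD(1)[OF A]] graded_moduleD(3)[OF complexD(1)[OF B]] by auto
    show "?s i \<in> gmod_hom S (cterm ?X i) (cterm ?Y i)"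
      unfolding t
    proof (rule gmod_homI)
      show "?s i x \<in> gcomp (gmod_sum (cterm A (i + 1 + 1)) (cterm B (i + 1))) \<gamma>"
        if "x \<in> gcomp (gmod_sum (cterm A (i + 1 + 1)) (cterm B (i + 1))) \<gamma>" for x \<gamma>
        using that gA gcomp_closed(4)[OF complexD(1)[OF A]] by (auto simp: sum_ops subset_iff)
    qed (auto simp: sum_ops A2'.M.minus_add A2'.smult_r_minus)
    have ss: "?s i (?s i p) = p" if "p \<in> carrier (cterm ?X i)" for p
      using that by (auto simp: t sum_ops)
    have sc: "?s i p \<in> carrier (cterm ?X i)" if "p \<in> carrier (cterm ?X i)" for p
      using that by (auto simp: t sum_ops)
    show "bij_betw (?s i) (carrier (cterm ?X i)) (carrier (cterm ?Y i))"
      unfolding t(2) by (rule bij_betwI[where g = "?s i"]) (use ss sc in auto)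
    fix \<gamma>
    have sg: "?s i p \<in> gcomp (cterm ?X i) \<gamma>" if "p \<in> gcomp (cterm ?X i) \<gamma>" for p
      using that gA gcomp_closed(4)[OF complexD(1)[OF A]] by (auto simp: t sum_ops subset_iff)
    have gc: "gcomp (cterm ?X i) \<gamma> \<subseteq> carrier (cterm ?X i)" using graded_moduleD(3)[OF complexD(1)[OF X]] .
    show "?s i ` gcomp (cterm ?X i) \<gamma> = gcomp (cterm ?Y i) \<gamma>"
      unfolding t(2)
    proof (intro equalityI subsetI)
      fix p assume p: "p \<in> gcomp (cterm ?X i) \<gamma>"
      have "p = ?s i (?s i p)" using ss[of p] subsetD[OF gc p] by simp
      then show "p \<in> ?s i ` gcomp (cterm ?X i) \<gamma>" using sg[OF p] by (rule image_eqI)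
    qed (use sg in blast)
    fix x assume "x \<in> carrier (cterm ?X i)"
    then obtain a b where ab: "x = (a, b)" "a \<in> carrier (cterm A (i + 1 + 1))" "b \<in> carrier (cterm B (i + 1))"
      by (auto simp: t sum_ops)
    have e: "i + 1 + 1 = i + 2" "i + 2 + 1 = i + 3" "i + 1 + 2 = i + 3" by auto
    have a: "a \<in> carrier (cterm A (i + 2))" using ab by (simp add: e)
    have da: "cdiff A (i + 2) a \<in> carrier (cterm A (i + 3))" using diff_props(1)[OF A a] by (simp add: e)
    have fa: "f (i + 2) a \<in> carrier (cterm B (i + 2))" using chain_map_props(1)[OF A B f a] .
    have db: "cdiff B (i + 1) b \<in> carrier (cterm B (i + 2))" using diff_props(1)[OF B ab(3)] by (simp add: e)
    have na: "\<ominus>\<^bsub>cterm A (i + 2)\<^esub> a \<in> carrier (cterm A (i + 2))" using A2.a_inv_closed[OF ab(2)] by (simp add: e)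
    have 1: "cdiff ?X i x = (cdiff A (i + 2) a, f (i + 2) a \<oplus>\<^bsub>cterm B (i + 2)\<^esub> \<ominus>\<^bsub>cterm B (i + 2)\<^esub> cdiff B (i + 1) b)"
      unfolding ab(1)
      using cone_ops(2)[of a "cplx_shift A" i b "cplx_shift B" "\<lambda>i. f (i + 1)"] ab(2,3) a da
        cplx_shift_ops(2)[of a A "i + 1"] cplx_shift_ops(2)[of b B i]
      by (simp add: cplx_shift_ops(1) e)
    have 2: "cdiff (mapping_cone A B f) (i + 1) (\<ominus>\<^bsub>cterm A (i + 2)\<^esub> a, b) =
        (cdiff A (i + 2) a, \<ominus>\<^bsub>cterm B (i + 2)\<^esub> f (i + 2) a \<oplus>\<^bsub>cterm B (i + 2)\<^esub> cdiff B (i + 1) b)"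
      using cone_ops(2)[of "\<ominus>\<^bsub>cterm A (i + 2)\<^esub> a" A "i + 1" b B f] na ab(3) diff_props(4)[OF A a]
        chain_map_props(4)[OF A B f a] da by (simp add: e)
    have pc: "(\<ominus>\<^bsub>cterm A (i + 2)\<^esub> a, b) \<in> carrier (cterm (mapping_cone A B f) (i + 1))"
      using na ab(3) by (simp add: cone_ops sum_ops e)
    have neg: "\<ominus>\<^bsub>gmod_sum (cterm A (i + 3)) (cterm B (i + 2))\<^esub> (u, w) =
        (\<ominus>\<^bsub>cterm A (i + 3)\<^esub> u, \<ominus>\<^bsub>cterm B (i + 2)\<^esub> w)"
      if "u \<in> carrier (cterm A (i + 3))" "w \<in> carrier (cterm B (i + 2))" for u w
      using graded_moduleD(4)[OF graded_module_sum(1)[OF complexD(1)[OF A, of "i + 3"] complexD(1)[OF B, of "i + 2"]]] that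
      by (intro abelian_group.minus_equality) (auto simp: sum_ops A3.l_neg B2.l_neg)
    have "cdiff ?Y i (\<ominus>\<^bsub>cterm A (i + 2)\<^esub> a, b) = \<ominus>\<^bsub>gmod_sum (cterm A (i + 3)) (cterm B (i + 2))\<^esub>
        (cdiff (mapping_cone A B f) (i + 1) (\<ominus>\<^bsub>cterm A (i + 2)\<^esub> a, b))"
      using cplx_shift_ops(2)[OF pc] by (simp add: cone_ops(1) e)
    also have "\<dots> = (\<ominus>\<^bsub>cterm A (i + 3)\<^esub> cdiff A (i + 2) a,
        f (i + 2) a \<oplus>\<^bsub>cterm B (i + 2)\<^esub> \<ominus>\<^bsub>cterm B (i + 2)\<^esub> cdiff B (i + 1) b)"
      unfolding 2 using neg da fa db by (simp add: B2.minus_add)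
    finally show "?s (i + 1) (cdiff ?X i x) = cdiff ?Y i (?s i x)"
      using ab da fa db unfolding 1 by (simp add: e)
  qed
qed

lemma cone_preserving_shift: "cone_preserving CC (ShO CC) (ShA CC)"
  unfolding cone_preserving_def
proof (intro conjI allI impI)
  show "endofunctor CC (ShO CC) (ShA CC)"
    unfolding endofunctor_def
    by (auto simp: cplx_shift_complex cplx_shift_map cplx_shift_ops(1))
  fix f' g' h' assume "(f', g', h') \<in> Tri CC"
  then obtain A B C f g h \<phi> where t: "f' = (A, B, f)" "g' = (B, C, g)" "h' = (C, cplx_shift A, h)"
    "A \<in> BF" "B \<in> BF" "C \<in> BF" "chain_map S A B f" "chain_map S B C g" "chain_map S C (cplx_shift A) h"
    "chain_iso S (mapping_cone A B f) C \<phi>"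
    and tg: "\<And>i b. b \<in> carrier (cterm B i) ==> g i b = \<phi> i (\<zero>\<^bsub>cterm A (i + 1)\<^esub>, b)"
    and th: "\<And>i a b. a \<in> carrier (cterm A (i + 1)) ==> b \<in> carrier (cterm B i) ==> h i (\<phi> i (a, b)) = a"
    by (rule triE) blast
  note sA = cplx_shift_complex[OF t(4)] and sB = cplx_shift_complex[OF t(5)] and sC = cplx_shift_complex[OF t(6)]
  note sf = cplx_shift_map[OF t(4,5,7)] and sg = cplx_shift_map[OF t(5,6,8)]
  note sh = cplx_shift_map[OF t(6) sA t(9)]
  note X = cone_complex[OF t(4,5,7)]
  note iso = chain_iso_compose[OF cone_complex[OF sA sB sf] cplx_shift_complex[OF X] cone_shift[OF t(4,5,7)]
      chain_iso_shift[OF X t(6,10)]]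
  \<comment> \<open>The minus sign is forced: the identification of the cones negates the
    \<open>A\<close>-coordinate, which is what the last arrow reads off.\<close>
  define h1 where "h1 = (\<lambda>i. \<lambda>x\<in>carrier (cterm (cplx_shift C) i). \<ominus>\<^bsub>cterm (cplx_shift (cplx_shift A)) i\<^esub> h (i + 1) x)"
  have "((cplx_shift A, cplx_shift B, \<lambda>i. f (i + 1)), (cplx_shift B, cplx_shift C, \<lambda>i. g (i + 1)),
      (cplx_shift C, cplx_shift (cplx_shift A), h1)) \<in> Tri CC"
  proof (rule triI[OF sA sB sC sf sg _ iso])
    show "chain_map S (cplx_shift C) (cplx_shift (cplx_shift A)) h1"
      unfolding h1_def by (rule neg_chain_map[OF sC cplx_shift_complex[OF sA] sh])
    fix i a b assume "b \<in> carrier (cterm (cplx_shift B) i)"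
    then have b: "b \<in> carrier (cterm B (i + 1))" by (simp add: cplx_shift_ops)
    interpret A2: abelian_group "cterm A (i + 1 + 1)" by (rule complexD(6)[OF t(4)])
    have n0: "\<ominus>\<^bsub>cterm A (i + 1 + 1)\<^esub> \<zero>\<^bsub>cterm A (i + 1 + 1)\<^esub> = \<zero>\<^bsub>cterm A (i + 1 + 1)\<^esub>"
      by (rule A2.minus_equality[OF A2.l_zero[OF A2.zero_closed] A2.zero_closed A2.zero_closed])
    have cX: "carrier (cterm (mapping_cone (cplx_shift A) (cplx_shift B) (\<lambda>i. f (i + 1))) i) =
        carrier (cterm A (i + 1 + 1)) \<times> carrier (cterm B (i + 1))"
      by (simp add: cone_ops sum_ops cplx_shift_ops)
    show "g (i + 1) b = compose (carrier (cterm (mapping_cone (cplx_shift A) (cplx_shift B) (\<lambda>i. f (i + 1))) i)) (\<phi> (i + 1))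
        (\<lambda>p\<in>carrier (cterm A (i + 1 + 1)) \<times> carrier (cterm B (i + 1)). (\<ominus>\<^bsub>cterm A (i + 1 + 1)\<^esub> fst p, snd p))
        (\<zero>\<^bsub>cterm (cplx_shift A) (i + 1)\<^esub>, b)"
      unfolding cX using b tg[OF b] n0 A2.zero_closed by (simp add: compose_def cplx_shift_ops(1))
    assume "a \<in> carrier (cterm (cplx_shift A) (i + 1))"
    then have a: "a \<in> carrier (cterm A (i + 1 + 1))" by (simp add: cplx_shift_ops)
    have na: "\<ominus>\<^bsub>cterm A (i + 1 + 1)\<^esub> a \<in> carrier (cterm A (i + 1 + 1))" by (rule A2.a_inv_closed[OF a])
    have "(\<ominus>\<^bsub>cterm A (i + 1 + 1)\<^esub> a, b) \<in> carrier (cterm (mapping_cone A B f) (i + 1))"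
      using na b by (simp add: cone_ops sum_ops)
    then have \<phi>c: "\<phi> (i + 1) (\<ominus>\<^bsub>cterm A (i + 1 + 1)\<^esub> a, b) \<in> carrier (cterm C (i + 1))"
      by (rule chain_map_props(1)[OF X t(6) chain_isoD(1)[OF t(10)]])
    have "compose (carrier (cterm (mapping_cone (cplx_shift A) (cplx_shift B) (\<lambda>i. f (i + 1))) i)) (\<phi> (i + 1))
        (\<lambda>p\<in>carrier (cterm A (i + 1 + 1)) \<times> carrier (cterm B (i + 1)). (\<ominus>\<^bsub>cterm A (i + 1 + 1)\<^esub> fst p, snd p)) (a, b)
        = \<phi> (i + 1) (\<ominus>\<^bsub>cterm A (i + 1 + 1)\<^esub> a, b)"
      unfolding cX using a b by (simp add: compose_def)
    then show "h1 i (compose (carrier (cterm (mapping_cone (cplx_shift A) (cplx_shift B) (\<lambda>i. f (i + 1))) i)) (\<phi> (i + 1))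
        (\<lambda>p\<in>carrier (cterm A (i + 1 + 1)) \<times> carrier (cterm B (i + 1)). (\<ominus>\<^bsub>cterm A (i + 1 + 1)\<^esub> fst p, snd p)) (a, b)) = a"
      using \<phi>c th[OF na b] A2.minus_minus[OF a] by (simp add: h1_def cplx_shift_ops(1))
  qed
  then show "\<exists>g'' h''. (ShA CC f', g'', h'') \<in> Tri CC \<and> Cod CC g'' = ShO CC (Cod CC g')"
    unfolding t by (intro exI[of _ "(cplx_shift B, cplx_shift C, \<lambda>i. g (i + 1))"] exI[of _ "(cplx_shift C, cplx_shift (cplx_shift A), h1)"]) simp
qed

lemma zero_complex: "\<lparr>cterm = \<lambda>_. zero_gmod z, cdiff = \<lambda>_. \<lambda>x\<in>{z}. z\<rparr> \<in> bounded_fg_complexes S"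
  (is "?Z \<in> _")
proof (rule complexI)
  fix i
  show "graded_module S (cterm ?Z i)" "fin_gen S (cterm ?Z i)" using graded_module_zero by auto
  show "cdiff ?Z i \<in> gmod_hom S (cterm ?Z i) (cterm ?Z (i + 1))"
    by (rule gmod_homI) (auto simp: zero_gmod_def)
qed (auto simp: zero_gmod_def)

lemma tri_cat_CC: "tri_cat CC"
proof (rule tri_cat.intro[OF cat_CC], unfold_locales)
  show "cone_preserving CC (ShO CC) (ShA CC)" by (rule cone_preserving_shift)
  show "is_triangle CC t" if "t \<in> Tri CC" for t
  proof -
    obtain f' g' h' where t: "t = (f', g', h')" by (cases t)
    from that[unfolded t] show ?thesis
      by (rule triE) (auto simp: t is_triangle_def cplx_shift_complex)
  qed
  show "\<exists>g h. (Idt CC X, g, h) \<in> Tri CC" if "X \<in> Ob CC" for X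
    using cone_triangle[of X X] that id_chain_map[of X] by fastforce
  fix z :: 'b
  \<comment> \<open>One-point modules in every degree, on an arbitrary point. The cone of the map
    from this complex to X is X, by the second projection.\<close>
  let ?Z = "\<lparr>cterm = \<lambda>_. zero_gmod z, cdiff = \<lambda>_. \<lambda>x\<in>{z}. z\<rparr> :: ('g, 'a, 'b) cplx"
  have Z: "?Z \<in> BF" by (rule zero_complex)
  have "\<exists>f h. (f, Idt CC X, h) \<in> Tri CC \<and> Dom CC f = ?Z" if X: "X \<in> Ob CC" for X
  proof -
    have X: "X \<in> BF" using X by simp
    note cX = complexD[OF X] and sZ = cplx_shift_complex[OF Z]
    define f where "f = (\<lambda>i. \<lambda>x\<in>carrier (cterm ?Z i). \<zero>\<^bsub>cterm X i\<^esub>)"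
    define h where "h = (\<lambda>i. \<lambda>x\<in>carrier (cterm X i). \<zero>\<^bsub>cterm (cplx_shift ?Z) i\<^esub>)"
    define \<phi> where "\<phi> = (\<lambda>i. \<lambda>p\<in>{z} \<times> carrier (cterm X i). snd p)"
    have f: "chain_map S ?Z X f" unfolding chain_map_def
    proof (intro conjI allI ballI)
      fix i show "f i \<in> gmod_hom S (cterm ?Z i) (cterm X i)"
        unfolding f_def by (rule zero_hom[OF complexD(1)[OF Z] cX(1)])
      show "f (i + 1) (cdiff ?Z i x) = cdiff X i (f i x)" if "x \<in> carrier (cterm ?Z i)" for x
        using that diff_props(3)[OF X] by (simp add: f_def zero_gmod_def)
    qed
    have h: "chain_map S X (cplx_shift ?Z) h" unfolding chain_map_def
    proof (intro conjI allI ballI)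
      fix i show "h i \<in> gmod_hom S (cterm X i) (cterm (cplx_shift ?Z) i)"
        unfolding h_def by (rule zero_hom[OF cX(1) complexD(1)[OF sZ]])
      show "h (i + 1) (cdiff X i x) = cdiff (cplx_shift ?Z) i (h i x)" if "x \<in> carrier (cterm X i)" for x
        using that diff_props(1)[OF X that] diff_props(3)[OF sZ] by (simp add: h_def)
    qed
    have cC: "cterm (mapping_cone ?Z X f) i = gmod_sum (zero_gmod z) (cterm X i)" for i
      by (simp add: cone_ops)
    have zs: "carrier (zero_gmod z) = {z}" "\<zero>\<^bsub>zero_gmod z\<^esub> = z" "gcomp (zero_gmod z) \<gamma> = {z}"
      "x \<oplus>\<^bsub>zero_gmod z\<^esub> y = z" "s \<odot>\<^bsub>zero_gmod z\<^esub> y = z" for \<gamma> x y s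
      by (auto simp: zero_gmod_def)
    have iso: "chain_iso S (mapping_cone ?Z X f) X \<phi>"
      unfolding chain_iso_def chain_map_def
    proof (intro conjI allI ballI)
      fix i
      interpret Xi: Module.module S "cterm X i" by (rule graded_moduleD(1)[OF cX(1)])
      interpret X1: Module.module S "cterm X (i + 1)" by (rule graded_moduleD(1)[OF cX(1)])
      show "\<phi> i \<in> gmod_hom S (cterm (mapping_cone ?Z X f) i) (cterm X i)"
        by (rule gmod_homI)
          (use subsetD[OF graded_moduleD(3)[OF cX(1)]] in \<open>auto simp: cC sum_ops zs \<phi>_def\<close>)
      show "bij_betw (\<phi> i) (carrier (cterm (mapping_cone ?Z X f) i)) (carrier (cterm X i))"
        by (rule bij_betwI[where g = "\<lambda>x. (z, x)"]) (auto simp: cC sum_ops zs \<phi>_def)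
      show "\<phi> i ` gcomp (cterm (mapping_cone ?Z X f) i) \<gamma> = gcomp (cterm X i) \<gamma>" for \<gamma>
      proof -
        have "\<phi> i ` gcomp (cterm (mapping_cone ?Z X f) i) \<gamma> = \<phi> i ` ({z} \<times> gcomp (cterm X i) \<gamma>)"
          by (simp add: cC sum_ops zs)
        also have "\<dots> = snd ` ({z} \<times> gcomp (cterm X i) \<gamma>)"
          using graded_moduleD(3)[OF cX(1), of i \<gamma>] by (intro image_cong) (auto simp: \<phi>_def)
        finally show ?thesis by (simp add: snd_image_times)
      qed
      show "\<phi> (i + 1) (cdiff (mapping_cone ?Z X f) i x) = cdiff X i (\<phi> i x)"
        if x: "x \<in> carrier (cterm (mapping_cone ?Z X f) i)" for x
      proof -
        obtain b where b: "x = (z, b)" "b \<in> carrier (cterm X i)" using x by (auto simp: cC sum_ops zs)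
        have nz: "\<ominus>\<^bsub>zero_gmod z\<^esub> z = z"
          using abelian_group.a_inv_closed[OF graded_moduleD(4)[OF graded_module_zero(1)[of z]], of z]
          by (simp add: zs)
        show ?thesis using cone_ops(2)[of z ?Z i b X f] b diff_props(1)[OF X b(2)]
          by (simp add: zs \<phi>_def f_def nz)
      qed
    qed
    have "((?Z, X, f), (X, X, \<lambda>i. \<lambda>x\<in>carrier (cterm X i). x), (X, cplx_shift ?Z, h)) \<in> Tri CC"
    proof (rule triI[OF Z X X f id_chain_map[OF X] h iso])
      show "(\<lambda>x\<in>carrier (cterm X i). x) b = \<phi> i (\<zero>\<^bsub>cterm ?Z (i + 1)\<^esub>, b)" if "b \<in> carrier (cterm X i)" for i b
        using that by (simp add: \<phi>_def zs)
      show "h i (\<phi> i (a, b)) = a" if "a \<in> carrier (cterm ?Z (i + 1))" "b \<in> carrier (cterm X i)" for i a b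
        using that by (simp add: \<phi>_def zs h_def cplx_shift_ops)
    qed
    then show ?thesis by (intro exI[of _ "(?Z, X, f)"] exI[of _ "(X, cplx_shift ?Z, h)"]) simp
  qed
  then show "\<exists>Z\<in>Ob CC. \<forall>X\<in>Ob CC. \<exists>f h. (f, Idt CC X, h) \<in> Tri CC \<and> Dom CC f = Z"
    using Z by (intro bexI[of _ ?Z] ballI) auto
qed

definition twist_map where
  "twist_map q = (\<lambda>(A, B, f). (cplx_twist q A, cplx_twist q B, f))"

lemma shift_twist: "cplx_shift (cplx_twist q A) = cplx_twist q (cplx_shift A)"
  by (simp add: cplx_shift_def cplx_twist_def)

lemma gmod_sum_shift: "gmod_sum (degree_shift q M) (degree_shift q N) = degree_shift q (gmod_sum M N)"
  by (simp add: gmod_sum_def degree_shift_def)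

lemma cone_twist: "mapping_cone (cplx_twist q A) (cplx_twist q B) f = cplx_twist q (mapping_cone A B f)"
  by (simp add: mapping_cone_def cplx_twist_def gmod_sum_shift)

text \<open>Regrading leaves carriers, operations and differentials alone, so twisting commutes
  strictly with shifts and cones, and the same maps serve again.\<close>

lemma cone_preserving_twist: "cone_preserving CC (cplx_twist q) (twist_map q)"
  unfolding cone_preserving_def
proof (intro conjI allI impI)
  show "endofunctor CC (cplx_twist q) (twist_map q)"
    unfolding endofunctor_def twist_map_def by (auto simp: cplx_twist_complex cplx_twist_map)
  fix f' g' h' assume "(f', g', h') \<in> Tri CC"
  then obtain A B C f g h \<phi> where t: "f' = (A, B, f)" "g' = (B, C, g)" "h' = (C, cplx_shift A, h)"
    "A \<in> BF" "B \<in> BF" "C \<in> BF" "chain_map S A B f" "chain_map S B C g" "chain_map S C (cplx_shift A) h"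
    "chain_iso S (mapping_cone A B f) C \<phi>"
    and tg: "\<And>i b. b \<in> carrier (cterm B i) ==> g i b = \<phi> i (\<zero>\<^bsub>cterm A (i + 1)\<^esub>, b)"
    and th: "\<And>i a b. a \<in> carrier (cterm A (i + 1)) ==> b \<in> carrier (cterm B i) ==> h i (\<phi> i (a, b)) = a"
    by (rule triE) blast
  have h: "chain_map S (cplx_twist q C) (cplx_shift (cplx_twist q A)) h"
    unfolding shift_twist by (rule cplx_twist_map[OF t(9)])
  have iso: "chain_iso S (mapping_cone (cplx_twist q A) (cplx_twist q B) f) (cplx_twist q C) \<phi>"
    unfolding cone_twist by (rule chain_iso_twist[OF t(10)])
  have "((cplx_twist q A, cplx_twist q B, f), (cplx_twist q B, cplx_twist q C, g),
      (cplx_twist q C, cplx_shift (cplx_twist q A), h)) \<in> Tri CC"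
    by (rule triI[OF cplx_twist_complex[OF t(4)] cplx_twist_complex[OF t(5)] cplx_twist_complex[OF t(6)]
        cplx_twist_map[OF t(7)] cplx_twist_map[OF t(8)] h iso]) (use tg th in auto)
  then show "\<exists>g'' h''. (twist_map q f', g'', h'') \<in> Tri CC \<and> Cod CC g'' = cplx_twist q (Cod CC g')"
    unfolding t twist_map_def
    by (intro exI[of _ "(cplx_twist q B, cplx_twist q C, g)"]
        exI[of _ "(cplx_twist q C, cplx_shift (cplx_twist q A), h)"]) simp
qed

end

section \<open>Singularity categories and phases\<close>

context tri_cat
begin

lemma tri_cat_verdier:
  assumes N: "\<And>X. X \<in> N ==> ShO C X \<in> N"
  shows "tri_cat (verdier_quotient C N)"
  unfolding verdier_quotient_def
  by (rule tri_cat_localization[OF arrows_with_cone_in_endofunctor[OF shift N]])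

lemma cone_preserving_verdier:
  assumes N: "\<And>X. X \<in> N ==> ShO C X \<in> N" and F: "cone_preserving C Fo Fm"
    and FN: "\<And>X. X \<in> N ==> Fo X \<in> N"
  shows "\<exists>Fm'. cone_preserving (verdier_quotient C N) Fo Fm'"
  unfolding verdier_quotient_def
  using cone_preserving_loc[OF arrows_with_cone_in_endofunctor[OF shift N] F
      arrows_with_cone_in_endofunctor[OF F FN]] by blast

lemma K_relations_verdier:
  assumes N: "\<And>X. X \<in> N ==> ShO C X \<in> N"
  shows "K_relations C \<subseteq> K_relations (verdier_quotient C N)"
  unfolding verdier_quotient_def
  by (rule K_relations_loc[OF arrows_with_cone_in_endofunctor[OF shift N]])

lemma K_null_object:
  assumes N: "\<And>X. X \<in> N ==> ShO C X \<in> N" and X: "X \<in> N" "X \<in> Ob C"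
  shows "frag_of X \<in> K_relations (verdier_quotient C N)"
  by (rule K_verdier_null[OF arrows_with_cone_in_endofunctor[OF shift N] X])

lemma Ob_verdier: "Ob (verdier_quotient C N) = Ob C"
  by (simp add: verdier_quotient_def)

lemma ShO_verdier: "ShO (verdier_quotient C N) = ShO C"
  by (simp add: verdier_quotient_def)

end

context cplx_setting
begin

abbreviation "qis \<equiv> {(A, B, f) \<in> Ar CC. quasi_iso S A B f}"

lemma qis_shift: "ShA CC ` (Ar CC \<inter> qis) \<subseteq> qis"
  by (auto simp: cplx_shift_complex cplx_shift_map quasi_iso_shift)

lemma qis_twist: "twist_map q ` (Ar CC \<inter> qis) \<subseteq> qis"
  by (auto simp: twist_map_def cplx_twist_complex cplx_twist_map quasi_iso_twist)

abbreviation DC :: "(('g, 'a, 'b) cplx, _) tcat" where "DC \<equiv> derived_cat S"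
abbreviation SC :: "(('g, 'a, 'b) cplx, _) tcat" where "SC \<equiv> sing_cat S"
abbreviation PC :: "'a set \<Rightarrow> (('g, 'a, 'b) cplx, _) tcat" where "PC J \<equiv> phase_cat S J"

lemma tri_cat_DC: "tri_cat DC"
  unfolding derived_cat_def by (rule tri_cat.tri_cat_localization[OF tri_cat_CC qis_shift])

lemma Ob_DC: "Ob DC = BF" "ShO DC = cplx_shift"
  unfolding derived_cat_def by (auto simp: cat.loc_simps[OF cat_CC])

lemma twist_DC: "\<exists>Fm. cone_preserving DC (cplx_twist q) Fm"
  unfolding derived_cat_def
  using tri_cat.cone_preserving_loc[OF tri_cat_CC qis_shift cone_preserving_twist qis_twist] by blast

lemma derived_ess_closed:
  fixes N :: "('g, 'a, 'b) cplx set"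
  assumes "X \<in> essential_closure DC N"
  shows "(\<And>X. X \<in> N ==> cplx_shift X \<in> N) ==> cplx_shift X \<in> essential_closure DC N"
    and "(\<And>X. X \<in> N ==> cplx_twist q X \<in> N) ==> cplx_twist q X \<in> essential_closure DC N"
proof -
  interpret D: tri_cat DC by (rule tri_cat_DC)
  show "cplx_shift X \<in> essential_closure DC N" if N: "\<And>X. X \<in> N ==> cplx_shift X \<in> N"
    using D.essential_closure_endofunctor[OF D.endofunctor_shift _ assms] N unfolding Ob_DC by blast
  show "cplx_twist q X \<in> essential_closure DC N" if N: "\<And>X. X \<in> N ==> cplx_twist q X \<in> N"
  proof -
    obtain Fm where "cone_preserving DC (cplx_twist q) Fm" using twist_DC by blast
    then have "endofunctor DC (cplx_twist q) Fm" by (simp add: cone_preserving_def)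
    from D.essential_closure_endofunctor[OF this _ assms] N show ?thesis by blast
  qed
qed

lemma graded_free_twist: "graded_free S M ==> graded_free S (degree_shift q M)"
proof -
  assume M: "graded_free S M"
  have "gcomp M \<gamma> = gcomp (degree_shift q M) (\<gamma> - q)" for \<gamma> by simp
  then have "(\<Union>\<gamma>. gcomp M \<gamma>) = (\<Union>\<gamma>. gcomp (degree_shift q M) \<gamma>)" by (auto simp del: shift_ops) auto
  then show ?thesis using M unfolding graded_free_def by simp
qed

abbreviation "free_complexes \<equiv> {A \<in> BF. \<forall>i. graded_free S (cterm A i)}"
abbreviation "torsion_complexes J \<equiv> {A \<in> BF. \<forall>i. torsion S J (cterm A i)}"

lemma free_complexes_closed: "X \<in> free_complexes ==> cplx_shift X \<in> free_complexes"
  "X \<in> free_complexes ==> cplx_twist q X \<in> free_complexes"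
  by (auto simp: cplx_shift_complex cplx_twist_complex cplx_shift_ops(1) graded_free_twist)

lemma torsion_complexes_closed: "X \<in> torsion_complexes J ==> cplx_shift X \<in> torsion_complexes J"
  "X \<in> torsion_complexes J ==> cplx_twist q X \<in> torsion_complexes J"
  by (auto simp: cplx_shift_complex cplx_twist_complex cplx_shift_ops(1) torsion_def)

lemma perf_closed: "X \<in> perf S ==> cplx_shift X \<in> perf S" "X \<in> perf S ==> cplx_twist q X \<in> perf S"
  for X :: "('g, 'a, 'b) cplx"
  unfolding perf_def by (erule derived_ess_closed, erule free_complexes_closed)+

lemma derived_tor_closed: "X \<in> derived_tor S J ==> cplx_shift X \<in> derived_tor S J"
  "X \<in> derived_tor S J ==> cplx_twist q X \<in> derived_tor S J" for X :: "('g, 'a, 'b) cplx"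
  unfolding derived_tor_def by (erule derived_ess_closed, erule torsion_complexes_closed)+

lemma perf_shift: "X \<in> perf S ==> ShO DC X \<in> perf S" for X :: "('g, 'a, 'b) cplx"
  unfolding Ob_DC(2) by (rule perf_closed)

lemma tri_cat_SC: "tri_cat SC"
  unfolding sing_cat_def by (rule tri_cat.tri_cat_verdier[OF tri_cat_DC perf_shift])

lemma Ob_SC: "Ob SC = BF" "ShO SC = cplx_shift"
  unfolding sing_cat_def tri_cat.Ob_verdier[OF tri_cat_DC] tri_cat.ShO_verdier[OF tri_cat_DC]
  by (rule Ob_DC)+

lemma twist_SC: "\<exists>Fm. cone_preserving SC (cplx_twist q) Fm"
proof -
  obtain Fm where F: "cone_preserving DC (cplx_twist q) Fm" using twist_DC by blast
  show ?thesis unfolding sing_cat_def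
    by (rule tri_cat.cone_preserving_verdier[OF tri_cat_DC perf_shift F perf_closed(2)])
qed

lemma sing_tor_closed: "X \<in> sing_tor S J ==> ShO SC X \<in> sing_tor S J"
  "X \<in> sing_tor S J ==> cplx_twist q X \<in> sing_tor S J" for X :: "('g, 'a, 'b) cplx"
proof -
  interpret SC: tri_cat SC by (rule tri_cat_SC)
  assume X: "X \<in> sing_tor S J"
  show "ShO SC X \<in> sing_tor S J" unfolding sing_tor_def
    by (rule SC.essential_closure_endofunctor[OF SC.endofunctor_shift _ X[unfolded sing_tor_def]])
      (simp add: Ob_SC derived_tor_closed)
  obtain Fm where "cone_preserving SC (cplx_twist q) Fm" using twist_SC by blast
  then have e: "endofunctor SC (cplx_twist q) Fm" by (simp add: cone_preserving_def)
  show "cplx_twist q X \<in> sing_tor S J" unfolding sing_tor_def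
    by (rule SC.essential_closure_endofunctor[OF e _ X[unfolded sing_tor_def]])
      (simp add: derived_tor_closed)
qed

lemma tri_cat_PC: "tri_cat (PC J)"
  unfolding phase_cat_def by (rule tri_cat.tri_cat_verdier[OF tri_cat_SC sing_tor_closed(1)])

lemma Ob_PC: "Ob (PC J) = BF"
  unfolding phase_cat_def tri_cat.Ob_verdier[OF tri_cat_SC] by (rule Ob_SC)

lemma twist_PC: "\<exists>Fm. cone_preserving (PC J) (cplx_twist q) Fm"
proof -
  obtain Fm where F: "cone_preserving SC (cplx_twist q) Fm" using twist_SC by blast
  show ?thesis unfolding phase_cat_def
    by (rule tri_cat.cone_preserving_verdier[OF tri_cat_SC sing_tor_closed(1) F sing_tor_closed(2)])
qed

lemma K_chain: "K_relations DC \<subseteq> K_relations SC" "K_relations SC \<subseteq> K_relations (PC J)"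
  unfolding sing_cat_def phase_cat_def
  using tri_cat.K_relations_verdier[OF tri_cat_DC perf_shift]
    tri_cat.K_relations_verdier[OF tri_cat_SC[unfolded sing_cat_def] sing_tor_closed(1)[unfolded sing_cat_def]]
  by blast+

section \<open>Relations between classes of complexes in a phase\<close>

abbreviation "KR J \<equiv> K_relations (PC J)"

lemma KR_closed: "0 \<in> KR J" "x \<in> KR J ==> y \<in> KR J ==> x + y \<in> KR J"
  "x \<in> KR J ==> y \<in> KR J ==> x - y \<in> KR J" "x \<in> KR J ==> - x \<in> KR J"
proof -
  interpret PC: tri_cat "PC J" by (rule tri_cat_PC)
  show "0 \<in> KR J" "x \<in> KR J ==> y \<in> KR J ==> x + y \<in> KR J"
    "x \<in> KR J ==> y \<in> KR J ==> x - y \<in> KR J" "x \<in> KR J ==> - x \<in> KR J"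
    by (rule PC.K_zero, rule PC.K_add, assumption+, rule PC.K_diff, assumption+, rule PC.K_uminus, assumption+)
qed

lemma KR_twist: "c \<in> KR J ==> frag_extend (\<lambda>A. frag_of (cplx_twist q A)) c \<in> KR J"
proof -
  interpret PC: tri_cat "PC J" by (rule tri_cat_PC)
  assume c: "c \<in> KR J"
  obtain Fm where "cone_preserving (PC J) (cplx_twist q) Fm" using twist_PC by blast
  from PC.K_relations_functor[OF this c] show ?thesis .
qed

text \<open>A free complex lies in the subcategory divided out first; objects of such a subcategory
  have class zero, and the relation persists in the second quotient.\<close>

lemma KR_free:
  assumes "X \<in> free_complexes"
  shows "frag_of X \<in> KR J"
proof -
  interpret D: tri_cat DC by (rule tri_cat_DC)
  have X: "X \<in> BF" using assms by simp
  have "X \<in> perf S" unfolding perf_def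
    by (rule D.essential_closureI[OF assms]) (use X in \<open>simp add: Ob_DC\<close>)
  from D.K_null_object[OF perf_shift this] have "frag_of X \<in> K_relations SC"
    unfolding sing_cat_def using X by (simp add: Ob_DC)
  then show ?thesis using K_chain(2) by blast
qed

lemma KR_torsion:
  assumes "X \<in> torsion_complexes J"
  shows "frag_of X \<in> KR J"
proof -
  interpret D: tri_cat DC by (rule tri_cat_DC)
  interpret SC: tri_cat SC by (rule tri_cat_SC)
  have X: "X \<in> BF" using assms by simp
  have 1: "X \<in> derived_tor S J" unfolding derived_tor_def
    by (rule D.essential_closureI[OF assms]) (use X in \<open>simp add: Ob_DC\<close>)
  have "X \<in> sing_tor S J" unfolding sing_tor_def
    by (rule SC.essential_closureI[OF 1]) (use X in \<open>simp add: Ob_SC\<close>)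
  from SC.K_null_object[OF sing_tor_closed(1) this] show ?thesis
    unfolding phase_cat_def using X by (simp add: Ob_SC)
qed

lemma KR_quasi_iso:
  assumes A: "A \<in> BF" "B \<in> BF" and f: "quasi_iso S A B f"
  shows "frag_of B - frag_of A \<in> KR J"
proof -
  have "(A, B, f) \<in> Ar CC \<inter> qis" using A f by (auto simp: quasi_iso_def)
  from tri_cat.K_inverted[OF tri_cat_CC qis_shift this]
  have "frag_of B - frag_of A \<in> K_relations DC" by (simp add: derived_cat_def)
  then show ?thesis using K_chain by blast
qed

lemma KR_tri:
  assumes "(f, g, h) \<in> Tri CC"
  shows "frag_of (Dom CC g) - frag_of (Dom CC f) - frag_of (Dom CC h) \<in> KR J"
  using tri_cat.K_generators[OF tri_cat_CC assms] tri_cat.K_relations_loc[OF tri_cat_CC qis_shift]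
    K_chain unfolding derived_cat_def by blast

text \<open>The triangle on the injection has a copy of its cone as third object, and the cone is
  quasi-isomorphic to the quotient complex; hence the class of that object may be replaced by the
  class of \<open>A''\<close>.\<close>

lemma KR_exact:
  assumes A': "A' \<in> BF" and A: "A \<in> BF" and A'': "A'' \<in> BF"
    and \<iota>: "chain_map S A' A \<iota>" and p: "chain_map S A A'' p"
    and inj: "\<And>i. inj_on (\<iota> i) (carrier (cterm A' i))"
    and surj: "\<And>i. p i ` carrier (cterm A i) = carrier (cterm A'' i)"
    and ex: "\<And>i x. x \<in> carrier (cterm A i) ==> p i x = \<zero>\<^bsub>cterm A'' i\<^esub> \<longleftrightarrow> x \<in> \<iota> i ` carrier (cterm A' i)"
  shows "frag_of A - frag_of A' - frag_of A'' \<in> KR J"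
proof -
  obtain C g h \<phi> where C: "C \<in> BF" "((A', A, \<iota>), (A, C, g), (C, cplx_shift A', h)) \<in> Tri CC"
    "chain_iso S (mapping_cone A' A \<iota>) C \<phi>"
    using cone_triangle[OF A' A \<iota>] by blast
  have "frag_of A - frag_of A' - frag_of C \<in> KR J" using KR_tri[OF C(2)] by simp
  moreover have "frag_of A'' - frag_of C \<in> KR J"
    by (rule KR_quasi_iso[OF C(1) A'' quasi_iso_compose_inv[OF cone_complex[OF A' A \<iota>] C(1,3)
        cone_quasi_iso[OF A' A A'' \<iota> p inj surj ex]]])
  ultimately have "(frag_of A - frag_of A' - frag_of C) - (frag_of A'' - frag_of C) \<in> KR J" by (rule KR_closed(3))
  then show ?thesis by simp
qed

end

section \<open>Kernels and cokernels in the Grothendieck group\<close>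

context graded_base
begin

lemma graded_sub_kernel:
  assumes M: "graded_module S M" and N: "graded_module S N" and h: "h \<in> gmod_hom S M N"
  shows "graded_sub S M {x \<in> carrier M. h x = \<zero>\<^bsub>N\<^esub>}"
proof -
  interpret M: Module.module S M using graded_moduleD(1)[OF M] .
  interpret N: Module.module S N using graded_moduleD(1)[OF N] .
  note p = gmod_hom_props[OF M N h]
  show ?thesis
  proof (rule graded_subI[OF M])
    fix F c \<gamma> assume F: "finite F" "\<And>\<gamma>. \<gamma> \<in> F ==> c \<gamma> \<in> gcomp M \<gamma>"
      "finsum M c F \<in> {x \<in> carrier M. h x = \<zero>\<^bsub>N\<^esub>}" "\<gamma> \<in> F"
    have c: "c \<in> F \<rightarrow> carrier M" using F(2) graded_moduleD(3)[OF M] by blast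
    have 0: "finsum N (\<lambda>i. h (c i)) F = \<zero>\<^bsub>N\<^esub>"
      using additive_map_finsum[OF M.abelian_group_axioms N.abelian_group_axioms gmod_homD(1)[OF h] F(1) c] F(3)
      by simp
    have "h (c \<gamma>) = \<zero>\<^bsub>N\<^esub>" by (rule graded_module_indep[OF N F(1) _ 0 F(4)]) (rule p(7)[OF F(2)])
    then show "c \<gamma> \<in> {x \<in> carrier M. h x = \<zero>\<^bsub>N\<^esub>}" using c F(4) by auto
  qed (use p in auto)
qed

lemma graded_sub_image:
  assumes M: "graded_module S M" and N: "graded_module S N" and h: "h \<in> gmod_hom S M N"
  shows "graded_sub S N (h ` carrier M)"
proof -
  interpret M: Module.module S M using graded_moduleD(1)[OF M] .
  interpret N: Module.module S N using graded_moduleD(1)[OF N] .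
  note p = gmod_hom_props[OF M N h]
  show ?thesis
  proof (rule graded_subI[OF N])
    show "\<zero>\<^bsub>N\<^esub> \<in> h ` carrier M" using p(3) by (metis M.M.zero_closed imageI)
    show "x \<oplus>\<^bsub>N\<^esub> y \<in> h ` carrier M" if xy: "x \<in> h ` carrier M" "y \<in> h ` carrier M" for x y
    proof -
      obtain a b where "a \<in> carrier M" "x = h a" "b \<in> carrier M" "y = h b" using xy by blast
      then show ?thesis using p(2)[of a b] by (auto intro!: image_eqI[of _ _ "a \<oplus>\<^bsub>M\<^esub> b"])
    qed
    show "s \<odot>\<^bsub>N\<^esub> x \<in> h ` carrier M" if sx: "s \<in> carrier S" "x \<in> h ` carrier M" for s x
    proof -
      obtain a where "a \<in> carrier M" "x = h a" using sx by blast
      then show ?thesis using p(6)[of s a] sx(1) by (auto intro!: image_eqI[of _ _ "s \<odot>\<^bsub>M\<^esub> a"])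
    qed
    fix F c \<gamma> assume F: "finite F" "\<And>\<gamma>. \<gamma> \<in> F ==> c \<gamma> \<in> gcomp N \<gamma>" "finsum N c F \<in> h ` carrier M" "\<gamma> \<in> F"
    then obtain x where x: "x \<in> carrier M" "finsum N c F = h x" by blast
    obtain H d where d: "finite H" "\<And>\<gamma>. d \<gamma> \<in> gcomp M \<gamma>" "x = finsum M d H"
      using graded_module_decomp[OF M x(1)] by blast
    have dM: "d \<gamma> \<in> carrier M" for \<gamma> using d(2) graded_moduleD(3)[OF M] by blast
    have cN: "c \<in> F \<rightarrow> carrier N" using F(2) graded_moduleD(3)[OF N] by blast
    \<comment> \<open>The given components and the images of the components of x decompose the same
      element; padded by zero to a common index set, they agree by independence.\<close>
    define c' where "c' = (\<lambda>\<gamma>. if \<gamma> \<in> F then c \<gamma> else \<zero>\<^bsub>N\<^esub>)"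
    define d' where "d' = (\<lambda>\<gamma>. if \<gamma> \<in> H then h (d \<gamma>) else \<zero>\<^bsub>N\<^esub>)"
    have fin: "finite (F \<union> H)" using F(1) d(1) by blast
    have c'N: "c' \<in> F \<union> H \<rightarrow> carrier N" using cN by (auto simp: c'_def)
    have d'N: "d' \<in> F \<union> H \<rightarrow> carrier N" using p(1)[OF dM] by (auto simp: d'_def)
    have "finsum N c F = finsum N c' F" by (rule N.finsum_cong') (use cN in \<open>auto simp: c'_def\<close>)
    also have "\<dots> = finsum N c' (F \<union> H)" by (rule N.finsum_extend[OF fin _ c'N]) (auto simp: c'_def)
    finally have 1: "finsum N c F = finsum N c' (F \<union> H)" .
    have "h x = finsum N (\<lambda>i. h (d i)) H" unfolding d(3)
      by (rule additive_map_finsum[OF M.abelian_group_axioms N.abelian_group_axioms gmod_homD(1)[OF h] d(1)])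
        (use dM in auto)
    also have "\<dots> = finsum N d' H" by (rule N.finsum_cong') (use p(1)[OF dM] in \<open>auto simp: d'_def\<close>)
    also have "\<dots> = finsum N d' (F \<union> H)" by (rule N.finsum_extend[OF fin _ d'N]) (auto simp: d'_def)
    finally have 2: "h x = finsum N d' (F \<union> H)" .
    have "finsum N c' (F \<union> H) \<in> carrier N" by (rule N.finsum_closed[OF c'N])
    then have 0: "finsum N (\<lambda>\<gamma>. c' \<gamma> \<ominus>\<^bsub>N\<^esub> d' \<gamma>) (F \<union> H) = \<zero>\<^bsub>N\<^esub>"
      using N.finsum_minus[OF fin c'N d'N] 1 2 x(2) N.minus_eq_zero_iff by simp
    have "c' \<gamma> \<ominus>\<^bsub>N\<^esub> d' \<gamma> = \<zero>\<^bsub>N\<^esub>"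
    proof (rule graded_module_indep[OF N fin _ 0])
      show "c' \<delta> \<ominus>\<^bsub>N\<^esub> d' \<delta> \<in> gcomp N \<delta>" for \<delta>
        using F(2)[of \<delta>] p(7)[OF d(2)] gcomp_closed(1)[OF N] by (intro gcomp_closed(3)[OF N]) (auto simp: c'_def d'_def)
    qed (use F(4) in simp)
    moreover have "c' \<gamma> \<in> carrier N" "d' \<gamma> \<in> carrier N" using c'N d'N F(4) by (auto simp: Pi_iff)
    ultimately have "c' \<gamma> = d' \<gamma>" using N.minus_eq_zero_iff by blast
    then have "c \<gamma> = h (if \<gamma> \<in> H then d \<gamma> else \<zero>\<^bsub>M\<^esub>)" using F(4) p(3) by (auto simp: c'_def d'_def)
    then show "c \<gamma> \<in> h ` carrier M" using dM by (auto intro!: image_eqI)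
  qed (use p(1) in auto)
qed

end

section \<open>Noetherian modules\<close>

context Module.module
begin

text \<open>Submodules over the scalars generated by \<open>Z\<close>; negatives become available
  once -1 is in \<open>Z\<close>.\<close>

definition scalar_closed :: "'a set \<Rightarrow> 'c set \<Rightarrow> bool" where
  "scalar_closed Z X \<longleftrightarrow> X \<subseteq> carrier M \<and> \<zero>\<^bsub>M\<^esub> \<in> X \<and> (\<forall>x\<in>X. \<forall>y\<in>X. x \<oplus>\<^bsub>M\<^esub> y \<in> X) \<and>
     (\<forall>z\<in>Z. \<forall>x\<in>X. z \<odot>\<^bsub>M\<^esub> x \<in> X)"

text \<open>Subsets closed under addition and the scalars in \<open>Z\<close> are finitely generated as soon as they
  are contained in something finitely generated.\<close>

definition scalar_noetherian :: "'a set \<Rightarrow> bool" where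
  "scalar_noetherian Z \<longleftrightarrow> (\<forall>B X. finite B \<longrightarrow> B \<subseteq> carrier M \<longrightarrow> scalar_closed Z X \<longrightarrow>
     X \<subseteq> scalar_span Z M B \<longrightarrow> (\<exists>B'. finite B' \<and> B' \<subseteq> X \<and> X \<subseteq> scalar_span Z M B'))"

lemma scalar_closedD:
  assumes "scalar_closed Z X"
  shows "x \<in> X ==> x \<in> carrier M" "\<zero>\<^bsub>M\<^esub> \<in> X" "x \<in> X ==> y \<in> X ==> x \<oplus>\<^bsub>M\<^esub> y \<in> X"
    "z \<in> Z ==> x \<in> X ==> z \<odot>\<^bsub>M\<^esub> x \<in> X" "X \<subseteq> carrier M"
  using assms by (auto simp: scalar_closed_def)

lemma scalar_closedI:
  assumes "X \<subseteq> carrier M" "\<zero>\<^bsub>M\<^esub> \<in> X" "\<And>x y. x \<in> X ==> y \<in> X ==> x \<oplus>\<^bsub>M\<^esub> y \<in> X"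
    "\<And>z x. z \<in> Z ==> x \<in> X ==> z \<odot>\<^bsub>M\<^esub> x \<in> X"
  shows "scalar_closed Z X"
  using assms by (auto simp: scalar_closed_def)

lemma scalar_closed_neg:
  assumes Z: "\<ominus> \<one> \<in> Z" and X: "scalar_closed Z X" and x: "x \<in> X" "y \<in> X"
  shows "\<ominus>\<^bsub>M\<^esub> x \<in> X" "x \<ominus>\<^bsub>M\<^esub> y \<in> X"
proof -
  have "\<ominus>\<^bsub>M\<^esub> x \<in> X" if "x \<in> X" for x
    using scalar_closedD(4)[OF X Z that] scalar_closedD(1)[OF X that] smult_l_minus[of \<one> x] by simp
  then show "\<ominus>\<^bsub>M\<^esub> x \<in> X" "x \<ominus>\<^bsub>M\<^esub> y \<in> X"
    using x scalar_closedD(3)[OF X x(1), of "\<ominus>\<^bsub>M\<^esub> y"] by (auto simp: a_minus_def)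
qed

lemma scalar_closed_span: "Z \<subseteq> carrier R ==> B \<subseteq> carrier M ==> scalar_closed Z (scalar_span Z M B)"
  using span_closed by (intro scalar_closedI) (auto intro: scalar_span.intros)

lemma span_least: "scalar_closed Z X ==> B \<subseteq> X ==> scalar_span Z M B \<subseteq> X"
proof
  fix x assume X: "scalar_closed Z X" and B: "B \<subseteq> X" and x: "x \<in> scalar_span Z M B"
  from x show "x \<in> X"
    by (induction rule: scalar_span.induct) (use B scalar_closedD(2-4)[OF X] in auto)
qed

lemma scalar_closed_Int: "scalar_closed Z X ==> scalar_closed Z Y ==> scalar_closed Z (X \<inter> Y)"
  by (auto simp: scalar_closed_def)

text \<open>The union of the chain is finitely generated, and finitely many generators lie in one
  member already.\<close>

lemma noetherian_chain:
  assumes N: "scalar_noetherian Z" and Z: "Z \<subseteq> carrier R" and B: "finite B" "B \<subseteq> carrier M"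
    and C: "\<And>n. scalar_closed Z (C n)" "\<And>n. C n \<subseteq> scalar_span Z M B" "\<And>n::nat. C n \<subseteq> C (Suc n)"
  shows "\<exists>m. \<forall>n. C n \<subseteq> C m"
proof -
  have mono: "C m \<subseteq> C n" if "m \<le> n" for m n using C(3) that by (rule lift_Suc_mono_le)
  have "scalar_closed Z (\<Union>n. C n)"
  proof (rule scalar_closedI)
    show "x \<oplus>\<^bsub>M\<^esub> y \<in> (\<Union>n. C n)" if xy: "x \<in> (\<Union>n. C n)" "y \<in> (\<Union>n. C n)" for x y
    proof -
      obtain m n where "x \<in> C m" "y \<in> C n" using xy by blast
      then have "x \<in> C (max m n)" "y \<in> C (max m n)" using mono[of m "max m n"] mono[of n "max m n"] by auto
      then show ?thesis using scalar_closedD(3)[OF C(1)] by blast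
    qed
    show "(\<Union>n. C n) \<subseteq> carrier M" using scalar_closedD(5)[OF C(1)] by blast
    show "\<zero>\<^bsub>M\<^esub> \<in> (\<Union>n. C n)" using scalar_closedD(2)[OF C(1), of 0] by blast
    show "z \<odot>\<^bsub>M\<^esub> x \<in> (\<Union>n. C n)" if "z \<in> Z" "x \<in> (\<Union>n. C n)" for z x
      using that scalar_closedD(4)[OF C(1)] by blast
  qed
  moreover have "(\<Union>n. C n) \<subseteq> scalar_span Z M B" using C(2) by blast
  ultimately obtain B' where B': "finite B'" "B' \<subseteq> (\<Union>n. C n)" "(\<Union>n. C n) \<subseteq> scalar_span Z M B'"
    using N B unfolding scalar_noetherian_def by meson
  have "\<exists>m. B' \<subseteq> C m"
    using B'(1,2)
  proof (induction B')
    case (insert b B')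
    then obtain m n where "B' \<subseteq> C m" "b \<in> C n" by blast
    then have "insert b B' \<subseteq> C (max m n)" using mono[of m "max m n"] mono[of n "max m n"] by auto
    then show ?case by blast
  qed auto
  then obtain m where "B' \<subseteq> C m" by blast
  then have "scalar_span Z M B' \<subseteq> C m" by (rule span_least[OF C(1)])
  then show ?thesis using B'(3) by blast
qed

text \<open>Base case of the basis theorem, with a field inside the ring as scalars. Induct on the
  spanning set: one element x of X with nonzero coefficient at the new generator b is enough to
  eliminate that coefficient from all others.\<close>

lemma noetherian_field:
  assumes K: "K \<subseteq> carrier R" "\<ominus> \<one> \<in> K" "\<zero> \<in> K" "\<And>a b. a \<in> K ==> b \<in> K ==> a \<oplus> b \<in> K"
    "\<And>a b. a \<in> K ==> b \<in> K ==> a \<otimes> b \<in> K"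
    and inv: "\<And>a. a \<in> K ==> a \<noteq> \<zero> ==> \<exists>b\<in>K. b \<otimes> a = \<one>"
  shows "scalar_noetherian K"
  unfolding scalar_noetherian_def
proof (intro allI impI)
  fix B X assume "finite B" "B \<subseteq> carrier M" "scalar_closed K X" "X \<subseteq> scalar_span K M B"
  then show "\<exists>B'. finite B' \<and> B' \<subseteq> X \<and> X \<subseteq> scalar_span K M B'"
  proof (induction B arbitrary: X)
    case empty
    have "scalar_closed K {\<zero>\<^bsub>M\<^esub>}" using K(1) by (intro scalar_closedI) auto
    then have "scalar_span K M {} \<subseteq> {\<zero>\<^bsub>M\<^esub>}" by (rule span_least) simp
    then show ?case using empty by (intro exI[of _ "{}"]) (auto intro: scalar_span.intros)
  next
    case (insert b B)
    have bB: "b \<in> carrier M" "B \<subseteq> carrier M" using insert by auto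
    note sB = scalar_closed_span[OF K(1) bB(2)]
    have form: "\<exists>c\<in>K. \<exists>y\<in>scalar_span K M B. x = c \<odot>\<^bsub>M\<^esub> b \<oplus>\<^bsub>M\<^esub> y"
      if "x \<in> scalar_span K M (insert b B)" for x
      using that
    proof (induction rule: scalar_span.induct)
      case span_zero
      then show ?case using bB K(3)
        by (intro bexI[of _ \<zero>] bexI[of _ "\<zero>\<^bsub>M\<^esub>"]) (auto intro: scalar_span.intros)
    next
      case (span_base x)
      have 1: "\<one> \<in> K" using K(5)[OF K(2) K(2)] by (simp add: l_minus r_minus)
      show ?case
      proof (cases "x = b")
        case True
        then show ?thesis using bB 1
          by (intro bexI[of _ \<one>] bexI[of _ "\<zero>\<^bsub>M\<^esub>"]) (auto intro: scalar_span.intros)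
      next
        case False
        then have "x \<in> B" using span_base by simp
        then show ?thesis using bB K(3)
          by (intro bexI[of _ \<zero>] bexI[of _ x]) (auto intro: scalar_span.intros)
      qed
    next
      case (span_add x x')
      then obtain c y c' y' where c: "c \<in> K" "y \<in> scalar_span K M B" "x = c \<odot>\<^bsub>M\<^esub> b \<oplus>\<^bsub>M\<^esub> y"
        "c' \<in> K" "y' \<in> scalar_span K M B" "x' = c' \<odot>\<^bsub>M\<^esub> b \<oplus>\<^bsub>M\<^esub> y'" by blast
      have "y \<in> carrier M" "y' \<in> carrier M" "c \<in> carrier R" "c' \<in> carrier R"
        using c scalar_closedD(1)[OF sB] K(1) by auto
      then have "x \<oplus>\<^bsub>M\<^esub> x' = (c \<oplus> c') \<odot>\<^bsub>M\<^esub> b \<oplus>\<^bsub>M\<^esub> (y \<oplus>\<^bsub>M\<^esub> y')"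
        using bB(1) by (simp add: c(3,6) smult_l_distr M.a_ac)
      then show ?case using K(4)[OF c(1,4)] scalar_span.span_add[OF c(2,5)] by blast
    next
      case (span_smult z x)
      then obtain c y where c: "c \<in> K" "y \<in> scalar_span K M B" "x = c \<odot>\<^bsub>M\<^esub> b \<oplus>\<^bsub>M\<^esub> y" by blast
      have "y \<in> carrier M" "c \<in> carrier R" "z \<in> carrier R"
        using c span_smult scalar_closedD(1)[OF sB] K(1) by auto
      then have "z \<odot>\<^bsub>M\<^esub> x = (z \<otimes> c) \<odot>\<^bsub>M\<^esub> b \<oplus>\<^bsub>M\<^esub> z \<odot>\<^bsub>M\<^esub> y"
        using bB(1) by (simp add: c(3) smult_r_distr smult_assoc1)
      then show ?case using K(5)[OF span_smult(1) c(1)] scalar_span.span_smult[OF span_smult(1) c(2)] by blast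
    qed
    have "scalar_closed K (X \<inter> scalar_span K M B)" by (rule scalar_closed_Int[OF insert.prems(2) sB])
    from insert.IH[OF bB(2) this] obtain B' where B': "finite B'" "B' \<subseteq> X"
      "X \<inter> scalar_span K M B \<subseteq> scalar_span K M B'" by auto
    show ?case
    proof (cases "X \<subseteq> scalar_span K M B")
      case True
      then show ?thesis using B' by blast
    next
      case False
      then obtain x where x: "x \<in> X" "x \<notin> scalar_span K M B" by blast
      obtain c y where c: "c \<in> K" "y \<in> scalar_span K M B" "x = c \<odot>\<^bsub>M\<^esub> b \<oplus>\<^bsub>M\<^esub> y"
        using form[of x] x insert.prems(3) by blast
      have yM: "y \<in> carrier M" using c scalar_closedD(1)[OF sB] by blast
      have "c \<noteq> \<zero>" using c x yM bB by auto
      then obtain d where d: "d \<in> K" "d \<otimes> c = \<one>" using inv[OF c(1)] by blast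
      have cR: "c \<in> carrier R" "d \<in> carrier R" using c d K(1) by auto
      have "x' \<in> scalar_span K M (insert x B')" if x': "x' \<in> X" for x'
      proof -
        obtain c' y' where c': "c' \<in> K" "y' \<in> scalar_span K M B" "x' = c' \<odot>\<^bsub>M\<^esub> b \<oplus>\<^bsub>M\<^esub> y'"
          using form[of x'] x' insert.prems(3) by blast
        have y'M: "y' \<in> carrier M" and c'R: "c' \<in> carrier R" using c' scalar_closedD(1)[OF sB] K(1) by auto
        \<comment> \<open>Since d inverts c, this multiple of x has the same coefficient at b as
          x'.\<close>
        let ?e = "c' \<otimes> d"
        have eK: "?e \<in> K" using K(5)[OF c'(1) d(1)] .
        have eR: "?e \<in> carrier R" using cR c'R by simp
        have "?e \<odot>\<^bsub>M\<^esub> x = (?e \<otimes> c) \<odot>\<^bsub>M\<^esub> b \<oplus>\<^bsub>M\<^esub> ?e \<odot>\<^bsub>M\<^esub> y"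
          using cR eR bB yM by (simp add: c(3) smult_r_distr smult_assoc1)
        also have "?e \<otimes> c = c'" using cR c'R d(2) by (simp add: m_assoc)
        finally have ex: "?e \<odot>\<^bsub>M\<^esub> x = c' \<odot>\<^bsub>M\<^esub> b \<oplus>\<^bsub>M\<^esub> ?e \<odot>\<^bsub>M\<^esub> y" .
        have eyM: "?e \<odot>\<^bsub>M\<^esub> y \<in> carrier M" using eR yM by simp
        have cbM: "c' \<odot>\<^bsub>M\<^esub> b \<in> carrier M" using c'R bB by simp
        have "y' \<ominus>\<^bsub>M\<^esub> ?e \<odot>\<^bsub>M\<^esub> y = x' \<ominus>\<^bsub>M\<^esub> ?e \<odot>\<^bsub>M\<^esub> x"
        proof -
          have "x' \<ominus>\<^bsub>M\<^esub> ?e \<odot>\<^bsub>M\<^esub> x = (c' \<odot>\<^bsub>M\<^esub> b \<oplus>\<^bsub>M\<^esub> \<ominus>\<^bsub>M\<^esub> (c' \<odot>\<^bsub>M\<^esub> b)) \<oplus>\<^bsub>M\<^esub> (y' \<oplus>\<^bsub>M\<^esub> \<ominus>\<^bsub>M\<^esub> (?e \<odot>\<^bsub>M\<^esub> y))"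
            unfolding ex c'(3) a_minus_def using cbM eyM y'M by (simp add: M.minus_add M.a_ac)
          then show ?thesis using cbM eyM y'M by (simp add: M.r_neg a_minus_def)
        qed
        moreover have "y' \<ominus>\<^bsub>M\<^esub> ?e \<odot>\<^bsub>M\<^esub> y \<in> scalar_span K M B"
          by (rule scalar_closed_neg(2)[OF K(2) sB c'(2) scalar_span.span_smult[OF eK c(2)]])
        moreover have "x' \<ominus>\<^bsub>M\<^esub> ?e \<odot>\<^bsub>M\<^esub> x \<in> X"
          by (rule scalar_closed_neg(2)[OF K(2) insert.prems(2) x' scalar_closedD(4)[OF insert.prems(2) eK x(1)]])
        ultimately have "x' \<ominus>\<^bsub>M\<^esub> ?e \<odot>\<^bsub>M\<^esub> x \<in> scalar_span K M B'" using B'(3) by auto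
        then have 1: "x' \<ominus>\<^bsub>M\<^esub> ?e \<odot>\<^bsub>M\<^esub> x \<in> scalar_span K M (insert x B')"
          using span_mono[of B' "insert x B'"] by blast
        have 2: "?e \<odot>\<^bsub>M\<^esub> x \<in> scalar_span K M (insert x B')"
          by (rule scalar_span.span_smult[OF eK scalar_span.span_base]) simp
        have "x' = (x' \<ominus>\<^bsub>M\<^esub> ?e \<odot>\<^bsub>M\<^esub> x) \<oplus>\<^bsub>M\<^esub> ?e \<odot>\<^bsub>M\<^esub> x"
          using scalar_closedD(1)[OF insert.prems(2) x'] scalar_closedD(1)[OF insert.prems(2) x(1)] eR
          by (simp add: a_minus_def M.a_assoc M.l_neg)
        then show ?thesis using scalar_span.span_add[OF 1 2] by simp
      qed
      then show ?thesis using B'(1,2) x(1) by (intro exI[of _ "insert x B'"]) auto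
    qed
  qed
qed

lemma lead_step:
  assumes "y \<in> carrier R" "a \<in> carrier M" "f \<in> carrier M"
  shows "y \<odot>\<^bsub>M\<^esub> (y [^] n \<odot>\<^bsub>M\<^esub> a \<oplus>\<^bsub>M\<^esub> f) = y [^] Suc n \<odot>\<^bsub>M\<^esub> a \<oplus>\<^bsub>M\<^esub> y \<odot>\<^bsub>M\<^esub> f"
proof -
  have "y \<otimes> y [^] n = y [^] Suc n" using assms nat_pow_comm[of y 1 n] by (simp add: m_comm)
  then show ?thesis using assms by (simp add: smult_r_distr smult_assoc1[symmetric])
qed

text \<open>Elements of degree below \<open>n\<close> in the operator \<open>y\<close> with coefficients in \<open>L\<close>.\<close>

primrec deg_below :: "'a \<Rightarrow> 'c set \<Rightarrow> nat \<Rightarrow> 'c set" where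
  "deg_below y L 0 = {\<zero>\<^bsub>M\<^esub>}"
| "deg_below y L (Suc n) = {y [^] n \<odot>\<^bsub>M\<^esub> a \<oplus>\<^bsub>M\<^esub> f | a f. a \<in> L \<and> f \<in> deg_below y L n}"

lemma deg_below:
  assumes Z: "Z \<subseteq> carrier R" "\<ominus> \<one> \<in> Z" and y: "y \<in> carrier R" and L: "scalar_closed Z L"
  shows deg_below_closed: "scalar_closed Z (deg_below y L n)"
    and deg_below_Suc: "deg_below y L n \<subseteq> deg_below y L (Suc n)"
    and deg_below_mult: "f \<in> deg_below y L n ==> y \<odot>\<^bsub>M\<^esub> f \<in> deg_below y L (Suc n)"
    and deg_below_mono: "m \<le> n ==> deg_below y L m \<subseteq> deg_below y L n"
    and deg_below_pow: "f \<in> deg_below y L n ==> y [^] k \<odot>\<^bsub>M\<^esub> f \<in> deg_below y L (n + k)"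
proof -
  note l = scalar_closedD[OF L]
  show cl: "scalar_closed Z (deg_below y L n)" for n
  proof (induction n)
    case 0
    then show ?case using Z by (intro scalar_closedI) auto
  next
    case (Suc n)
    note f = scalar_closedD[OF Suc]
    show ?case
    proof (rule scalar_closedI)
      show "deg_below y L (Suc n) \<subseteq> carrier M" using l(1) f(1) y by auto
      show "\<zero>\<^bsub>M\<^esub> \<in> deg_below y L (Suc n)"
        using l(2) f(2) y by (auto intro!: exI[of _ "\<zero>\<^bsub>M\<^esub>"])
      fix x assume "x \<in> deg_below y L (Suc n)"
      then obtain a u where x: "x = y [^] n \<odot>\<^bsub>M\<^esub> a \<oplus>\<^bsub>M\<^esub> u" "a \<in> L" "u \<in> deg_below y L n" by auto
      { fix x' assume "x' \<in> deg_below y L (Suc n)"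
        then obtain b v where x': "x' = y [^] n \<odot>\<^bsub>M\<^esub> b \<oplus>\<^bsub>M\<^esub> v" "b \<in> L" "v \<in> deg_below y L n" by auto
        have "x \<oplus>\<^bsub>M\<^esub> x' = y [^] n \<odot>\<^bsub>M\<^esub> (a \<oplus>\<^bsub>M\<^esub> b) \<oplus>\<^bsub>M\<^esub> (u \<oplus>\<^bsub>M\<^esub> v)"
          unfolding x(1) x'(1) using l(1)[OF x(2)] l(1)[OF x'(2)] f(1)[OF x(3)] f(1)[OF x'(3)] y
          by (simp add: smult_r_distr M.a_ac)
        then show "x \<oplus>\<^bsub>M\<^esub> x' \<in> deg_below y L (Suc n)"
          using l(3)[OF x(2) x'(2)] f(3)[OF x(3) x'(3)] by auto }
      fix z assume z: "z \<in> Z"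
      have zR: "z \<in> carrier R" using z Z(1) by blast
      have "z \<odot>\<^bsub>M\<^esub> (y [^] n \<odot>\<^bsub>M\<^esub> a) = y [^] n \<odot>\<^bsub>M\<^esub> (z \<odot>\<^bsub>M\<^esub> a)"
        using zR y l(1)[OF x(2)] by (simp add: smult_assoc1[symmetric] m_comm)
      then have "z \<odot>\<^bsub>M\<^esub> x = y [^] n \<odot>\<^bsub>M\<^esub> (z \<odot>\<^bsub>M\<^esub> a) \<oplus>\<^bsub>M\<^esub> z \<odot>\<^bsub>M\<^esub> u"
        unfolding x(1) using zR y l(1)[OF x(2)] f(1)[OF x(3)] by (simp add: smult_r_distr)
      then show "z \<odot>\<^bsub>M\<^esub> x \<in> deg_below y L (Suc n)" using l(4)[OF z x(2)] f(4)[OF z x(3)] by auto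
    qed
  qed
  show mono1: "deg_below y L n \<subseteq> deg_below y L (Suc n)" for n
  proof
    fix f assume f: "f \<in> deg_below y L n"
    have "f = y [^] n \<odot>\<^bsub>M\<^esub> \<zero>\<^bsub>M\<^esub> \<oplus>\<^bsub>M\<^esub> f" using y scalar_closedD(1)[OF cl f] by simp
    then show "f \<in> deg_below y L (Suc n)" using f l(2) by auto
  qed
  show mult: "f \<in> deg_below y L n ==> y \<odot>\<^bsub>M\<^esub> f \<in> deg_below y L (Suc n)" for f n
  proof (induction n arbitrary: f)
    case 0
    then show ?case using y l(2) by (auto intro!: exI[of _ "\<zero>\<^bsub>M\<^esub>"])
  next
    case (Suc n)
    then obtain a u where x: "f = y [^] n \<odot>\<^bsub>M\<^esub> a \<oplus>\<^bsub>M\<^esub> u" "a \<in> L" "u \<in> deg_below y L n" by auto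
    have "y \<odot>\<^bsub>M\<^esub> f = y [^] Suc n \<odot>\<^bsub>M\<^esub> a \<oplus>\<^bsub>M\<^esub> y \<odot>\<^bsub>M\<^esub> u"
      unfolding x(1) by (rule lead_step[OF y l(1)[OF x(2)] scalar_closedD(1)[OF cl x(3)]])
    then show ?case using x(2) Suc.IH[OF x(3)] by (subst deg_below.simps) blast
  qed
  show "m \<le> n ==> deg_below y L m \<subseteq> deg_below y L n" using mono1 by (rule lift_Suc_mono_le)
  show "f \<in> deg_below y L n ==> y [^] k \<odot>\<^bsub>M\<^esub> f \<in> deg_below y L (n + k)"
  proof (induction k)
    case 0
    then show ?case using scalar_closedD(1)[OF cl] by simp
  next
    case (Suc k)
    have "y [^] Suc k \<odot>\<^bsub>M\<^esub> f = y \<odot>\<^bsub>M\<^esub> (y [^] k \<odot>\<^bsub>M\<^esub> f)"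
      using lead_step[OF y scalar_closedD(1)[OF cl Suc.prems] M.zero_closed, of k]
        y scalar_closedD(1)[OF cl Suc.prems] by simp
    then show ?case using mult[OF Suc.IH[OF Suc.prems]] by simp
  qed
qed

text \<open>The union over all degrees is closed under y as well as under \<open>Z\<close>. Thus one
  more scalar means an increasing sequence of sets that are closed under the old scalars.\<close>

lemma span_insert_eq:
  assumes Z: "Z \<subseteq> carrier R" "\<ominus> \<one> \<in> Z" and y: "y \<in> carrier R" and B: "B \<subseteq> carrier M"
  shows "scalar_span (insert y Z) M B = (\<Union>n. deg_below y (scalar_span Z M B) n)"
proof
  let ?L = "scalar_span Z M B"
  note L = scalar_closed_span[OF Z(1) B]
  note d = deg_below[OF Z y L]
  show "scalar_span (insert y Z) M B \<subseteq> (\<Union>n. deg_below y ?L n)"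
  proof (rule span_least)
    show "scalar_closed (insert y Z) (\<Union>n. deg_below y ?L n)"
    proof (rule scalar_closedI)
      show "x \<oplus>\<^bsub>M\<^esub> x' \<in> (\<Union>n. deg_below y ?L n)"
        if x: "x \<in> (\<Union>n. deg_below y ?L n)" "x' \<in> (\<Union>n. deg_below y ?L n)" for x x'
      proof -
        obtain m n where "x \<in> deg_below y ?L m" "x' \<in> deg_below y ?L n" using x by blast
        then have "x \<in> deg_below y ?L (max m n)" "x' \<in> deg_below y ?L (max m n)"
          using d(4)[of m "max m n"] d(4)[of n "max m n"] by auto
        then show ?thesis using scalar_closedD(3)[OF d(1)] by blast
      qed
      show "z \<odot>\<^bsub>M\<^esub> x \<in> (\<Union>n. deg_below y ?L n)"
        if x: "z \<in> insert y Z" "x \<in> (\<Union>n. deg_below y ?L n)" for z x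
        using x d(3) scalar_closedD(4)[OF d(1)] by blast
      show "(\<Union>n. deg_below y ?L n) \<subseteq> carrier M" using scalar_closedD(5)[OF d(1)] by blast
      show "\<zero>\<^bsub>M\<^esub> \<in> (\<Union>n. deg_below y ?L n)" using scalar_closedD(2)[OF d(1), of 0] by blast
    qed
    show "B \<subseteq> (\<Union>n. deg_below y ?L n)"
    proof
      fix b assume b: "b \<in> B"
      then have "b \<in> ?L" by (rule scalar_span.span_base)
      moreover have "b = y [^] (0::nat) \<odot>\<^bsub>M\<^esub> b \<oplus>\<^bsub>M\<^esub> \<zero>\<^bsub>M\<^esub>" using b B by auto
      ultimately have "b \<in> deg_below y ?L (Suc 0)" by auto
      then show "b \<in> (\<Union>n. deg_below y ?L n)" by blast
    qed
  qed
  have S: "scalar_closed (insert y Z) (scalar_span (insert y Z) M B)"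
    by (rule scalar_closed_span) (use Z y B in auto)
  have LS: "?L \<subseteq> scalar_span (insert y Z) M B"
    by (rule span_least) (use S in \<open>auto simp: scalar_closed_def intro: scalar_span.span_base\<close>)
  have pow: "y [^] n \<odot>\<^bsub>M\<^esub> a \<in> scalar_span (insert y Z) M B" if a: "a \<in> scalar_span (insert y Z) M B" for a and n :: nat
  proof (induction n)
    case 0
    then show ?case using a scalar_closedD(1)[OF S a] by simp
  next
    case (Suc n)
    have "y [^] Suc n \<odot>\<^bsub>M\<^esub> a = y \<odot>\<^bsub>M\<^esub> (y [^] n \<odot>\<^bsub>M\<^esub> a)"
      using lead_step[OF y scalar_closedD(1)[OF S a] M.zero_closed, of n] y scalar_closedD(1)[OF S a] by simp
    then show ?case using Suc by (simp add: scalar_span.span_smult)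
  qed
  have "deg_below y ?L n \<subseteq> scalar_span (insert y Z) M B" for n
  proof (induction n)
    case (Suc n)
    then show ?case using pow LS by (auto intro!: scalar_span.span_add)
  qed (auto intro: scalar_span.span_zero)
  then show "(\<Union>n. deg_below y ?L n) \<subseteq> scalar_span (insert y Z) M B" by blast
qed

text \<open>Hilbert's basis theorem: the leading coefficients of the elements of degree \<open>n\<close> in \<open>y\<close> form an
  ascending chain.\<close>

theorem noetherian_insert:
  assumes Z: "Z \<subseteq> carrier R" "\<ominus> \<one> \<in> Z" and y: "y \<in> carrier R" and N: "scalar_noetherian Z"
  shows "scalar_noetherian (insert y Z)"
  unfolding scalar_noetherian_def
proof (intro allI impI)
  fix B X assume B: "finite B" "B \<subseteq> carrier M" and X: "scalar_closed (insert y Z) X"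
    and XB: "X \<subseteq> scalar_span (insert y Z) M B"
  let ?L = "scalar_span Z M B"
  note L = scalar_closed_span[OF Z(1) B(2)]
  note d = deg_below[OF Z y L] and x = scalar_closedD[OF X] and l = scalar_closedD[OF L]
  define F where "F = deg_below y ?L"
  note Fc = scalar_closedD[OF d(1), folded F_def]
  \<comment> \<open>The leading coefficients, zero included, of the elements of Y of degree at most
    n; f stands for the unspecified lower part.\<close>
  define C where "C = (\<lambda>Y n. {a \<in> ?L. \<exists>f\<in>F n. y [^] n \<odot>\<^bsub>M\<^esub> a \<oplus>\<^bsub>M\<^esub> f \<in> Y})"
  have Cc: "scalar_closed Z (C Y n)" if Y: "scalar_closed Z Y" for Y n
  proof (rule scalar_closedI)
    note yc = scalar_closedD[OF Y]
    show "C Y n \<subseteq> carrier M" using l(1) by (auto simp: C_def)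
    show "\<zero>\<^bsub>M\<^esub> \<in> C Y n" unfolding C_def using l(2) Fc(2)[of n] yc(2) y by (auto intro!: bexI[of _ "\<zero>\<^bsub>M\<^esub>"])
    fix a assume "a \<in> C Y n"
    then obtain f where a: "a \<in> ?L" "f \<in> F n" "y [^] n \<odot>\<^bsub>M\<^esub> a \<oplus>\<^bsub>M\<^esub> f \<in> Y" by (auto simp: C_def)
    { fix b assume "b \<in> C Y n"
      then obtain g where b: "b \<in> ?L" "g \<in> F n" "y [^] n \<odot>\<^bsub>M\<^esub> b \<oplus>\<^bsub>M\<^esub> g \<in> Y" by (auto simp: C_def)
      have "(y [^] n \<odot>\<^bsub>M\<^esub> a \<oplus>\<^bsub>M\<^esub> f) \<oplus>\<^bsub>M\<^esub> (y [^] n \<odot>\<^bsub>M\<^esub> b \<oplus>\<^bsub>M\<^esub> g) =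
          y [^] n \<odot>\<^bsub>M\<^esub> (a \<oplus>\<^bsub>M\<^esub> b) \<oplus>\<^bsub>M\<^esub> (f \<oplus>\<^bsub>M\<^esub> g)"
        using l(1)[OF a(1)] l(1)[OF b(1)] Fc(1)[OF a(2)] Fc(1)[OF b(2)] y by (simp add: smult_r_distr M.a_ac)
      then have "y [^] n \<odot>\<^bsub>M\<^esub> (a \<oplus>\<^bsub>M\<^esub> b) \<oplus>\<^bsub>M\<^esub> (f \<oplus>\<^bsub>M\<^esub> g) \<in> Y" using yc(3)[OF a(3) b(3)] by simp
      then show "a \<oplus>\<^bsub>M\<^esub> b \<in> C Y n" using l(3)[OF a(1) b(1)] Fc(3)[OF a(2) b(2)] by (auto simp: C_def) }
    fix z assume z: "z \<in> Z"
    have zR: "z \<in> carrier R" using z Z(1) by blast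
    have "z \<odot>\<^bsub>M\<^esub> (y [^] n \<odot>\<^bsub>M\<^esub> a) = y [^] n \<odot>\<^bsub>M\<^esub> (z \<odot>\<^bsub>M\<^esub> a)"
      using zR y l(1)[OF a(1)] by (simp add: smult_assoc1[symmetric] m_comm)
    then have "z \<odot>\<^bsub>M\<^esub> (y [^] n \<odot>\<^bsub>M\<^esub> a \<oplus>\<^bsub>M\<^esub> f) = y [^] n \<odot>\<^bsub>M\<^esub> (z \<odot>\<^bsub>M\<^esub> a) \<oplus>\<^bsub>M\<^esub> z \<odot>\<^bsub>M\<^esub> f"
      using zR y l(1)[OF a(1)] Fc(1)[OF a(2)] by (simp add: smult_r_distr)
    then have "y [^] n \<odot>\<^bsub>M\<^esub> (z \<odot>\<^bsub>M\<^esub> a) \<oplus>\<^bsub>M\<^esub> z \<odot>\<^bsub>M\<^esub> f \<in> Y" using yc(4)[OF z a(3)] by simp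
    then show "z \<odot>\<^bsub>M\<^esub> a \<in> C Y n" using l(4)[OF z a(1)] Fc(4)[OF z a(2)] by (auto simp: C_def)
  qed
  \<comment> \<open>Multiplication by a power of y raises the degree and keeps the leading
    coefficient.\<close>
  have up: "y [^] (n + k) \<odot>\<^bsub>M\<^esub> a \<oplus>\<^bsub>M\<^esub> y [^] k \<odot>\<^bsub>M\<^esub> f \<in> Y"
    if Y: "scalar_closed (insert y Z) Y" and a: "a \<in> ?L" "f \<in> F n" "y [^] n \<odot>\<^bsub>M\<^esub> a \<oplus>\<^bsub>M\<^esub> f \<in> Y" for Y a f n k
  proof (induction k)
    case 0
    then show ?case using a Fc(1)[OF a(2)] by simp
  next
    case (Suc k)
    have aM: "a \<in> carrier M" "f \<in> carrier M" using l(1)[OF a(1)] Fc(1)[OF a(2)] by auto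
    have "y \<odot>\<^bsub>M\<^esub> (y [^] (n + k) \<odot>\<^bsub>M\<^esub> a \<oplus>\<^bsub>M\<^esub> y [^] k \<odot>\<^bsub>M\<^esub> f) =
        y [^] Suc (n + k) \<odot>\<^bsub>M\<^esub> a \<oplus>\<^bsub>M\<^esub> y \<odot>\<^bsub>M\<^esub> (y [^] k \<odot>\<^bsub>M\<^esub> f)"
      by (rule lead_step) (use aM y in auto)
    also have "y \<odot>\<^bsub>M\<^esub> (y [^] k \<odot>\<^bsub>M\<^esub> f) = y [^] Suc k \<odot>\<^bsub>M\<^esub> f"
      using lead_step[OF y aM(2) M.zero_closed, of k] aM y by simp
    finally show ?case using scalar_closedD(4)[OF Y _ Suc, of y] by simp
  qed
  have XZ: "scalar_closed Z X" using X by (auto simp: scalar_closed_def)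
  have "\<exists>m. \<forall>n. C X n \<subseteq> C X m"
  proof (rule noetherian_chain[OF N Z(1) B Cc[OF XZ]])
    show "C X n \<subseteq> ?L" for n by (auto simp: C_def)
    show "C X n \<subseteq> C X (Suc n)" for n
    proof
      fix a assume "a \<in> C X n"
      then obtain f where a: "a \<in> ?L" "f \<in> F n" "y [^] n \<odot>\<^bsub>M\<^esub> a \<oplus>\<^bsub>M\<^esub> f \<in> X" by (auto simp: C_def)
      have "y [^] (n + 1) \<odot>\<^bsub>M\<^esub> a \<oplus>\<^bsub>M\<^esub> y [^] (1::nat) \<odot>\<^bsub>M\<^esub> f \<in> X" by (rule up[OF X a])
      moreover have "y [^] (1::nat) \<odot>\<^bsub>M\<^esub> f \<in> F (n + 1)" using d(5)[of f n 1] a(2) by (simp add: F_def)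
      ultimately show "a \<in> C X (Suc n)" using a(1) by (auto simp: C_def)
    qed
  qed
  then obtain m where m: "\<And>n. C X n \<subseteq> C X m" by blast
  have "\<exists>D. finite D \<and> D \<subseteq> C X n \<and> C X n \<subseteq> scalar_span Z M D" for n
    using N B Cc[OF XZ, of n] unfolding scalar_noetherian_def by (auto simp: C_def)
  then obtain D where D: "\<And>n. finite (D n)" "\<And>n. D n \<subseteq> C X n" "\<And>n. C X n \<subseteq> scalar_span Z M (D n)" by metis
  have "\<forall>n. \<forall>a\<in>D n. \<exists>f. f \<in> F n \<and> y [^] n \<odot>\<^bsub>M\<^esub> a \<oplus>\<^bsub>M\<^esub> f \<in> X" using D(2) by (fastforce simp: C_def)
  then obtain g where g: "\<And>n a. a \<in> D n ==> g n a \<in> F n \<and> y [^] n \<odot>\<^bsub>M\<^esub> a \<oplus>\<^bsub>M\<^esub> g n a \<in> X" by metis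
  \<comment> \<open>Degrees up to m suffice: beyond m no new leading coefficient appears, and
    \<open>up\<close> raises the degree of what is there.\<close>
  define B' where "B' = (\<Union>n\<le>m. (\<lambda>a. y [^] n \<odot>\<^bsub>M\<^esub> a \<oplus>\<^bsub>M\<^esub> g n a) ` D n)"
  have B': "finite B'" "B' \<subseteq> X" using D(1) g by (auto simp: B'_def)
  let ?X' = "scalar_span (insert y Z) M B'"
  have X'c: "scalar_closed (insert y Z) ?X'"
    by (rule scalar_closed_span) (use Z y B' x(5) in auto)
  have X'Z: "scalar_closed Z ?X'" using X'c by (auto simp: scalar_closed_def)
  have X'X: "?X' \<subseteq> X" by (rule span_least[OF X B'(2)])
  have low: "C X n \<subseteq> C ?X' n" if "n \<le> m" for n
  proof -
    have "D n \<subseteq> C ?X' n"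
    proof
      fix a assume a: "a \<in> D n"
      have "y [^] n \<odot>\<^bsub>M\<^esub> a \<oplus>\<^bsub>M\<^esub> g n a \<in> ?X'"
        by (rule scalar_span.span_base) (use a that in \<open>auto simp: B'_def\<close>)
      then show "a \<in> C ?X' n" using g[OF a] subsetD[OF D(2) a] by (auto simp: C_def)
    qed
    from span_least[OF Cc[OF X'Z] this] D(3)[of n] show ?thesis by blast
  qed
  have all: "C X n \<subseteq> C ?X' n" for n
  proof (cases "n \<le> m")
    case False
    show ?thesis
    proof
      fix a assume "a \<in> C X n"
      then have "a \<in> C ?X' m" using m low[of m] by blast
      then obtain f where a: "a \<in> ?L" "f \<in> F m" "y [^] m \<odot>\<^bsub>M\<^esub> a \<oplus>\<^bsub>M\<^esub> f \<in> ?X'" by (auto simp: C_def)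
      have "y [^] (m + (n - m)) \<odot>\<^bsub>M\<^esub> a \<oplus>\<^bsub>M\<^esub> y [^] (n - m) \<odot>\<^bsub>M\<^esub> f \<in> ?X'" by (rule up[OF X'c a])
      moreover have "y [^] (n - m) \<odot>\<^bsub>M\<^esub> f \<in> F (m + (n - m))" using d(5)[of f m "n - m"] a(2) by (simp add: F_def)
      ultimately show "a \<in> C ?X' n" using a(1) False by (auto simp: C_def)
    qed
  qed (rule low)
  \<comment> \<open>Induction on the degree: subtract an element of the generated set with the same
    leading coefficient.\<close>
  have "X \<inter> F n \<subseteq> ?X'" for n
  proof (induction n)
    case 0
    then show ?case by (auto simp: F_def intro: scalar_span.span_zero)
  next
    case (Suc n)
    show ?case
    proof
      fix u assume u: "u \<in> X \<inter> F (Suc n)"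
      then obtain a f where a: "a \<in> ?L" "f \<in> F n" "u = y [^] n \<odot>\<^bsub>M\<^esub> a \<oplus>\<^bsub>M\<^esub> f" by (auto simp: F_def)
      then have "a \<in> C X n" using u by (auto simp: C_def)
      then obtain f' where f': "f' \<in> F n" "y [^] n \<odot>\<^bsub>M\<^esub> a \<oplus>\<^bsub>M\<^esub> f' \<in> ?X'" using all[of n] by (auto simp: C_def)
      let ?u' = "y [^] n \<odot>\<^bsub>M\<^esub> a \<oplus>\<^bsub>M\<^esub> f'"
      have cM: "y [^] n \<odot>\<^bsub>M\<^esub> a \<in> carrier M" "f \<in> carrier M" "f' \<in> carrier M"
        using l(1)[OF a(1)] Fc(1)[OF a(2)] Fc(1)[OF f'(1)] y by auto
      have "u \<ominus>\<^bsub>M\<^esub> ?u' = (y [^] n \<odot>\<^bsub>M\<^esub> a \<oplus>\<^bsub>M\<^esub> \<ominus>\<^bsub>M\<^esub> (y [^] n \<odot>\<^bsub>M\<^esub> a)) \<oplus>\<^bsub>M\<^esub> (f \<oplus>\<^bsub>M\<^esub> \<ominus>\<^bsub>M\<^esub> f')"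
        unfolding a(3) a_minus_def using cM by (simp add: M.minus_add M.a_ac)
      then have "u \<ominus>\<^bsub>M\<^esub> ?u' = f \<ominus>\<^bsub>M\<^esub> f'" using cM by (simp add: M.r_neg a_minus_def)
      then have "u \<ominus>\<^bsub>M\<^esub> ?u' \<in> F n"
        using scalar_closed_neg(2)[OF Z(2) d(1)[of n, folded F_def] a(2) f'(1)] by simp
      moreover have "u \<ominus>\<^bsub>M\<^esub> ?u' \<in> X"
        by (rule scalar_closed_neg(2)[OF Z(2) XZ]) (use u f' X'X in auto)
      ultimately have 1: "u \<ominus>\<^bsub>M\<^esub> ?u' \<in> ?X'" using Suc by blast
      have "u = (u \<ominus>\<^bsub>M\<^esub> ?u') \<oplus>\<^bsub>M\<^esub> ?u'"
        using x(1)[of u] u cM by (simp add: a_minus_def M.a_assoc M.l_neg)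
      then show "u \<in> ?X'" using scalar_span.span_add[OF 1 f'(2)] by simp
    qed
  qed
  moreover have "X \<subseteq> (\<Union>n. F n)" using XB unfolding span_insert_eq[OF Z y B(2)] F_def .
  ultimately have "X \<subseteq> ?X'" by blast
  then show "\<exists>B'. finite B' \<and> B' \<subseteq> X \<and> X \<subseteq> scalar_span (insert y Z) M B'" using B' by blast
qed

lemma noetherian_union:
  assumes "Z \<subseteq> carrier R" "\<ominus> \<one> \<in> Z" "scalar_noetherian Z" and "finite V" "V \<subseteq> carrier R"
  shows "scalar_noetherian (V \<union> Z)"
  using assms(4,5)
proof (induction V)
  case (insert v V)
  then have "scalar_noetherian (insert v (V \<union> Z))"
    using assms by (intro noetherian_insert) auto
  then show ?case by simp
qed (use assms in simp)

end

section \<open>Subcomplexes, quotient complexes and multiplication by a ring element\<close>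

lemma span_sub_gmod: "scalar_span Z (sub_gmod N M) B = scalar_span Z M B"
proof -
  have ops: "add (sub_gmod N M) = add M" "\<zero>\<^bsub>sub_gmod N M\<^esub> = \<zero>\<^bsub>M\<^esub>" "smult (sub_gmod N M) = smult M"
    by (auto simp: sub_gmod_def)
  show ?thesis
  proof (intro equalityI subsetI)
  fix x assume "x \<in> scalar_span Z (sub_gmod N M) B"
  then show "x \<in> scalar_span Z M B"
    by (induction rule: scalar_span.induct) (auto simp: ops intro: scalar_span.intros)
next
  fix x assume "x \<in> scalar_span Z M B"
  then show "x \<in> scalar_span Z (sub_gmod N M) B"
    by (induction rule: scalar_span.induct)
      (use scalar_span.intros[where M = "sub_gmod N M", unfolded ops] in \<open>auto\<close>)
qed
qed

text \<open>The first assumption makes kernels and images of chain maps objects of the category; the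
  second, that the ring is graded as a module over itself, makes spans of single homogeneous
  elements graded submodules.\<close>

locale noetherian_setting = cplx_setting S \<pi>
  for S :: "('g::ab_group_add, 'a) gring" and \<pi> :: "'b \<times> 'b \<Rightarrow> 'b" +
  assumes fin_gen_sub: "graded_module S (M :: ('g, 'a, 'b) gmod) ==> fin_gen S M ==> graded_sub S M N ==>
      fin_gen S (sub_gmod N M)"
    and graded_regular: "graded_module S (regular_module S)"
begin

text \<open>Cosets would be sets of elements of the carrier type; choosing a representative of each
  coset keeps the quotient in the type itself.\<close>

lemma quotient_map_exists:
  fixes M :: "('g, 'a, 'b) gmod"
  assumes M: "graded_module S M" and N: "graded_sub S M N"
  shows "\<exists>\<theta> :: 'b \<Rightarrow> 'b. \<forall>x\<in>carrier M. \<forall>y\<in>carrier M. \<theta> x = \<theta> y \<longleftrightarrow> x \<ominus>\<^bsub>M\<^esub> y \<in> N"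
proof -
  interpret M: Module.module S M using graded_moduleD(1)[OF M] .
  note n = graded_subD[OF N]
  define E where "E = (\<lambda>x. {z \<in> carrier M. z \<ominus>\<^bsub>M\<^esub> x \<in> N})"
  have tr: "x \<ominus>\<^bsub>M\<^esub> z \<in> N" if "x \<ominus>\<^bsub>M\<^esub> y \<in> N" "y \<ominus>\<^bsub>M\<^esub> z \<in> N" "x \<in> carrier M" "y \<in> carrier M" "z \<in> carrier M" for x y z
  proof -
    have "(x \<ominus>\<^bsub>M\<^esub> y) \<oplus>\<^bsub>M\<^esub> (y \<ominus>\<^bsub>M\<^esub> z) = (y \<oplus>\<^bsub>M\<^esub> \<ominus>\<^bsub>M\<^esub> y) \<oplus>\<^bsub>M\<^esub> (x \<oplus>\<^bsub>M\<^esub> \<ominus>\<^bsub>M\<^esub> z)"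
      using that(3-5) by (simp add: a_minus_def M.a_ac)
    then show ?thesis using n(3)[OF that(1,2)] that(3-5) by (simp add: a_minus_def M.r_neg)
  qed
  have sy: "y \<ominus>\<^bsub>M\<^esub> x \<in> N" if "x \<ominus>\<^bsub>M\<^esub> y \<in> N" "x \<in> carrier M" "y \<in> carrier M" for x y
    using n(4)[OF that(1)] that(2,3) by (simp add: a_minus_def M.minus_add M.a_comm)
  have E: "x \<in> E x" if "x \<in> carrier M" for x using that n(2) by (simp add: E_def a_minus_def M.r_neg)
  define \<theta> where "\<theta> = (\<lambda>x. SOME z. z \<in> E x)"
  have \<theta>: "\<theta> x \<in> E x" if "x \<in> carrier M" for x unfolding \<theta>_def using E[OF that] by (rule someI)
  have "\<theta> x = \<theta> y \<longleftrightarrow> x \<ominus>\<^bsub>M\<^esub> y \<in> N" if x: "x \<in> carrier M" and y: "y \<in> carrier M" for x y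
  proof
    assume e: "\<theta> x = \<theta> y"
    have "\<theta> x \<in> carrier M" "\<theta> x \<ominus>\<^bsub>M\<^esub> x \<in> N" "\<theta> x \<ominus>\<^bsub>M\<^esub> y \<in> N"
      using \<theta>[OF x] \<theta>[OF y] e by (auto simp: E_def)
    then show "x \<ominus>\<^bsub>M\<^esub> y \<in> N" using tr sy x y by metis
  next
    assume d: "x \<ominus>\<^bsub>M\<^esub> y \<in> N"
    have "E x = E y"
    proof (intro equalityI subsetI)
      show "z \<in> E y" if "z \<in> E x" for z using that tr[of z x y] d x y by (auto simp: E_def)
      show "z \<in> E x" if "z \<in> E y" for z using that tr[of z y x] sy[OF d x y] x y by (auto simp: E_def)
    qed
    then show "\<theta> x = \<theta> y" by (simp add: \<theta>_def)
  qed
  then show ?thesis by blast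
qed

lemma quotient_complex:
  assumes A: "A \<in> BF" and N: "graded_subcplx A N"
  obtains C t where "C \<in> BF" "chain_map S A C t" "\<And>i. t i ` carrier (cterm A i) = carrier (cterm C i)"
    "\<And>i \<gamma>. t i ` gcomp (cterm A i) \<gamma> = gcomp (cterm C i) \<gamma>"
    "\<And>i x. x \<in> carrier (cterm A i) ==> t i x = \<zero>\<^bsub>cterm C i\<^esub> \<longleftrightarrow> x \<in> N i"
proof -
  have gs: "graded_sub S (cterm A i) (N i)" for i using N by (simp add: graded_subcplx_def)
  have "\<forall>i. \<exists>\<theta> :: 'b \<Rightarrow> 'b. \<forall>x\<in>carrier (cterm A i). \<forall>y\<in>carrier (cterm A i). \<theta> x = \<theta> y \<longleftrightarrow> x \<ominus>\<^bsub>cterm A i\<^esub> y \<in> N i"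
    using quotient_map_exists[OF complexD(1)[OF A] gs] by blast
  then obtain \<theta> :: "int \<Rightarrow> 'b \<Rightarrow> 'b" where \<theta>: "\<And>i x y. x \<in> carrier (cterm A i) ==> y \<in> carrier (cterm A i) ==>
      \<theta> i x = \<theta> i y \<longleftrightarrow> x \<ominus>\<^bsub>cterm A i\<^esub> y \<in> N i" by metis
  show ?thesis
    by (rule that[of "image_cplx \<theta> A" "\<lambda>i. restrict (\<theta> i) (carrier (cterm A i))"])
      (rule image_cplx[OF A N \<theta>], assumption+)+
qed

lemma subcplx_kernel:
  assumes A: "A \<in> BF" and B: "B \<in> BF" and f: "chain_map S A B f"
  shows "graded_subcplx A (\<lambda>j. {x \<in> carrier (cterm A j). f j x = \<zero>\<^bsub>cterm B j\<^esub>})"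
    and "graded_subcplx B (\<lambda>j. f j ` carrier (cterm A j))"
proof -
  show "graded_subcplx A (\<lambda>j. {x \<in> carrier (cterm A j). f j x = \<zero>\<^bsub>cterm B j\<^esub>})"
    unfolding graded_subcplx_def
    using graded_sub_kernel[OF complexD(1)[OF A] complexD(1)[OF B] chain_mapD(1)[OF f]]
      chain_mapD(2)[OF f] diff_props(1)[OF A] diff_props(3)[OF B] by auto
  show "graded_subcplx B (\<lambda>j. f j ` carrier (cterm A j))"
    unfolding graded_subcplx_def
  proof (intro conjI allI ballI)
    show "graded_sub S (cterm B j) (f j ` carrier (cterm A j))" for j
      by (rule graded_sub_image[OF complexD(1)[OF A] complexD(1)[OF B] chain_mapD(1)[OF f]])
    fix j y assume "y \<in> f j ` carrier (cterm A j)"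
    then obtain x where x: "x \<in> carrier (cterm A j)" "y = f j x" by blast
    then show "cdiff B j y \<in> f (j + 1) ` carrier (cterm A (j + 1))"
      using chain_mapD(2)[OF f x(1)] diff_props(1)[OF A x(1)] by (auto intro!: image_eqI)
  qed
qed

lemma sub_cplx_BF:
  assumes A: "A \<in> BF" and N: "graded_subcplx A N"
  shows "sub_cplx N A \<in> BF" "chain_map S (sub_cplx N A) A (\<lambda>i. \<lambda>x\<in>N i. x)"
proof -
  have "fin_gen S (sub_gmod (N i) (cterm A i))" for i
    by (rule fin_gen_sub[OF complexD(1)[OF A] complexD(4)[OF A]]) (use N in \<open>simp add: graded_subcplx_def\<close>)
  then show "sub_cplx N A \<in> BF" "chain_map S (sub_cplx N A) A (\<lambda>i. \<lambda>x\<in>N i. x)" by (rule sub_cplx[OF A N])+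
qed

lemma sub_cplx_ops: "cterm (sub_cplx N A) i = sub_gmod (N i) (cterm A i)"
  by (simp add: sub_cplx_def)

text \<open>Cut at the image of f, a subcomplex of B, and subtract the relations of the two short
  exact sequences.\<close>

lemma KR_exact4:
  assumes K: "K \<in> BF" and A: "A \<in> BF" and B: "B \<in> BF" and C: "C \<in> BF"
    and \<iota>: "chain_map S K A \<iota>" and f: "chain_map S A B f" and p: "chain_map S B C p"
    and inj: "\<And>i. inj_on (\<iota> i) (carrier (cterm K i))"
    and exA: "\<And>i x. x \<in> carrier (cterm A i) ==> f i x = \<zero>\<^bsub>cterm B i\<^esub> \<longleftrightarrow> x \<in> \<iota> i ` carrier (cterm K i)"
    and exB: "\<And>i y. y \<in> carrier (cterm B i) ==> p i y = \<zero>\<^bsub>cterm C i\<^esub> \<longleftrightarrow> y \<in> f i ` carrier (cterm A i)"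
    and surj: "\<And>i. p i ` carrier (cterm B i) = carrier (cterm C i)"
  shows "frag_of K - frag_of A + frag_of B - frag_of C \<in> KR J"
proof -
  let ?N = "\<lambda>j. f j ` carrier (cterm A j)"
  let ?I = "sub_cplx ?N B"
  note N = subcplx_kernel(2)[OF A B f]
  note I = sub_cplx_BF[OF B N]
  note fp = chain_map_props[OF A B f]
  have f': "chain_map S A ?I f"
    unfolding chain_map_def
  proof (intro conjI allI ballI)
    show "f i \<in> gmod_hom S (cterm A i) (cterm ?I i)" for i
      unfolding sub_cplx_ops
      by (rule gmod_homI) (use fp subsetD[OF graded_moduleD(3)[OF complexD(1)[OF A]]] in \<open>auto simp: sub_ops\<close>)
    show "f (i + 1) (cdiff A i x) = cdiff ?I i (f i x)" if "x \<in> carrier (cterm A i)" for i x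
      using that chain_mapD(2)[OF f that] by (simp add: sub_cplx_def)
  qed
  have "frag_of A - frag_of K - frag_of ?I \<in> KR J"
    by (rule KR_exact[OF K A I(1) \<iota> f' inj]) (use exA in \<open>simp_all add: sub_cplx_ops sub_ops\<close>)
  moreover have "frag_of B - frag_of ?I - frag_of C \<in> KR J"
    by (rule KR_exact[OF I(1) B C I(2) p _ surj])
      (use exB in \<open>simp_all add: sub_cplx_ops sub_ops inj_on_def\<close>)
  ultimately have "(frag_of B - frag_of ?I - frag_of C) - (frag_of A - frag_of K - frag_of ?I) \<in> KR J"
    by (rule KR_closed(3)[rotated])
  moreover have "(frag_of B - frag_of ?I - frag_of C) - (frag_of A - frag_of K - frag_of ?I) =
      frag_of K - frag_of A + frag_of B - frag_of C" by simp
  ultimately show ?thesis by metis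
qed

definition annihilates :: "'a \<Rightarrow> ('g, 'a, 'b) cplx \<Rightarrow> bool" where
  "annihilates s A \<longleftrightarrow> (\<forall>j. \<forall>x\<in>carrier (cterm A j). s \<odot>\<^bsub>cterm A j\<^esub> x = \<zero>\<^bsub>cterm A j\<^esub>)"

text \<open>Multiplication by s has degree zero only as a map from A to A(\<gamma>), which is where
  the twist comes from. Annihilators of A pass to the subcomplex \<open>K\<close> of A and to the
  quotient \<open>C\<close> of the twist.\<close>

lemma KR_mult:
  assumes A: "A \<in> BF" and s: "s \<in> rcomp S \<gamma>"
  shows "\<exists>K C. K \<in> BF \<and> C \<in> BF \<and> frag_of K - frag_of A + frag_of (cplx_twist \<gamma> A) - frag_of C \<in> KR J \<and>
    annihilates s K \<and> annihilates s C \<and>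
    (\<forall>r\<in>carrier S. annihilates r A \<longrightarrow> annihilates r K \<and> annihilates r C)"
proof -
  let ?B = "cplx_twist \<gamma> A" and ?f = "\<lambda>j. \<lambda>x\<in>carrier (cterm A j). s \<odot>\<^bsub>cterm A j\<^esub> x"
  have sS: "s \<in> carrier S" using s rcomp_closed by blast
  note B = cplx_twist_complex[OF A]
  have f: "chain_map S A ?B ?f"
    unfolding chain_map_def
  proof (intro conjI allI ballI)
    fix i
    interpret Ai: Module.module S "cterm A i" by (rule graded_moduleD(1)[OF complexD(1)[OF A]])
    show "?f i \<in> gmod_hom S (cterm A i) (cterm ?B i)"
    proof (rule gmod_homI)
      show "?f i (r \<odot>\<^bsub>cterm A i\<^esub> x) = r \<odot>\<^bsub>cterm ?B i\<^esub> ?f i x" if "r \<in> carrier S" "x \<in> carrier (cterm A i)" for r x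
        using that sS by (simp add: Ai.smult_assoc1[symmetric] m_comm)
      show "?f i x \<in> gcomp (cterm ?B i) \<delta>" if "x \<in> gcomp (cterm A i) \<delta>" for x \<delta>
        using that graded_moduleD(6)[OF complexD(1)[OF A] s that] subsetD[OF graded_moduleD(3)[OF complexD(1)[OF A]] that]
        by (simp add: add.commute)
    qed (use sS in \<open>auto simp: Ai.smult_r_distr\<close>)
    show "?f (i + 1) (cdiff A i x) = cdiff ?B i (?f i x)" if "x \<in> carrier (cterm A i)" for x
      using that diff_props(1,6)[OF A] sS by simp
  qed
  let ?N = "\<lambda>j. {x \<in> carrier (cterm A j). ?f j x = \<zero>\<^bsub>cterm ?B j\<^esub>}"
  let ?K = "sub_cplx ?N A"
  note K = sub_cplx_BF[OF A subcplx_kernel(1)[OF A B f]]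
  obtain C t where C: "C \<in> BF" "chain_map S ?B C t" "\<And>i. t i ` carrier (cterm ?B i) = carrier (cterm C i)"
    "\<And>i \<gamma>. t i ` gcomp (cterm ?B i) \<gamma> = gcomp (cterm C i) \<gamma>"
    "\<And>i x. x \<in> carrier (cterm ?B i) ==> t i x = \<zero>\<^bsub>cterm C i\<^esub> \<longleftrightarrow> x \<in> ?f i ` carrier (cterm A i)"
    by (rule quotient_complex[OF B subcplx_kernel(2)[OF A B f]]) (rule that)
  note tp = chain_map_props[OF B C(1,2)]
  have "frag_of ?K - frag_of A + frag_of ?B - frag_of C \<in> KR J"
    by (rule KR_exact4[OF K(1) A B C(1) K(2) f C(2) _ _ C(5) C(3)])
      (auto simp: sub_cplx_ops sub_ops inj_on_def)
  moreover have "annihilates s ?K" by (auto simp: annihilates_def sub_cplx_ops sub_ops)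
  moreover have "annihilates s C"
    unfolding annihilates_def
  proof (intro allI ballI)
    fix j y assume "y \<in> carrier (cterm C j)"
    then obtain x where x: "x \<in> carrier (cterm A j)" "y = t j x" using C(3)[of j] by auto
    interpret Aj: Module.module S "cterm A j" by (rule graded_moduleD(1)[OF complexD(1)[OF A]])
    have "s \<odot>\<^bsub>cterm C j\<^esub> y = t j (s \<odot>\<^bsub>cterm A j\<^esub> x)" using tp(6)[OF sS, of x j] x by simp
    also have "\<dots> = \<zero>\<^bsub>cterm C j\<^esub>" using C(5)[of "s \<odot>\<^bsub>cterm A j\<^esub> x" j] x sS by (auto intro!: image_eqI)
    finally show "s \<odot>\<^bsub>cterm C j\<^esub> y = \<zero>\<^bsub>cterm C j\<^esub>" .
  qed
  moreover have "annihilates r ?K \<and> annihilates r C" if r: "r \<in> carrier S" "annihilates r A" for r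
  proof
    show "annihilates r ?K" using r(2) by (auto simp: annihilates_def sub_cplx_ops sub_ops)
    show "annihilates r C"
      unfolding annihilates_def
    proof (intro allI ballI)
      fix j y assume "y \<in> carrier (cterm C j)"
      then obtain x where x: "x \<in> carrier (cterm A j)" "y = t j x" using C(3)[of j] by auto
      have "r \<odot>\<^bsub>cterm C j\<^esub> y = t j (r \<odot>\<^bsub>cterm A j\<^esub> x)" using tp(6)[OF r(1), of x j] x by simp
      also have "\<dots> = \<zero>\<^bsub>cterm C j\<^esub>" using r(2) x tp(3)[of j] by (simp add: annihilates_def)
      finally show "r \<odot>\<^bsub>cterm C j\<^esub> y = \<zero>\<^bsub>cterm C j\<^esub>" .
    qed
  qed
  ultimately show ?thesis using K(1) C(1) by blast
qed

subsection \<open>Filtrations with cyclic subquotients\<close>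

lemma finsum_in_span:
  assumes M: "Module.module S M" and B: "B \<subseteq> carrier M" and "finite F" "\<And>i. i \<in> F ==> c i \<in> scalar_span (carrier S) M B"
  shows "finsum M c F \<in> scalar_span (carrier S) M B"
proof -
  interpret M: Module.module S M by fact
  have sp: "scalar_span (carrier S) M B \<subseteq> carrier M" by (rule M.span_closed[OF _ B]) simp
  show ?thesis using assms(3,4)
  proof (induction F)
    case (insert i F)
    then have "finsum M c (insert i F) = c i \<oplus>\<^bsub>M\<^esub> finsum M c F"
      using sp by (intro M.finsum_insert) auto
    then show ?case using insert by (auto intro!: scalar_span.span_add)
  qed (auto intro: scalar_span.span_zero)
qed

lemma homogeneous_generators:
  assumes M: "graded_module S M" and fg: "fin_gen S M"
  shows "\<exists>B. finite B \<and> B \<subseteq> (\<Union>\<gamma>. gcomp M \<gamma>) \<and> carrier M \<subseteq> scalar_span (carrier S) M B"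
proof -
  note m = graded_moduleD(1)[OF M]
  obtain B where B: "finite B" "B \<subseteq> carrier M" "carrier M \<subseteq> scalar_span (carrier S) M B"
    using fg fin_gen_iff[OF m] by blast
  have "\<forall>b\<in>B. \<exists>H. finite H \<and> H \<subseteq> (\<Union>\<gamma>. gcomp M \<gamma>) \<and> b \<in> scalar_span (carrier S) M H"
  proof
    fix b assume "b \<in> B"
    then have "b \<in> carrier M" using B by blast
    then obtain F c where F: "finite F" "\<And>\<gamma>. c \<gamma> \<in> gcomp M \<gamma>" "b = finsum M c F"
      using graded_module_decomp[OF M] by blast
    have "c ` F \<subseteq> carrier M" using F(2) graded_moduleD(3)[OF M] by blast
    from finsum_in_span[OF m this F(1), of c] have "b \<in> scalar_span (carrier S) M (c ` F)"
      unfolding F(3) by (simp add: scalar_span.span_base)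
    then show "\<exists>H. finite H \<and> H \<subseteq> (\<Union>\<gamma>. gcomp M \<gamma>) \<and> b \<in> scalar_span (carrier S) M H"
      using F(1,2) by (intro exI[of _ "c ` F"]) auto
  qed
  then obtain H where H: "\<And>b. b \<in> B ==> finite (H b) \<and> H b \<subseteq> (\<Union>\<gamma>. gcomp M \<gamma>) \<and> b \<in> scalar_span (carrier S) M (H b)"
    by metis
  let ?H = "\<Union>b\<in>B. H b"
  have "B \<subseteq> scalar_span (carrier S) M ?H"
  proof
    fix b assume b: "b \<in> B"
    then have "H b \<subseteq> ?H" by blast
    from span_mono[OF this] show "b \<in> scalar_span (carrier S) M ?H" using H[OF b] by blast
  qed
  from span_subset[OF this] have "carrier M \<subseteq> scalar_span (carrier S) M ?H" using B(3) by blast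
  moreover have "finite ?H" using H B(1) by blast
  moreover have "?H \<subseteq> (\<Union>\<gamma>. gcomp M \<gamma>)" using H by blast
  ultimately show ?thesis by blast
qed

lemma regular_ops:
  "carrier (regular_module S) = carrier S" "add (regular_module S) = add S"
  "smult (regular_module S) = monoid.mult S" "\<zero>\<^bsub>regular_module S\<^esub> = \<zero>\<^bsub>S\<^esub>"
  "gcomp (regular_module S) \<gamma> = rcomp S \<gamma>"
  by (auto simp: regular_module_def)

text \<open>The span is the image of S(-\<beta>) under the homomorphism that sends 1 to b, and
  images are graded submodules.\<close>

lemma cyclic_sub:
  assumes M: "graded_module S M" and b: "b \<in> gcomp M \<beta>"
  shows "graded_sub S M (scalar_span (carrier S) M {b})"
    "scalar_span (carrier S) M {b} = (\<lambda>s. s \<odot>\<^bsub>M\<^esub> b) ` carrier S"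
proof -
  interpret M: Module.module S M by (rule graded_moduleD(1)[OF M])
  have bM: "b \<in> carrier M" using b graded_moduleD(3)[OF M] by blast
  let ?R = "degree_shift (- \<beta>) (regular_module S)" and ?h = "\<lambda>s\<in>carrier S. s \<odot>\<^bsub>M\<^esub> b"
  have h: "?h \<in> gmod_hom S ?R M"
  proof (rule gmod_homI)
    show "?h s \<in> gcomp M \<gamma>" if "s \<in> gcomp ?R \<gamma>" for s \<gamma>
    proof -
      have s: "s \<in> rcomp S (\<gamma> - \<beta>)" using that by (simp add: regular_ops)
      then have "s \<in> carrier S" using rcomp_closed by blast
      then show ?thesis using graded_moduleD(6)[OF M s b] by simp
    qed
  qed (use bM in \<open>auto simp: regular_ops M.smult_l_distr M.smult_assoc1\<close>)
  have "graded_sub S M (?h ` carrier ?R)"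
    by (rule graded_sub_image[OF graded_module_shift[OF graded_regular] M h])
  moreover have "?h ` carrier ?R = (\<lambda>s. s \<odot>\<^bsub>M\<^esub> b) ` carrier S" by (simp add: regular_ops)
  ultimately have g: "graded_sub S M ((\<lambda>s. s \<odot>\<^bsub>M\<^esub> b) ` carrier S)" by simp
  show e: "scalar_span (carrier S) M {b} = (\<lambda>s. s \<odot>\<^bsub>M\<^esub> b) ` carrier S"
  proof
    show "scalar_span (carrier S) M {b} \<subseteq> (\<lambda>s. s \<odot>\<^bsub>M\<^esub> b) ` carrier S"
    proof
      fix x assume "x \<in> scalar_span (carrier S) M {b}"
      then show "x \<in> (\<lambda>s. s \<odot>\<^bsub>M\<^esub> b) ` carrier S"
      proof (induction rule: scalar_span.induct)
        case (span_base x)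
        then show ?case using bM by (intro image_eqI[of _ _ "\<one>\<^bsub>S\<^esub>"]) auto
      qed (use graded_subD(2,3,5)[OF g] in auto)
    qed
    show "(\<lambda>s. s \<odot>\<^bsub>M\<^esub> b) ` carrier S \<subseteq> scalar_span (carrier S) M {b}"
      by (rule image_subsetI, rule scalar_span.span_smult, assumption, rule scalar_span.span_base) simp
  qed
  show "graded_sub S M (scalar_span (carrier S) M {b})" unfolding e by (rule g)
qed

definition cyclic_complex :: "('g, 'a, 'b) cplx \<Rightarrow> int \<Rightarrow> 'b \<Rightarrow> 'g \<Rightarrow> bool" where
  "cyclic_complex A i b \<beta> \<longleftrightarrow> A \<in> BF \<and> b \<in> gcomp (cterm A i) \<beta> \<and>
     carrier (cterm A i) = scalar_span (carrier S) (cterm A i) {b} \<and>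
     (\<forall>j. j \<noteq> i \<longrightarrow> carrier (cterm A j) = {\<zero>\<^bsub>cterm A j\<^esub>})"

text \<open>Induction on the number of homogeneous generators of all terms together. A generator in
  the highest degree that has generators spans a subcomplex, since its differential lands in a zero
  module; the quotient is generated by the images of the others.\<close>

lemma cyclic_filtration:
  assumes A: "A \<in> BF"
    and zero: "\<And>A. A \<in> BF ==> (\<And>i. carrier (cterm A i) = {\<zero>\<^bsub>cterm A i\<^esub>}) ==> P A"
    and cyc: "\<And>A i b \<beta>. cyclic_complex A i b \<beta> ==> P A"
    and ext: "\<And>A' A A'' \<iota> p. A' \<in> BF ==> A \<in> BF ==> A'' \<in> BF ==> chain_map S A' A \<iota> ==> chain_map S A A'' p ==>
      (\<And>i. inj_on (\<iota> i) (carrier (cterm A' i))) ==>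
      (\<And>i. p i ` carrier (cterm A i) = carrier (cterm A'' i)) ==>
      (\<And>i x. x \<in> carrier (cterm A i) ==> p i x = \<zero>\<^bsub>cterm A'' i\<^esub> \<longleftrightarrow> x \<in> \<iota> i ` carrier (cterm A' i)) ==>
      P A' ==> P A'' ==> P A"
  shows "P A"
proof -
  define gens where "gens = (\<lambda>(A :: ('g, 'a, 'b) cplx) (X :: (int \<times> 'b) set). finite X \<and> (\<forall>(j, b)\<in>X. b \<in> (\<Union>\<gamma>. gcomp (cterm A j) \<gamma>)) \<and>
    (\<forall>j. carrier (cterm A j) \<subseteq> scalar_span (carrier S) (cterm A j) {b. (j, b) \<in> X}))"
  have main: "P A" if "A \<in> BF" "gens A X" for A and X :: "(int \<times> 'b) set"
    using that
  proof (induction "card X" arbitrary: A X rule: less_induct)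
    case less
    note A = less.prems(1) and X = less.prems(2)[unfolded gens_def]
    show ?case
    proof (cases "X = {}")
      case True
      show ?thesis
      proof (rule zero[OF A])
        fix i
        interpret Ai: Module.module S "cterm A i" by (rule graded_moduleD(1)[OF complexD(1)[OF A]])
        have "x = \<zero>\<^bsub>cterm A i\<^esub>" if "x \<in> scalar_span (carrier S) (cterm A i) {}" for x
          using that by (induction rule: scalar_span.induct) auto
        then show "carrier (cterm A i) = {\<zero>\<^bsub>cterm A i\<^esub>}" using X True by auto
      qed
    next
      case False
      define i where "i = Max (fst ` X)"
      have fX: "finite X" using X by blast
      have "i \<in> fst ` X" unfolding i_def using fX False by (intro Max_in) auto
      then obtain b where ib: "(i, b) \<in> X" by force
      have top: "j \<le> i" if "(j, c) \<in> X" for j c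
        unfolding i_def using fX that by (intro Max_ge) (auto simp: image_iff intro: bexI[of _ "(j, c)"])
      obtain \<beta> where b: "b \<in> gcomp (cterm A i) \<beta>" using X ib by blast
      have bM: "b \<in> carrier (cterm A i)" using b graded_moduleD(3)[OF complexD(1)[OF A]] by blast
      have zero_above: "x = \<zero>\<^bsub>cterm A j\<^esub>" if j: "j > i" and x: "x \<in> carrier (cterm A j)" for j x
      proof -
        interpret Aj: Module.module S "cterm A j" by (rule graded_moduleD(1)[OF complexD(1)[OF A]])
        have "{c. (j, c) \<in> X} = {}" using top j by fastforce
        then have "x \<in> scalar_span (carrier S) (cterm A j) {}" using X x by (metis subsetD)
        then show ?thesis by (induction rule: scalar_span.induct) auto
      qed
      let ?N = "\<lambda>j. if j = i then scalar_span (carrier S) (cterm A i) {b} else {\<zero>\<^bsub>cterm A j\<^esub>}"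
      note cs = cyclic_sub[OF complexD(1)[OF A] b]
      have N: "graded_subcplx A ?N"
        unfolding graded_subcplx_def
      proof (intro conjI allI ballI)
        fix j
        interpret Aj: Module.module S "cterm A j" by (rule graded_moduleD(1)[OF complexD(1)[OF A]])
        have "graded_sub S (cterm A j) {\<zero>\<^bsub>cterm A j\<^esub>}"
        proof (rule graded_subI[OF complexD(1)[OF A]])
          show "c \<gamma> \<in> {\<zero>\<^bsub>cterm A j\<^esub>}" if "finite F" "\<And>\<gamma>. \<gamma> \<in> F ==> c \<gamma> \<in> gcomp (cterm A j) \<gamma>"
            "finsum (cterm A j) c F \<in> {\<zero>\<^bsub>cterm A j\<^esub>}" "\<gamma> \<in> F" for F c \<gamma>
            using graded_module_indep[OF complexD(1)[OF A] that(1,2) _ that(4)] that(3) by simp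
        qed auto
        then show "graded_sub S (cterm A j) (?N j)" using cs(1) by simp
        fix x assume x: "x \<in> ?N j"
        show "cdiff A j x \<in> ?N (j + 1)"
        proof (cases "j = i")
          case True
          then have "x \<in> carrier (cterm A i)" using x graded_subD(1)[OF cs(1)] by auto
          then show ?thesis using zero_above[OF _ diff_props(1)[OF A]] True by simp
        next
          case False
          then have "cdiff A j x = \<zero>\<^bsub>cterm A (j + 1)\<^esub>" using x diff_props(3)[OF A] by simp
          then show ?thesis using graded_subD(2)[OF cs(1)] by simp
        qed
      qed
      note A' = sub_cplx_BF[OF A N]
      obtain C t where C: "C \<in> BF" "chain_map S A C t" "\<And>i. t i ` carrier (cterm A i) = carrier (cterm C i)"
        "\<And>i \<gamma>. t i ` gcomp (cterm A i) \<gamma> = gcomp (cterm C i) \<gamma>"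
        "\<And>i x. x \<in> carrier (cterm A i) ==> t i x = \<zero>\<^bsub>cterm C i\<^esub> \<longleftrightarrow> x \<in> ?N i"
        by (rule quotient_complex[OF A N]) (rule that)
      have "cyclic_complex (sub_cplx ?N A) i b \<beta>"
        unfolding cyclic_complex_def sub_cplx_ops span_sub_gmod
        using A'(1) b by (auto simp: sub_ops sub_cplx_ops intro: scalar_span.span_base)
      then have P': "P (sub_cplx ?N A)" by (rule cyc)
      \<comment> \<open>The removed generator becomes zero in the quotient, so the images of the
        others still generate.\<close>
      let ?X = "(\<lambda>(j, c). (j, t j c)) ` (X - {(i, b)})"
      have XM: "c \<in> carrier (cterm A j)" if "(j, c) \<in> X" for j c
        using X that graded_moduleD(3)[OF complexD(1)[OF A]] by blast
      have "gens C ?X"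
        unfolding gens_def
      proof (intro conjI allI)
        show "finite ?X" using fX by blast
        show "\<forall>(j, c)\<in>?X. c \<in> (\<Union>\<gamma>. gcomp (cterm C j) \<gamma>)" using X C(4) by fastforce
        fix j
        let ?B = "{c. (j, c) \<in> X}" and ?D = "{c. (j, c) \<in> ?X}"
        have "t j ` ?B \<subseteq> scalar_span (carrier S) (cterm C j) ?D"
        proof (rule image_subsetI)
          fix c assume c: "c \<in> ?B"
          show "t j c \<in> scalar_span (carrier S) (cterm C j) ?D"
          proof (cases "(j, c) = (i, b)")
            case True
            then have "t j c = \<zero>\<^bsub>cterm C j\<^esub>" using C(5)[OF bM] by (auto intro: scalar_span.span_base)
            then show ?thesis by (auto intro: scalar_span.span_zero)
          next
            case False
            have "(j, c) \<in> X - {(i, b)}" using c False by simp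
            from imageI[OF this, of "\<lambda>(j, c). (j, t j c)"] have "(j, t j c) \<in> ?X" by simp
            then show ?thesis by (intro scalar_span.span_base) simp
          qed
        qed
        from span_subset[OF this] have sp: "scalar_span (carrier S) (cterm C j) (t j ` ?B) \<subseteq> scalar_span (carrier S) (cterm C j) ?D" .
        have tx: "t j x \<in> scalar_span (carrier S) (cterm C j) (t j ` ?B)" if x: "x \<in> carrier (cterm A j)" for x
        proof (rule span_image[OF complexD(6)[OF C(1)] graded_moduleD(1)[OF complexD(1)[OF A]]
            gmod_homD(1)[OF chain_mapD(1)[OF C(2)]]])
          show "t j (s \<odot>\<^bsub>cterm A j\<^esub> x) = s \<odot>\<^bsub>cterm C j\<^esub> t j x" if "s \<in> carrier S" "x \<in> carrier (cterm A j)" for s x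
            by (rule chain_map_props(6)[OF A C(1,2) that])
          show "?B \<subseteq> carrier (cterm A j)" using XM by blast
          show "x \<in> scalar_span (carrier S) (cterm A j) ?B" using X x by blast
        qed
        show "carrier (cterm C j) \<subseteq> scalar_span (carrier S) (cterm C j) ?D"
          unfolding C(3)[symmetric] by (rule image_subsetI) (use tx sp in blast)
      qed
      moreover have "card ?X < card X"
      proof -
        have "card ?X \<le> card (X - {(i, b)})" using fX by (intro card_image_le) simp
        also have "\<dots> < card X" using fX ib by (rule card_Diff1_less)
        finally show ?thesis .
      qed
      ultimately have P'': "P C" using less.hyps C(1) by blast
      show ?thesis
        by (rule ext[OF A'(1) A C(1) A'(2) C(2) _ C(3) _ P' P''])
          (use C(5) in \<open>auto simp: sub_cplx_ops sub_ops inj_on_def\<close>)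
    qed
  qed
  obtain n where n: "\<And>i. \<bar>i\<bar> > n ==> carrier (cterm A i) = {\<zero>\<^bsub>cterm A i\<^esub>}" using complexD(5)[OF A] by blast
  obtain B where B: "\<And>j. finite (B j) \<and> B j \<subseteq> (\<Union>\<gamma>. gcomp (cterm A j) \<gamma>) \<and>
      carrier (cterm A j) \<subseteq> scalar_span (carrier S) (cterm A j) (B j)"
    using homogeneous_generators[OF complexD(1)[OF A] complexD(4)[OF A]] by metis
  \<comment> \<open>Degrees outside this range carry zero modules; leaving them out keeps the set of
    generators finite.\<close>
  let ?X = "Sigma {- n..n} B"
  have "gens A ?X"
    unfolding gens_def
  proof (intro conjI allI)
    show "finite ?X" using B by blast
    show "\<forall>(j, b)\<in>?X. b \<in> (\<Union>\<gamma>. gcomp (cterm A j) \<gamma>)" using B by blast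
    show "carrier (cterm A j) \<subseteq> scalar_span (carrier S) (cterm A j) {b. (j, b) \<in> ?X}" for j
    proof (cases "\<bar>j\<bar> > n")
      case True
      then show ?thesis using n[of j] by (auto intro: scalar_span.span_zero)
    next
      case False
      then have "{b. (j, b) \<in> ?X} = B j" by auto
      then show ?thesis using B by simp
    qed
  qed
  then show ?thesis by (rule main[OF A])
qed

end

section \<open>Substitutions and homogeneous components of polynomials\<close>

lemma poly_mapping_sum_single:
  fixes p :: "'a \<Rightarrow>\<^sub>0 'b::comm_monoid_add"
  shows "p = (\<Sum>m\<in>Poly_Mapping.keys p. Poly_Mapping.single m (Poly_Mapping.lookup p m))"
  by (rule poly_mapping_eqI)
    (auto simp: lookup_sum lookup_single when_def in_keys_iff sum.delta')

lemma poly_mapping_additive_induct [case_names single add]: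
  fixes p :: "'a \<Rightarrow>\<^sub>0 'b::comm_monoid_add"
  assumes single: "\<And>m c. P (Poly_Mapping.single m c)" and add: "\<And>p q. P p ==> P q ==> P (p + q)"
  shows "P p"
proof -
  have "P (\<Sum>m\<in>A. Poly_Mapping.single m (Poly_Mapping.lookup p m))" if "finite A" for A
    using that
  proof (induction A)
    case empty
    show ?case using single[of undefined 0] by simp
  qed (use single add in simp)
  from this[OF finite_keys] show ?thesis using poly_mapping_sum_single[of p] by metis
qed

abbreviation const :: "complex \<Rightarrow> 'z mpoly" where "const c \<equiv> Poly_Mapping.single 0 c"
abbreviation psubst :: "('z::finite \<Rightarrow> 'w mpoly) \<Rightarrow> 'z mpoly \<Rightarrow> 'w mpoly" where
  "psubst x \<equiv> mpoly_subst const x"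

lemma psubst_alt:
  fixes x :: "'z::finite \<Rightarrow> 'w mpoly"
  assumes "finite A" "Poly_Mapping.keys p \<subseteq> A"
  shows "psubst x p = (\<Sum>m\<in>A. const (Poly_Mapping.lookup p m) * (\<Prod>i\<in>UNIV. x i ^ Poly_Mapping.lookup m i))"
  unfolding mpoly_subst_def by (rule sum.mono_neutral_left) (use assms in \<open>auto simp: in_keys_iff\<close>)

lemma psubst_add: "psubst x (p + q) = psubst x p + psubst x q"
proof -
  let ?A = "Poly_Mapping.keys p \<union> Poly_Mapping.keys q"
  have "finite ?A" "Poly_Mapping.keys (p + q) \<subseteq> ?A" using keys_add[of p q] by auto
  then show ?thesis
    by (simp add: psubst_alt[of ?A] lookup_add single_add distrib_right sum.distrib)
qed

lemma psubst_single: "psubst x (Poly_Mapping.single m c) = const c * (\<Prod>i\<in>UNIV. x i ^ Poly_Mapping.lookup m i)"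
  using psubst_alt[of "{m}" "Poly_Mapping.single m c" x] by simp

lemma psubst_mult:
  fixes x :: "'z::finite \<Rightarrow> 'w mpoly"
  shows "psubst x (p * q) = psubst x p * psubst x q"
proof (induction p rule: poly_mapping_additive_induct)
  case (single m c)
  show ?case
  proof (induction q rule: poly_mapping_additive_induct)
    case (single m' c')
    have e: "(const (c * c') :: 'w mpoly) = const c * const c'" by (simp add: mult_single)
    have "psubst x (Poly_Mapping.single m c * Poly_Mapping.single m' c') =
        const (c * c') * (\<Prod>i\<in>UNIV. x i ^ Poly_Mapping.lookup (m + m') i)"
      by (simp add: mult_single psubst_single)
    also have "\<dots> = (const c * const c') *
        ((\<Prod>i\<in>UNIV. x i ^ Poly_Mapping.lookup m i) * (\<Prod>i\<in>UNIV. x i ^ Poly_Mapping.lookup m' i))"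
      by (simp only: e lookup_add power_add prod.distrib)
    finally show ?case by (simp add: psubst_single mult.assoc mult.left_commute)
  qed (simp add: psubst_add distrib_left)
qed (simp add: psubst_add distrib_right)

lemma psubst_const [simp]: "psubst x (const c) = const c"
  by (simp add: psubst_single)

lemma psubst_zero [simp]: "psubst x 0 = 0"
  using psubst_const[of x 0] by simp

lemma psubst_one [simp]: "psubst x 1 = 1"
  using psubst_const[of x 1] by simp

lemma psubst_uminus: "psubst x (- p) = - psubst x p"
  using psubst_add[of x p "- p"] by (simp add: eq_neg_iff_add_eq_0 add.commute)

lemma psubst_diff: "psubst x (p - q) = psubst x p - psubst x q"
  using psubst_add[of x p "- q"] by (simp add: psubst_uminus)

lemma psubst_var [simp]: "psubst x (mvar i) = x i"
proof -
  have "(\<Prod>j\<in>UNIV. x j ^ Poly_Mapping.lookup (Poly_Mapping.single i 1) j) = (\<Prod>j\<in>UNIV. if j = i then x i else 1)"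
    by (intro prod.cong) (auto simp: lookup_single when_def)
  then show ?thesis unfolding mvar_def by (simp add: psubst_single)
qed

lemma mpoly_induct [case_names const add var]:
  fixes p :: "'z::finite mpoly"
  assumes const: "\<And>c. P (const c)" and add: "\<And>p q. P p ==> P q ==> P (p + q)"
    and var: "\<And>i p. P p ==> P (mvar i * p)"
  shows "P p"
proof (induction p rule: poly_mapping_additive_induct)
  case (single m c)
  show ?case
  proof (induction "\<Sum>i\<in>UNIV. Poly_Mapping.lookup m i" arbitrary: m rule: less_induct)
    case less
    show ?case
    proof (cases "m = 0")
      case True
      then show ?thesis using const by simp
    next
      case False
      then obtain i where i: "Poly_Mapping.lookup m i \<noteq> 0" by (metis lookup_zero poly_mapping_eqI)
      define m' where "m' = m - Poly_Mapping.single i 1"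
      have m: "m = Poly_Mapping.single i 1 + m'"
        by (rule poly_mapping_eqI) (use i in \<open>auto simp: m'_def lookup_add lookup_minus lookup_single when_def\<close>)
      have "(\<Sum>j\<in>UNIV. Poly_Mapping.lookup m j) = (\<Sum>j\<in>UNIV. Poly_Mapping.lookup (Poly_Mapping.single i 1) j) +
          (\<Sum>j\<in>UNIV. Poly_Mapping.lookup m' j)"
        by (simp add: m lookup_add sum.distrib)
      also have "(\<Sum>j\<in>UNIV. Poly_Mapping.lookup (Poly_Mapping.single i 1) j) = (1::nat)"
        by (simp add: lookup_single when_def sum.delta)
      finally have "P (Poly_Mapping.single m' c)" by (intro less) simp
      from var[OF this, of i] show ?thesis by (simp add: mvar_def mult_single m)
    qed
  qed
qed (rule add)

lemma psubst_eqI: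
  assumes "\<And>i. psubst y (x i) = z i"
  shows "psubst y (psubst x p) = psubst z p"
  by (induction p rule: mpoly_induct) (auto simp: psubst_add psubst_mult assms)

lemma psubst_mvar: "psubst mvar p = p"
  by (induction p rule: mpoly_induct) (auto simp: psubst_add psubst_mult)

subsection \<open>Homogeneous polynomials\<close>

lemma monomial_degree_alt:
  fixes wt :: "'z::finite \<Rightarrow> 'g::comm_monoid_add"
  shows "monomial_degree wt m = (\<Sum>i\<in>UNIV. \<Sum>_<Poly_Mapping.lookup m i. wt i)"
  unfolding monomial_degree_def by (rule sum.mono_neutral_left) (auto simp: in_keys_iff)

lemma sum_const_add: "(\<Sum>_<a + b. x) = (\<Sum>_<a. x) + (\<Sum>_<(b::nat). x :: 'g::comm_monoid_add)"
  by (induction b) (auto simp: add_ac)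

lemma monomial_degree_add:
  fixes wt :: "'z::finite \<Rightarrow> 'g::comm_monoid_add"
  shows "monomial_degree wt (m + m') = monomial_degree wt m + monomial_degree wt m'"
  by (simp add: monomial_degree_alt lookup_add sum_const_add sum.distrib)

lemma monomial_degree_zero [simp]: "monomial_degree wt 0 = 0"
  by (simp add: monomial_degree_def)

lemma homogeneous_zero [simp]: "homogeneous wt \<gamma> 0"
  by (simp add: homogeneous_def)

lemma homogeneous_single: "monomial_degree wt m = \<gamma> ==> homogeneous wt \<gamma> (Poly_Mapping.single m c)"
  by (auto simp: homogeneous_def)

lemma homogeneous_const [simp]: "homogeneous wt 0 (const c)"
  by (rule homogeneous_single) simp

lemma homogeneous_one [simp]: "homogeneous wt 0 1"
  using homogeneous_const[of wt 1] by simp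

lemma homogeneous_var: "homogeneous wt (wt i) (mvar i)"
  unfolding mvar_def by (rule homogeneous_single) (simp add: monomial_degree_def)

lemma homogeneous_add: "homogeneous wt \<gamma> p ==> homogeneous wt \<gamma> q ==> homogeneous wt \<gamma> (p + q)"
  using keys_add[of p q] by (auto simp: homogeneous_def)

lemma homogeneous_uminus: "homogeneous wt \<gamma> p ==> homogeneous wt \<gamma> (- p)"
  by (auto simp: homogeneous_def)

lemma homogeneous_diff: "homogeneous wt \<gamma> p ==> homogeneous wt \<gamma> q ==> homogeneous wt \<gamma> (p - q)"
  using keys_diff[of p q] by (auto simp: homogeneous_def)

lemma homogeneous_mult:
  fixes wt :: "'z::finite \<Rightarrow> 'g::comm_monoid_add"
  shows "homogeneous wt \<gamma> p ==> homogeneous wt \<delta> q ==> homogeneous wt (\<gamma> + \<delta>) (p * q)"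
  using keys_mult[of p q] monomial_degree_add[of wt] by (fastforce simp: homogeneous_def)

text \<open>The n-fold sum is n times the degree, written as in \<open>monomial_degree\<close>
  because degrees form just a commutative monoid here.\<close>

lemma homogeneous_power:
  fixes wt :: "'z::finite \<Rightarrow> 'g::comm_monoid_add"
  shows "homogeneous wt \<gamma> p ==> homogeneous wt (\<Sum>_<n. \<gamma>) (p ^ n)"
proof (induction n)
  case (Suc n)
  then show ?case using homogeneous_mult[of wt \<gamma> p "\<Sum>_<n. \<gamma>" "p ^ n"] by (simp add: add.commute)
qed simp

lemma homogeneous_prod:
  fixes wt :: "'z::finite \<Rightarrow> 'g::comm_monoid_add"
  shows "finite A ==> (\<And>i. i \<in> A ==> homogeneous wt (\<gamma> i) (p i)) ==> homogeneous wt (\<Sum>i\<in>A. \<gamma> i) (\<Prod>i\<in>A. p i)"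
  by (induction A rule: finite_induct) (auto intro: homogeneous_mult)

lemma homogeneous_sum:
  "finite A ==> (\<And>i. i \<in> A ==> homogeneous wt \<gamma> (p i)) ==> homogeneous wt \<gamma> (\<Sum>i\<in>A. p i)"
  by (induction A rule: finite_induct) (auto intro: homogeneous_add)

lemma homogeneous_psubst:
  fixes wt :: "'z::finite \<Rightarrow> 'g::comm_monoid_add" and wt' :: "'w::finite \<Rightarrow> 'g"
  assumes x: "\<And>i. homogeneous wt' (wt i) (x i)" and p: "homogeneous wt \<gamma> p"
  shows "homogeneous wt' \<gamma> (psubst x p)"
  unfolding mpoly_subst_def
proof (rule homogeneous_sum)
  fix m assume "m \<in> Poly_Mapping.keys p"
  then have "monomial_degree wt m = \<gamma>" using p by (auto simp: homogeneous_def)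
  moreover have "homogeneous wt' (\<Sum>i\<in>UNIV. \<Sum>_<Poly_Mapping.lookup m i. wt i) (\<Prod>i\<in>UNIV. x i ^ Poly_Mapping.lookup m i)"
    by (rule homogeneous_prod) (auto intro: homogeneous_power x)
  ultimately show "homogeneous wt' \<gamma> (const (Poly_Mapping.lookup p m) * (\<Prod>i\<in>UNIV. x i ^ Poly_Mapping.lookup m i))"
    using homogeneous_mult[OF homogeneous_const] by (fastforce simp: monomial_degree_alt)
qed simp

definition hcomp :: "('z \<Rightarrow> 'g::comm_monoid_add) \<Rightarrow> 'g \<Rightarrow> 'z mpoly \<Rightarrow> 'z mpoly" where
  "hcomp wt \<gamma> p = (\<Sum>m\<in>{m \<in> Poly_Mapping.keys p. monomial_degree wt m = \<gamma>}. Poly_Mapping.single m (Poly_Mapping.lookup p m))"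

lemma lookup_hcomp: "Poly_Mapping.lookup (hcomp wt \<gamma> p) m = (if monomial_degree wt m = \<gamma> then Poly_Mapping.lookup p m else 0)"
  by (auto simp: hcomp_def lookup_sum lookup_single when_def in_keys_iff sum.delta')

lemma hcomp_homogeneous: "homogeneous wt \<gamma> (hcomp wt \<gamma> p)"
  by (auto simp: homogeneous_def in_keys_iff lookup_hcomp split: if_splits)

lemma hcomp_add: "hcomp wt \<gamma> (p + q) = hcomp wt \<gamma> p + hcomp wt \<gamma> q"
  by (rule poly_mapping_eqI) (simp add: lookup_hcomp lookup_add)

lemma hcomp_zero [simp]: "hcomp wt \<gamma> 0 = 0"
  by (rule poly_mapping_eqI) (simp add: lookup_hcomp)

lemma hcomp_sum: "hcomp wt \<gamma> (\<Sum>i\<in>A. p i) = (\<Sum>i\<in>A. hcomp wt \<gamma> (p i))"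
  by (induction A rule: infinite_finite_induct) (auto simp: hcomp_add)

lemma hcomp_of_homogeneous: "homogeneous wt \<gamma> p ==> hcomp wt \<delta> p = (if \<gamma> = \<delta> then p else 0)"
  by (rule poly_mapping_eqI) (auto simp: lookup_hcomp homogeneous_def in_keys_iff)

lemma sum_hcomp: "(\<Sum>\<gamma>\<in>monomial_degree wt ` Poly_Mapping.keys p. hcomp wt \<gamma> p) = p"
  by (rule poly_mapping_eqI) (auto simp: lookup_sum lookup_hcomp sum.delta image_iff in_keys_iff)

text \<open>Decompose q: multiplying by p moves each component by \<gamma>, so just the one of
  degree \<delta> - \<gamma> arrives in degree \<delta>.\<close>

lemma hcomp_mult:
  fixes wt :: "'z::finite \<Rightarrow> 'g::ab_group_add"
  assumes p: "homogeneous wt \<gamma> p"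
  shows "hcomp wt \<delta> (p * q) = p * hcomp wt (\<delta> - \<gamma>) q"
proof -
  let ?D = "monomial_degree wt ` Poly_Mapping.keys q"
  have "hcomp wt \<delta> (p * q) = hcomp wt \<delta> (\<Sum>\<epsilon>\<in>?D. p * hcomp wt \<epsilon> q)"
    by (simp add: sum_distrib_left[symmetric] sum_hcomp)
  also have "\<dots> = (\<Sum>\<epsilon>\<in>?D. if \<epsilon> = \<delta> - \<gamma> then p * hcomp wt \<epsilon> q else 0)"
    unfolding hcomp_sum
    by (intro sum.cong refl) (auto simp: hcomp_of_homogeneous[OF homogeneous_mult[OF p hcomp_homogeneous]])
  also have "\<dots> = p * hcomp wt (\<delta> - \<gamma>) q"
  proof (cases "\<delta> - \<gamma> \<in> ?D")
    case False
    then have "hcomp wt (\<delta> - \<gamma>) q = 0"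
      by (intro poly_mapping_eqI) (simp add: lookup_hcomp, metis image_eqI in_keys_iff)
    then show ?thesis using False by (simp add: sum.delta)
  qed (simp add: sum.delta)
  finally show ?thesis .
qed

subsection \<open>Renaming variables\<close>

definition rename_mon :: "('z::finite \<Rightarrow> 'w) \<Rightarrow> ('z \<Rightarrow>\<^sub>0 nat) \<Rightarrow> 'w \<Rightarrow>\<^sub>0 nat" where
  "rename_mon e m = (\<Sum>i\<in>UNIV. Poly_Mapping.single (e i) (Poly_Mapping.lookup m i))"

lemma lookup_rename_mon: "inj e ==> Poly_Mapping.lookup (rename_mon e m) (e j) = Poly_Mapping.lookup m j"
  by (auto simp: rename_mon_def lookup_sum lookup_single when_def inj_eq sum.delta)

lemma lookup_rename_mon_notin: "j \<notin> range e ==> Poly_Mapping.lookup (rename_mon e m) j = 0"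
  by (auto simp: rename_mon_def lookup_sum lookup_single when_def intro!: sum.neutral)

lemma inj_rename_mon: "inj e ==> inj (rename_mon e)"
  by (rule injI, rule poly_mapping_eqI) (metis lookup_rename_mon)

lemma mvar_power: "mvar i ^ n = Poly_Mapping.single (Poly_Mapping.single i n) 1"
  by (induction n) (auto simp: mvar_def mult_single single_add[symmetric])

lemma prod_single: "(\<Prod>i\<in>A. Poly_Mapping.single (f i) (1::complex)) = Poly_Mapping.single (\<Sum>i\<in>A. f i) 1"
  by (induction A rule: infinite_finite_induct) (auto simp: mult_single)

lemma psubst_rename:
  "psubst (\<lambda>i. mvar (e i)) p = (\<Sum>m\<in>Poly_Mapping.keys p. Poly_Mapping.single (rename_mon e m) (Poly_Mapping.lookup p m))"
  unfolding mpoly_subst_def mvar_power prod_single rename_mon_def by (simp add: mult_single)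

lemma lookup_psubst_rename:
  assumes "inj e"
  shows "Poly_Mapping.lookup (psubst (\<lambda>i. mvar (e i)) p) (rename_mon e m) = Poly_Mapping.lookup p m"
  unfolding psubst_rename
  by (auto simp: lookup_sum lookup_single when_def inj_eq[OF inj_rename_mon[OF assms]] in_keys_iff sum.delta')

text \<open>Rename the variables injectively by natural numbers. There the exponents carry a linear
  order compatible with addition, so that leading terms multiply; renaming is injective on
  polynomials.\<close>

lemma mpoly_no_zero_divisors:
  fixes p q :: "'z::finite mpoly"
  assumes "p * q = 0"
  shows "p = 0 \<or> q = 0"
proof -
  obtain n and e :: "'z \<Rightarrow> nat" where e: "inj e" using finite_imp_inj_to_nat_seg[of "UNIV :: 'z set"] by auto
  let ?r = "psubst (\<lambda>i. mvar (e i))"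
  have "?r p * ?r q = 0" using assms by (simp add: psubst_mult[symmetric])
  then have "?r p = 0 \<or> ?r q = 0" by simp
  moreover have "x = 0" if "?r x = 0" for x
    using lookup_psubst_rename[OF e, of x] that by (intro poly_mapping_eqI) simp
  ultimately show ?thesis by blast
qed

lemma mpoly_mult_cancel:
  fixes p q r :: "'z::finite mpoly"
  shows "p \<noteq> 0 ==> p * q = p * r ==> q = r"
  using mpoly_no_zero_divisors[of p "q - r"] by (auto simp: right_diff_distrib)

text \<open>A monomial of the product determines its two factors, as the sets of variables are
  disjoint; hence nothing cancels.\<close>

lemma lookup_separated_product:
  fixes p b :: "'v::finite mpoly"
  shows "Poly_Mapping.lookup (psubst (\<lambda>i. mvar (Inl i)) p * psubst (\<lambda>i. mvar (Inr i)) b)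
    (rename_mon (Inl :: 'v \<Rightarrow> 'v + 'v) m + rename_mon Inr m') = Poly_Mapping.lookup p m * Poly_Mapping.lookup b m'"
proof -
  have eq: "rename_mon (Inl :: 'v \<Rightarrow> 'v + 'v) m1 + rename_mon Inr m2 = rename_mon Inl m + rename_mon Inr m' \<longleftrightarrow> m1 = m \<and> m2 = m'"
    for m1 m2
  proof
    assume e: "rename_mon (Inl :: 'v \<Rightarrow> 'v + 'v) m1 + rename_mon Inr m2 = rename_mon Inl m + rename_mon Inr m'"
    have n: "Inl a \<notin> range (Inr :: 'v \<Rightarrow> 'v + 'v)" "Inr a \<notin> range (Inl :: 'v \<Rightarrow> 'v + 'v)" for a :: 'v by auto
    have "Poly_Mapping.lookup m1 v = Poly_Mapping.lookup m v" for v
      using arg_cong[OF e, of "\<lambda>x. Poly_Mapping.lookup x (Inl v)"]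
      by (simp add: lookup_add lookup_rename_mon lookup_rename_mon_notin n)
    moreover have "Poly_Mapping.lookup m2 v = Poly_Mapping.lookup m' v" for v
      using arg_cong[OF e, of "\<lambda>x. Poly_Mapping.lookup x (Inr v)"]
      by (simp add: lookup_add lookup_rename_mon lookup_rename_mon_notin n)
    ultimately show "m1 = m \<and> m2 = m'" by (auto intro: poly_mapping_eqI)
  qed auto
  have "psubst (\<lambda>i. mvar (Inl i)) p * psubst (\<lambda>i. mvar (Inr i)) b =
    (\<Sum>m1\<in>Poly_Mapping.keys p. \<Sum>m2\<in>Poly_Mapping.keys b.
      Poly_Mapping.single (rename_mon (Inl :: 'v \<Rightarrow> 'v + 'v) m1 + rename_mon Inr m2) (Poly_Mapping.lookup p m1 * Poly_Mapping.lookup b m2))"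
    unfolding psubst_rename sum_product by (simp add: mult_single)
  then have "Poly_Mapping.lookup (psubst (\<lambda>i. mvar (Inl i)) p * psubst (\<lambda>i. mvar (Inr i)) b)
      (rename_mon (Inl :: 'v \<Rightarrow> 'v + 'v) m + rename_mon Inr m') =
    (\<Sum>m1\<in>Poly_Mapping.keys p. \<Sum>m2\<in>Poly_Mapping.keys b.
      if m1 = m then (if m2 = m' then Poly_Mapping.lookup p m1 * Poly_Mapping.lookup b m2 else 0) else 0)"
    by (simp add: lookup_sum lookup_single when_def eq) (intro sum.cong refl, auto)
  also have "\<dots> = (\<Sum>m1\<in>Poly_Mapping.keys p. if m1 = m then Poly_Mapping.lookup p m1 * Poly_Mapping.lookup b m' else 0)"
    by (intro sum.cong refl) (auto simp: in_keys_iff sum.delta)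
  also have "\<dots> = Poly_Mapping.lookup p m * Poly_Mapping.lookup b m'"
    by (auto simp: in_keys_iff sum.delta)
  finally show ?thesis .
qed

text \<open>Linear independence over the constants.\<close>

definition independent_polys :: "'v mpoly set \<Rightarrow> bool" where
  "independent_polys B \<longleftrightarrow> finite B \<and> (\<forall>c. (\<Sum>b\<in>B. const (c b) * b) = 0 \<longrightarrow> (\<forall>b\<in>B. c b = 0))"

text \<open>The coefficients of a fixed monomial m of the first copy form a linear relation between
  the elements of B over the constants. So linear independence over the constants becomes
  independence over the polynomials in separate variables, the source of freeness below.\<close>

lemma independent_separated:
  fixes B :: "'v::finite mpoly set"
  assumes B: "independent_polys B"
    and sum: "(\<Sum>b\<in>B. psubst (\<lambda>i. mvar (Inl i)) (p b) * psubst (\<lambda>i. mvar (Inr i)) b) = (0 :: ('v + 'v) mpoly)" and b: "b \<in> B"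
  shows "p b = 0"
proof (rule poly_mapping_eqI)
  fix m
  have "(\<Sum>b\<in>B. const (Poly_Mapping.lookup (p b) m) * b) = 0"
  proof (rule poly_mapping_eqI)
    fix m'
    have c: "Poly_Mapping.lookup (const c * q) m' = c * Poly_Mapping.lookup q m'" for c and q :: "'v mpoly"
    proof (induction q rule: poly_mapping_additive_induct)
      case (single k a)
      show ?case by (simp add: mult_single lookup_single when_def)
    qed (simp add: distrib_left lookup_add)
    have "Poly_Mapping.lookup 0 (rename_mon Inl m + rename_mon Inr m') = Poly_Mapping.lookup (\<Sum>b\<in>B. psubst (\<lambda>i. mvar (Inl i)) (p b) * psubst (\<lambda>i. mvar (Inr i)) b)
        (rename_mon (Inl :: 'v \<Rightarrow> 'v + 'v) m + rename_mon Inr m')" by (simp only: sum)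
    also have "\<dots> = (\<Sum>b\<in>B. Poly_Mapping.lookup (p b) m * Poly_Mapping.lookup b m')"
      by (simp add: lookup_sum lookup_separated_product)
    finally show "Poly_Mapping.lookup (\<Sum>b\<in>B. const (Poly_Mapping.lookup (p b) m) * b) m' = Poly_Mapping.lookup 0 m'"
      by (simp add: lookup_sum c)
  qed
  with B have "\<forall>b\<in>B. Poly_Mapping.lookup (p b) m = 0"
    unfolding independent_polys_def by (elim conjE allE[of _ "\<lambda>b. Poly_Mapping.lookup (p b) m"] impE)
  with b show "Poly_Mapping.lookup (p b) m = Poly_Mapping.lookup 0 m" by simp
qed

text \<open>Take a spanning subset of least cardinality: a nontrivial relation could be solved for
  one of its elements, which could then be dropped.\<close>

lemma independent_subset:
  fixes B :: "'v::finite mpoly set"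
  assumes "finite B"
  shows "\<exists>B'\<subseteq>B. independent_polys B' \<and> (\<forall>b\<in>B. \<exists>c. b = (\<Sum>a\<in>B'. const (c a) * a))"
proof -
  define Q where "Q = (\<lambda>B'. B' \<subseteq> B \<and> (\<forall>b\<in>B. \<exists>c. b = (\<Sum>a\<in>B'. const (c a) * a)))"
  have "Q B"
    unfolding Q_def
  proof (intro conjI ballI subset_refl)
    fix b assume b: "b \<in> B"
    have "(\<Sum>a\<in>B. const (if a = b then 1 else 0) * a) = (\<Sum>a\<in>B. if a = b then a else 0)"
      by (intro sum.cong) auto
    also have "\<dots> = b" using b assms by (simp add: sum.delta)
    finally show "\<exists>c. b = (\<Sum>a\<in>B. const (c a) * a)" by (intro exI[of _ "\<lambda>a. if a = b then 1 else 0"]) (rule HOL.sym, assumption)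
  qed
  then obtain B' where B': "Q B'" and min: "\<And>C. Q C ==> card B' \<le> card C"
    using exists_least_iff[of "\<lambda>n. \<exists>C. Q C \<and> card C = n"] by (metis leI)
  have fin: "finite B'" using B' assms finite_subset by (auto simp: Q_def)
  have "independent_polys B'"
    unfolding independent_polys_def
  proof (intro conjI allI impI ballI fin)
    fix c b assume z: "(\<Sum>a\<in>B'. const (c a) * a) = 0" and b: "b \<in> B'"
    show "c b = 0"
    proof (rule ccontr)
      assume cb: "c b \<noteq> 0"
      have "const (c b) * b + (\<Sum>a\<in>B' - {b}. const (c a) * a) = 0" using z fin b by (simp add: sum.remove)
      then have n: "const (c b) * b = - (\<Sum>a\<in>B' - {b}. const (c a) * a)"
        by (simp only: eq_neg_iff_add_eq_0)
      have "const (1 / c b) * const (c b) = (1 :: 'v mpoly)" using cb by (simp add: mult_single)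
      then have "b = const (1 / c b) * (const (c b) * b)" by (simp only: mult.assoc[symmetric] mult_1_left)
      also have "\<dots> = (\<Sum>a\<in>B' - {b}. - (const (1 / c b) * const (c a) * a))"
        unfolding n by (simp add: sum_distrib_left sum_negf mult.assoc)
      also have "\<dots> = (\<Sum>a\<in>B' - {b}. const (- c a / c b) * a)"
        by (intro sum.cong HOL.refl) (simp add: mult_single single_uminus)
      finally have b_eq: "b = (\<Sum>a\<in>B' - {b}. const (- c a / c b) * a)" .
      have "Q (B' - {b})"
        unfolding Q_def
      proof (intro conjI ballI)
        show "B' - {b} \<subseteq> B" using B' by (auto simp: Q_def)
        fix x assume "x \<in> B"
        then obtain e where e: "x = (\<Sum>a\<in>B'. const (e a) * a)" using B' by (auto simp: Q_def)
        have "x = const (e b) * b + (\<Sum>a\<in>B' - {b}. const (e a) * a)" using fin b by (simp add: e sum.remove)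
        also have "const (e b) * b = (\<Sum>a\<in>B' - {b}. const (e b * (- c a / c b)) * a)"
          by (subst b_eq) (simp add: sum_distrib_left mult.assoc[symmetric] mult_single)
        finally have "x = (\<Sum>a\<in>B' - {b}. const (e b * (- c a / c b) + e a) * a)"
          by (simp only: sum.distrib[symmetric] single_add distrib_right)
        then show "\<exists>c. x = (\<Sum>a\<in>B' - {b}. const (c a) * a)"
          by (rule exI[of _ "\<lambda>a. e b * (- c a / c b) + e a"])
      qed
      from min[OF this] show False using card_Diff1_less[OF fin b] by simp
    qed
  qed
  then show ?thesis using B' by (auto simp: Q_def)
qed

section \<open>The coordinate ring of a hypersurface and its modules\<close>

abbreviation poly_ring :: "'w mpoly ring" where "poly_ring \<equiv> ring_of_type_algebra"

text \<open>The polynomial ring over itself with a dummy grading; it serves to apply spans and the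
  basis theorem to sets of polynomials.\<close>

definition poly_module :: "(unit, 'w mpoly, 'w mpoly) gmod" where
  "poly_module = \<lparr>carrier = UNIV, monoid.mult = undefined, one = undefined, ring.zero = 0, add = (+),
     smult = (*), gcomp = \<lambda>_. UNIV\<rparr>"

lemma poly_ops [simp]:
  "carrier poly_ring = UNIV" "x \<oplus>\<^bsub>poly_ring\<^esub> y = x + y" "x \<otimes>\<^bsub>poly_ring\<^esub> y = x * y" "\<one>\<^bsub>poly_ring\<^esub> = 1" "\<zero>\<^bsub>poly_ring\<^esub> = 0"
  "carrier poly_module = UNIV" "x \<oplus>\<^bsub>poly_module\<^esub> y = x + y" "x \<odot>\<^bsub>poly_module\<^esub> y = x * y" "\<zero>\<^bsub>poly_module\<^esub> = 0"
  by (simp_all add: ring_of_type_algebra_def poly_module_def)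

interpretation U: Module.module "poly_ring :: 'w mpoly ring" poly_module
  rewrites "carrier poly_ring = UNIV" and "carrier poly_module = UNIV"
proof -
  show "Module.module (poly_ring :: 'w mpoly ring) poly_module"
  proof (rule Module.moduleI)
    show "abelian_group (poly_module :: (unit, 'w mpoly, 'w mpoly) gmod)"
      by (rule abelian_groupI) (auto simp: add_ac intro: exI[of _ "- x" for x])
  qed (auto simp: algebra_simps cring_from_type_algebra)
qed auto

lemma poly_ring_neg [simp]: "\<ominus>\<^bsub>poly_ring\<^esub> x = - x"
proof -
  have "\<ominus>\<^bsub>poly_ring\<^esub> x + x = 0" using U.R.l_neg[of x] by simp
  then show ?thesis by (simp add: eq_neg_iff_add_eq_0)
qed

lemma poly_ring_pow [simp]: "x [^]\<^bsub>poly_ring\<^esub> (n::nat) = x ^ n"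
  by (induction n) (auto simp: mult.commute)

abbreviation uspan :: "'w mpoly set \<Rightarrow> 'w mpoly set \<Rightarrow> 'w mpoly set" where
  "uspan Z B \<equiv> scalar_span Z poly_module B"

lemma uspan_intros: "0 \<in> uspan Z B" "b \<in> B ==> b \<in> uspan Z B"
  "s \<in> uspan Z B ==> t \<in> uspan Z B ==> s + t \<in> uspan Z B" "z \<in> Z ==> t \<in> uspan Z B ==> z * t \<in> uspan Z B"
  using scalar_span.intros[where M = poly_module] by auto

lemma uspan_induct [consumes 1, case_names zero base add smult]:
  assumes "t \<in> uspan Z B" "P 0" "\<And>b. b \<in> B ==> P b" "\<And>s t. P s ==> P t ==> P (s + t)"
    "\<And>z t. z \<in> Z ==> P t ==> P (z * t)"
  shows "P t"
  using assms(1) by (induction rule: scalar_span.induct) (auto simp: assms)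

lemma poly_noetherian: "finite Y ==> U.scalar_noetherian (Y \<union> range const)" for Y :: "'w mpoly set"
proof (rule U.noetherian_union)
  show "U.scalar_noetherian (range const :: 'w mpoly set)"
  proof (rule U.noetherian_field)
    show "\<exists>b\<in>range const. b \<otimes>\<^bsub>poly_ring\<^esub> a = \<one>\<^bsub>poly_ring\<^esub>"
      if a: "a \<in> range const" "a \<noteq> \<zero>\<^bsub>poly_ring\<^esub>" for a :: "'w mpoly"
    proof -
      obtain c where c: "a = const c" using a by blast
      with a have "c \<noteq> 0" by auto
      then have "const (1 / c) * a = 1" by (simp add: c mult_single)
      then show ?thesis by auto
    qed
    show "\<ominus>\<^bsub>poly_ring\<^esub> \<one>\<^bsub>poly_ring\<^esub> \<in> (range const :: 'w mpoly set)"
      by (rule range_eqI[of _ _ "- 1"]) (simp add: single_uminus)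
  qed (auto simp: mult_single single_add[symmetric] intro: range_eqI[of _ _ 0])
  show "\<ominus>\<^bsub>poly_ring\<^esub> \<one>\<^bsub>poly_ring\<^esub> \<in> (range const :: 'w mpoly set)"
    by (rule range_eqI[of _ _ "- 1"]) (simp add: single_uminus)
qed auto

definition residue :: "'v mpoly \<Rightarrow> 'v mpoly \<Rightarrow> 'v mpoly set" where
  "residue W p = (PIdl\<^bsub>poly_ring\<^esub> W) +>\<^bsub>poly_ring\<^esub> p"

text \<open>The hypersurface ring for arbitrary weights and an arbitrary polynomial in a single set
  of variables; \<open>hypersurface_ring_eq\<close> matches it with the ring of the
  statement.\<close>

definition quotient_ring :: "('v \<Rightarrow> 'g::comm_monoid_add) \<Rightarrow> 'v mpoly \<Rightarrow> ('g, 'v mpoly set) gring" where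
  "quotient_ring wt W = ring.extend (poly_ring Quot (PIdl\<^bsub>poly_ring\<^esub> W))
     \<lparr>rcomp = \<lambda>\<gamma>. residue W ` {p. homogeneous wt \<gamma> p}\<rparr>"

lemma residue_alt: "residue W p = range (\<lambda>r. W * r + p)"
  by (auto simp: residue_def a_r_coset_def' cgenideal_def mult.commute)

lemma residue_eq: "residue W p = residue W q \<longleftrightarrow> (\<exists>r. p - q = W * r)"
proof
  assume "residue W p = residue W q"
  then have "W * 0 + p \<in> range (\<lambda>r. W * r + q)" unfolding residue_alt by blast
  then show "\<exists>r. p - q = W * r" by (auto simp: algebra_simps)
next
  assume "\<exists>r. p - q = W * r"
  then obtain r where r: "p = W * r + q" by (auto simp: algebra_simps)
  have "W * s + p = W * (s + r) + q" "W * s + q = W * (s - r) + p" for s by (auto simp: r algebra_simps)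
  then show "residue W p = residue W q" unfolding residue_alt by blast
qed

lemma quotient_ring_ops:
  fixes W :: "'v mpoly" and wt :: "'v \<Rightarrow> 'g::ab_group_add"
  defines "S \<equiv> quotient_ring wt W"
  shows "carrier S = range (residue W)" "residue W p \<oplus>\<^bsub>S\<^esub> residue W q = residue W (p + q)"
    "residue W p \<otimes>\<^bsub>S\<^esub> residue W q = residue W (p * q)" "\<one>\<^bsub>S\<^esub> = residue W 1" "\<zero>\<^bsub>S\<^esub> = residue W 0"
    "rcomp S \<gamma> = residue W ` {p. homogeneous wt \<gamma> p}"
proof -
  interpret I: ideal "PIdl\<^bsub>poly_ring\<^esub> W" poly_ring
    by (rule U.cgenideal_ideal) simp
  have h: "residue W \<in> ring_hom poly_ring (poly_ring Quot (PIdl\<^bsub>poly_ring\<^esub> W))"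
    using I.rcos_ring_hom by (simp add: residue_def[abs_def])
  show "residue W p \<oplus>\<^bsub>S\<^esub> residue W q = residue W (p + q)"
    "residue W p \<otimes>\<^bsub>S\<^esub> residue W q = residue W (p * q)" "\<one>\<^bsub>S\<^esub> = residue W 1"
    using ring_hom_add[OF h, of p q] ring_hom_mult[OF h, of p q] ring_hom_one[OF h]
    by (simp_all add: S_def quotient_ring_def ring.defs)
  show "carrier S = range (residue W)" "\<zero>\<^bsub>S\<^esub> = residue W 0" "rcomp S \<gamma> = residue W ` {p. homogeneous wt \<gamma> p}"
    by (auto simp: S_def quotient_ring_def ring.defs FactRing_def A_RCOSETS_def' residue_def residue_alt[unfolded residue_def]
        cgenideal_def a_r_coset_def' mult.commute)
qed

lemma graded_base_quotient_ring:
  fixes W :: "'v mpoly" and wt :: "'v \<Rightarrow> 'g::ab_group_add"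
  shows "graded_base (quotient_ring wt W)"
proof -
  note ops = quotient_ring_ops[of wt W]
  have "cring (quotient_ring wt W)"
  proof (rule cringI)
    show "abelian_group (quotient_ring wt W)"
    proof (rule abelian_groupI)
      show "\<exists>y\<in>carrier (quotient_ring wt W). y \<oplus>\<^bsub>quotient_ring wt W\<^esub> x = \<zero>\<^bsub>quotient_ring wt W\<^esub>"
        if x: "x \<in> carrier (quotient_ring wt W)" for x
      proof -
        obtain p where "x = residue W p" using x ops(1) by auto
        then show ?thesis by (intro bexI[of _ "residue W (- p)"]) (simp_all add: ops)
      qed
    qed (auto simp: ops add_ac)
    show "Group.comm_monoid (quotient_ring wt W)" by (rule comm_monoidI) (auto simp: ops mult_ac)
  qed (auto simp: ops algebra_simps)
  then show ?thesis by (rule graded_base.intro) (unfold_locales, auto simp: ops)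
qed

text \<open>There are countably many monomials, so a polynomial is a sequence of coefficients; each
  coefficient is stored as a constant polynomial.\<close>

lemma enumerable_polys: "\<exists>f :: ('w::finite) mpoly \<Rightarrow> nat \<Rightarrow> 'v mpoly. inj f"
proof -
  let ?n = "\<lambda>m :: 'w \<Rightarrow>\<^sub>0 nat. to_nat (Poly_Mapping.lookup m)"
  have "inj ?n" by (rule injI) (simp add: lookup_inject)
  then have n: "inv_into UNIV ?n (?n m) = m" for m by (rule inv_f_f)
  show ?thesis
  proof (intro exI injI poly_mapping_eqI)
    fix p q :: "'w mpoly" and m
    assume "(\<lambda>k. const (Poly_Mapping.lookup p (inv_into UNIV ?n k)) :: 'v mpoly) = (\<lambda>k. const (Poly_Mapping.lookup q (inv_into UNIV ?n k)))"
    from fun_cong[OF this, of "?n m"] show "Poly_Mapping.lookup p m = Poly_Mapping.lookup q m"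
      unfolding n by (metis lookup_single_eq)
  qed
qed

text \<open>Codes polynomials in the doubled variables, so that sets of them become elements of the
  carrier type used in the statement.\<close>

definition enc :: "('w::finite) mpoly \<Rightarrow> nat \<Rightarrow> 'v mpoly" where
  "enc = (SOME f. inj f)"

lemma inj_enc: "inj enc"
  unfolding enc_def using someI_ex[OF enumerable_polys] .

text \<open>A disjoint union: sequences are prefixed with 0 or 1 to mark their origin. This is the
  injection of pairs that \<open>cplx_setting\<close> asks for.\<close>

definition set_pair :: "(nat \<Rightarrow> 'v mpoly) set \<times> (nat \<Rightarrow> 'v mpoly) set \<Rightarrow> (nat \<Rightarrow> 'v mpoly) set" where
  "set_pair X = case_nat 0 ` fst X \<union> case_nat 1 ` snd X"

lemma inj_set_pair: "inj set_pair"
proof (rule injI)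
  fix X Y :: "(nat \<Rightarrow> 'v mpoly) set \<times> (nat \<Rightarrow> 'v mpoly) set"
  assume e: "set_pair X = set_pair Y"
  have c: "case_nat a f = case_nat b g \<longleftrightarrow> a = b \<and> f = g" for a b and f g :: "nat \<Rightarrow> 'v mpoly"
    by (auto simp: fun_eq_iff split: nat.splits)
  have "fst Z = {f. case_nat 0 f \<in> set_pair Z}" "snd Z = {f. case_nat 1 f \<in> set_pair Z}"
    for Z :: "(nat \<Rightarrow> 'v mpoly) set \<times> (nat \<Rightarrow> 'v mpoly) set"
    by (auto simp: set_pair_def c image_iff)
  with e show "X = Y" by (metis prod_eqI)
qed

text \<open>\<open>W_nonzero\<close> makes multiplication by \<open>W\<close> injective on
  polynomials; \<open>\<delta>_nonzero\<close> excludes a constant term of \<open>W\<close> and so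
  keeps the quotient ring nonzero.\<close>

locale hypersurface =
  fixes wt :: "'v::finite \<Rightarrow> 'g::ab_group_add" and W :: "'v mpoly" and \<delta> :: 'g
  assumes W_homogeneous: "homogeneous wt \<delta> W" and W_nonzero: "W \<noteq> 0" and \<delta>_nonzero: "\<delta> \<noteq> 0"
begin

abbreviation S :: "('g, 'v mpoly set) gring" where "S \<equiv> quotient_ring wt W"
abbreviation rc :: "'v mpoly \<Rightarrow> 'v mpoly set" where "rc \<equiv> residue W"

sublocale graded_base S by (rule graded_base_quotient_ring)

lemmas S_ops = quotient_ring_ops[of wt W]

text \<open>Two copies of the variables: the first is the module variable acted on by the ring, the
  second is only a parameter; in \<open>act V\<close> the ring variables in \<open>V\<close> act through the second copy.\<close>

definition wtU :: "'v + 'v \<Rightarrow> 'g" where "wtU = case_sum wt wt"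

definition dvar :: "'v set \<Rightarrow> 'v \<Rightarrow> ('v + 'v) mpoly" where
  "dvar V v = (if v \<in> V then mvar (Inr v) else mvar (Inl v))"

abbreviation act :: "'v set \<Rightarrow> 'v mpoly \<Rightarrow> ('v + 'v) mpoly" where "act V \<equiv> psubst (dvar V)"

lemma homogeneous_dvar: "homogeneous wtU (wt v) (dvar V v)"
  using homogeneous_var[of wtU "Inl v"] homogeneous_var[of wtU "Inr v"] by (simp add: dvar_def wtU_def)

lemma homogeneous_act: "homogeneous wt \<gamma> p ==> homogeneous wtU \<gamma> (act V p)"
  by (rule homogeneous_psubst[OF homogeneous_dvar])

text \<open>Graded submodules for the action \<open>act V\<close>. They need not be ideals of the
  doubled ring: multiplication by the variables through which nothing acts may lead out.\<close>

definition graded_subspace :: "'v set \<Rightarrow> ('v + 'v) mpoly set \<Rightarrow> bool" where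
  "graded_subspace V T \<longleftrightarrow> 0 \<in> T \<and> (\<forall>s\<in>T. \<forall>t\<in>T. s + t \<in> T) \<and> (\<forall>p. \<forall>t\<in>T. act V p * t \<in> T) \<and>
     (\<forall>\<gamma>. \<forall>t\<in>T. hcomp wtU \<gamma> t \<in> T)"

lemma graded_subspaceD:
  assumes "graded_subspace V T"
  shows "0 \<in> T" "s \<in> T ==> t \<in> T ==> s + t \<in> T" "t \<in> T ==> act V p * t \<in> T" "t \<in> T ==> hcomp wtU \<gamma> t \<in> T"
    "t \<in> T ==> - t \<in> T" "s \<in> T ==> t \<in> T ==> s - t \<in> T"
proof -
  show *: "0 \<in> T" "s \<in> T ==> t \<in> T ==> s + t \<in> T" "t \<in> T ==> act V p * t \<in> T" "t \<in> T ==> hcomp wtU \<gamma> t \<in> T"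
    for s t p using assms by (auto simp: graded_subspace_def)
  show m: "- t \<in> T" if t: "t \<in> T" for t using *(3)[OF t, of "- 1"] by (simp add: psubst_uminus)
  show "s \<in> T ==> t \<in> T ==> s - t \<in> T" using *(2)[of s "- t"] m[of t] by simp
qed

text \<open>\<open>M\<close> is the module \<open>(T / N)(- q)\<close>, where \<open>\<theta>\<close> is the quotient map.\<close>

definition presented :: "'v set \<Rightarrow> 'g \<Rightarrow> ('v + 'v) mpoly set \<Rightarrow> ('v + 'v) mpoly set \<Rightarrow>
    (('v + 'v) mpoly \<Rightarrow> 'b) \<Rightarrow> ('g, 'v mpoly set, 'b) gmod \<Rightarrow> bool" where
  "presented V q T N \<theta> M \<longleftrightarrow> graded_subspace V T \<and> graded_subspace V N \<and> N \<subseteq> T \<and>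
     carrier M = \<theta> ` T \<and> \<zero>\<^bsub>M\<^esub> = \<theta> 0 \<and> (\<forall>s\<in>T. \<forall>t\<in>T. \<theta> s \<oplus>\<^bsub>M\<^esub> \<theta> t = \<theta> (s + t)) \<and>
     (\<forall>p. \<forall>t\<in>T. rc p \<odot>\<^bsub>M\<^esub> \<theta> t = \<theta> (act V p * t)) \<and>
     (\<forall>\<gamma>. gcomp M \<gamma> = \<theta> ` {t \<in> T. homogeneous wtU (\<gamma> + q) t}) \<and>
     (\<forall>s\<in>T. \<forall>t\<in>T. \<theta> s = \<theta> t \<longleftrightarrow> s - t \<in> N)"

lemma presentedD:
  assumes "presented V q T N \<theta> M"
  shows "graded_subspace V T" "graded_subspace V N" "N \<subseteq> T"
    "carrier M = \<theta> ` T" "\<zero>\<^bsub>M\<^esub> = \<theta> 0" "s \<in> T ==> t \<in> T ==> \<theta> s \<oplus>\<^bsub>M\<^esub> \<theta> t = \<theta> (s + t)"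
    "t \<in> T ==> rc p \<odot>\<^bsub>M\<^esub> \<theta> t = \<theta> (act V p * t)" "gcomp M \<gamma> = \<theta> ` {t \<in> T. homogeneous wtU (\<gamma> + q) t}"
    "s \<in> T ==> t \<in> T ==> \<theta> s = \<theta> t \<longleftrightarrow> s - t \<in> N" "t \<in> T ==> \<theta> t = \<zero>\<^bsub>M\<^esub> \<longleftrightarrow> t \<in> N"
proof -
  show *: "graded_subspace V T" "graded_subspace V N" "N \<subseteq> T"
    "carrier M = \<theta> ` T" "\<zero>\<^bsub>M\<^esub> = \<theta> 0" "s \<in> T ==> t \<in> T ==> \<theta> s \<oplus>\<^bsub>M\<^esub> \<theta> t = \<theta> (s + t)"
    "t \<in> T ==> rc p \<odot>\<^bsub>M\<^esub> \<theta> t = \<theta> (act V p * t)" "gcomp M \<gamma> = \<theta> ` {t \<in> T. homogeneous wtU (\<gamma> + q) t}"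
    "s \<in> T ==> t \<in> T ==> \<theta> s = \<theta> t \<longleftrightarrow> s - t \<in> N" for s t p
    using assms unfolding presented_def by (elim conjE; simp)+
  show "t \<in> T ==> \<theta> t = \<zero>\<^bsub>M\<^esub> \<longleftrightarrow> t \<in> N"
    using *(9)[of t 0] graded_subspaceD(1)[OF *(1)] by (simp add: *(5))
qed

lemma presented_module:
  assumes P: "presented V q T N \<theta> M"
  shows "Module.module S M"
proof -
  note p = presentedD[OF P] and T = graded_subspaceD[OF presentedD(1)[OF P]]
  show ?thesis
  proof (rule Module.moduleI)
    show "abelian_group M"
    proof (rule abelian_groupI)
      show "\<exists>y\<in>carrier M. y \<oplus>\<^bsub>M\<^esub> x = \<zero>\<^bsub>M\<^esub>" if x: "x \<in> carrier M" for x
      proof -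
        obtain t where t: "x = \<theta> t" "t \<in> T" using x p(4) by auto
        then show ?thesis by (intro bexI[of _ "\<theta> (- t)"]) (simp_all add: p(4,5,6) T(5))
      qed
    qed (auto simp: p(4,5,6) T add_ac)
  qed (auto simp: S_ops p(4,5,6,7) T psubst_add psubst_mult distrib_left distrib_right mult.assoc is_cring)
qed

lemma presented_finsum:
  assumes P: "presented V q T N \<theta> M" and "finite F" "\<And>i. i \<in> F ==> f i \<in> T"
  shows "finsum M (\<lambda>i. \<theta> (f i)) F = \<theta> (\<Sum>i\<in>F. f i)" "(\<Sum>i\<in>F. f i) \<in> T"
proof -
  note p = presentedD[OF P] and T = graded_subspaceD[OF presentedD(1)[OF P]]
  interpret M: Module.module S M by (rule presented_module[OF P])
  have "finsum M (\<lambda>i. \<theta> (f i)) F = \<theta> (\<Sum>i\<in>F. f i) \<and> (\<Sum>i\<in>F. f i) \<in> T"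
    using assms(2,3)
  proof (induction F)
    case (insert i F)
    then have "(\<lambda>i. \<theta> (f i)) \<in> F \<rightarrow> carrier M" "\<theta> (f i) \<in> carrier M" by (auto simp: p(4))
    then show ?case using insert by (simp add: M.finsum_insert p(6) T(2))
  qed (auto simp: p(5) T(1))
  then show "finsum M (\<lambda>i. \<theta> (f i)) F = \<theta> (\<Sum>i\<in>F. f i)" "(\<Sum>i\<in>F. f i) \<in> T" by auto
qed

lemma presented_graded_module:
  assumes P: "presented V q T N \<theta> M"
  shows "graded_module S M"
proof (rule graded_moduleI[OF presented_module[OF P]])
  note p = presentedD[OF P] and T = graded_subspaceD[OF presentedD(1)[OF P]]
    and N = graded_subspaceD[OF presentedD(2)[OF P]]
  interpret M: Module.module S M by (rule presented_module[OF P])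
  show "subgroup (gcomp M \<gamma>) (add_monoid M)" for \<gamma>
  proof (rule add_subgroupI)
    show "\<zero>\<^bsub>M\<^esub> \<in> gcomp M \<gamma>" unfolding p(5,8) using T(1) by auto
    show "\<ominus>\<^bsub>M\<^esub> x \<in> gcomp M \<gamma>" if x: "x \<in> gcomp M \<gamma>" for x
    proof -
      obtain t where t: "x = \<theta> t" "t \<in> T" "homogeneous wtU (\<gamma> + q) t" using x unfolding p(8) by blast
      have "\<theta> (- t) \<oplus>\<^bsub>M\<^esub> x = \<zero>\<^bsub>M\<^esub>" unfolding t(1) p(5) using t(2) T(5) by (simp add: p(6))
      then have "\<ominus>\<^bsub>M\<^esub> x = \<theta> (- t)"
        by (intro M.minus_equality) (use t T(5) in \<open>auto simp: p(4)\<close>)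
      then show ?thesis using t T(5) homogeneous_uminus unfolding p(8) by blast
    qed
    show "x \<oplus>\<^bsub>M\<^esub> y \<in> gcomp M \<gamma>" if "x \<in> gcomp M \<gamma>" "y \<in> gcomp M \<gamma>" for x y
      using that T(2) homogeneous_add unfolding p(8) by (force simp: p(6))
  qed (auto simp: p(4,8))
  show "s \<odot>\<^bsub>M\<^esub> x \<in> gcomp M (\<gamma> + \<epsilon>)" if s: "s \<in> rcomp S \<gamma>" and x: "x \<in> gcomp M \<epsilon>" for s x \<gamma> \<epsilon>
  proof -
    obtain f where f: "s = rc f" "homogeneous wt \<gamma> f" using s unfolding S_ops by blast
    obtain t where t: "x = \<theta> t" "t \<in> T" "homogeneous wtU (\<epsilon> + q) t" using x unfolding p(8) by blast
    have "homogeneous wtU (\<gamma> + (\<epsilon> + q)) (act V f * t)" by (rule homogeneous_mult[OF homogeneous_act[OF f(2)] t(3)])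
    then show ?thesis unfolding p(8) f(1) t(1) p(7)[OF t(2)] using T(3)[OF t(2)] by (auto simp: add.assoc)
  qed
  show "\<exists>F c. finite F \<and> (\<forall>\<gamma>\<in>F. c \<gamma> \<in> gcomp M \<gamma>) \<and> x = finsum M c F" if x: "x \<in> carrier M" for x
  proof -
    obtain t where t: "x = \<theta> t" "t \<in> T" using x p(4) by auto
    let ?D = "monomial_degree wtU ` Poly_Mapping.keys t" and ?h = "\<lambda>\<gamma>. hcomp wtU (\<gamma> + q) t"
    let ?F = "(\<lambda>\<gamma>. \<gamma> - q) ` ?D"
    have "(\<Sum>\<gamma>\<in>?F. ?h \<gamma>) = t"
      using sum_hcomp[of wtU t] by (subst sum.reindex) (auto simp: inj_on_def)
    then have "x = finsum M (\<lambda>\<gamma>. \<theta> (?h \<gamma>)) ?F"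
      using presented_finsum(1)[OF P, of ?F ?h] T(4)[OF t(2)] by (simp add: t(1))
    moreover have "\<theta> (?h \<gamma>) \<in> gcomp M \<gamma>" for \<gamma>
      unfolding p(8) using T(4)[OF t(2)] hcomp_homogeneous by blast
    ultimately show ?thesis by (intro exI[of _ ?F] exI[of _ "\<lambda>\<gamma>. \<theta> (?h \<gamma>)"] conjI ballI) auto
  qed
  show "c \<gamma> = \<zero>\<^bsub>M\<^esub>" if F: "finite F" and c: "\<And>\<gamma>. \<gamma> \<in> F ==> c \<gamma> \<in> gcomp M \<gamma>"
    and z: "finsum M c F = \<zero>\<^bsub>M\<^esub>" and \<gamma>: "\<gamma> \<in> F" for F c \<gamma>
  proof -
    have "\<forall>\<gamma>\<in>F. \<exists>t. t \<in> T \<and> homogeneous wtU (\<gamma> + q) t \<and> c \<gamma> = \<theta> t" using c unfolding p(8) by blast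
    then obtain f where f: "\<And>\<gamma>. \<gamma> \<in> F ==> f \<gamma> \<in> T" "\<And>\<gamma>. \<gamma> \<in> F ==> homogeneous wtU (\<gamma> + q) (f \<gamma>)"
      "\<And>\<gamma>. \<gamma> \<in> F ==> c \<gamma> = \<theta> (f \<gamma>)" by metis
    have "finsum M c F = finsum M (\<lambda>\<gamma>. \<theta> (f \<gamma>)) F"
      by (rule M.finsum_cong') (use f p(4) in auto)
    then have "\<theta> (\<Sum>\<gamma>\<in>F. f \<gamma>) = \<zero>\<^bsub>M\<^esub>" using presented_finsum(1)[OF P F f(1)] z by simp
    then have "(\<Sum>\<gamma>\<in>F. f \<gamma>) \<in> N" using p(10)[OF presented_finsum(2)[OF P F f(1)]] by simp
    \<comment> \<open>The submodule \<open>N\<close> contains the homogeneous components of its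
      elements, and this component of the sum is the single term \<open>f \<gamma>\<close>.\<close>
    then have "hcomp wtU (\<gamma> + q) (\<Sum>\<gamma>\<in>F. f \<gamma>) \<in> N" by (rule N(4))
    also have "hcomp wtU (\<gamma> + q) (\<Sum>\<gamma>\<in>F. f \<gamma>) = (\<Sum>\<epsilon>\<in>F. if \<epsilon> = \<gamma> then f \<gamma> else 0)"
      unfolding hcomp_sum by (intro sum.cong HOL.refl) (auto simp: hcomp_of_homogeneous[OF f(2)])
    also have "\<dots> = f \<gamma>" using F \<gamma> by (simp add: sum.delta)
    finally show ?thesis using f(3)[OF \<gamma>] p(10)[OF f(1)[OF \<gamma>]] by simp
  qed
qed

text \<open>The map is computed on picked representatives; \<open>\<phi>\<close> carries
  \<open>N\<close> into \<open>N'\<close>, so the choice is immaterial.\<close>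

lemma presented_hom:
  assumes P: "presented V q T N \<theta> M" and P': "presented V' q' T' N' \<theta>' M'"
    and \<phi>: "\<And>s t. s \<in> T ==> t \<in> T ==> \<phi> (s + t) = \<phi> s + \<phi> t" "\<And>p t. t \<in> T ==> \<phi> (act V p * t) = act V' p * \<phi> t"
    and T: "\<And>t. t \<in> T ==> \<phi> t \<in> T'" and N: "\<And>t. t \<in> N ==> \<phi> t \<in> N'"
    and hom: "\<And>\<gamma> t. t \<in> T ==> homogeneous wtU (\<gamma> + q) t ==> homogeneous wtU (\<gamma> + q') (\<phi> t)"
  obtains h where "h \<in> gmod_hom S M M'" "\<And>t. t \<in> T ==> h (\<theta> t) = \<theta>' (\<phi> t)"
proof -
  note p = presentedD[OF P] and p' = presentedD[OF P'] and Ts = graded_subspaceD[OF presentedD(1)[OF P]]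
  define h where "h = (\<lambda>x\<in>carrier M. \<theta>' (\<phi> (inv_into T \<theta> x)))"
  have h: "h (\<theta> t) = \<theta>' (\<phi> t)" if t: "t \<in> T" for t
  proof -
    let ?s = "inv_into T \<theta> (\<theta> t)"
    have s: "?s \<in> T" "\<theta> ?s = \<theta> t" using t by (auto intro: inv_into_into f_inv_into_f)
    then have "?s - t \<in> N" using p(9) t by blast
    then have d: "\<phi> (?s - t) \<in> N'" "?s - t \<in> T" using N p(3) by auto
    have "\<phi> ?s = \<phi> (?s - t) + \<phi> t" using \<phi>(1)[OF d(2) t] by simp
    then have "\<theta>' (\<phi> ?s) = \<theta>' (\<phi> t)" using p'(9)[OF T[OF s(1)] T[OF t]] d(1) by simp
    then show ?thesis using t by (simp add: h_def p(4))
  qed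
  show thesis
  proof (rule that[OF _ h])
    show "h \<in> gmod_hom S M M'"
    proof (rule gmod_homI)
      show "h \<in> extensional (carrier M)" by (simp add: h_def)
      show "h x \<in> carrier M'" if "x \<in> carrier M" for x
        using that T by (auto simp: p(4) p'(4) h)
      show "h (x \<oplus>\<^bsub>M\<^esub> y) = h x \<oplus>\<^bsub>M'\<^esub> h y" if "x \<in> carrier M" "y \<in> carrier M" for x y
        using that by (auto simp: p(4,6) p'(6) h Ts \<phi>(1) T)
      show "h (s \<odot>\<^bsub>M\<^esub> x) = s \<odot>\<^bsub>M'\<^esub> h x" if "s \<in> carrier S" "x \<in> carrier M" for s x
        using that by (auto simp: S_ops p(4,7) p'(7) h Ts \<phi>(2) T)
      show "h x \<in> gcomp M' \<gamma>" if "x \<in> gcomp M \<gamma>" for x \<gamma>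
        using that T hom by (auto simp: p(8) p'(8) h)
    qed
  qed
qed

definition dvars :: "'v set \<Rightarrow> ('v + 'v) mpoly set" where
  "dvars V = range (dvar V) \<union> range const"

lemma presented_fin_gen:
  assumes P: "presented V q T N \<theta> M" and B: "finite B" "B \<subseteq> T" "T \<subseteq> uspan (dvars V) B"
  shows "fin_gen S M"
  unfolding fin_gen_iff[OF presented_module[OF P]]
proof (intro exI conjI)
  note p = presentedD[OF P] and T = graded_subspaceD[OF presentedD(1)[OF P]]
  have z: "\<exists>p. z = act V p" if "z \<in> dvars V" for z
    using that psubst_var[of "dvar V"] psubst_const[of "dvar V"] unfolding dvars_def by (metis UnE imageE)
  show "finite (\<theta> ` B)" "\<theta> ` B \<subseteq> carrier M" using B(1,2) p(4) by auto
  have "\<theta> t \<in> scalar_span (carrier S) M (\<theta> ` B) \<and> t \<in> T" if "t \<in> uspan (dvars V) B" for t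
    using that
  proof (induction rule: uspan_induct)
    case zero
    then show ?case using T(1) scalar_span.span_zero[of M] by (simp add: p(5))
  next
    case (base b)
    then show ?case using B(2) by (auto intro: scalar_span.span_base)
  next
    case (add s t)
    then show ?case using T(2) scalar_span.span_add[of "\<theta> s" _ M _ "\<theta> t"] by (simp add: p(6))
  next
    case (smult z t)
    obtain f where f: "z = act V f" using z[OF smult(1)] by blast
    have "rc f \<odot>\<^bsub>M\<^esub> \<theta> t \<in> scalar_span (carrier S) M (\<theta> ` B)"
      using smult(2) by (intro scalar_span.span_smult) (auto simp: S_ops)
    then show ?case using smult(2) T(3) by (simp add: p(7) f)
  qed
  then show "carrier M \<subseteq> scalar_span (carrier S) M (\<theta> ` B)" using B(3) unfolding p(4) by blast
qed

definition cls :: "('v + 'v) mpoly set \<Rightarrow> ('v + 'v) mpoly \<Rightarrow> (nat \<Rightarrow> 'v mpoly) set" where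
  "cls N t = enc ` {s. s - t \<in> N}"

text \<open>Encoded cosets of \<open>N\<close> in \<open>T\<close>. A ring element acts through a
  picked polynomial that represents it, which is legitimate if \<open>W\<close> carries
  \<open>T\<close> into \<open>N\<close>; hence that assumption in
  \<open>presented_qm\<close>.\<close>

definition qm :: "'v set \<Rightarrow> 'g \<Rightarrow> ('v + 'v) mpoly set \<Rightarrow> ('v + 'v) mpoly set \<Rightarrow>
    ('g, 'v mpoly set, (nat \<Rightarrow> 'v mpoly) set) gmod" where
  "qm V q T N = \<lparr>carrier = cls N ` T, monoid.mult = undefined, one = undefined, ring.zero = cls N 0,
     add = (\<lambda>x y. cls N (inv_into T (cls N) x + inv_into T (cls N) y)),
     smult = (\<lambda>s x. cls N (act V (SOME p. rc p = s) * inv_into T (cls N) x)),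
     gcomp = (\<lambda>\<gamma>. cls N ` {t \<in> T. homogeneous wtU (\<gamma> + q) t})\<rparr>"

lemma presented_qm:
  assumes T: "graded_subspace V T" and N: "graded_subspace V N" "N \<subseteq> T"
    and W: "\<And>t. t \<in> T ==> act V W * t \<in> N"
  shows "presented V q T N (cls N) (qm V q T N)"
proof -
  note Ts = graded_subspaceD[OF T] and Ns = graded_subspaceD[OF N(1)]
  have c: "cls N s = cls N t \<longleftrightarrow> s - t \<in> N" for s t
  proof -
    have "cls N s = cls N t \<longleftrightarrow> {r. r - s \<in> N} = {r. r - t \<in> N}"
      unfolding cls_def by (rule inj_image_eq_iff[OF inj_enc])
    also have "\<dots> \<longleftrightarrow> s - t \<in> N"
    proof
      assume "{r. r - s \<in> N} = {r. r - t \<in> N}"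
      moreover have "s \<in> {r. r - s \<in> N}" using Ns(1) by simp
      ultimately have "s \<in> {r. r - t \<in> N}" by metis
      then show "s - t \<in> N" by simp
    next
      assume "s - t \<in> N"
      then have "r - s \<in> N \<longleftrightarrow> r - t \<in> N" for r
        using Ns(2)[of "r - s" "s - t"] Ns(6)[of "r - t" "s - t"] by auto
      then show "{r. r - s \<in> N} = {r. r - t \<in> N}" by blast
    qed
    finally show ?thesis .
  qed
  have inv: "inv_into T (cls N) (cls N t) \<in> T" "inv_into T (cls N) (cls N t) - t \<in> N" if "t \<in> T" for t
    using that f_inv_into_f[of "cls N t" "cls N" T] c by (auto intro: inv_into_into)
  have "cls N (inv_into T (cls N) (cls N s) + inv_into T (cls N) (cls N t)) = cls N (s + t)" if "s \<in> T" "t \<in> T" for s t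
    unfolding c using Ns(2)[OF inv(2)[OF that(1)] inv(2)[OF that(2)]] by (simp add: algebra_simps)
  moreover have "cls N (act V (SOME p'. rc p' = rc p) * inv_into T (cls N) (cls N t)) = cls N (act V p * t)" if t: "t \<in> T" for p t
  proof -
    let ?p = "SOME p'. rc p' = rc p" and ?t = "inv_into T (cls N) (cls N t)"
    have "rc ?p = rc p" by (rule someI) (rule HOL.refl)
    then obtain r where r: "?p - p = W * r" by (auto simp: residue_eq)
    have "act V ?p * ?t - act V p * t = act V (?p - p) * ?t + act V p * (?t - t)"
      by (simp add: psubst_diff algebra_simps)
    also have "act V (?p - p) * ?t = act V W * (act V r * ?t)" by (simp add: r psubst_mult mult.assoc)
    finally have "act V ?p * ?t - act V p * t \<in> N"
      using Ns(2)[OF W[OF Ts(3)[OF inv(1)[OF t]]] Ns(3)[OF inv(2)[OF t]]] by simp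
    then show ?thesis unfolding c .
  qed
  ultimately show ?thesis
    unfolding presented_def using T N by (auto simp: qm_def c)
qed

end

section \<open>Finiteness and graded ideals over the hypersurface ring\<close>

context hypersurface
begin

lemma carrier_S_closed:
  assumes M: "Module.module S M"
    and X: "module.scalar_closed M (rc ` range mvar \<union> rc ` range const) X" and x: "x \<in> X"
  shows "rc p \<odot>\<^bsub>M\<^esub> x \<in> X"
proof -
  interpret M: Module.module S M by (rule M)
  note cl = M.scalar_closedD[OF X]
  show ?thesis
    using x
  proof (induction p arbitrary: x rule: mpoly_induct)
    case (const c)
    then show ?case by (intro cl(4)) auto
  next
    case (add p q)
    have "rc (p + q) \<odot>\<^bsub>M\<^esub> x = rc p \<odot>\<^bsub>M\<^esub> x \<oplus>\<^bsub>M\<^esub> rc q \<odot>\<^bsub>M\<^esub> x"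
      using M.smult_l_distr[of "rc p" "rc q" x] cl(1)[OF add.prems] by (simp add: S_ops)
    then show ?case using cl(3) add by simp
  next
    case (var i p)
    have "rc (mvar i * p) \<odot>\<^bsub>M\<^esub> x = rc (mvar i) \<odot>\<^bsub>M\<^esub> (rc p \<odot>\<^bsub>M\<^esub> x)"
      using M.smult_assoc1[of "rc (mvar i)" "rc p" x] cl(1)[OF var.prems] by (simp add: S_ops)
    moreover have "rc (mvar i) \<odot>\<^bsub>M\<^esub> (rc p \<odot>\<^bsub>M\<^esub> x) \<in> X" by (rule cl(4)[OF _ var.IH[OF var.prems]]) simp
    ultimately show ?case by simp
  qed
qed

text \<open>The residues of variables and constants generate the ring, by
  \<open>carrier_S_closed\<close>. So the basis theorem, applied to M with finitely many variables
  over the field of constants, yields generators over the ring.\<close>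

lemma fin_gen_submodule:
  assumes M: "graded_module S M" and fg: "fin_gen S M" and N: "graded_sub S M N"
  shows "fin_gen S (sub_gmod N M)"
proof -
  interpret M: Module.module S M by (rule graded_moduleD(1)[OF M])
  interpret N: Module.module S "sub_gmod N M" by (rule graded_moduleD(1)[OF graded_module_sub[OF M N]])
  let ?K = "rc ` range const" and ?Y = "rc ` range mvar"
  note n = graded_subD[OF N]
  have neg: "\<ominus>\<^bsub>S\<^esub> \<one>\<^bsub>S\<^esub> = rc (const (- 1))"
  proof -
    have "rc (const (- 1)) \<oplus>\<^bsub>S\<^esub> \<one>\<^bsub>S\<^esub> = \<zero>\<^bsub>S\<^esub>" by (simp add: S_ops single_uminus)
    then show ?thesis by (intro minus_equality) (auto simp: S_ops)
  qed
  have KS: "?K \<subseteq> carrier S" "\<ominus>\<^bsub>S\<^esub> \<one>\<^bsub>S\<^esub> \<in> ?K" unfolding neg by (auto simp: S_ops)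
  have "M.scalar_noetherian ?K"
  proof (rule M.noetherian_field[OF KS])
    show "\<zero>\<^bsub>S\<^esub> \<in> ?K" by (auto simp: S_ops image_iff intro: exI[of _ 0])
    show "a \<oplus>\<^bsub>S\<^esub> b \<in> ?K" "a \<otimes>\<^bsub>S\<^esub> b \<in> ?K" if "a \<in> ?K" "b \<in> ?K" for a b
      using that by (auto simp: S_ops mult_single single_add[symmetric])
    show "\<exists>b\<in>?K. b \<otimes>\<^bsub>S\<^esub> a = \<one>\<^bsub>S\<^esub>" if a: "a \<in> ?K" "a \<noteq> \<zero>\<^bsub>S\<^esub>" for a
    proof -
      obtain c where c: "a = rc (const c)" using a by blast
      with a have "c \<noteq> 0" by (auto simp: S_ops)
      then have "rc (const (1 / c)) \<otimes>\<^bsub>S\<^esub> a = \<one>\<^bsub>S\<^esub>" by (simp add: c S_ops mult_single)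
      then show ?thesis by blast
    qed
  qed
  then have noeth: "M.scalar_noetherian (?Y \<union> ?K)"
    by (intro M.noetherian_union KS) (auto simp: S_ops)
  obtain B where B: "finite B" "B \<subseteq> carrier M" "carrier M \<subseteq> scalar_span (carrier S) M B"
    using fg unfolding fin_gen_iff[OF M.module_axioms] by blast
  have YK: "?Y \<union> ?K \<subseteq> carrier S" by (auto simp: S_ops)
  note sp = M.scalar_closed_span[OF YK B(2)]
  have "M.scalar_closed (carrier S) (scalar_span (?Y \<union> ?K) M B)"
    by (rule M.scalar_closedI) (use M.scalar_closedD[OF sp] carrier_S_closed[OF M.module_axioms sp] in \<open>auto simp: S_ops\<close>)
  then have "scalar_span (carrier S) M B \<subseteq> scalar_span (?Y \<union> ?K) M B"
    by (rule M.span_least) (auto intro: scalar_span.span_base)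
  then have "N \<subseteq> scalar_span (?Y \<union> ?K) M B" using n(1) B(3) by blast
  moreover have "M.scalar_closed (?Y \<union> ?K) N"
    by (rule M.scalar_closedI) (use n(1-3,5) in \<open>auto simp: S_ops\<close>)
  ultimately obtain B' where B': "finite B'" "B' \<subseteq> N" "N \<subseteq> scalar_span (?Y \<union> ?K) M B'"
    using noeth B(1,2) unfolding M.scalar_noetherian_def by meson
  have "scalar_span (?Y \<union> ?K) M B' \<subseteq> scalar_span (carrier S) M B'"
  proof (rule M.span_least)
    note sp' = M.scalar_closedD[OF M.scalar_closed_span[OF subset_refl subset_trans[OF B'(2) n(1)]]]
    show "M.scalar_closed (?Y \<union> ?K) (scalar_span (carrier S) M B')"
      by (rule M.scalar_closedI[OF sp'(5,2,3)]) (use sp'(4) YK in blast)+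
  qed (auto intro: scalar_span.span_base)
  then show ?thesis
    unfolding fin_gen_iff[OF N.module_axioms] span_sub_gmod
    using B' by (intro exI[of _ B']) (auto simp: sub_ops)
qed

subsection \<open>Ideals and graded subspaces\<close>

text \<open>\<open>emb\<close> writes a polynomial in the second copy alone; \<open>merge\<close>
  identifies the two copies and is a left inverse of every \<open>act V\<close>.\<close>

abbreviation emb :: "'v mpoly \<Rightarrow> ('v + 'v) mpoly" where "emb \<equiv> act UNIV"
abbreviation merge :: "('v + 'v) mpoly \<Rightarrow> 'v mpoly" where "merge \<equiv> psubst (case_sum mvar mvar)"

lemma merge_act [simp]: "merge (act V p) = p"
proof -
  have "merge (act V p) = psubst mvar p" by (rule psubst_eqI) (simp add: dvar_def)
  then show ?thesis by (simp add: psubst_mvar)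
qed

lemma act_nonzero: "act V W \<noteq> 0"
  by (metis merge_act psubst_zero W_nonzero)

lemma hcomp_act: "hcomp wtU \<gamma> (act V p) = act V (hcomp wt \<gamma> p)"
proof (induction p rule: poly_mapping_additive_induct)
  case (single m c)
  have h: "homogeneous wt (monomial_degree wt m) (Poly_Mapping.single m c)" by (rule homogeneous_single) simp
  show ?case unfolding hcomp_of_homogeneous[OF h] hcomp_of_homogeneous[OF homogeneous_act[OF h]] by simp
qed (simp add: hcomp_add psubst_add)

lemma graded_subspace_ideal:
  assumes "0 \<in> I" "\<And>a b. a \<in> I ==> b \<in> I ==> a + b \<in> I" "\<And>p a. a \<in> I ==> p * a \<in> I"
    "\<And>\<gamma> a. a \<in> I ==> hcomp wt \<gamma> a \<in> I"
  shows "graded_subspace UNIV (emb ` I)"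
  unfolding graded_subspace_def
  using assms(1) assms(2-4)[THEN imageI[where f = emb]]
  by (auto simp: hcomp_act psubst_add psubst_mult intro: image_eqI[of _ _ 0])

lemma graded_subspace_range: "graded_subspace UNIV (range emb)"
  by (rule graded_subspace_ideal) auto

lemma graded_subspace_mult:
  assumes T: "graded_subspace V T" and f: "homogeneous wtU \<epsilon> f"
  shows "graded_subspace V ((*) f ` T)"
  unfolding graded_subspace_def
proof (intro conjI ballI allI)
  note t = graded_subspaceD[OF T]
  show "0 \<in> (*) f ` T" using t(1) by (auto intro: image_eqI[of _ _ 0])
  show "s + s' \<in> (*) f ` T" if "s \<in> (*) f ` T" "s' \<in> (*) f ` T" for s s'
    using that t(2) by (auto simp: distrib_left[symmetric])
  show "act V p * s \<in> (*) f ` T" if "s \<in> (*) f ` T" for p s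
    using that t(3) by (auto simp: mult.left_commute)
  show "hcomp wtU \<gamma> s \<in> (*) f ` T" if "s \<in> (*) f ` T" for \<gamma> s
    using that t(4) by (auto simp: hcomp_mult[OF f])
qed

lemma graded_subspace_uspan:
  assumes B: "\<And>b. b \<in> B ==> \<exists>\<gamma>. homogeneous wtU \<gamma> b"
  shows "graded_subspace V (uspan (dvars V) B)"
  unfolding graded_subspace_def
proof (intro conjI ballI allI)
  note i = uspan_intros[where Z = "dvars V" and B = B]
  show "act V p * t \<in> uspan (dvars V) B" if "t \<in> uspan (dvars V) B" for p t
    using that
  proof (induction p arbitrary: t rule: mpoly_induct)
    case (const c)
    then show ?case using i(4) by (simp add: dvars_def)
  next
    case (add p q)
    then show ?case using i(3) by (simp add: psubst_add distrib_right)
  next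
    case (var v p)
    have "dvar V v * (act V p * t) \<in> uspan (dvars V) B"
      by (rule i(4)[OF _ var.IH[OF var.prems]]) (simp add: dvars_def)
    then show ?case by (simp add: psubst_mult mult.assoc)
  qed
  have z: "\<exists>\<epsilon>. homogeneous wtU \<epsilon> z" if "z \<in> dvars V" for z
  proof -
    consider v where "z = dvar V v" | c where "z = const c" using \<open>z \<in> dvars V\<close> unfolding dvars_def by blast
    then show ?thesis
    proof cases
      case 1
      then show ?thesis using homogeneous_dvar by blast
    next
      case 2
      show ?thesis unfolding 2 by (rule exI, rule homogeneous_const)
    qed
  qed
  show "hcomp wtU \<gamma> t \<in> uspan (dvars V) B" if "t \<in> uspan (dvars V) B" for \<gamma> t
    using that
  proof (induction arbitrary: \<gamma> rule: uspan_induct)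
    case (base b)
    obtain \<epsilon> where "homogeneous wtU \<epsilon> b" using B[OF base] by blast
    then show ?case using i(1) i(2)[OF base] by (simp add: hcomp_of_homogeneous)
  next
    case (smult z t)
    obtain \<epsilon> where "homogeneous wtU \<epsilon> z" using z[OF smult(1)] by blast
    then show ?case using i(4)[OF smult(1) smult(2)] by (simp add: hcomp_mult)
  qed (use i in \<open>auto simp: hcomp_add\<close>)
qed (use uspan_intros in auto)

text \<open>Writes the ring as polynomials in the second copy modulo \<open>W\<close>. Being
  presented, it is a graded module over itself, as \<open>noetherian_setting\<close>
  demands.\<close>

lemma presented_regular:
  "presented UNIV 0 (range emb) (emb ` range ((*) W)) (rc \<circ> merge) (regular_module S)"
proof -
  have "graded_subspace UNIV (emb ` range ((*) W))"
  proof (rule graded_subspace_ideal)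
    show "hcomp wt \<gamma> a \<in> range ((*) W)" if "a \<in> range ((*) W)" for \<gamma> a
      using that by (auto simp: hcomp_mult[OF W_homogeneous])
    show "a + b \<in> range ((*) W)" if "a \<in> range ((*) W)" "b \<in> range ((*) W)" for a b
      using that by (auto simp: distrib_left[symmetric])
    show "p * a \<in> range ((*) W)" if "a \<in> range ((*) W)" for p a
      using that by (auto simp: mult.left_commute)
    show "0 \<in> range ((*) W)" by (auto intro: range_eqI[of _ _ 0])
  qed
  moreover have "rc ` {p. homogeneous wt \<gamma> p} = (rc \<circ> merge) ` {t \<in> range emb. homogeneous wtU \<gamma> t}" for \<gamma>
  proof (intro equalityI subsetI)
    fix a assume "a \<in> rc ` {p. homogeneous wt \<gamma> p}"
    then obtain p where p: "homogeneous wt \<gamma> p" "a = (rc \<circ> merge) (emb p)" by auto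
    then show "a \<in> (rc \<circ> merge) ` {t \<in> range emb. homogeneous wtU \<gamma> t}"
      using homogeneous_act by blast
  next
    fix a assume "a \<in> (rc \<circ> merge) ` {t \<in> range emb. homogeneous wtU \<gamma> t}"
    then obtain t where t: "homogeneous wtU \<gamma> t" "a = rc (merge t)" by auto
    have "homogeneous wt \<gamma> (merge t)"
      by (rule homogeneous_psubst[OF _ t(1)]) (auto simp: wtU_def homogeneous_var split: sum.splits)
    then show "a \<in> rc ` {p. homogeneous wt \<gamma> p}" using t(2) by blast
  qed
  moreover have "(rc \<circ> merge) s = (rc \<circ> merge) t \<longleftrightarrow> s - t \<in> emb ` range ((*) W)"
    if st: "s \<in> range emb" "t \<in> range emb" for s t
  proof -
    obtain p q where p: "s = emb p" "t = emb q" using st by blast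
    have inj: "emb a = emb b \<longleftrightarrow> a = b" for a b by (metis merge_act)
    show ?thesis unfolding p psubst_diff[symmetric] by (auto simp: residue_eq inj)
  qed
  moreover have "emb ` range ((*) W) \<subseteq> range emb" by blast
  moreover have "carrier (regular_module S) = (rc \<circ> merge) ` range emb" by (auto simp: regular_module_def S_ops image_iff)
  moreover have "rc p \<odot>\<^bsub>regular_module S\<^esub> (rc \<circ> merge) t = (rc \<circ> merge) (emb p * t)" for p t
    by (simp add: regular_module_def S_ops psubst_mult)
  moreover have "(rc \<circ> merge) s \<oplus>\<^bsub>regular_module S\<^esub> (rc \<circ> merge) t = (rc \<circ> merge) (s + t)" for s t
    by (simp add: regular_module_def S_ops psubst_add)
  moreover have "\<zero>\<^bsub>regular_module S\<^esub> = (rc \<circ> merge) 0" "gcomp (regular_module S) \<gamma> = rc ` {p. homogeneous wt \<gamma> p}" for \<gamma>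
    by (simp_all add: regular_module_def S_ops)
  ultimately show ?thesis
    unfolding presented_def add_0_right using graded_subspace_range by (intro conjI ballI allI) simp_all
qed

sublocale noetherian_setting S set_pair
  by unfold_locales
    (rule inj_set_pair fin_gen_submodule presented_graded_module[OF presented_regular]; assumption?)+

subsection \<open>Complexes concentrated in one degree\<close>

abbreviation concentrated :: "int \<Rightarrow> ('g, 'v mpoly set, (nat \<Rightarrow> 'v mpoly) set) cplx \<Rightarrow> bool" where
  "concentrated i A \<equiv> A \<in> BF \<and> (\<forall>j. j \<noteq> i \<longrightarrow> carrier (cterm A j) = {\<zero>\<^bsub>cterm A j\<^esub>})"

definition conc :: "int \<Rightarrow> ('g, 'v mpoly set, (nat \<Rightarrow> 'v mpoly) set) gmod \<Rightarrow>
    ('g, 'v mpoly set, (nat \<Rightarrow> 'v mpoly) set) cplx" where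
  "conc i M = (let t = \<lambda>j. if j = i then M else zero_gmod {} in
     \<lparr>cterm = t, cdiff = \<lambda>j. \<lambda>x\<in>carrier (t j). \<zero>\<^bsub>t (j + 1)\<^esub>\<rparr>)"

lemma conc_term: "cterm (conc i M) j = (if j = i then M else zero_gmod {})" "cterm (conc i M) i = M"
  by (simp_all add: conc_def Let_def)

lemma conc_diff: "cdiff (conc i M) j = (\<lambda>x\<in>carrier (cterm (conc i M) j). \<zero>\<^bsub>cterm (conc i M) (j + 1)\<^esub>)"
  by (simp add: conc_def Let_def)

lemma zero_gmod_ops: "carrier (zero_gmod z) = {z}" "\<zero>\<^bsub>zero_gmod z\<^esub> = z"
  by (simp_all add: zero_gmod_def)

lemma concentrated_conc:
  assumes M: "graded_module S M" "fin_gen S M"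
  shows "concentrated i (conc i M)"
proof (intro conjI allI impI)
  have g: "graded_module S (cterm (conc i M) j)" "fin_gen S (cterm (conc i M) j)" for j
    using M graded_module_zero by (auto simp: conc_term(1))
  have z: "\<zero>\<^bsub>cterm (conc i M) j\<^esub> \<in> carrier (cterm (conc i M) j)" for j
  proof -
    interpret Module.module S "cterm (conc i M) j" by (rule graded_moduleD(1)[OF g(1)])
    show ?thesis by (rule M.zero_closed)
  qed
  show "conc i M \<in> BF"
  proof (rule complexI)
    show "cdiff (conc i M) j \<in> gmod_hom S (cterm (conc i M) j) (cterm (conc i M) (j + 1))" for j
      unfolding conc_diff by (rule zero_hom[OF g(1) g(1)])
    show "cdiff (conc i M) (j + 1) (cdiff (conc i M) j x) = \<zero>\<^bsub>cterm (conc i M) (j + 2)\<^esub>"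
      if "x \<in> carrier (cterm (conc i M) j)" for j x
      using that z[of "j + 1"] by (simp add: conc_diff add.assoc)
    show "\<exists>N. \<forall>j. \<bar>j\<bar> > N \<longrightarrow> carrier (cterm (conc i M) j) = {\<zero>\<^bsub>cterm (conc i M) j\<^esub>}"
      by (rule exI[of _ "\<bar>i\<bar>"]) (auto simp: conc_term(1) zero_gmod_ops)
  qed (use g in auto)
  show "carrier (cterm (conc i M) j) = {\<zero>\<^bsub>cterm (conc i M) j\<^esub>}" if "j \<noteq> i" for j
    using that by (simp add: conc_term(1) zero_gmod_ops)
qed

definition conc_map where
  "conc_map i A B f = (\<lambda>j. if j = i then f else (\<lambda>x\<in>carrier (cterm A j). \<zero>\<^bsub>cterm B j\<^esub>))"

lemma conc_chain_map:
  assumes A: "concentrated i A" and B: "concentrated i B" and f: "f \<in> gmod_hom S (cterm A i) (cterm B i)"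
  shows "chain_map S A B (conc_map i A B f)"
  unfolding chain_map_def
proof (intro conjI allI ballI)
  note a = complexD[OF conjunct1[OF A]] and b = complexD[OF conjunct1[OF B]]
  note da = diff_props[OF conjunct1[OF A]] and db = diff_props[OF conjunct1[OF B]]
  have hom: "conc_map i A B f j \<in> gmod_hom S (cterm A j) (cterm B j)" for j
    using f zero_hom[OF a(1) b(1)] by (simp add: conc_map_def)
  then show "conc_map i A B f j \<in> gmod_hom S (cterm A j) (cterm B j)" for j .
  note hp = gmod_hom_props[OF a(1) b(1) hom]
  have zero: "conc_map i A B f j \<zero>\<^bsub>cterm A j\<^esub> = \<zero>\<^bsub>cterm B j\<^esub>" for j
    by (rule hp(3))
  fix j x assume x: "x \<in> carrier (cterm A j)"
  show "conc_map i A B f (j + 1) (cdiff A j x) = cdiff B j (conc_map i A B f j x)"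
  proof (cases "j = i")
    case True
    then have "carrier (cterm A (j + 1)) = {\<zero>\<^bsub>cterm A (j + 1)\<^esub>}" "carrier (cterm B (j + 1)) = {\<zero>\<^bsub>cterm B (j + 1)\<^esub>}"
      using A B by auto
    moreover have "cdiff A j x \<in> carrier (cterm A (j + 1))" using da(1) x .
    moreover have "cdiff B j (conc_map i A B f j x) \<in> carrier (cterm B (j + 1))" using db(1) hp(1)[OF x] by blast
    ultimately show ?thesis using zero[of "j + 1"] by auto
  next
    case False
    then have "x = \<zero>\<^bsub>cterm A j\<^esub>" using A x by auto
    then show ?thesis by (simp add: zero da(3) db(3))
  qed
qed

lemma KR_conc_exact4:
  assumes c: "concentrated i K" "concentrated i A" "concentrated i B" "concentrated i C"
    and h: "\<iota> \<in> gmod_hom S (cterm K i) (cterm A i)" "f \<in> gmod_hom S (cterm A i) (cterm B i)"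
      "p \<in> gmod_hom S (cterm B i) (cterm C i)"
    and inj: "inj_on \<iota> (carrier (cterm K i))"
    and exA: "\<And>x. x \<in> carrier (cterm A i) ==> f x = \<zero>\<^bsub>cterm B i\<^esub> \<longleftrightarrow> x \<in> \<iota> ` carrier (cterm K i)"
    and exB: "\<And>y. y \<in> carrier (cterm B i) ==> p y = \<zero>\<^bsub>cterm C i\<^esub> \<longleftrightarrow> y \<in> f ` carrier (cterm A i)"
    and surj: "p ` carrier (cterm B i) = carrier (cterm C i)"
  shows "frag_of K - frag_of A + frag_of B - frag_of C \<in> KR J"
proof (rule KR_exact4[OF _ _ _ _ conc_chain_map[OF c(1,2) h(1)] conc_chain_map[OF c(2,3) h(2)]
        conc_chain_map[OF c(3,4) h(3)]])
  show "inj_on (conc_map i K A \<iota> j) (carrier (cterm K j))" for j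
    by (cases "j = i") (use c inj in \<open>simp_all add: conc_map_def\<close>)
  show "conc_map i A B f j x = \<zero>\<^bsub>cterm B j\<^esub> \<longleftrightarrow> x \<in> conc_map i K A \<iota> j ` carrier (cterm K j)"
    if "x \<in> carrier (cterm A j)" for j x
    by (cases "j = i") (use c that exA in \<open>simp_all add: conc_map_def\<close>)
  show "conc_map i B C p j x = \<zero>\<^bsub>cterm C j\<^esub> \<longleftrightarrow> x \<in> conc_map i A B f j ` carrier (cterm A j)"
    if "x \<in> carrier (cterm B j)" for j x
    by (cases "j = i") (use c that exB in \<open>simp_all add: conc_map_def\<close>)
  show "conc_map i B C p j ` carrier (cterm B j) = carrier (cterm C j)" for j
    by (cases "j = i") (use c surj in \<open>simp_all add: conc_map_def\<close>)
qed (use c in auto)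

lemma KR_conc_exact:
  assumes c: "concentrated i A'" "concentrated i A" "concentrated i A''"
    and h: "\<iota> \<in> gmod_hom S (cterm A' i) (cterm A i)" "p \<in> gmod_hom S (cterm A i) (cterm A'' i)"
    and inj: "inj_on \<iota> (carrier (cterm A' i))"
    and ex: "\<And>x. x \<in> carrier (cterm A i) ==> p x = \<zero>\<^bsub>cterm A'' i\<^esub> \<longleftrightarrow> x \<in> \<iota> ` carrier (cterm A' i)"
    and surj: "p ` carrier (cterm A i) = carrier (cterm A'' i)"
  shows "frag_of A - frag_of A' - frag_of A'' \<in> KR J"
proof (rule KR_exact[OF _ _ _ conc_chain_map[OF c(1,2) h(1)] conc_chain_map[OF c(2,3) h(2)]])
  show "inj_on (conc_map i A' A \<iota> j) (carrier (cterm A' j))" for j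
    by (cases "j = i") (use c inj in \<open>simp_all add: conc_map_def\<close>)
  show "conc_map i A A'' p j x = \<zero>\<^bsub>cterm A'' j\<^esub> \<longleftrightarrow> x \<in> conc_map i A' A \<iota> j ` carrier (cterm A' j)"
    if "x \<in> carrier (cterm A j)" for j x
    by (cases "j = i") (use c that ex in \<open>simp_all add: conc_map_def\<close>)
  show "conc_map i A A'' p j ` carrier (cterm A j) = carrier (cterm A'' j)" for j
    by (cases "j = i") (use c surj in \<open>simp_all add: conc_map_def\<close>)
qed (use c in auto)

end

section \<open>Spans of polynomials and their filtration by degree in one variable\<close>

lemma psubst_sum: "psubst x (\<Sum>i\<in>A. p i) = (\<Sum>i\<in>A. psubst x (p i))"
  by (induction A rule: infinite_finite_induct) (auto simp: psubst_add)

lemma udeg_Suc: "f \<in> U.deg_below y L (Suc n) \<longleftrightarrow> (\<exists>a\<in>L. \<exists>g\<in>U.deg_below y L n. f = y ^ n * a + g)"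
  by auto

lemma uclosedD:
  assumes "U.scalar_closed Z X" "range const \<subseteq> Z"
  shows "0 \<in> X" "s \<in> X ==> t \<in> X ==> s + t \<in> X" "z \<in> Z ==> t \<in> X ==> z * t \<in> X" "t \<in> X ==> - t \<in> X"
    "s \<in> X ==> t \<in> X ==> s - t \<in> X"
proof -
  show *: "0 \<in> X" "s \<in> X ==> t \<in> X ==> s + t \<in> X" "z \<in> Z ==> t \<in> X ==> z * t \<in> X" for s t z
    using U.scalar_closedD[OF assms(1)] by auto
  show m: "- t \<in> X" if "t \<in> X" for t
  proof -
    have "const (- 1) * t \<in> X" by (rule *(3)[OF subsetD[OF assms(2) rangeI] \<open>t \<in> X\<close>])
    then show ?thesis by (simp add: single_uminus)
  qed
  show "s \<in> X ==> t \<in> X ==> s - t \<in> X" using *(2)[of s "- t"] m[of t] by simp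
qed

lemma uclosed_uspan: "U.scalar_closed Z (uspan Z B)"
  by (rule U.scalar_closed_span) auto

lemma udeg:
  assumes Z: "range const \<subseteq> Z" and L: "U.scalar_closed Z L"
  shows "U.scalar_closed Z (U.deg_below y L n)" "f \<in> U.deg_below y L n ==> y * f \<in> U.deg_below y L (Suc n)"
    "m \<le> n ==> U.deg_below y L m \<subseteq> U.deg_below y L n" "f \<in> U.deg_below y L n ==> y ^ k * f \<in> U.deg_below y L (n + k)"
proof -
  have "- 1 = const (- 1)" by (simp add: single_uminus)
  then have 1: "\<ominus>\<^bsub>poly_ring\<^esub> \<one>\<^bsub>poly_ring\<^esub> \<in> Z" using Z by auto
  show "U.scalar_closed Z (U.deg_below y L n)" by (rule U.deg_below_closed[OF _ 1 _ L]) auto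
  show "m \<le> n ==> U.deg_below y L m \<subseteq> U.deg_below y L n" by (rule U.deg_below_mono[OF _ 1 _ L]) auto
  show "f \<in> U.deg_below y L n ==> y * f \<in> U.deg_below y L (Suc n)"
    using U.deg_below_mult[OF _ 1 _ L, of y f n] by simp
  show "f \<in> U.deg_below y L n ==> y ^ k * f \<in> U.deg_below y L (n + k)"
    using U.deg_below_pow[OF _ 1 _ L, of y f n k] by simp
qed

lemma uspan_insert:
  assumes "range const \<subseteq> Z"
  shows "uspan (insert y Z) B = (\<Union>n. U.deg_below y (uspan Z B) n)"
proof -
  have "- 1 = const (- 1)" by (simp add: single_uminus)
  then have "\<ominus>\<^bsub>poly_ring\<^esub> \<one>\<^bsub>poly_ring\<^esub> \<in> Z" using assms by auto
  then show ?thesis by (intro U.span_insert_eq) auto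
qed

text \<open>Makes each step of the filtration by degree in y a span of the same kind, with the
  generators multiplied by powers of y.\<close>

lemma deg_below_eq_uspan:
  assumes Z: "range const \<subseteq> Z"
  shows "U.deg_below y (uspan Z B) n = uspan Z ((\<lambda>(j, b). y ^ j * b) ` ({..<n} \<times> B))"
proof
  let ?B = "\<lambda>n. (\<lambda>(j, b). y ^ j * b) ` ({..<n} \<times> B)"
  show "U.deg_below y (uspan Z B) n \<subseteq> uspan Z (?B n)"
  proof (induction n)
    case 0
    then show ?case using uspan_intros(1) by auto
  next
    case (Suc n)
    have "y ^ n * a \<in> uspan Z (?B (Suc n))" if "a \<in> uspan Z B" for a
      using that
    proof (induction rule: uspan_induct)
      case (base b)
      then show ?case by (intro uspan_intros(2)) force
    next
      case (smult z t)
      then show ?case using uspan_intros(4)[OF smult(1) smult(2)] by (simp add: mult.left_commute)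
    qed (auto simp: distrib_left intro: uspan_intros)
    moreover have "uspan Z (?B n) \<subseteq> uspan Z (?B (Suc n))" by (rule span_mono) auto
    ultimately show ?case using Suc uspan_intros(3)[of _ Z "?B (Suc n)"]
      unfolding subset_iff udeg_Suc by blast
  qed
  note u = udeg[OF Z uclosed_uspan[of Z B]]
  show "uspan Z (?B n) \<subseteq> U.deg_below y (uspan Z B) n"
  proof (rule U.span_least[OF u(1)], rule subsetI)
    fix t assume "t \<in> ?B n"
    then obtain j b where t: "t = y ^ j * b" "j < n" "b \<in> B" by auto
    have "b \<in> U.deg_below y (uspan Z B) (Suc 0)"
      unfolding udeg_Suc using uspan_intros(2)[OF t(3)] by (intro bexI[of _ b] bexI[of _ 0]) auto
    from u(4)[OF this, of j] have "t \<in> U.deg_below y (uspan Z B) (Suc j)" by (simp add: t)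
    then show "t \<in> U.deg_below y (uspan Z B) n" using u(3)[of "Suc j" n] t(2) by auto
  qed
qed

section \<open>Exact sequences of presented modules and the quotients T/WT\<close>

context hypersurface
begin

text \<open>A homomorphism on the level of representing polynomials; injectivity, exactness and
  surjectivity below thereby become statements on polynomials.\<close>

definition pres_map where
  "pres_map V q T N V' q' T' N' \<phi> \<longleftrightarrow> (\<forall>s\<in>T. \<forall>t\<in>T. \<phi> (s + t) = \<phi> s + \<phi> t) \<and>
     (\<forall>p. \<forall>t\<in>T. \<phi> (act V p * t) = act V' p * \<phi> t) \<and> (\<forall>t\<in>T. \<phi> t \<in> T') \<and> (\<forall>t\<in>N. \<phi> t \<in> N') \<and>
     (\<forall>\<gamma>. \<forall>t\<in>T. homogeneous wtU (\<gamma> + q) t \<longrightarrow> homogeneous wtU (\<gamma> + q') (\<phi> t))"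

lemma pres_map_hom:
  assumes P: "presented V q T N \<theta> M" and P': "presented V' q' T' N' \<theta>' M'"
    and \<phi>: "pres_map V q T N V' q' T' N' \<phi>"
  obtains h where "h \<in> gmod_hom S M M'" "\<And>t. t \<in> T ==> h (\<theta> t) = \<theta>' (\<phi> t)"
  by (rule presented_hom[OF P P', of \<phi>]) (use \<phi> that in \<open>auto simp: pres_map_def\<close>)

lemma pres_map_inj:
  assumes P: "presented V q T N \<theta> M" and P': "presented V' q' T' N' \<theta>' M'"
    and \<phi>: "pres_map V q T N V' q' T' N' \<phi>" and h: "\<And>t. t \<in> T ==> h (\<theta> t) = \<theta>' (\<phi> t)"
    and inj: "\<And>t. t \<in> T ==> \<phi> t \<in> N' ==> t \<in> N"
  shows "inj_on h (carrier M)"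
proof (rule inj_onI)
  note p = presentedD[OF P] and p' = presentedD[OF P'] and T = graded_subspaceD[OF presentedD(1)[OF P]]
  fix x y assume "x \<in> carrier M" "y \<in> carrier M" and e: "h x = h y"
  then obtain s t where s: "x = \<theta> s" "s \<in> T" "y = \<theta> t" "t \<in> T" unfolding p(4) by blast
  have T': "\<phi> s \<in> T'" "\<phi> t \<in> T'" using \<phi> s by (auto simp: pres_map_def)
  have "\<theta>' (\<phi> s) = \<theta>' (\<phi> t)" using e s h by simp
  then have "\<phi> s - \<phi> t \<in> N'" using p'(9)[OF T'] by blast
  moreover have "\<phi> ((s - t) + t) = \<phi> (s - t) + \<phi> t"
    using \<phi> T(6)[OF s(2,4)] s(4) unfolding pres_map_def by blast
  ultimately have "s - t \<in> N" by (intro inj T(6) s) simp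
  then show "x = y" using p(9)[OF s(2,4)] s by simp
qed

lemma pres_map_exact:
  assumes P: "presented V q T N \<theta> M" and P': "presented V' q' T' N' \<theta>' M'" and P'': "presented V'' q'' T'' N'' \<theta>'' M''"
    and \<phi>: "pres_map V q T N V' q' T' N' \<phi>" and \<psi>: "pres_map V' q' T' N' V'' q'' T'' N'' \<psi>"
    and h: "\<And>t. t \<in> T ==> h (\<theta> t) = \<theta>' (\<phi> t)" and k: "\<And>t. t \<in> T' ==> k (\<theta>' t) = \<theta>'' (\<psi> t)"
    and ex: "\<And>t. t \<in> T' ==> \<psi> t \<in> N'' \<longleftrightarrow> (\<exists>s\<in>T. t - \<phi> s \<in> N')" and x: "x \<in> carrier M'"
  shows "k x = \<zero>\<^bsub>M''\<^esub> \<longleftrightarrow> x \<in> h ` carrier M"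
proof -
  obtain t where t: "x = \<theta>' t" "t \<in> T'" using x presentedD(4)[OF P'] by auto
  have T: "\<phi> s \<in> T'" if "s \<in> T" for s using \<phi> that by (auto simp: pres_map_def)
  have "\<psi> t \<in> T''" using \<psi> t(2) by (auto simp: pres_map_def)
  then have "k x = \<zero>\<^bsub>M''\<^esub> \<longleftrightarrow> \<psi> t \<in> N''" using presentedD(10)[OF P''] k[OF t(2)] t(1) by simp
  also have "\<dots> \<longleftrightarrow> (\<exists>s\<in>T. \<theta>' t = \<theta>' (\<phi> s))" unfolding ex[OF t(2)] using presentedD(9)[OF P' t(2) T] by blast
  also have "\<dots> \<longleftrightarrow> x \<in> h ` carrier M" unfolding t(1) presentedD(4)[OF P] image_image using h by (auto simp: image_iff)
  finally show ?thesis .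
qed

lemma pres_map_surj:
  assumes P: "presented V q T N \<theta> M" and P': "presented V' q' T' N' \<theta>' M'"
    and \<phi>: "pres_map V q T N V' q' T' N' \<phi>" and h: "\<And>t. t \<in> T ==> h (\<theta> t) = \<theta>' (\<phi> t)"
    and surj: "\<And>u. u \<in> T' ==> \<exists>t\<in>T. \<phi> t = u"
  shows "h ` carrier M = carrier M'"
proof -
  have "\<phi> ` T = T'" using surj \<phi> by (auto simp: pres_map_def)
  moreover have "h ` \<theta> ` T = \<theta>' ` \<phi> ` T" using h by (simp add: image_image)
  ultimately show ?thesis unfolding presentedD(4)[OF P] presentedD(4)[OF P'] by simp
qed

text \<open>The module T/WT with shift q. For V full and T an ideal I written in the second copy
  this is I/WI; for T all of P it is the ring itself.\<close>

definition Wquot :: "'v set \<Rightarrow> 'g \<Rightarrow> ('v + 'v) mpoly set \<Rightarrow> ('g, 'v mpoly set, (nat \<Rightarrow> 'v mpoly) set) gmod" where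
  "Wquot V q T = qm V q T ((*) (act V W) ` T)"

lemma presented_Wquot:
  assumes T: "graded_subspace V T"
  shows "presented V q T ((*) (act V W) ` T) (cls ((*) (act V W) ` T)) (Wquot V q T)"
  unfolding Wquot_def
  by (rule presented_qm[OF T graded_subspace_mult[OF T homogeneous_act[OF W_homogeneous]]])
    (use graded_subspaceD(3)[OF T] in auto)

text \<open>Generators lie in the second copy alone, so for empty V the acting variables do not
  occur in them.\<close>

definition homogeneous_set :: "('v + 'v) mpoly set \<Rightarrow> bool" where
  "homogeneous_set B \<longleftrightarrow> finite B \<and> B \<subseteq> range emb \<and> (\<forall>b\<in>B. \<exists>\<gamma>. homogeneous wtU \<gamma> b)"

abbreviation vspan :: "'v set \<Rightarrow> ('v + 'v) mpoly set \<Rightarrow> ('v + 'v) mpoly set" where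
  "vspan V B \<equiv> uspan (dvars V) B"

lemma vspan_subspace: "homogeneous_set B ==> graded_subspace V (vspan V B)"
  by (rule graded_subspace_uspan) (auto simp: homogeneous_set_def)

lemma concentrated_Wquot:
  assumes B: "homogeneous_set B"
  shows "concentrated i (conc i (Wquot V q (vspan V B)))"
proof -
  note P = presented_Wquot[OF vspan_subspace[OF B, of V], of q]
  show ?thesis
    by (rule concentrated_conc[OF presented_graded_module[OF P] presented_fin_gen[OF P, of B]])
      (use B in \<open>auto simp: homogeneous_set_def intro: uspan_intros\<close>)
qed

text \<open>All monomials of \<open>W\<close> have the nonzero degree \<open>\<delta>\<close>, so
  \<open>W\<close> has no constant term; setting all variables to 0 in 1 = W r gives 1 = 0.\<close>

lemma residue_one: "rc 1 \<noteq> rc 0"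
proof
  assume "rc 1 = rc 0"
  then obtain r where r: "1 = W * r" by (auto simp: residue_eq)
  let ?z = "psubst (\<lambda>_. 0 :: 'v mpoly)"
  have "?z W = 0"
    unfolding mpoly_subst_def
  proof (rule sum.neutral, rule ballI)
    fix m assume "m \<in> Poly_Mapping.keys W"
    then have "monomial_degree wt m = \<delta>" using W_homogeneous by (auto simp: homogeneous_def)
    then have "m \<noteq> 0" using \<delta>_nonzero by auto
    then obtain i where "Poly_Mapping.lookup m i \<noteq> 0" by (metis lookup_zero poly_mapping_eqI)
    then have "\<exists>i\<in>UNIV. (0 :: 'v mpoly) ^ Poly_Mapping.lookup m i = 0" by (intro bexI[of _ i]) (auto simp: power_0_left)
    then have "(\<Prod>i\<in>UNIV. (0 :: 'v mpoly) ^ Poly_Mapping.lookup m i) = 0" by (intro prod_zero) auto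
    then show "const (Poly_Mapping.lookup W m) * (\<Prod>i\<in>UNIV. (0 :: 'v mpoly) ^ Poly_Mapping.lookup m i) = 0" by simp
  qed
  then have "?z (W * r) = 0" by (simp add: psubst_mult)
  then show False using r[symmetric] by simp
qed

lemma graded_free_zero: "graded_free S (zero_gmod z)"
proof -
  interpret Module.module S "zero_gmod z" by (rule graded_moduleD(1)[OF graded_module_zero(1)])
  show ?thesis
    unfolding graded_free_def by (rule exI[of _ "{}"]) (auto simp: zero_gmod_ops)
qed

text \<open>For empty V the ring acts through the first copy while the generators lie in the second,
  so the span is the tensor product of P with the space spanned by B over the constants. A basis of
  that space is a basis over P, and modulo \<open>W\<close> a basis over the ring.\<close>

lemma free_Wquot:
  assumes B: "homogeneous_set B"
  shows "graded_free S (Wquot {} q (vspan {} B))"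
proof -
  let ?T = "vspan {} B" and ?N = "(*) (act {} W) ` vspan {} B" and ?M = "Wquot {} q (vspan {} B)"
  note P = presented_Wquot[OF vspan_subspace[OF B, of "{}"], of q]
  note p = presentedD[OF P] and T = graded_subspaceD[OF presentedD(1)[OF P]]
  interpret M: Module.module S ?M by (rule presented_module[OF P])
  have d: "dvar {} = (\<lambda>i. mvar (Inl i))" "dvar UNIV = (\<lambda>i. mvar (Inr i))" by (auto simp: dvar_def)
  have emb_merge: "emb (merge b) = b" if "b \<in> B" for b using that B by (auto simp: homogeneous_set_def)
  have "finite (merge ` B)" using B by (simp add: homogeneous_set_def)
  from independent_subset[OF this] obtain B' where B': "B' \<subseteq> merge ` B" "independent_polys B'"
    "\<And>b. b \<in> B ==> \<exists>c. merge b = (\<Sum>a\<in>B'. const (c a) * a)" by blast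
  have fin: "finite B'" using B'(2) by (simp add: independent_polys_def)
  have embB: "emb b \<in> B" if "b \<in> B'" for b using that B'(1) emb_merge by auto
  then have embT: "act {} f * emb b \<in> ?T" if "b \<in> B'" for b f using that T(3) uspan_intros(2) by blast
  \<comment> \<open>The general combination of the basis, with coefficients acting through the first
    copy.\<close>
  define L where "L = (\<lambda>f. \<Sum>b\<in>B'. act {} (f b) * emb b)"
  have L_diff: "L f - L g = L (\<lambda>b. f b - g b)" for f g
    by (simp add: L_def psubst_diff left_diff_distrib sum_subtractf)
  have L_mult: "act {} r * L f = L (\<lambda>b. r * f b)" for f r
    by (simp add: L_def psubst_mult sum_distrib_left mult.assoc)
  have L_T: "L f \<in> ?T" for f unfolding L_def by (rule presented_finsum(2)[OF P fin embT])
  have L_ex: "\<exists>f. t = L f" if "t \<in> ?T" for t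
    using that
  proof (induction rule: uspan_induct)
    case zero
    show ?case by (rule exI[of _ "\<lambda>_. 0"]) (simp add: L_def)
  next
    case (base b)
    obtain c where c: "merge b = (\<Sum>a\<in>B'. const (c a) * a)" using B'(3)[OF base] by blast
    have "b = emb (\<Sum>a\<in>B'. const (c a) * a)" using emb_merge[OF base] c by simp
    then show ?case by (intro exI[of _ "\<lambda>a. const (c a)"]) (simp add: L_def psubst_sum psubst_mult)
  next
    case (add s t)
    then obtain f g where "s = L f" "t = L g" by blast
    then show ?case by (intro exI[of _ "\<lambda>b. f b + g b"]) (simp add: L_def psubst_add distrib_right sum.distrib)
  next
    case (smult z t)
    then obtain f where f: "t = L f" by blast
    obtain r where "z = act {} r"
      using smult(1) psubst_var[of "dvar {}"] psubst_const[of "dvar {}"] unfolding dvars_def by (metis UnE imageE)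
    then show ?case using L_mult f by blast
  qed
  have L_zero: "f b = 0" if f: "L f = 0" and b: "b \<in> B'" for f b
    by (rule independent_separated[OF B'(2) _ b]) (use f in \<open>simp add: L_def d\<close>)
  \<comment> \<open>A combination in the multiples of \<open>W\<close> is \<open>W\<close> times a
    combination, so its coefficients are divisible by \<open>W\<close>: coefficients are unique as
    residues.\<close>
  have L_eq: "rc (f b) = rc (g b)" if e: "cls ?N (L f) = cls ?N (L g)" and b: "b \<in> B'" for f g b
  proof -
    have "L (\<lambda>b. f b - g b) \<in> ?N" using e p(9)[OF L_T L_T] by (simp add: L_diff)
    then obtain t where "L (\<lambda>b. f b - g b) = act {} W * t" "t \<in> ?T" by blast
    moreover obtain r where "t = L r" using L_ex[OF \<open>t \<in> ?T\<close>] by blast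
    ultimately have "L (\<lambda>b. (f b - g b) - W * r b) = 0" by (simp add: L_diff[symmetric] L_mult)
    from L_zero[OF this b] show ?thesis by (auto simp: residue_eq)
  qed
  define \<beta> where "\<beta> = (\<lambda>b. cls ?N (emb b))"
  have \<beta>_single: "\<beta> b = cls ?N (L (\<lambda>a. if a = b then 1 else 0))" if b: "b \<in> B'" for b
  proof -
    have "L (\<lambda>a. if a = b then 1 else 0) = (\<Sum>a\<in>B'. if a = b then emb a else 0)"
      unfolding L_def by (intro sum.cong) auto
    then show ?thesis using fin b by (simp add: \<beta>_def)
  qed
  \<comment> \<open>Distinct basis elements stay distinct modulo \<open>W\<close> because the
    residues of 1 and 0 differ.\<close>
  have inj: "inj_on \<beta> B'"
  proof (rule inj_onI, rule ccontr)
    fix a b assume ab: "a \<in> B'" "b \<in> B'" "\<beta> a = \<beta> b" "a \<noteq> b"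
    have "cls ?N (L (\<lambda>x. if x = a then 1 else 0)) = cls ?N (L (\<lambda>x. if x = b then 1 else 0))"
      using ab(3) unfolding \<beta>_single[OF ab(1)] \<beta>_single[OF ab(2)] .
    from L_eq[OF this ab(1)] show False using ab(4) residue_one by simp
  qed
  have comb: "finsum ?M (\<lambda>e. c e \<odot>\<^bsub>?M\<^esub> e) (\<beta> ` B') = cls ?N (L f)"
    if c: "\<And>b. b \<in> B' ==> c (\<beta> b) = rc (f b)" for c f
  proof -
    have s: "c (\<beta> b) \<odot>\<^bsub>?M\<^esub> \<beta> b = cls ?N (act {} (f b) * emb b)" if b: "b \<in> B'" for b
    proof -
      have "rc (f b) \<odot>\<^bsub>?M\<^esub> \<beta> b = cls ?N (act {} (f b) * emb b)"
        unfolding \<beta>_def by (rule p(7)[OF uspan_intros(2)[OF embB[OF b]]])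
      then show ?thesis by (simp only: c[OF b])
    qed
    have sM: "cls ?N (act {} (f b) * emb b) \<in> carrier ?M" if "b \<in> B'" for b
      unfolding p(4) using embT[OF that] by blast
    have "finsum ?M (\<lambda>e. c e \<odot>\<^bsub>?M\<^esub> e) (\<beta> ` B') = finsum ?M (\<lambda>b. c (\<beta> b) \<odot>\<^bsub>?M\<^esub> \<beta> b) B'"
      by (rule M.finsum_reindex[OF _ inj]) (use s sM in auto)
    also have "\<dots> = finsum ?M (\<lambda>b. cls ?N (act {} (f b) * emb b)) B'"
      by (rule M.finsum_cong') (use s sM in auto)
    also have "\<dots> = cls ?N (L f)" unfolding L_def by (rule presented_finsum(1)[OF P fin embT])
    finally show ?thesis .
  qed
  show ?thesis
    unfolding graded_free_def
  proof (intro exI[of _ "\<beta> ` B'"] conjI ballI)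
    show "finite (\<beta> ` B')" using fin by simp
    show "\<beta> ` B' \<subseteq> (\<Union>\<gamma>. gcomp ?M \<gamma>)"
    proof (rule image_subsetI)
      fix b assume b: "b \<in> B'"
      obtain \<gamma> where "homogeneous wtU \<gamma> (emb b)" using B embB[OF b] by (auto simp: homogeneous_set_def)
      then have "emb b \<in> {t \<in> ?T. homogeneous wtU (\<gamma> - q + q) t}" using uspan_intros(2)[OF embB[OF b]] by simp
      then have "\<beta> b \<in> gcomp ?M (\<gamma> - q)" unfolding p(8) \<beta>_def by (rule imageI)
      then show "\<beta> b \<in> (\<Union>\<gamma>. gcomp ?M \<gamma>)" by blast
    qed
    fix x assume "x \<in> carrier ?M"
    then obtain f where f: "x = cls ?N (L f)" unfolding p(4) using L_ex by blast
    let ?c = "\<lambda>e\<in>\<beta> ` B'. rc (f (inv_into B' \<beta> e))"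
    show "\<exists>!c. c \<in> \<beta> ` B' \<rightarrow>\<^sub>E carrier S \<and> x = finsum ?M (\<lambda>e. c e \<odot>\<^bsub>?M\<^esub> e) (\<beta> ` B')"
    proof (rule ex1I[of _ ?c])
      have "finsum ?M (\<lambda>e. ?c e \<odot>\<^bsub>?M\<^esub> e) (\<beta> ` B') = cls ?N (L f)"
        by (rule comb) (simp add: inv_into_f_f[OF inj])
      moreover have "?c \<in> \<beta> ` B' \<rightarrow>\<^sub>E carrier S" by (auto simp: S_ops)
      ultimately show "?c \<in> \<beta> ` B' \<rightarrow>\<^sub>E carrier S \<and> x = finsum ?M (\<lambda>e. ?c e \<odot>\<^bsub>?M\<^esub> e) (\<beta> ` B')" by (simp only: f)
    next
      fix c assume c: "c \<in> \<beta> ` B' \<rightarrow>\<^sub>E carrier S \<and> x = finsum ?M (\<lambda>e. c e \<odot>\<^bsub>?M\<^esub> e) (\<beta> ` B')"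
      have "\<forall>b\<in>B'. \<exists>g. c (\<beta> b) = rc g"
      proof
        fix b assume "b \<in> B'"
        then have "c (\<beta> b) \<in> carrier S" using c by (intro PiE_mem[OF conjunct1[OF c]]) simp
        then show "\<exists>g. c (\<beta> b) = rc g" by (auto simp: S_ops)
      qed
      then obtain g where g: "\<And>b. b \<in> B' ==> c (\<beta> b) = rc (g b)" by metis
      have "cls ?N (L g) = cls ?N (L f)" using comb[of c g, OF g] conjunct2[OF c] f by simp
      then have "c (\<beta> b) = ?c (\<beta> b)" if "b \<in> B'" for b
        using that L_eq[of g f b] g by (simp add: inv_into_f_f[OF inj])
      then show "c = ?c"
        using conjunct1[OF c] by (intro extensionalityI[of _ "\<beta> ` B'"]) (auto simp: PiE_def)
    qed
  qed
qed

text \<open>All generating sets and all shifts at once: the step to one more variable multiplies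
  generators by powers of that variable and shifts degrees.\<close>

definition null :: "'v mpoly set set \<Rightarrow> 'v set \<Rightarrow> bool" where
  "null J V \<longleftrightarrow> (\<forall>B q i. homogeneous_set B \<longrightarrow> frag_of (conc i (Wquot V q (vspan V B))) \<in> KR J)"

lemma null_empty: "null J {}"
  unfolding null_def
proof (intro allI impI)
  fix B q i assume B: "homogeneous_set B"
  have "conc i (Wquot {} q (vspan {} B)) \<in> free_complexes"
    using concentrated_Wquot[OF B] by (auto simp: conc_term(1) free_Wquot[OF B] graded_free_zero)
  then show "frag_of (conc i (Wquot {} q (vspan {} B))) \<in> KR J" by (rule KR_free)
qed


text \<open>The two copies of v are x and y; x is the one through which v acts for V, and y the one
  for \<open>insert v V\<close>. With D n the polynomials of y-degree below n over the span L of B,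
  T n consists of the polynomials in x over D n. Substituting y for x maps T (m + 1) onto the new
  span with kernel (x - y) T m, for suitable m; T m and T (m + 1) are spans for V.\<close>

lemma null_insert:
  assumes null: "null J V" and v: "v \<notin> V"
  shows "null J (insert v V)"
  unfolding null_def
proof (intro allI impI)
  fix B q i assume B: "homogeneous_set B"
  let ?V = "insert v V"
  define x y :: "('v + 'v) mpoly" where "x = mvar (Inl v)" and "y = mvar (Inr v)"
  \<comment> \<open>The scalars common to V and \<open>insert v V\<close>.\<close>
  define Z where "Z = dvar V ` (- {v}) \<union> range const"
  have Zc: "range const \<subseteq> Z" by (auto simp: Z_def)
  have ZV: "dvars V = insert x Z"
    using v unfolding dvars_def Z_def x_def by (auto simp: dvar_def image_iff)
  have ZV': "dvars ?V = insert y Z"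
  proof -
    have "dvar ?V u = dvar V u" if "u \<noteq> v" for u using that by (simp add: dvar_def)
    then have "dvar ?V ` (- {v}) = dvar V ` (- {v})" by (intro image_cong) auto
    moreover have "range (dvar ?V) = insert (dvar ?V v) (dvar ?V ` (- {v}))" by blast
    ultimately show ?thesis unfolding dvars_def Z_def y_def by (simp add: dvar_def)
  qed
  define L where "L = uspan Z B"
  define D where "D = U.deg_below y L"
  have L: "U.scalar_closed Z L" unfolding L_def by (rule uclosed_uspan)
  note u = udeg[where y = y, OF Zc L, folded D_def]
  note Dc = uclosedD[OF u(1) Zc]
  \<comment> \<open>The quotient of D (m + 1) by D m is L modulo A m: these are the coefficients
    whose term of degree m can be rewritten in lower degree. The sets grow with m; once they are
    stationary, multiplication by y identifies successive quotients.\<close>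
  define A where "A = (\<lambda>m. {a \<in> L. y ^ m * a \<in> D m})"
  have "\<exists>m. \<forall>n. A n \<subseteq> A m"
  proof (rule U.noetherian_chain[of Z B A])
    show "U.scalar_noetherian Z" unfolding Z_def by (rule poly_noetherian) simp
    show "U.scalar_closed Z (A m)" for m
      by (rule U.scalar_closedI)
        (use uclosedD[OF L Zc] Dc in \<open>auto simp: A_def distrib_left mult.left_commute[of "y ^ m"]\<close>)
    show "A m \<subseteq> A (Suc m)" for m using u(2)[of _ m] by (auto simp: A_def mult.assoc)
  qed (use B in \<open>auto simp: A_def L_def homogeneous_set_def\<close>)
  then obtain m where m: "\<And>n. A n \<subseteq> A m" by blast
  \<comment> \<open>One more than m, so that multiplication by y maps D m into D ?k; being at least
    1, it also makes B part of the generators of T ?k.\<close>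
  let ?k = "Suc m"
  \<comment> \<open>Only the coefficient c of y ^ m matters: it lies in A (n + m), hence in A m by
    stationarity.\<close>
  have key: "a \<in> D m" if a: "a \<in> D ?k" and n: "y ^ n * a \<in> D (n + m)" for a n
  proof -
    obtain c g where c: "c \<in> L" "g \<in> D m" "a = y ^ m * c + g" using a unfolding D_def udeg_Suc by blast
    have "y ^ n * g \<in> D (n + m)" using u(4)[OF c(2), of n] by (simp add: add.commute)
    from Dc(5)[OF n this] have "y ^ (n + m) * c \<in> D (n + m)" by (simp add: c(3) algebra_simps power_add)
    then have "c \<in> A m" using m[of "n + m"] c(1) by (auto simp: A_def)
    then show ?thesis using Dc(2) c(2,3) by (auto simp: A_def)
  qed
  define Bs where "Bs = (\<lambda>n. (\<lambda>(j, b). y ^ j * b) ` ({..<n} \<times> B))"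
  have D_span: "D n = uspan Z (Bs n)" for n
    unfolding D_def L_def Bs_def by (rule deg_below_eq_uspan[OF Zc])
  have y_emb: "y ^ j = emb (mvar v ^ j)" for j by (induction j) (auto simp: psubst_mult y_def dvar_def)
  have hy: "homogeneous wtU (\<Sum>_<j. wt v) (y ^ j)" for j
    using homogeneous_power[OF homogeneous_var[of wtU "Inr v"]] by (simp add: y_def wtU_def)
  have HBs: "homogeneous_set (Bs n)" for n
    unfolding homogeneous_set_def
  proof (intro conjI ballI subsetI)
    show "finite (Bs n)" using B by (simp add: Bs_def homogeneous_set_def)
    fix t assume "t \<in> Bs n"
    then obtain j b where t: "t = y ^ j * b" "b \<in> B" by (auto simp: Bs_def)
    then obtain p where p: "b = emb p" using B by (auto simp: homogeneous_set_def)
    have "t = emb (mvar v ^ j * p)" by (simp add: t p y_emb psubst_mult)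
    then show "t \<in> range emb" by blast
    obtain \<gamma> where "homogeneous wtU \<gamma> b" using B t(2) by (auto simp: homogeneous_set_def)
    then show "\<exists>\<gamma>. homogeneous wtU \<gamma> t" unfolding t(1) using homogeneous_mult[OF hy] by blast
  qed
  define T where "T = (\<lambda>n. vspan V (Bs n))"
  have T_deg: "T n = (\<Union>r. U.deg_below x (D n) r)" for n
    unfolding T_def ZV D_span by (rule uspan_insert[OF Zc])
  note xd = udeg[where y = x, OF Zc u(1)]
  have gT: "graded_subspace V (T n)" for n unfolding T_def by (rule vspan_subspace[OF HBs])
  note Ts = graded_subspaceD[OF gT]
  have xT: "x * t \<in> T n" if "t \<in> T n" for t n
    using Ts(3)[OF that, of "mvar v"] v by (simp add: dvar_def x_def)
  have T_mono: "T m \<subseteq> T ?k" unfolding T_def by (rule span_mono) (auto simp: Bs_def)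
  have DT: "D n \<subseteq> T n" for n
    unfolding T_def ZV D_span by (rule U.span_least[OF U.scalar_closedI])
      (auto intro: uspan_intros)
  have yT: "y * t \<in> T ?k" if "t \<in> T m" for t
    using that unfolding T_def
  proof (induction rule: uspan_induct)
    case (base b)
    then obtain j b' where b: "b = y ^ j * b'" "j < m" "b' \<in> B" by (auto simp: Bs_def)
    then have "y * b = y ^ Suc j * b'" "Suc j < ?k" by (auto simp: mult.assoc)
    then have "y * b \<in> Bs ?k" unfolding Bs_def using b(3) by force
    then show ?case by (rule uspan_intros(2))
  next
    case (smult z t)
    then show ?case using uspan_intros(4)[OF smult(1) smult(2)] by (simp add: mult.left_commute)
  qed (auto simp: distrib_left intro: uspan_intros)
  have xyT: "(x - y) * t \<in> T ?k" if "t \<in> T m" for t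
    using Ts(6)[OF subsetD[OF T_mono xT[OF that]] yT[OF that]] by (simp add: left_diff_distrib)
  \<comment> \<open>Identifies x with y; it fixes whatever does not involve x, in particular
    \<open>Z\<close> and every D n.\<close>
  define \<tau> where "\<tau> = psubst (\<lambda>u. if u = Inl v then y else mvar u)"
  have \<tau>_add: "\<tau> (s + t) = \<tau> s + \<tau> t" and \<tau>_mult: "\<tau> (s * t) = \<tau> s * \<tau> t" and \<tau>_diff: "\<tau> (s - t) = \<tau> s - \<tau> t" for s t
    by (auto simp: \<tau>_def psubst_add psubst_mult psubst_diff)
  have \<tau>_act: "\<tau> (act V p) = act ?V p" for p
    unfolding \<tau>_def by (rule psubst_eqI) (use v in \<open>auto simp: dvar_def y_def\<close>)
  have \<tau>_emb: "\<tau> (emb p) = emb p" for p unfolding \<tau>_def by (rule psubst_eqI) (auto simp: dvar_def)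
  have \<tau>xy: "\<tau> x = y" "\<tau> y = y" "\<tau> (y ^ j) = y ^ j" "\<tau> 0 = 0" for j
    using \<tau>_emb[of "mvar v ^ j"] by (auto simp: \<tau>_def x_def y_def y_emb[unfolded y_def])
  have \<tau>xn: "\<tau> (x ^ n) = y ^ n" for n
    by (induction n) (auto simp: \<tau>_mult \<tau>xy, simp add: \<tau>_def)
  have \<tau>_Bs: "\<tau> b = b" if "b \<in> Bs n" for b n
    using HBs[of n] that \<tau>_emb by (auto simp: homogeneous_set_def)
  have \<tau>_Z: "\<tau> z = z" if "z \<in> Z" for z
    using that by (auto simp: Z_def \<tau>_def dvar_def split: if_splits)
  have \<tau>_D: "\<tau> t = t" if "t \<in> D n" for t n
    using that unfolding D_span
    by (induction rule: uspan_induct) (auto simp: \<tau>_add \<tau>_mult \<tau>_Z \<tau>_Bs \<tau>xy)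
  \<comment> \<open>Degree at most m in y from D ?k and degree below n in x add up to degree below m
    + n.\<close>
  have \<tau>_deg: "\<tau> t \<in> D (m + n)" if "t \<in> U.deg_below x (D ?k) n" for t n
    using that
  proof (induction n arbitrary: t)
    case 0
    then show ?case using Dc(1) by (simp add: \<tau>xy)
  next
    case (Suc n)
    then obtain a f where t: "a \<in> D ?k" "f \<in> U.deg_below x (D ?k) n" "t = x ^ n * a + f" unfolding udeg_Suc by blast
    have "y ^ n * a \<in> D (m + Suc n)" using u(4)[OF t(1), of n] by simp
    moreover have "\<tau> f \<in> D (m + Suc n)" using Suc.IH[OF t(2)] u(3)[of "m + n" "m + Suc n"] by auto
    ultimately show ?case using Dc(2) by (simp add: t(3) \<tau>_add \<tau>_mult \<tau>xn \<tau>_D[OF t(1)])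
  qed
  \<comment> \<open>Division by x - y: the leading coefficient a in x lies in D m by
    \<open>key\<close>, and replacing x ^ n a by x ^ (n - 1) y a lowers the degree in x, with y a
    still in D ?k.\<close>
  have ker: "\<exists>s\<in>T m. t = (x - y) * s" if "t \<in> U.deg_below x (D ?k) n" "\<tau> t = 0" for t n
    using that
  proof (induction n arbitrary: t)
    case 0
    then show ?case using Ts(1) by (intro bexI[of _ 0]) auto
  next
    case (Suc n)
    then obtain a f where t: "a \<in> D ?k" "f \<in> U.deg_below x (D ?k) n" "t = x ^ n * a + f" unfolding udeg_Suc by blast
    have "y ^ n * a + \<tau> f = 0" using Suc.prems(2) by (simp add: t(3) \<tau>_add \<tau>_mult \<tau>xn \<tau>_D[OF t(1)])
    then have "y ^ n * a = - \<tau> f" by (simp only: eq_neg_iff_add_eq_0)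
    then have "y ^ n * a \<in> D (n + m)" using Dc(4)[OF \<tau>_deg[OF t(2)]] by (simp add: add.commute)
    then have aD: "a \<in> D m" by (rule key[OF t(1)])
    show ?case
    proof (cases n)
      case 0
      then have "t = a" using t by simp
      then have "t = 0" using Suc.prems(2) \<tau>_D[OF t(1)] by simp
      then show ?thesis using Ts(1) by (intro bexI[of _ 0]) auto
    next
      case (Suc n')
      let ?t = "x ^ n' * (y * a) + f"
      have ya: "y * a \<in> D ?k" by (rule u(2)[OF aD])
      have "x ^ n' * (y * a) + 0 \<in> U.deg_below x (D ?k) (Suc n')"
        unfolding udeg_Suc using ya uclosedD(1)[OF xd(1) Zc] by blast
      then have e: "x ^ n' * (y * a) \<in> U.deg_below x (D ?k) (Suc n')" by (simp only: add_0_right)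
      have t'D: "?t \<in> U.deg_below x (D ?k) n"
        unfolding Suc by (rule uclosedD(2)[OF xd(1) Zc e t(2)[unfolded Suc]])
      have t': "t = (x - y) * (x ^ n' * a) + ?t" by (simp add: t(3) Suc algebra_simps)
      then have "\<tau> ?t = 0" using Suc.prems(2) by (simp add: \<tau>_add \<tau>_mult \<tau>_diff \<tau>xy)
      then obtain s where s: "s \<in> T m" "?t = (x - y) * s" using Suc.IH[OF t'D] by blast
      have "x ^ n' * a + 0 \<in> U.deg_below x (D m) (Suc n')"
        unfolding udeg_Suc using aD uclosedD(1)[OF xd(1) Zc] by blast
      then have "x ^ n' * a \<in> T m" unfolding T_deg add_0_right by blast
      from Ts(2)[OF this s(1)] show ?thesis
        by (rule bexI[rotated]) (use t' s(2) in \<open>simp add: distrib_left\<close>)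
    qed
  qed
  have kerT: "\<exists>s\<in>T m. t = (x - y) * s" if "t \<in> T ?k" "\<tau> t = 0" for t
    using that ker unfolding T_deg by blast
  have xy0: "x - y \<noteq> 0"
  proof
    assume "x - y = 0"
    then have "Poly_Mapping.single (Inl v) (1::nat) = Poly_Mapping.single (Inr v) 1"
      unfolding x_def y_def mvar_def by (metis eq_iff_diff_eq_0 lookup_single_eq lookup_single_not_eq zero_neq_one)
    then show False by (metis lookup_single_eq lookup_single_not_eq sum.distinct(1) zero_neq_one)
  qed
  let ?T = "vspan ?V B"
  have gT': "graded_subspace ?V ?T" by (rule vspan_subspace[OF B])
  note Ts' = graded_subspaceD[OF gT']
  have B_Bs: "B \<subseteq> Bs ?k" unfolding Bs_def by force
  have \<tau>T: "\<tau> t \<in> ?T" if "t \<in> T ?k" for t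
    using that unfolding T_def
  proof (induction rule: uspan_induct)
    case (base b)
    then obtain j b' where b: "b = y ^ j * b'" "b' \<in> B" by (auto simp: Bs_def)
    have "act ?V (mvar v ^ j) * b' \<in> ?T" by (rule Ts'(3)[OF uspan_intros(2)[OF b(2)]])
    moreover have "act ?V (mvar v ^ j) = y ^ j" by (induction j) (auto simp: psubst_mult y_def dvar_def)
    ultimately show ?case using \<tau>_Bs[OF base] b(1) by simp
  next
    case (smult z t)
    have "\<tau> z \<in> dvars ?V" using smult(1) \<tau>_Z \<tau>xy unfolding ZV ZV' by auto
    then show ?case using uspan_intros(4)[OF _ smult(2)] by (simp add: \<tau>_mult)
  qed (auto simp: \<tau>_add \<tau>xy intro: uspan_intros)
  have \<tau>_surj: "\<exists>s\<in>T ?k. \<tau> s = t" if "t \<in> ?T" for t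
    using that
  proof (induction rule: uspan_induct)
    case zero
    show ?case using Ts(1) \<tau>xy by blast
  next
    case (base b)
    then have "b \<in> Bs ?k" using B_Bs by blast
    then show ?case using \<tau>_Bs uspan_intros(2) unfolding T_def by blast
  next
    case (add s t)
    then show ?case using Ts(2) \<tau>_add by metis
  next
    case (smult z t)
    then obtain s where s: "s \<in> T ?k" "\<tau> s = t" by blast
    obtain z' where z': "z' \<in> dvars V" "\<tau> z' = z" using smult(1) \<tau>_Z \<tau>xy unfolding ZV ZV' by blast
    have "z' * s \<in> T ?k" using uspan_intros(4)[OF z'(1)] s(1) unfolding T_def by blast
    then show ?case by (rule bexI[rotated]) (simp add: \<tau>_mult z' s)
  qed
  let ?N = "\<lambda>n. (*) (act V W) ` T n" and ?N' = "(*) (act ?V W) ` ?T"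
  \<comment> \<open>The shift \<open>q - wt v\<close> compensates the degree of x - y.\<close>
  note P1 = presented_Wquot[OF gT[of m], of "q - wt v"] and P2 = presented_Wquot[OF gT[of ?k], of q]
    and P3 = presented_Wquot[OF gT', of q]
  have \<phi>: "pres_map V (q - wt v) (T m) (?N m) V q (T ?k) (?N ?k) ((*) (x - y))"
    unfolding pres_map_def
  proof (intro conjI ballI allI impI)
    show "(x - y) * t \<in> ?N ?k" if "t \<in> ?N m" for t
    proof -
      obtain s where s: "t = act V W * s" "s \<in> T m" using \<open>t \<in> ?N m\<close> by blast
      then have "(x - y) * t = act V W * ((x - y) * s)" by (simp only: mult.left_commute)
      then show ?thesis using xyT[OF s(2)] by blast
    qed
    show "homogeneous wtU (\<gamma> + q) ((x - y) * t)" if t: "homogeneous wtU (\<gamma> + (q - wt v)) t" for \<gamma> t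
    proof -
      have "homogeneous wtU (wt v) (x - y)"
        using homogeneous_diff[OF homogeneous_var[of wtU "Inl v"]] homogeneous_var[of wtU "Inr v"]
        by (simp add: x_def y_def wtU_def)
      from homogeneous_mult[OF this t] show ?thesis by (simp add: algebra_simps)
    qed
  qed (auto simp: distrib_left mult.left_commute xyT)
  have \<psi>: "pres_map V q (T ?k) (?N ?k) ?V q ?T ?N' \<tau>"
    unfolding pres_map_def
  proof (intro conjI ballI allI impI)
    show "\<tau> t \<in> ?N'" if "t \<in> ?N ?k" for t
    proof -
      obtain s where s: "t = act V W * s" "s \<in> T ?k" using \<open>t \<in> ?N ?k\<close> by blast
      then have "\<tau> t = act ?V W * \<tau> s" by (simp only: \<tau>_mult \<tau>_act)
      then show ?thesis using \<tau>T[OF s(2)] by blast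
    qed
    show "homogeneous wtU (\<gamma> + q) (\<tau> t)" if t: "homogeneous wtU (\<gamma> + q) t" for \<gamma> t
      unfolding \<tau>_def by (rule homogeneous_psubst[OF _ t])
        (use homogeneous_var[of wtU "Inr v"] homogeneous_var[of wtU] in \<open>auto simp: y_def wtU_def\<close>)
  qed (auto simp: \<tau>_add \<tau>_mult \<tau>_act \<tau>T)
  obtain h where h: "h \<in> gmod_hom S (Wquot V (q - wt v) (T m)) (Wquot V q (T ?k))"
    "\<And>t. t \<in> T m ==> h (cls (?N m) t) = cls (?N ?k) ((x - y) * t)" by (rule pres_map_hom[OF P1 P2 \<phi>]) (rule that)
  obtain k where k: "k \<in> gmod_hom S (Wquot V q (T ?k)) (Wquot ?V q ?T)"
    "\<And>t. t \<in> T ?k ==> k (cls (?N ?k) t) = cls ?N' (\<tau> t)" by (rule pres_map_hom[OF P2 P3 \<psi>]) (rule that)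
  \<comment> \<open>Injectivity survives division by \<open>W\<close>: applying \<tau> gives \<tau>
    s = 0, as \<open>act ?V W\<close> is no zero divisor, so s is itself x - y times an element of T
    m, and x - y is cancelled.\<close>
  have lift: "t \<in> ?N m" if t: "t \<in> T m" and e: "(x - y) * t \<in> ?N ?k" for t
  proof -
    obtain s where s: "s \<in> T ?k" "(x - y) * t = act V W * s" using e by blast
    have "0 = \<tau> ((x - y) * t)" by (simp add: \<tau>_mult \<tau>_diff \<tau>xy)
    also have "\<dots> = act ?V W * \<tau> s" unfolding s(2) by (simp add: \<tau>_mult \<tau>_act)
    finally have "\<tau> s = 0" using mpoly_no_zero_divisors[of "act ?V W" "\<tau> s"] act_nonzero by auto
    then obtain s' where s': "s' \<in> T m" "s = (x - y) * s'" using kerT[OF s(1)] by blast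
    have "(x - y) * t = (x - y) * (act V W * s')" using s(2) s'(2) by (simp add: mult.left_commute)
    then have "t = act V W * s'" by (rule mpoly_mult_cancel[OF xy0])
    then show ?thesis using s'(1) by blast
  qed
  have exact: "\<tau> t \<in> ?N' \<longleftrightarrow> (\<exists>s\<in>T m. t - (x - y) * s \<in> ?N ?k)" if t: "t \<in> T ?k" for t
  proof
    assume "\<tau> t \<in> ?N'"
    then obtain r where "r \<in> ?T" "\<tau> t = act ?V W * r" by blast
    then obtain s where s: "s \<in> T ?k" "\<tau> t = act ?V W * \<tau> s" using \<tau>_surj by metis
    have "t - act V W * s \<in> T ?k" "\<tau> (t - act V W * s) = 0"
      using Ts(6)[OF t Ts(3)[OF s(1)]] s(2) by (auto simp: \<tau>_diff \<tau>_mult \<tau>_act)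
    then obtain s' where s': "s' \<in> T m" "t - act V W * s = (x - y) * s'" using kerT by blast
    then have "t - (x - y) * s' = act V W * s" by (simp add: algebra_simps)
    then show "\<exists>s\<in>T m. t - (x - y) * s \<in> ?N ?k" using s'(1) s(1) by blast
  next
    assume "\<exists>s\<in>T m. t - (x - y) * s \<in> ?N ?k"
    then obtain s r where "t - (x - y) * s = act V W * r" "r \<in> T ?k" by blast
    then have "\<tau> (t - (x - y) * s) = act ?V W * \<tau> r" by (simp add: \<tau>_mult \<tau>_act)
    then have "\<tau> t = act ?V W * \<tau> r" by (simp add: \<tau>_diff \<tau>_mult \<tau>xy)
    then show "\<tau> t \<in> ?N'" using \<tau>T[OF \<open>r \<in> T ?k\<close>] by blast
  qed
  have c: "concentrated i (conc i (Wquot V (q - wt v) (T m)))" "concentrated i (conc i (Wquot V q (T ?k)))"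
    "concentrated i (conc i (Wquot ?V q ?T))"
    unfolding T_def by (rule concentrated_Wquot[OF HBs] concentrated_Wquot[OF B])+
  have e: "frag_of (conc i (Wquot V q (T ?k))) - frag_of (conc i (Wquot V (q - wt v) (T m))) - frag_of (conc i (Wquot ?V q ?T)) \<in> KR J"
  proof (rule KR_conc_exact[OF c, unfolded conc_term(2), OF h(1) k(1)])
    show "inj_on h (carrier (Wquot V (q - wt v) (T m)))" by (rule pres_map_inj[OF P1 P2 \<phi> h(2) lift])
    show "k z = \<zero>\<^bsub>Wquot ?V q ?T\<^esub> \<longleftrightarrow> z \<in> h ` carrier (Wquot V (q - wt v) (T m))" if "z \<in> carrier (Wquot V q (T ?k))" for z
      by (rule pres_map_exact[OF P1 P2 P3 \<phi> \<psi> h(2) k(2) exact that])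
    show "k ` carrier (Wquot V q (T ?k)) = carrier (Wquot ?V q ?T)"
      by (rule pres_map_surj[OF P2 P3 \<psi> k(2) \<tau>_surj])
  qed
  have "frag_of (conc i (Wquot V q (T ?k))) \<in> KR J" "frag_of (conc i (Wquot V (q - wt v) (T m))) \<in> KR J"
    using null HBs unfolding null_def T_def by blast+
  from KR_closed(3)[OF KR_closed(3)[OF this] e] show "frag_of (conc i (Wquot ?V q ?T)) \<in> KR J" by simp
qed

lemma null_UNIV: "null J UNIV"
proof -
  have "null J V" if "finite V" for V
    using that by (induction V) (auto intro: null_empty null_insert)
  then show ?thesis by simp
qed

end

section \<open>Periodicity and the monodromy relation\<close>

lemma twist_twist: "cplx_twist q (cplx_twist q' A) = cplx_twist (q + q') A" "cplx_twist 0 A = A"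
  by (simp_all add: cplx_twist_def degree_shift_def add.assoc)

lemma sum_hcomp_superset:
  assumes "finite E" "monomial_degree wt ` Poly_Mapping.keys p \<subseteq> E"
  shows "(\<Sum>\<gamma>\<in>E. hcomp wt \<gamma> p) = p"
proof -
  have "hcomp wt \<gamma> p = 0" if "\<gamma> \<notin> monomial_degree wt ` Poly_Mapping.keys p" for \<gamma>
    using that by (intro poly_mapping_eqI) (simp add: lookup_hcomp, metis image_eqI in_keys_iff)
  then have "(\<Sum>\<gamma>\<in>E. hcomp wt \<gamma> p) = (\<Sum>\<gamma>\<in>monomial_degree wt ` Poly_Mapping.keys p. hcomp wt \<gamma> p)"
    using assms by (intro sum.mono_neutral_right) auto
  then show ?thesis by (simp add: sum_hcomp)
qed

type_synonym ('g, 'v) hypersurface_cplx = "('g, 'v mpoly set, (nat \<Rightarrow> 'v mpoly) set) cplx"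

context hypersurface
begin

lemma homogeneous_merge: "homogeneous wtU \<gamma> t ==> homogeneous wt \<gamma> (merge t)"
  by (erule homogeneous_psubst[rotated]) (auto simp: wtU_def homogeneous_var split: sum.splits)

text \<open>With I the annihilator of b, the module is P/I with its generator moved to degree
  \<beta>. The work lies in showing that I is homogeneous and that homogeneous elements of M come
  from homogeneous polynomials.\<close>

lemma cyclic_presented:
  assumes M: "graded_module S M" and b: "b \<in> gcomp M \<beta>"
    and cyc: "carrier M = scalar_span (carrier S) M {b}"
  defines "I \<equiv> {p. rc p \<odot>\<^bsub>M\<^esub> b = \<zero>\<^bsub>M\<^esub>}"
  shows "graded_subspace UNIV (emb ` I)" "W \<in> I" "\<And>p f. f \<in> I ==> p * f \<in> I"
    "presented UNIV (r - \<beta>) (range emb) (emb ` I) (\<lambda>t. rc (merge t) \<odot>\<^bsub>M\<^esub> b) (degree_shift r M)"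
proof -
  interpret M: Module.module S M by (rule graded_moduleD(1)[OF M])
  have bM: "b \<in> carrier M" using b graded_moduleD(3)[OF M] by blast
  have rcM: "rc p \<odot>\<^bsub>M\<^esub> b \<in> carrier M" for p using bM by (simp add: S_ops)
  have add: "rc (p + q) \<odot>\<^bsub>M\<^esub> b = rc p \<odot>\<^bsub>M\<^esub> b \<oplus>\<^bsub>M\<^esub> rc q \<odot>\<^bsub>M\<^esub> b" for p q
    using M.smult_l_distr[of "rc p" "rc q" b] bM by (simp add: S_ops)
  have mult: "rc (p * q) \<odot>\<^bsub>M\<^esub> b = rc p \<odot>\<^bsub>M\<^esub> (rc q \<odot>\<^bsub>M\<^esub> b)" for p q
    using M.smult_assoc1[of "rc p" "rc q" b] bM by (simp add: S_ops)
  have zero: "rc 0 \<odot>\<^bsub>M\<^esub> b = \<zero>\<^bsub>M\<^esub>" using M.smult_l_null[OF bM] by (simp add: S_ops)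
  have rz: "rc p \<odot>\<^bsub>M\<^esub> \<zero>\<^bsub>M\<^esub> = \<zero>\<^bsub>M\<^esub>" for p by (rule M.smult_r_null) (simp add: S_ops)
  have sum: "finsum M (\<lambda>\<gamma>. rc (f \<gamma>) \<odot>\<^bsub>M\<^esub> b) E = rc (\<Sum>\<gamma>\<in>E. f \<gamma>) \<odot>\<^bsub>M\<^esub> b" if "finite E" for f :: "'g \<Rightarrow> 'v mpoly" and E
    using that by (induction E) (auto simp: zero add rcM M.finsum_insert)
  have deg: "rc p \<odot>\<^bsub>M\<^esub> b \<in> gcomp M \<gamma>" if "homogeneous wt (\<gamma> - \<beta>) p" for p \<gamma>
    using graded_moduleD(6)[OF M, of "rc p" "\<gamma> - \<beta>" b \<beta>] b that by (simp add: S_ops)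
  \<comment> \<open>The parts of p outside degree \<gamma> - \<beta> contribute nothing together:
    their sum applied to b lies in degree \<gamma>, while its components lie in other
    degrees.\<close>
  have split: "rc (p - hcomp wt (\<gamma> - \<beta>) p) \<odot>\<^bsub>M\<^esub> b = \<zero>\<^bsub>M\<^esub>" if x: "rc p \<odot>\<^bsub>M\<^esub> b \<in> gcomp M \<gamma>" for p \<gamma>
  proof -
    define E where "E = insert \<gamma> ((\<lambda>\<eta>. \<eta> + \<beta>) ` monomial_degree wt ` Poly_Mapping.keys p)"
    have E: "finite E" "\<gamma> \<in> E" by (auto simp: E_def)
    let ?h = "\<lambda>\<eta>. hcomp wt (\<eta> - \<beta>) p"
    have "(\<Sum>\<eta>\<in>E. ?h \<eta>) = (\<Sum>\<eta>\<in>(\<lambda>\<eta>. \<eta> - \<beta>) ` E. hcomp wt \<eta> p)"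
      by (subst sum.reindex) (auto simp: inj_on_def)
    also have "\<dots> = p" by (rule sum_hcomp_superset) (auto simp: E_def image_iff)
    finally have hp: "(\<Sum>\<eta>\<in>E - {\<gamma>}. ?h \<eta>) = p - ?h \<gamma>" using E by (simp add: sum_diff1)
    define x where "x = rc (p - ?h \<gamma>) \<odot>\<^bsub>M\<^esub> b"
    have xM: "x \<in> carrier M" by (simp add: x_def rcM)
    have "x = rc p \<odot>\<^bsub>M\<^esub> b \<oplus>\<^bsub>M\<^esub> rc (- ?h \<gamma>) \<odot>\<^bsub>M\<^esub> b" unfolding x_def by (simp add: add[symmetric])
    also have "\<dots> \<in> gcomp M \<gamma>"
      by (rule gcomp_closed(2)[OF M x deg]) (rule homogeneous_uminus[OF hcomp_homogeneous])
    finally have xg: "x \<in> gcomp M \<gamma>" .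
    \<comment> \<open>Placing the negated sum of the other parts in degree \<gamma> produces a
      decomposition of zero.\<close>
    let ?c = "\<lambda>\<eta>. if \<eta> = \<gamma> then \<ominus>\<^bsub>M\<^esub> x else rc (?h \<eta>) \<odot>\<^bsub>M\<^esub> b"
    have "finsum M ?c (insert \<gamma> (E - {\<gamma>})) = \<ominus>\<^bsub>M\<^esub> x \<oplus>\<^bsub>M\<^esub> finsum M ?c (E - {\<gamma>})"
      using E xM rcM by (subst M.finsum_insert) auto
    also have "finsum M ?c (E - {\<gamma>}) = finsum M (\<lambda>\<eta>. rc (?h \<eta>) \<odot>\<^bsub>M\<^esub> b) (E - {\<gamma>})"
      by (rule M.finsum_cong') (use rcM in auto)
    also have "\<dots> = x" using sum[of "E - {\<gamma>}" ?h] E by (simp add: hp x_def)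
    finally have z: "finsum M ?c E = \<zero>\<^bsub>M\<^esub>" using E xM by (simp add: insert_absorb M.l_neg)
    have "?c \<eta> \<in> gcomp M \<eta>" for \<eta>
      using gcomp_closed(4)[OF M xg] deg[OF hcomp_homogeneous] by simp
    from graded_module_indep[OF M E(1) this z E(2)] have "\<ominus>\<^bsub>M\<^esub> x = \<zero>\<^bsub>M\<^esub>" by simp
    then have "x = \<zero>\<^bsub>M\<^esub>" using M.l_neg[OF xM] xM by simp
    then show ?thesis unfolding x_def .
  qed
  show I_mult: "p * f \<in> I" if "f \<in> I" for p f
    using that by (simp add: I_def mult rz)
  have "rc W = rc 0" by (auto simp: residue_eq intro: exI[of _ 1])
  then show "W \<in> I" using zero by (simp add: I_def)
  have I_add: "f + g \<in> I" if "f \<in> I" "g \<in> I" for f g using that by (simp add: I_def add)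
  show gI: "graded_subspace UNIV (emb ` I)"
  proof (rule graded_subspace_ideal)
    show "0 \<in> I" using zero by (simp add: I_def)
    show "hcomp wt \<gamma> f \<in> I" if f: "f \<in> I" for \<gamma> f
    proof -
      have "rc (f - hcomp wt (\<gamma> + \<beta> - \<beta>) f) \<odot>\<^bsub>M\<^esub> b = \<zero>\<^bsub>M\<^esub>"
        using f by (intro split) (simp add: I_def gcomp_closed(1)[OF M])
      then have "f - hcomp wt \<gamma> f \<in> I" by (simp add: I_def)
      from I_add[OF f I_mult[OF this, of "- 1"]] show ?thesis by simp
    qed
  qed (use I_add I_mult in auto)
  have eq: "rc p \<odot>\<^bsub>M\<^esub> b = rc q \<odot>\<^bsub>M\<^esub> b \<longleftrightarrow> p - q \<in> I" for p q
  proof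
    assume "rc p \<odot>\<^bsub>M\<^esub> b = rc q \<odot>\<^bsub>M\<^esub> b"
    then have "rc (p + - q) \<odot>\<^bsub>M\<^esub> b = rc (q + - q) \<odot>\<^bsub>M\<^esub> b" unfolding add by simp
    then show "p - q \<in> I" by (simp add: I_def zero)
  next
    assume "p - q \<in> I"
    then have "rc ((p - q) + q) \<odot>\<^bsub>M\<^esub> b = rc q \<odot>\<^bsub>M\<^esub> b" unfolding add by (simp add: I_def rcM)
    then show "rc p \<odot>\<^bsub>M\<^esub> b = rc q \<odot>\<^bsub>M\<^esub> b" by simp
  qed
  have inj: "emb a = emb c \<longleftrightarrow> a = c" for a c by (metis merge_act)
  have car: "carrier M = (\<lambda>p. rc p \<odot>\<^bsub>M\<^esub> b) ` UNIV"
    using cyc unfolding cyclic_sub(2)[OF M b] by (simp add: S_ops image_image)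
  show "presented UNIV (r - \<beta>) (range emb) (emb ` I) (\<lambda>t. rc (merge t) \<odot>\<^bsub>M\<^esub> b) (degree_shift r M)"
    unfolding presented_def
  proof (intro conjI ballI allI)
    show "carrier (degree_shift r M) = (\<lambda>t. rc (merge t) \<odot>\<^bsub>M\<^esub> b) ` range emb"
      unfolding image_image by (simp add: car)
    show "gcomp (degree_shift r M) \<gamma> = (\<lambda>t. rc (merge t) \<odot>\<^bsub>M\<^esub> b) ` {t \<in> range emb. homogeneous wtU (\<gamma> + (r - \<beta>)) t}" for \<gamma>
    proof (intro equalityI subsetI)
      fix x assume "x \<in> gcomp (degree_shift r M) \<gamma>"
      then have x: "x \<in> gcomp M (\<gamma> + r)" by simp
      then obtain p where p: "x = rc p \<odot>\<^bsub>M\<^esub> b" using graded_moduleD(3)[OF M] car by blast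
      let ?p = "hcomp wt (\<gamma> + r - \<beta>) p"
      have "p - ?p \<in> I" using split[of p "\<gamma> + r"] x p by (simp add: I_def)
      then have "x = rc (merge (emb ?p)) \<odot>\<^bsub>M\<^esub> b" using eq p by simp
      moreover have "homogeneous wtU (\<gamma> + (r - \<beta>)) (emb ?p)"
        using homogeneous_act[OF hcomp_homogeneous[of wt "\<gamma> + r - \<beta>" p], of UNIV] by (simp add: add_diff_eq)
      ultimately show "x \<in> (\<lambda>t. rc (merge t) \<odot>\<^bsub>M\<^esub> b) ` {t \<in> range emb. homogeneous wtU (\<gamma> + (r - \<beta>)) t}" by blast
    next
      fix x assume "x \<in> (\<lambda>t. rc (merge t) \<odot>\<^bsub>M\<^esub> b) ` {t \<in> range emb. homogeneous wtU (\<gamma> + (r - \<beta>)) t}"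
      then obtain t where t: "x = rc (merge t) \<odot>\<^bsub>M\<^esub> b" "homogeneous wtU (\<gamma> + (r - \<beta>)) t" by blast
      show "x \<in> gcomp (degree_shift r M) \<gamma>"
        using deg[of "\<gamma> + r" "merge t"] homogeneous_merge[OF t(2)] by (simp add: t(1) add_diff_eq)
    qed
    show "rc (merge s) \<odot>\<^bsub>M\<^esub> b = rc (merge t) \<odot>\<^bsub>M\<^esub> b \<longleftrightarrow> s - t \<in> emb ` I" if st: "s \<in> range emb" "t \<in> range emb" for s t
    proof -
      obtain p q where "s = emb p" "t = emb q" using st by blast
      then show ?thesis unfolding eq by (auto simp: psubst_diff[symmetric] image_iff inj)
    qed
    show "rc p \<odot>\<^bsub>degree_shift r M\<^esub> (rc (merge t) \<odot>\<^bsub>M\<^esub> b) = rc (merge (emb p * t)) \<odot>\<^bsub>M\<^esub> b" for p t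
      by (simp add: psubst_mult mult)
  qed (use gI graded_subspace_range in \<open>auto simp: psubst_add add zero\<close>)
qed

text \<open>The ideal lies in the span of 1, so the basis theorem gives finitely many generators;
  their homogeneous components stay in the ideal and generate it as well.\<close>

lemma ideal_vspan:
  assumes I: "graded_subspace UNIV (emb ` I)"
  obtains B where "homogeneous_set B" "emb ` I = vspan UNIV B"
proof -
  note t = graded_subspaceD[OF I]
  have one: "homogeneous_set {1}"
    using psubst_one[of "dvar UNIV"] homogeneous_one[of wtU] unfolding homogeneous_set_def
    by (auto simp del: homogeneous_one psubst_one)
  have dv: "\<exists>p. z = emb p" if "z \<in> dvars UNIV" for z
    using that psubst_var[of "dvar UNIV"] psubst_const[of "dvar UNIV"] unfolding dvars_def by (metis UnE imageE)
  have closed: "U.scalar_closed (dvars UNIV) (emb ` I)"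
  proof (rule U.scalar_closedI)
    show "z \<odot>\<^bsub>poly_module\<^esub> x \<in> emb ` I" if z: "z \<in> dvars UNIV" and x: "x \<in> emb ` I" for z x
    proof -
      obtain p where "z = emb p" using dv[OF z] by blast
      then show ?thesis using t(3)[OF x, of p] by simp
    qed
    show "x \<oplus>\<^bsub>poly_module\<^esub> y \<in> emb ` I" if "x \<in> emb ` I" "y \<in> emb ` I" for x y
      using t(2)[OF that] by simp
  qed (use t(1) in auto)
  have o: "1 \<in> vspan UNIV {1}" by (rule uspan_intros(2)) simp
  have "emb p \<in> vspan UNIV {1}" for p
    using graded_subspaceD(3)[OF vspan_subspace[OF one] o, of p] by simp
  then have sub: "emb ` I \<subseteq> vspan UNIV {1}" by blast
  have "U.scalar_noetherian (dvars UNIV)" unfolding dvars_def by (rule poly_noetherian) simp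
  with closed sub obtain C where C: "finite C" "C \<subseteq> emb ` I" "emb ` I \<subseteq> vspan UNIV C"
    unfolding U.scalar_noetherian_def by (metis finite.emptyI finite.insertI subset_UNIV)
  let ?D = "\<lambda>c. monomial_degree wtU ` Poly_Mapping.keys c"
  let ?B = "(\<lambda>(c, \<gamma>). hcomp wtU \<gamma> c) ` (Sigma C ?D)"
  have BI: "?B \<subseteq> emb ` I" using C(2) t(4) by auto
  have B: "homogeneous_set ?B"
    unfolding homogeneous_set_def
  proof (intro conjI ballI)
    show "finite ?B" using C(1) by simp
    show "?B \<subseteq> range emb" using BI by blast
    show "\<exists>\<gamma>. homogeneous wtU \<gamma> b" if b: "b \<in> ?B" for b
    proof -
      obtain c \<gamma> where "b = hcomp wtU \<gamma> c" using b by auto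
      then show ?thesis using hcomp_homogeneous[of wtU \<gamma> c] by blast
    qed
  qed
  note s = graded_subspaceD[OF vspan_subspace[OF B, of UNIV]]
  have "c \<in> vspan UNIV ?B" if c: "c \<in> C" for c
  proof -
    have "(\<Sum>\<gamma>\<in>F. hcomp wtU \<gamma> c) \<in> vspan UNIV ?B" if "finite F" "F \<subseteq> ?D c" for F
      using that
    proof (induction F)
      case (insert \<gamma> F)
      then have "hcomp wtU \<gamma> c \<in> ?B" using c by (intro image_eqI[of _ _ "(c, \<gamma>)"]) auto
      then have h: "hcomp wtU \<gamma> c \<in> vspan UNIV ?B" by (rule uspan_intros(2))
      have "(\<Sum>\<gamma>\<in>F. hcomp wtU \<gamma> c) \<in> vspan UNIV ?B" using insert.prems by (intro insert.IH) simp
      from s(2)[OF h this] show ?case unfolding sum.insert[OF insert.hyps] .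
    qed (use s(1) in simp)
    from this[of "?D c"] show ?thesis by (simp add: sum_hcomp)
  qed
  then have "vspan UNIV C \<subseteq> vspan UNIV ?B" by (intro span_subset) blast
  moreover have "vspan UNIV ?B \<subseteq> emb ` I" by (rule U.span_least[OF closed BI])
  ultimately show ?thesis using that[OF B] C(3) by blast
qed

text \<open>Both middle terms, I/WI and P/WP, have the form treated by \<open>null_UNIV\<close>, so
  the four-term relation leaves just the two outer classes.\<close>

lemma KR_cyclic_periodic:
  fixes A :: "('g, 'v) hypersurface_cplx"
  assumes A: "cyclic_complex A i b \<beta>"
  shows "frag_of (cplx_twist (- \<delta>) A) - frag_of A \<in> KR J"
proof -
  have AB: "A \<in> BF" and b: "b \<in> gcomp (cterm A i) \<beta>"
    and cyc: "carrier (cterm A i) = scalar_span (carrier S) (cterm A i) {b}"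
    and conA: "concentrated i A" using A by (auto simp: cyclic_complex_def)
  define I where "I = {p. rc p \<odot>\<^bsub>cterm A i\<^esub> b = \<zero>\<^bsub>cterm A i\<^esub>}"
  let ?\<theta> = "\<lambda>t. rc (merge t) \<odot>\<^bsub>cterm A i\<^esub> b" and ?E = "range emb" and ?X = "emb ` I"
  note cp = cyclic_presented[OF complexD(1)[OF AB] b cyc, folded I_def]
  obtain B where B: "homogeneous_set B" "?X = vspan UNIV B" by (rule ideal_vspan[OF cp(1)])
  obtain B' where B': "homogeneous_set B'" "?E = vspan UNIV B'" by (rule ideal_vspan[OF graded_subspace_range])
  \<comment> \<open>Twisting by \<beta> puts the generator in degree zero, so that the middle terms
    can be taken with shift 0; the twist is undone at the end.\<close>
  let ?A1 = "cplx_twist (\<beta> - \<delta>) A" and ?A4 = "cplx_twist \<beta> A"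
  let ?A2 = "conc i (Wquot UNIV 0 ?X)" and ?A3 = "conc i (Wquot UNIV 0 ?E)"
  have tw: "concentrated i (cplx_twist q A)" for q using conA by (simp add: cplx_twist_complex)
  have c: "concentrated i ?A1" "concentrated i ?A2" "concentrated i ?A3" "concentrated i ?A4"
    unfolding B(2) B'(2) by (rule tw concentrated_Wquot B(1) B'(1))+
  have P1: "presented UNIV (- \<delta>) ?E ?X ?\<theta> (cterm ?A1 i)" using cp(4)[of "\<beta> - \<delta>"] by simp
  have P4: "presented UNIV 0 ?E ?X ?\<theta> (cterm ?A4 i)" using cp(4)[of \<beta>] by simp
  have P2: "presented UNIV 0 ?X ((*) (emb W) ` ?X) (cls ((*) (emb W) ` ?X)) (cterm ?A2 i)"
    unfolding conc_term(2) by (rule presented_Wquot[OF cp(1)])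
  have P3: "presented UNIV 0 ?E ((*) (emb W) ` ?E) (cls ((*) (emb W) ` ?E)) (cterm ?A3 i)"
    unfolding conc_term(2) by (rule presented_Wquot[OF graded_subspace_range])
  have WE: "emb W * t \<in> ?X" if t: "t \<in> ?E" for t
  proof -
    obtain p where "t = emb p" using t by blast
    then have "emb W * t = emb (p * W)" by (simp add: psubst_mult mult.commute)
    then show ?thesis using cp(3)[OF cp(2), of p] by blast
  qed
  have m1: "pres_map UNIV (- \<delta>) ?E ?X UNIV 0 ?X ((*) (emb W) ` ?X) ((*) (emb W))"
    unfolding pres_map_def
  proof (intro conjI ballI allI impI)
    show "homogeneous wtU (\<gamma> + 0) (emb W * t)" if "homogeneous wtU (\<gamma> + - \<delta>) t" for \<gamma> t
      using homogeneous_mult[OF homogeneous_act[OF W_homogeneous, of UNIV] that] by simp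
  qed (use WE in \<open>auto simp: distrib_left mult.left_commute\<close>)
  have m2: "pres_map UNIV 0 ?X ((*) (emb W) ` ?X) UNIV 0 ?E ((*) (emb W) ` ?E) (\<lambda>t. t)"
    unfolding pres_map_def by auto
  have m3: "pres_map UNIV 0 ?E ((*) (emb W) ` ?E) UNIV 0 ?E ?X (\<lambda>t. t)"
    unfolding pres_map_def using WE by auto
  obtain f where f: "f \<in> gmod_hom S (cterm ?A1 i) (cterm ?A2 i)"
    "\<And>t. t \<in> ?E ==> f (?\<theta> t) = cls ((*) (emb W) ` ?X) (emb W * t)" by (rule pres_map_hom[OF P1 P2 m1]) (rule that)
  obtain g where g: "g \<in> gmod_hom S (cterm ?A2 i) (cterm ?A3 i)"
    "\<And>t. t \<in> ?X ==> g (cls ((*) (emb W) ` ?X) t) = cls ((*) (emb W) ` ?E) t" by (rule pres_map_hom[OF P2 P3 m2]) (rule that)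
  obtain h where h: "h \<in> gmod_hom S (cterm ?A3 i) (cterm ?A4 i)"
    "\<And>t. t \<in> ?E ==> h (cls ((*) (emb W) ` ?E) t) = ?\<theta> t" by (rule pres_map_hom[OF P3 P4 m3]) (rule that)
  have e: "frag_of ?A1 - frag_of ?A2 + frag_of ?A3 - frag_of ?A4 \<in> KR J"
  proof (rule KR_conc_exact4[OF c f(1) g(1) h(1)])
    show "inj_on f (carrier (cterm ?A1 i))"
    proof (rule pres_map_inj[OF P1 P2 m1 f(2)])
      \<comment> \<open>If W t = W s with s in the ideal, then t = s: the kernel is computed in the
        polynomial ring, where \<open>W\<close> can be cancelled.\<close>
      show "t \<in> ?X" if t: "emb W * t \<in> (*) (emb W) ` ?X" for t
      proof -
        obtain s where s: "s \<in> ?X" "emb W * t = emb W * s" using t by blast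
        show ?thesis using mpoly_mult_cancel[OF act_nonzero s(2)] s(1) by simp
      qed
    qed
    show "g x = \<zero>\<^bsub>cterm ?A3 i\<^esub> \<longleftrightarrow> x \<in> f ` carrier (cterm ?A1 i)" if x: "x \<in> carrier (cterm ?A2 i)" for x
    proof (rule pres_map_exact[OF P1 P2 P3 m1 m2 f(2) g(2) _ x])
      show "t \<in> (*) (emb W) ` ?E \<longleftrightarrow> (\<exists>s\<in>?E. t - emb W * s \<in> (*) (emb W) ` ?X)" for t
      proof
        assume "t \<in> (*) (emb W) ` ?E"
        then obtain s where s: "s \<in> ?E" "t = emb W * s" by blast
        have "t - emb W * s = emb W * 0" by (simp add: s(2))
        then have "t - emb W * s \<in> (*) (emb W) ` ?X"
          by (rule image_eqI) (rule graded_subspaceD(1)[OF cp(1)])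
        then show "\<exists>s\<in>?E. t - emb W * s \<in> (*) (emb W) ` ?X" using s(1) by blast
      next
        assume "\<exists>s\<in>?E. t - emb W * s \<in> (*) (emb W) ` ?X"
        then obtain p q where "t - emb W * emb p = emb W * emb q" by blast
        then have "t = emb W * emb (p + q)" by (simp add: psubst_add algebra_simps)
        then show "t \<in> (*) (emb W) ` ?E" by blast
      qed
    qed
    show "h x = \<zero>\<^bsub>cterm ?A4 i\<^esub> \<longleftrightarrow> x \<in> g ` carrier (cterm ?A2 i)" if x: "x \<in> carrier (cterm ?A3 i)" for x
    proof (rule pres_map_exact[OF P2 P3 P4 m2 m3 g(2) h(2) _ x])
      fix t :: "('v + 'v) mpoly"
      show "t \<in> ?X \<longleftrightarrow> (\<exists>s\<in>?X. t - s \<in> (*) (emb W) ` ?E)"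
      proof
        assume t: "t \<in> ?X"
        have "t - t = emb W * 0" by simp
        then have "t - t \<in> (*) (emb W) ` ?E"
          by (rule image_eqI) (rule graded_subspaceD(1)[OF graded_subspace_range])
        then show "\<exists>s\<in>?X. t - s \<in> (*) (emb W) ` ?E"
          by (rule bexI[of "\<lambda>s. t - s \<in> (*) (emb W) ` ?E" t, OF _ t])
      next
        assume "\<exists>s\<in>?X. t - s \<in> (*) (emb W) ` ?E"
        then obtain s where s: "s \<in> ?X" "t - s \<in> (*) (emb W) ` ?E" by (rule bexE)
        from s(2) obtain u where u: "t - s = emb W * u" "u \<in> ?E" by (rule imageE)
        have "t - s \<in> ?X" unfolding u(1) by (rule WE[OF u(2)])
        note s = s(1) this
        show "t \<in> ?X" using graded_subspaceD(2)[OF cp(1) s] by simp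
      qed
    qed
    show "h ` carrier (cterm ?A3 i) = carrier (cterm ?A4 i)"
      by (rule pres_map_surj[OF P3 P4 m3 h(2)]) auto
  qed
  have "frag_of ?A2 \<in> KR J" "frag_of ?A3 \<in> KR J"
    using null_UNIV[of J] B B' unfolding null_def by auto
  from KR_closed(2)[OF e KR_closed(3)[OF this]] have "frag_of ?A1 - frag_of ?A4 \<in> KR J" by simp
  from KR_twist[OF this, of "- \<beta>"] show ?thesis
    by (simp add: frag_extend_diff twist_twist)
qed

lemma zero_torsion:
  fixes A :: "('g, 'v) hypersurface_cplx"
  assumes A: "A \<in> BF" and z: "\<And>i. carrier (cterm A i) = {\<zero>\<^bsub>cterm A i\<^esub>}"
  shows "A \<in> torsion_complexes J"
proof -
  have "torsion S J (cterm A i)" for i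
  proof -
    interpret Module.module S "cterm A i" by (rule graded_moduleD(1)[OF complexD(1)[OF A]])
    show ?thesis unfolding torsion_def
      by (rule exI[of _ 0]) (auto simp: ideal_power_def z)
  qed
  then show ?thesis using A by blast
qed

text \<open>Twisting is exact, so the claim is additive along a filtration with cyclic subquotients;
  zero complexes are torsion.\<close>

lemma KR_periodic:
  fixes A :: "('g, 'v) hypersurface_cplx"
  assumes A: "A \<in> BF"
  shows "frag_of (cplx_twist (- \<delta>) A) - frag_of A \<in> KR J"
  using A
proof (rule cyclic_filtration[where P = "\<lambda>A. frag_of (cplx_twist (- \<delta>) A) - frag_of A \<in> KR J"])
  show "frag_of (cplx_twist (- \<delta>) A) - frag_of A \<in> KR J"
    if "A \<in> BF" "\<And>i. carrier (cterm A i) = {\<zero>\<^bsub>cterm A i\<^esub>}" for A :: "('g, 'v) hypersurface_cplx"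
    using zero_torsion[OF that] by (intro KR_closed(3) KR_torsion torsion_complexes_closed(2))
  show "frag_of (cplx_twist (- \<delta>) A) - frag_of A \<in> KR J" if "cyclic_complex A i b \<beta>"
    for A :: "('g, 'v) hypersurface_cplx" and i b \<beta>
    by (rule KR_cyclic_periodic[OF that])
  fix A' A A'' :: "('g, 'v) hypersurface_cplx" and \<iota> p
  assume h: "A' \<in> BF" "A \<in> BF" "A'' \<in> BF" "chain_map S A' A \<iota>" "chain_map S A A'' p"
    "\<And>i. inj_on (\<iota> i) (carrier (cterm A' i))" "\<And>i. p i ` carrier (cterm A i) = carrier (cterm A'' i)"
    "\<And>i x. x \<in> carrier (cterm A i) ==> p i x = \<zero>\<^bsub>cterm A'' i\<^esub> \<longleftrightarrow> x \<in> \<iota> i ` carrier (cterm A' i)"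
    and IH: "frag_of (cplx_twist (- \<delta>) A') - frag_of A' \<in> KR J" "frag_of (cplx_twist (- \<delta>) A'') - frag_of A'' \<in> KR J"
  have e: "frag_of A - frag_of A' - frag_of A'' \<in> KR J" by (rule KR_exact[OF h])
  have "frag_of (cplx_twist (- \<delta>) A) - frag_of (cplx_twist (- \<delta>) A') - frag_of (cplx_twist (- \<delta>) A'') \<in> KR J"
    using KR_twist[OF e, of "- \<delta>"] by (simp add: frag_extend_diff)
  from KR_closed(3)[OF KR_closed(2)[OF KR_closed(2)[OF this IH(1)] IH(2)] e]
  show "frag_of (cplx_twist (- \<delta>) A) - frag_of A \<in> KR J" by (simp add: algebra_simps)
qed

text \<open>The relations together with the classes of complexes annihilated by all variables in X,
  closed to a subgroup; each further factor of the product enlarges X by one variable.\<close>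

inductive_set annihilated :: "'v mpoly set set \<Rightarrow> 'v set \<Rightarrow> (('g, 'v mpoly set, (nat \<Rightarrow> 'v mpoly) set) cplx \<Rightarrow>\<^sub>0 int) set"
  for J X where
  ann_KR: "c \<in> KR J ==> c \<in> annihilated J X"
| ann_base: "A \<in> BF ==> (\<And>j. j \<in> X ==> annihilates (rc (mvar j)) A) ==> frag_of A \<in> annihilated J X"
| ann_add: "c \<in> annihilated J X ==> c' \<in> annihilated J X ==> c + c' \<in> annihilated J X"
| ann_diff: "c \<in> annihilated J X ==> c' \<in> annihilated J X ==> c - c' \<in> annihilated J X"

text \<open>On a single complex the kernel and cokernel of multiplication by the variable do it. The
  twist needed there is \<open>wt j\<close>; where it exceeds \<open>\<gamma>\<close> by \<delta>,
  as for the fibre variables, periodicity makes up the difference.\<close>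

lemma annihilated_step:
  fixes c :: "('g, 'v) hypersurface_cplx \<Rightarrow>\<^sub>0 int"
  assumes c: "c \<in> annihilated J X" and \<gamma>: "wt j = \<gamma> \<or> wt j = \<gamma> + \<delta>"
  shows "frag_extend (\<lambda>A. frag_of (cplx_twist \<gamma> A)) c - c \<in> annihilated J (insert j X)"
  using c
proof (induction rule: annihilated.induct)
  case (ann_KR c)
  then show ?case by (intro annihilated.ann_KR KR_closed(3) KR_twist)
next
  case (ann_base A)
  have "rc (mvar j) \<in> rcomp S (wt j)" using homogeneous_var[of wt j] by (auto simp: S_ops)
  from KR_mult[OF ann_base(1) this, of J] obtain K C where KC: "K \<in> BF" "C \<in> BF"
    "frag_of K - frag_of A + frag_of (cplx_twist (wt j) A) - frag_of C \<in> KR J"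
    "annihilates (rc (mvar j)) K" "annihilates (rc (mvar j)) C"
    "\<And>r. r \<in> carrier S ==> annihilates r A ==> annihilates r K \<and> annihilates r C" by blast
  have ann: "annihilates (rc (mvar i)) K \<and> annihilates (rc (mvar i)) C" if "i \<in> insert j X" for i
    using that KC(4,5) KC(6)[of "rc (mvar i)"] ann_base(2)[of i] by (auto simp: S_ops)
  have "frag_of (cplx_twist \<gamma> A) - frag_of (cplx_twist (wt j) A) \<in> KR J"
  proof (cases "wt j = \<gamma>")
    case True
    then show ?thesis using KR_closed(1) by simp
  next
    case False
    then have "wt j = \<gamma> + \<delta>" using \<gamma> by simp
    then show ?thesis using KR_periodic[OF cplx_twist_complex[OF ann_base(1), of "wt j"], of J]
      by (simp add: twist_twist)
  qed
  from KR_closed(2)[OF this KC(3)]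
  have e: "frag_of (cplx_twist \<gamma> A) - frag_of (cplx_twist (wt j) A) +
    (frag_of K - frag_of A + frag_of (cplx_twist (wt j) A) - frag_of C) \<in> KR J" .
  have kc: "frag_of K \<in> annihilated J (insert j X)" "frag_of C \<in> annihilated J (insert j X)"
    by (rule annihilated.ann_base[OF KC(1)] annihilated.ann_base[OF KC(2)]; use ann in blast)+
  from annihilated.ann_add[OF annihilated.ann_diff[OF annihilated.ann_KR[OF e] kc(1)] kc(2)]
  show ?case by (simp add: algebra_simps)
next
  case (ann_add c c')
  from annihilated.ann_add[OF ann_add.IH] show ?case by (simp add: frag_extend_add algebra_simps)
next
  case (ann_diff c c')
  from annihilated.ann_diff[OF ann_diff.IH] show ?case by (simp add: frag_extend_diff algebra_simps)
qed

lemma foldr_in_KR: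
  fixes A :: "('g, 'v) hypersurface_cplx"
  assumes \<gamma>: "\<And>j. wt j = \<gamma> j \<or> wt j = \<gamma> j + \<delta>" and A: "A \<in> BF"
    and tor: "\<And>(A :: ('g, 'v) hypersurface_cplx) i. A \<in> BF ==> (\<And>j. j \<in> set js ==> annihilates (rc (mvar j)) A) ==> torsion S J (cterm A i)"
  shows "foldr (\<lambda>j c. frag_extend (\<lambda>A. frag_of (cplx_twist (\<gamma> j) A)) c - c) js (frag_of A) \<in> KR J"
proof -
  let ?op = "\<lambda>j c. frag_extend (\<lambda>A. frag_of (cplx_twist (\<gamma> j) A)) c - c"
  have "foldr ?op js (frag_of A) \<in> annihilated J (set js)" for js
  proof (induction js)
    case Nil
    show ?case using ann_base[of A "{}" J] A by simp
  next
    case (Cons j js)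
    from annihilated_step[OF Cons \<gamma>[of j]] show ?case by simp
  qed
  moreover have "c \<in> KR J" if "c \<in> annihilated J (set js)" for c
    using that
  proof (induction rule: annihilated.induct)
    case (ann_base A)
    then show ?case using tor by (intro KR_torsion) blast
  qed (auto intro: KR_closed)
  ultimately show ?thesis by blast
qed

lemma annihilated_torsion:
  fixes A :: "('g, 'v) hypersurface_cplx"
  assumes A: "A \<in> BF" and I: "\<And>j. j \<in> I ==> annihilates (rc (mvar j)) A"
    and R: "\<And>\<sigma>. \<sigma> \<in> \<Phi> ==> \<not> I \<subseteq> R \<sigma>"
  shows "torsion S (genideal S {rc (\<Prod>i\<in>- R \<sigma>. mvar i) | \<sigma>. \<sigma> \<in> \<Phi>}) (cterm A i)"
proof -
  let ?M = "cterm A i" and ?J = "genideal S {rc (\<Prod>i\<in>- R \<sigma>. mvar i) | \<sigma>. \<sigma> \<in> \<Phi>}"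
  interpret M: Module.module S ?M by (rule graded_moduleD(1)[OF complexD(1)[OF A]])
  define N where "N = {s \<in> carrier S. \<forall>x\<in>carrier ?M. s \<odot>\<^bsub>?M\<^esub> x = \<zero>\<^bsub>?M\<^esub>}"
  have "ideal N S"
  proof (rule idealI[OF ring_axioms])
    show "subgroup N (add_monoid S)"
      by (rule add_subgroupI) (auto simp: N_def M.smult_l_distr M.smult_l_minus)
    show "x \<otimes>\<^bsub>S\<^esub> a \<in> N" "a \<otimes>\<^bsub>S\<^esub> x \<in> N" if "a \<in> N" "x \<in> carrier S" for a x
      using that by (auto simp: N_def M.smult_assoc1)
  qed
  moreover have "{rc (\<Prod>i\<in>- R \<sigma>. mvar i) | \<sigma>. \<sigma> \<in> \<Phi>} \<subseteq> N"
  proof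
    fix s assume "s \<in> {rc (\<Prod>i\<in>- R \<sigma>. mvar i) | \<sigma>. \<sigma> \<in> \<Phi>}"
    then obtain \<sigma> where s: "s = rc (\<Prod>i\<in>- R \<sigma>. mvar i)" "\<sigma> \<in> \<Phi>" by blast
    obtain j where j: "j \<in> I" "j \<in> - R \<sigma>" using R[OF s(2)] by blast
    have "s = rc ((\<Prod>i\<in>- R \<sigma> - {j}. mvar i) * mvar j)"
      unfolding s(1) using j(2) by (simp add: prod.remove[of "- R \<sigma>" j] mult.commute)
    then have s': "s = rc (\<Prod>i\<in>- R \<sigma> - {j}. mvar i) \<otimes>\<^bsub>S\<^esub> rc (mvar j)" by (simp only: S_ops)
    have "rc (mvar j) \<odot>\<^bsub>?M\<^esub> x = \<zero>\<^bsub>?M\<^esub>" if "x \<in> carrier ?M" for x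
      using I[OF j(1)] that by (auto simp: annihilates_def)
    moreover have "rc p \<in> carrier S" for p by (simp add: S_ops)
    ultimately show "s \<in> N" unfolding N_def s' by (auto simp: M.smult_assoc1 M.smult_r_null)
  qed
  ultimately have JN: "?J \<subseteq> N" by (rule genideal_minimal)
  have "s \<odot>\<^bsub>?M\<^esub> x = \<zero>\<^bsub>?M\<^esub> \<and> s \<in> carrier S" if "s \<in> ideal_prod S (carrier S) ?J" "x \<in> carrier ?M" for s x
    using that
  proof (induction rule: ideal_prod.induct)
    case (prod s s')
    then have "s' \<in> N" using JN by blast
    then show ?case using prod by (auto simp: N_def M.smult_assoc1)
  next
    case (sum s s')
    then show ?case by (simp add: M.smult_l_distr)
  qed
  \<comment> \<open>Exponent 1 suffices: the annihilator of the module is an ideal that contains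
    every generator.\<close>
  then show ?thesis unfolding torsion_def by (intro exI[of _ 1]) (simp add: ideal_power_def)
qed

end

subsection \<open>The superpotential\<close>

lemma monomial_degree_pair: "monomial_degree (\<lambda>i. (w i, 0)) m = (monomial_degree w m, 0)"
  by (rule prod_eqI) (simp_all add: monomial_degree_def fst_sum snd_sum)

text \<open>The bidegrees (- d a, 1) of the fibre variable and (d a, 0) of its cofactor add up to
  (0, 1) for every a.\<close>

lemma superpotential_homogeneous:
  assumes G: "\<And>a. homogeneous w (d a) (G a)"
  shows "homogeneous (var_bidegree w d) (0, 1) (superpotential G)"
  unfolding superpotential_def
proof (rule homogeneous_sum)
  fix a
  have "homogeneous (\<lambda>i. (w i, 0 :: int)) (d a, 0) (G a)"
    using G[of a] by (auto simp: homogeneous_def monomial_degree_pair)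
  then have "homogeneous (var_bidegree w d) (d a, 0) (psubst (\<lambda>i. mvar (Inl i)) (G a))"
    by (rule homogeneous_psubst[rotated])
      (use homogeneous_var[of "var_bidegree w d" "Inl i" for i] in \<open>simp add: var_bidegree_def\<close>)
  from homogeneous_mult[OF homogeneous_var[of "var_bidegree w d" "Inr a"] this]
  show "homogeneous (var_bidegree w d) (0, 1) (mvar (Inr a) * psubst (\<lambda>i. mvar (Inl i)) (G a))"
    by (simp add: var_bidegree_def)
qed simp

text \<open>Setting one fibre variable to 1 and the others to 0 recovers the corresponding G a. So a
  vanishing superpotential makes every G a zero, against regularity.\<close>

lemma superpotential_nonzero:
  fixes G :: "'l::{finite,linorder} \<Rightarrow> 'n::finite mpoly"
  assumes G: "regular_sequence G"
  shows "superpotential G \<noteq> 0"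
proof
  assume z: "superpotential G = 0"
  have G0: "G a = 0" for a
  proof -
    let ?s = "psubst (case_sum mvar (\<lambda>b. if b = a then 1 else 0)) :: ('n + 'l) mpoly \<Rightarrow> 'n mpoly"
    have e: "?s (psubst (\<lambda>i. mvar (Inl i)) p) = p" for p
    proof -
      have "?s (psubst (\<lambda>i. mvar (Inl i)) p) = psubst mvar p" by (rule psubst_eqI) simp
      then show ?thesis by (simp add: psubst_mvar)
    qed
    have "?s (superpotential G) = (\<Sum>b\<in>UNIV. if b = a then G b else 0)"
      unfolding superpotential_def psubst_sum by (intro sum.cong HOL.refl) (simp add: psubst_mult e)
    then show ?thesis by (simp add: z)
  qed
  \<comment> \<open>Any index does: the preceding elements generate the zero ideal, and regularity
    would put 1 into it.\<close>
  let ?a = "undefined :: 'l"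
  let ?K = "genideal ring_of_type_algebra (G ` {..<?a})"
  have "?K \<subseteq> {\<zero>\<^bsub>ring_of_type_algebra\<^esub>}"
    by (rule U.genideal_minimal[OF U.zeroideal]) (use G0 in \<open>auto simp: ring_of_type_algebra_def\<close>)
  moreover have "0 \<in> ?K"
    using additive_subgroup.zero_closed[OF ideal.axioms(1)[OF U.genideal_ideal[of "G ` {..<?a}"]]]
    by (simp add: ring_of_type_algebra_def)
  then have "1 * G ?a \<in> ?K" using G0 by simp
  then have "1 \<in> ?K" using G unfolding regular_sequence_def by blast
  ultimately show False by (auto simp: ring_of_type_algebra_def)
qed

lemma hypersurface_ring_eq: "hypersurface_ring w d G = quotient_ring (var_bidegree w d) (superpotential G)"
  by (simp add: hypersurface_ring_def quotient_ring_def residue_class_def[abs_def] residue_def[abs_def])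

theorem corollary1:
  fixes \<Sigma> :: "(real^'r) set set"
    and v :: "'n::finite \<Rightarrow> real^'r"
    and w :: "'n \<Rightarrow> int^'k"
    and d :: "'l::{finite,linorder} \<Rightarrow> int^'k"
    and u :: "'n \<Rightarrow> 'l \<Rightarrow> int"
    and G :: "'l \<Rightarrow> 'n mpoly"
    and \<Gamma> :: "(real^'k) set"
    and \<Phi> :: "((real^'r) \<times> ((real, 'l) vec)) set set"
    and I :: "('n + 'l) set"
    and js :: "('n + 'l) list"
  assumes "CARD('n) = CARD('r) + CARD('k)"
    and "is_fan \<Sigma>" and "complete_fan \<Sigma>" and "smooth_fan \<Sigma>"
    and "primitive_ray_generators \<Sigma> v"
    and "divisor_classes v w"
    and "\<And>a. homogeneous w (d a) (G a)"
    and "regular_sequence G"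
    and "transversal \<Sigma> v G"
    and "(\<Sum>i\<in>UNIV. w i) = (\<Sum>a\<in>UNIV. d a)"
    and "\<And>a. (\<Sum>i\<in>UNIV. u i a *s w i) = d a"
    and "maximal_cone (secondary_fan (real_vec \<circ> enhanced_classes w d)) \<Gamma>"
    and "\<Phi> = phase_fan (enhanced_rays v u) (real_vec \<circ> enhanced_classes w d) \<Gamma>"
    and "\<not> (\<exists>\<sigma>\<in>\<Phi>. I \<subseteq> ray_indices (enhanced_rays v u) \<sigma>)"
    and "distinct js" and "set js = I"
  defines "K \<equiv> K_group (phase_category w d G (enhanced_rays v u) \<Phi>)"
    and "M \<equiv> \<lambda>j. monodromy w d G (enhanced_rays v u) \<Phi> (enhanced_classes w d j)"
  shows "\<forall>x\<in>carrier K. foldr (\<lambda>j. minus_id K (M j)) js x = \<one>\<^bsub>K\<^esub>"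
proof
  fix x assume x: "x \<in> carrier K"
  let ?wt = "var_bidegree w d" and ?W = "superpotential G" and ?v = "enhanced_rays v u"
  interpret hypersurface ?wt ?W "(0, 1)"
    by unfold_locales
      (simp_all add: superpotential_homogeneous[OF assms(7)] superpotential_nonzero[OF assms(8)] zero_prod_def)
  let ?J = "irrelevant_ideal w d G ?v \<Phi>"
  let ?F = "\<lambda>j. cplx_twist (enhanced_classes w d j, 0 :: int)"
  have pc: "phase_category w d G ?v \<Phi> = PC ?J"
    by (simp add: phase_category_def hypersurface_ring_eq)
  have J: "?J = genideal S {rc (\<Prod>i\<in>- ray_indices ?v \<sigma>. mvar i) | \<sigma>. \<sigma> \<in> \<Phi>}"
    by (simp add: irrelevant_ideal_def hypersurface_ring_eq residue_class_def residue_def)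
  have K: "K = K_group (PC ?J)" by (simp add: K_def pc)
  have M: "M j = K_map (PC ?J) (?F j)" for j by (simp add: M_def monodromy_def pc)
  show "foldr (\<lambda>j. minus_id K (M j)) js x = \<one>\<^bsub>K\<^esub>"
    unfolding K M
  proof (rule tri_cat.foldr_minus_id_eq_one[OF tri_cat_PC])
    show "\<exists>Fm. cone_preserving (PC ?J) (?F j) Fm" for j by (rule twist_PC)
    show "x \<in> carrier (K_group (PC ?J))" using x by (simp add: K)
    show "foldr (\<lambda>j c. frag_extend (\<lambda>A. frag_of (?F j A)) c - c) js (frag_of X) \<in> KR ?J"
      if "X \<in> Ob (PC ?J)" for X :: "('k bidegree, 'n + 'l) hypersurface_cplx"
    proof (rule foldr_in_KR[where \<gamma> = "\<lambda>j. (enhanced_classes w d j, 0)"])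
      \<comment> \<open>The first alternative holds for the coordinates x, the second for the fibre
        coordinates p.\<close>
      show "?wt j = (enhanced_classes w d j, 0) \<or> ?wt j = (enhanced_classes w d j, 0) + (0, 1)" for j
        by (cases j) (simp_all add: var_bidegree_def enhanced_classes_def)
      show "X \<in> BF" using that by (simp add: Ob_PC)
      show "torsion S ?J (cterm A i)"
        if "A \<in> BF" "\<And>j. j \<in> set js \<Longrightarrow> annihilates (rc (mvar j)) A"
        for A :: "('k bidegree, 'n + 'l) hypersurface_cplx" and i
        unfolding J
      proof (rule annihilated_torsion[OF that(1)])
        show "annihilates (rc (mvar j)) A" if "j \<in> I" for j
          using \<open>\<And>j. j \<in> set js \<Longrightarrow> annihilates (rc (mvar j)) A\<close> that assms(16) by blast
        show "\<not> I \<subseteq> ray_indices ?v \<sigma>" if "\<sigma> \<in> \<Phi>" for \<sigma> using assms(14) that by blast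
      qed
    qed
  qed
qed

end
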